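(* $\kappa$-heterogeneous logic (for a class $\mathcal{C}$) is sound with respect to well-determined models in $\kappa$-heterogeneous categories (for the same class $\mathcal{C}$): if a sequent $\phi\vdash_{\mathbf{x}}\psi$ is provable from a theory $\mathbb{T}$ in $\kappa$-heterogeneous logic, then it holds in every well-determined model of $\mathbb{T}$ in every $\kappa$-heterogeneous category.
   Context: Throughout, $\kappa$ is a regular cardinal with $\kappa^{<\kappa}=\kappa$. **Syntax.** A signature has a well-ordered set of sorts, and function and relation symbols of arity $<\kappa$; there are $\kappa$ many variables of each sort. Boldface $\mathbf{x}$ denotes blocks of fewer than $\kappa$ variables. Terms and atomic formulas (including equalities) are as usual. Formulas: if $\phi,\psi,\{\phi_\alpha:\alpha<\delta\}$ ($\delta<\kappa^+$) are formulas, then for each $\gamma<\kappa$ so are $(\forall\exists)_{\alpha<\gamma}\mathbf{x_\alpha}\phi$, $(\exists\forall)_{\alpha<\gamma}\mathbf{x_\alpha}\phi$, $\exists_{\alpha<\gamma}\mathbf{x_\alpha}\phi$, $\forall_{\alpha<\gamma}\mathbf{x_\alpha}\phi$, $\phi\to\psi$, $\bigwedge_{\alpha<\eta}\phi_\alpha$ ($\eta<\kappa$) and $\bigvee_{\alpha<\delta}\phi_\alpha$, the last two provided that fewer than $\kappa$ variables are free in the family. $\top,\bot$ are the empty conjunction and disjunction, $\neg\phi$ is $\phi\to\bot$. An ordinal $\alpha+n$ ($\alpha$ limit or $0$, $n<\omega$) is even/odd according to $n$; $\gamma-\beta$ is the order type of $\gamma\setminus\beta$. Notation: $(\forall\exists)_{\beta\le\alpha<\gamma}\mathbf{x_\alpha}\phi$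 is $(\forall\exists)_{\alpha<\gamma-\beta}\mathbf{x_{\beta+\alpha}}\phi$ if $\beta$ is even and $(\exists\forall)_{\alpha<\gamma-\beta}\mathbf{x_{\beta+\alpha}}\phi$ if $\beta$ is odd; $(\forall\exists)_{\beta<\alpha<\gamma}$ means $(\forall\exists)_{\beta+1\le\alpha<\gamma}$; $(\forall\exists)_\emptyset\,\phi:=\phi$; dually for $(\exists\forall)$. A class $\mathcal{C}$ of formulas is fixed, the same for syntax and semantics; heterogeneous quantifiers $(\forall\exists)$, $(\exists\forall)$ are applied only to formulas of $\mathcal{C}$ and their negations; in particular $\mathcal{C}$ contains the subformulas of the non-logical axioms to which heterogeneous quantification is applied. **Proof system of $\kappa$-heterogeneous logic.** Sequents $\phi\vdash_{\mathbf{x}}\psi$ have a context $\mathbf{x}$ of fewer than $\kappa$ variables containing all free variables. A theory is a set of sequents (its axioms). 1. Identity $\phi\vdash_{\mathbf{x}}\phi$; substitution (from $\phi\vdash_{\mathbf{x}}\psi$ infer $\phi[\mathbf{s}/\mathbf{x}]\vdash_{\mathbf{y}}\psi[\mathbf{s}/\mathbf{x}]$, $\mathbf{y}$ containing all variables of $\mathbf{s}$); cut. 2. Equality: $\top\vdash_x x=x$ and $(\mathbf{x}=\mathbf{y})\wedge\phi[\mathbf{x}/\mathbf{w}]\vdash_{\mathbf{z}}\phi[\mathbf{y}/\mathbf{w}]$. 3. Conjunction: $\bigwedge_{i<\gamma}\phi_i\vdash_{\mathbf{x}}\phi_j$; from all $\phi\vdash_{\mathbf{x}}\psi_i$ infer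 $\phi\vdash_{\mathbf{x}}\bigwedge_{i<\gamma}\psi_i$ ($\gamma<\kappa^+$, whenever the conjunction is a formula). 4. Disjunction: $\phi_j\vdash_{\mathbf{x}}\bigvee_{i<\gamma}\phi_i$; from all $\phi_i\vdash_{\mathbf{x}}\theta$ infer $\bigvee_{i<\gamma}\phi_i\vdash_{\mathbf{x}}\theta$ ($\gamma<\kappa^+$). 5. Implication (two-way): $\phi\wedge\psi\vdash_{\mathbf{x}}\eta$ iff $\phi\vdash_{\mathbf{x}}\psi\to\eta$. 6. Existential (two-way): $\phi\vdash_{\mathbf{x}\mathbf{y}}\psi$ iff $\exists\mathbf{y}\phi\vdash_{\mathbf{x}}\psi$ ($\mathbf{y}$ not free in $\psi$). 7. Universal (two-way): $\phi\vdash_{\mathbf{x}\mathbf{y}}\psi$ iff $\phi\vdash_{\mathbf{x}}\forall\mathbf{y}\psi$ ($\mathbf{y}$ not free in $\phi$). 8. Transfinite transitivity, for each cardinal $\gamma<\kappa^+$: given formulas $\phi_f$ ($f\in\gamma^{\beta}$, $\beta<\kappa$) with canonical contexts $\mathbf{y}_f$, from $\phi_f\vdash_{\mathbf{y}_f}\bigvee_{g\in\gamma^{\beta+1},\,g|_\beta=f}\exists\mathbf{x}_g\phi_g$ (all $\beta<\kappa$, $f\in\gamma^\beta$) and $\phi_f\dashv\vdash_{\mathbf{y}_f}\bigwedge_{\alpha<\beta}\phi_{f|_\alpha}$ (all limit $\beta<\kappa$, $f\in\gamma^\beta$) infer $\phi_\emptyset\vdash_{\mathbf{y}_\emptyset}\bigvee_{f\in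 B}\exists_{\beta<\delta_f}\mathbf{x}_{f|_{\beta+1}}\bigwedge_{\beta<\delta_f}\phi_{f|_{\beta+1}}$, where $B\subseteq\gamma^{<\kappa}$ is the set of minimal elements of a bar of the tree $\gamma^{<\kappa}$ (a set of nodes meeting every branch $f\in\gamma^\kappa$) and $\delta_f$ is the level of $f$; provided $FV(\phi_f)=FV(\phi_{f|_\beta})\cup\mathbf{x}_f$ and $\mathbf{x}_f\cap FV(\phi_{f|_\beta})=\emptyset$ for $f\in\gamma^{\beta+1}$, and $FV(\phi_f)=\bigcup_{\alpha<\beta}FV(\phi_{f|_\alpha})$ for limit $\beta$. The following are instantiated only for $\phi\in\mathcal{C}$: 9. Heterogeneous axioms: for limit $\gamma<\kappa$, $(\forall\exists)_{\alpha<\gamma}\mathbf{x_\alpha}\phi\vdash_{\mathbf{x}}\forall\mathbf{x_0}(\forall\exists)_{0<\alpha<\gamma}\mathbf{x_\alpha}\phi$ and $(\exists\forall)_{\alpha<\gamma}\mathbf{x_\alpha}\neg\phi\vdash_{\mathbf{x}}\exists\mathbf{x_0}(\exists\forall)_{0<\alpha<\gamma}\mathbf{x_\alpha}\neg\phi$; for limits $\beta<\gamma<\kappa$, $(\forall\exists)_{\alpha<\gamma}\mathbf{x_\alpha}\phi\vdash_{\mathbf{x}}(\forall\exists)_{\alpha<\beta}\mathbf{x_\alpha}(\forall\exists)_{\beta\le\alpha<\gamma}\mathbf{x_\alpha}\phi$ and $(\exists\forall)_{\alpha<\gamma}\mathbf{x_\alpha}\neg\phi\vdash_{\mathbf{x}}(\exists\forall)_{\alpha<\beta}\mathbf{x_\alpha}(\exists\forall)_{\beta\le\alpha<\gamma}\mathbf{x_\alpha}\neg\phi$.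 10. Preservation axioms, for limit $\gamma<\kappa$, with $\mathbf{y}_\gamma=\bigcup_{\alpha<\gamma}\mathbf{y_\alpha}$: $\bigwedge_{\beta<\gamma}(\forall\exists)_{\beta\le\alpha<\gamma}\mathbf{x_\alpha}\phi(\mathbf{x},\mathbf{y_0},\mathbf{y_1},\dots,\mathbf{x_\beta},\mathbf{x_{\beta+1}},\dots)\vdash_{\mathbf{x}\cup\mathbf{y}_\gamma}\phi(\mathbf{x},\mathbf{y_0},\mathbf{y_1},\dots)$ and $\bigwedge_{\beta<\gamma}(\exists\forall)_{\beta\le\alpha<\gamma}\mathbf{x_\alpha}\neg\phi(\mathbf{x},\mathbf{y_0},\mathbf{y_1},\dots,\mathbf{x_\beta},\mathbf{x_{\beta+1}},\dots)\vdash_{\mathbf{x}\cup\mathbf{y}_\gamma}\neg\phi(\mathbf{x},\mathbf{y_0},\mathbf{y_1},\dots)$ (in the $\beta$-th conjunct the blocks of index $<\beta$ are $\mathbf{y}$'s, the others $\mathbf{x}$'s). 11. Determinacy, for limit $\gamma<\kappa$: $\top\vdash_{\mathbf{x}}(\forall\exists)_{\alpha<\gamma}\mathbf{x_\alpha}\phi\vee(\exists\forall)_{\alpha<\gamma}\mathbf{x_\alpha}\neg\phi$. Excluded middle is not assumed. **Categories.** In a regular category with stable unions of at most $\kappa$ subobjects, a *covering family* is a jointly epic family of at most $\kappa$ arrows with common codomain, in the sense that the union of their images is the whole codomain. A *$\kappa$-Heyting category* is a category with the structure corresponding to 1–8: a regular category with limits of size $<\kappa$, stable unions of at most $\kappa$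 subobjects, right adjoints $\forall_f$ to all pullback maps $f^{-1}$ on subobjects, and the transfinite transitivity property (transfinite composites of covering families are covering: for a tree of objects with root $C$ in which the immediate successors of each node form a covering family of it, nodes at limit levels are limits of the branch below, and all branches have length $<\kappa$, the family of limit projections $D^b\to C$, $D^b$ the limit along the branch $b$, is covering). Given objects $(A_\alpha)_{\alpha<\kappa}$, a limit ordinal $\gamma<\kappa$ and $S\rightarrowtail A\times A_\gamma$, $A_\gamma:=\prod_{i<\gamma}A_i$, define sets of subobjects of $A$ as follows. For $l:C\rightarrowtail A$, $C\in T^{\gamma,S}_{(\forall\exists)}$ iff: for every arrow $D_0\to C$ and $e_0:D_0\to A_0$ there is a covering family $\{D_1^{i_1}\to D_0\}_{i_1\in I_1}$ and arrows $e_{i_1}:D_1^{i_1}\to A_1$ such that for every $i_1\in I_1$, every arrow $D_2^{i_1}\to D_1^{i_1}$ and every $e_2:D_2^{i_1}\to A_2$ there is a covering family $\{D_3^{i_3}\to D_2^{i_1}\}_{i_3\in I_3}$ and arrows $e_{i_3}:D_3^{i_3}\to A_3$ such that [and so on through all stages $\alpha<\gamma$, arbitrary arrows at even stages and covering families at odd ones; at limit stages the new arrow has as codomain the limit of the preceding chain] such that, for each resulting branch $b$ with limit $D_\gamma^b$ and limit projections $f_b:D_\gamma^b\to C$, $\pi_\alpha:D_\gamma^b\to D_\alpha$, the arrow $(lf_b,e_0\pi_0,e_{i_1}\pi_1,e_2\pi_2,e_{i_3}\pi_3,\dots):D_\gamma^b\to A\times A_\gamma$ factors through $S$. $T^{\gamma,S}_{(\exists\forall)}$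 is defined in the same way with parities interchanged: covering families (of $C$ at stage $0$, of the previous object at successor even stages, of the limit of the chain at limit stages) with arrows $e$ at even stages, arbitrary arrows at odd stages. These infinite alternations are understood in the metatheory as the existence of choice functions giving each existential choice as a function of all previous choices. A $\kappa$-Heyting category $\mathcal{H}$ is *$\kappa$-heterogeneous* (with respect to $\mathcal{C}$) if there are objects $(A_\alpha)_{\alpha<\kappa}$ such that for every limit $\gamma<\kappa$, every diagram $F:\gamma^{op}\to\mathcal{H}$, $F(\alpha)=A\times\prod_{i<\alpha}A_i$, with limit projection $f:A\times A_\gamma\to A$, and every $S\rightarrowtail A\times A_\gamma$ that is the interpretation in $\mathcal{H}$ of a formula of $\mathcal{C}$, the joins $\bigvee_{C\in T^{\gamma,S}_{(\forall\exists)}}C$ and $\bigvee_{C\in T^{\gamma,\neg S}_{(\exists\forall)}}C$ exist in $\mathcal{S}ub(A)$. In such a category, formulas in context are interpreted as subobjects in the standard way, and if the contexts $(\mathbf{x_\alpha},\top)$ and $(\mathbf{x},\top)$ are interpreted by $A_\alpha$ and $A$, the formulas $(\forall\exists)_{\alpha<\gamma}\mathbf{x_\alpha}\phi$ and $(\exists\forall)_{\alpha<\gamma}\mathbf{x_\alpha}\phi$ are interpreted by $\bigvee_{C\in T^{\gamma,[[\phi]]}_{(\forall\exists)}}C$ and $\bigvee_{C\in T^{\gamma,[[\phi]]}_{(\exists\forall)}}C$. A sequent $\phi\vdash_{\mathbf{x}}\psi$ holds if $[[\phi]]\le[[\psi]]$. A structure is *well-determined* (with respect to $\mathcal{C}$)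 if it satisfies the preservation axioms (10) and determinacy axioms (11) for $\phi\in\mathcal{C}$; a well-determined model of $\mathbb{T}$ is a well-determined structure in which all axioms of $\mathbb{T}$ hold.
   Formalization: In tails from an odd β each block keeps its original quantifier (empty blocks are inserted at limit stages), since the literal notation makes axiom 9 unsound for γ ≥ ω+ω; and the joins are required for all sequences of contexts, not one fixed family (A_α), so that all formulas are interpreted. *)

theory Defs
  imports Main
begin

unbundle cardinal_syntax

section \<open>The cardinal \<open>\<kappa>\<close> and its ordinals\<close>

text \<open>
  The cardinal \<open>\<kappa>\<close> is a well-ordered type \<open>'k\<close> whose order type is \<open>\<kappa>\<close>. Elements of \<open>'k\<close> are the
  ordinals below \<open>\<kappa>\<close>, and the ordinal \<open>\<alpha>\<close> is identified with \<open>{..<\<alpha>}\<close>. A sequence of length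
  \<open>\<gamma> < \<kappa>\<close> is a partial map with domain \<open>{..<\<gamma>}\<close>. An index set of size at most \<open>\<kappa>\<close> is a subset
  of \<open>'k\<close>.
\<close>

definition regular_kappa :: "'k::wellorder itself \<Rightarrow> bool" where
  "regular_kappa _ \<longleftrightarrow>
     (let r = {(a, b). a \<le> (b::'k)}
      in Cinfinite r \<and> regularCard r \<and> |{f :: 'k \<rightharpoonup> 'k. \<exists>\<beta>. dom f = {..<\<beta>}}| =o r)"

definition less_kappa :: "'k itself \<Rightarrow> 'x set \<Rightarrow> bool" where
  "less_kappa _ V \<longleftrightarrow> |V| <o |UNIV :: 'k set|"

definition ozero :: "'k::wellorder" where
  "ozero = (LEAST a. True)"

definition osuc :: "'k::wellorder \<Rightarrow> 'k" where
  "osuc a = (LEAST b. a < b)"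

definition is_lim :: "'k::wellorder \<Rightarrow> bool" where
  "is_lim l \<longleftrightarrow> (\<exists>b. b < l) \<and> (\<forall>b<l. \<exists>c. b < c \<and> c < l)"

definition ord_even :: "'k::wellorder \<Rightarrow> bool" where
  "ord_even a \<longleftrightarrow> (\<exists>l n. (is_lim l \<or> l = ozero) \<and> a = (osuc ^^ n) l \<and> even n)"

definition odiff :: "'k::wellorder \<Rightarrow> 'k \<Rightarrow> 'k" where
  "odiff g b = (THE d. \<exists>h. strict_mono_on {..<d} h \<and> h ` {..<d} = {b..<g})"

definition oplus :: "'k::wellorder \<Rightarrow> 'k \<Rightarrow> 'k" where
  "oplus b a = (THE z. b \<le> z \<and> odiff z b = a)"

definition len :: "('k::wellorder \<rightharpoonup> 'x) \<Rightarrow> 'k" where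
  "len s = (THE b. dom s = {..<b})"


section \<open>Syntax\<close>

record ('k, 's, 'f, 'r) signature =
  Sorts :: "'s set"
  Funs :: "'f set"
  Rels :: "'r set"
  fun_arity :: "'f \<Rightarrow> ('k \<rightharpoonup> 's)"
  fun_sort :: "'f \<Rightarrow> 's"
  rel_arity :: "'r \<Rightarrow> ('k \<rightharpoonup> 's)"

definition wf_signature :: "('k::wellorder, 's::wellorder, 'f, 'r) signature \<Rightarrow> bool" where
  "wf_signature Sg \<longleftrightarrow>
     (\<forall>f\<in>Funs Sg. (\<exists>g. dom (fun_arity Sg f) = {..<g}) \<and> ran (fun_arity Sg f) \<subseteq> Sorts Sg
                   \<and> fun_sort Sg f \<in> Sorts Sg) \<and>
     (\<forall>r\<in>Rels Sg. (\<exists>g. dom (rel_arity Sg r) = {..<g}) \<and> ran (rel_arity Sg r) \<subseteq> Sorts Sg)"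

text \<open>The variable \<open>(s, i)\<close> is the \<open>i\<close>-th variable of sort \<open>s\<close>.\<close>

type_synonym ('s, 'k) var = "'s \<times> 'k"
type_synonym ('s, 'k) block = "('s, 'k) var set"

datatype ('k, 's, 'f) tm = Var "('s, 'k) var" | App 'f "'k \<Rightarrow> ('k, 's, 'f) tm option"

datatype quant = QAll | QEx | QAE | QEA

datatype ('k, 's, 'f, 'r) fm =
    Eq "('k, 's, 'f) tm" "('k, 's, 'f) tm"
  | Rel 'r "'k \<Rightarrow> ('k, 's, 'f) tm option"
  | Imp "('k, 's, 'f, 'r) fm" "('k, 's, 'f, 'r) fm"
  | Conj "'k \<Rightarrow> ('k, 's, 'f, 'r) fm option"
  | Disj "'k \<Rightarrow> ('k, 's, 'f, 'r) fm option"
  | Quant quant "'k \<Rightarrow> ('s, 'k) block option" "('k, 's, 'f, 'r) fm"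

text \<open>
  \<open>AE X \<phi>\<close> is \<open>(\<forall>\<exists>)\<^sub>\<alpha>\<^sub><\<^sub>\<gamma> x\<^sub>\<alpha> \<phi>\<close>, where \<open>dom X = {..<\<gamma>}\<close> and \<open>X \<alpha> = Some x\<^sub>\<alpha>\<close>; dually for \<open>EA\<close>.
\<close>

abbreviation "Forall \<equiv> Quant QAll"
abbreviation "Exists \<equiv> Quant QEx"
abbreviation "AE \<equiv> Quant QAE"
abbreviation "EA \<equiv> Quant QEA"

abbreviation Top where "Top \<equiv> Conj Map.empty"
abbreviation Bot where "Bot \<equiv> Disj Map.empty"
abbreviation Neg where "Neg \<phi> \<equiv> Imp \<phi> Bot"

definition And :: "('k::wellorder, 's, 'f, 'r) fm \<Rightarrow> ('k, 's, 'f, 'r) fm \<Rightarrow> ('k, 's, 'f, 'r) fm" where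
  "And \<phi> \<psi> = Conj [ozero \<mapsto> \<phi>, osuc ozero \<mapsto> \<psi>]"

definition Or :: "('k::wellorder, 's, 'f, 'r) fm \<Rightarrow> ('k, 's, 'f, 'r) fm \<Rightarrow> ('k, 's, 'f, 'r) fm" where
  "Or \<phi> \<psi> = Disj [ozero \<mapsto> \<phi>, osuc ozero \<mapsto> \<psi>]"

primrec tvars :: "('k, 's, 'f) tm \<Rightarrow> ('s, 'k) block" where
  "tvars (Var v) = {v}"
| "tvars (App f ts) = (\<Union>i. \<Union> (set_option (map_option tvars (ts i))))"

definition bvars :: "('k \<rightharpoonup> ('s, 'k) block) \<Rightarrow> ('s, 'k) block" where
  "bvars X = \<Union> (ran X)"

primrec FV :: "('k, 's, 'f, 'r) fm \<Rightarrow> ('s, 'k) block" where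
  "FV (Eq s t) = tvars s \<union> tvars t"
| "FV (Rel r ts) = (\<Union>t\<in>ran ts. tvars t)"
| "FV (Imp \<phi> \<psi>) = FV \<phi> \<union> FV \<psi>"
| "FV (Conj F) = (\<Union>i. \<Union> (set_option (map_option FV (F i))))"
| "FV (Disj F) = (\<Union>i. \<Union> (set_option (map_option FV (F i))))"
| "FV (Quant q X \<phi>) = FV \<phi> - bvars X"

inductive wf_tm :: "('k, 's, 'f, 'r) signature \<Rightarrow> ('k, 's, 'f) tm \<Rightarrow> 's \<Rightarrow> bool" for Sg where
  "fst v \<in> Sorts Sg \<Longrightarrow> wf_tm Sg (Var v) (fst v)"
| "\<lbrakk>f \<in> Funs Sg; dom ts = dom (fun_arity Sg f);
    \<And>i t s. ts i = Some t \<Longrightarrow> fun_arity Sg f i = Some s \<Longrightarrow> wf_tm Sg t s\<rbrakk>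
   \<Longrightarrow> wf_tm Sg (App f ts) (fun_sort Sg f)"

definition wf_context :: "('k, 's, 'f, 'r) signature \<Rightarrow> ('s, 'k) block \<Rightarrow> bool" where
  "wf_context Sg x \<longleftrightarrow> fst ` x \<subseteq> Sorts Sg \<and> less_kappa TYPE('k) x"

definition wf_blocks ::
    "('k::wellorder, 's, 'f, 'r) signature \<Rightarrow> ('k \<rightharpoonup> ('s, 'k) block) \<Rightarrow> bool" where
  "wf_blocks Sg X \<longleftrightarrow> (\<exists>g. dom X = {..<g}) \<and> (\<forall>B\<in>ran X. wf_context Sg B) \<and>
     (\<forall>a b A B. a \<noteq> b \<longrightarrow> X a = Some A \<longrightarrow> X b = Some B \<longrightarrow> A \<inter> B = {})"

text \<open>The length of a heterogeneous quantifier is positive, since \<open>(\<forall>\<exists>)\<^sub>\<emptyset> \<phi>\<close> denotes \<open>\<phi>\<close> itself.\<close>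

inductive wf_fm ::
    "('k::wellorder, 's, 'f, 'r) signature \<Rightarrow> ('k, 's, 'f, 'r) fm set \<Rightarrow> ('k, 's, 'f, 'r) fm \<Rightarrow> bool"
  for Sg C where
  "wf_tm Sg t s \<Longrightarrow> wf_tm Sg u s \<Longrightarrow> wf_fm Sg C (Eq t u)"
| "\<lbrakk>r \<in> Rels Sg; dom ts = dom (rel_arity Sg r);
    \<And>i t s. ts i = Some t \<Longrightarrow> rel_arity Sg r i = Some s \<Longrightarrow> wf_tm Sg t s\<rbrakk>
   \<Longrightarrow> wf_fm Sg C (Rel r ts)"
| "wf_fm Sg C \<phi> \<Longrightarrow> wf_fm Sg C \<psi> \<Longrightarrow> wf_fm Sg C (Imp \<phi> \<psi>)"
| "\<lbrakk>dom F = {..<g}; \<And>i \<phi>. F i = Some \<phi> \<Longrightarrow> wf_fm Sg C \<phi>; less_kappa TYPE('k) (FV (Conj F))\<rbrakk>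
   \<Longrightarrow> wf_fm Sg C (Conj F)"
| "\<lbrakk>\<And>i \<phi>. F i = Some \<phi> \<Longrightarrow> wf_fm Sg C \<phi>; less_kappa TYPE('k) (FV (Disj F))\<rbrakk>
   \<Longrightarrow> wf_fm Sg C (Disj F)"
| "\<lbrakk>wf_blocks Sg X; wf_fm Sg C \<phi>;
    q = QAE \<or> q = QEA \<Longrightarrow> dom X \<noteq> {} \<and> (\<phi> \<in> C \<or> (\<exists>\<chi>\<in>C. \<phi> = Neg \<chi>))\<rbrakk>
   \<Longrightarrow> wf_fm Sg C (Quant q X \<phi>)"

primrec tsubst :: "(('s, 'k) var \<Rightarrow> ('k, 's, 'f) tm) \<Rightarrow> ('k, 's, 'f) tm \<Rightarrow> ('k, 's, 'f) tm" where
  "tsubst \<sigma> (Var v) = \<sigma> v"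
| "tsubst \<sigma> (App f ts) = App f (\<lambda>i. map_option (tsubst \<sigma>) (ts i))"

text \<open>
  \<open>subst \<sigma> \<phi> \<phi>'\<close>: the formula \<open>\<phi>'\<close> is a result of the capture-avoiding simultaneous substitution of
  \<open>\<sigma>\<close> in \<open>\<phi>\<close>, unique up to the choice of bound variables. In particular \<open>subst Var\<close> is
  \<open>\<alpha>\<close>-equivalence.
\<close>

inductive subst ::
    "(('s, 'k) var \<Rightarrow> ('k, 's, 'f) tm) \<Rightarrow> ('k, 's, 'f, 'r) fm \<Rightarrow> ('k, 's, 'f, 'r) fm \<Rightarrow> bool" where
  "subst \<sigma> (Eq s t) (Eq (tsubst \<sigma> s) (tsubst \<sigma> t))"
| "subst \<sigma> (Rel r ts) (Rel r (\<lambda>i. map_option (tsubst \<sigma>) (ts i)))"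
| "subst \<sigma> \<phi> \<phi>' \<Longrightarrow> subst \<sigma> \<psi> \<psi>' \<Longrightarrow> subst \<sigma> (Imp \<phi> \<psi>) (Imp \<phi>' \<psi>')"
| "\<lbrakk>dom F = dom F'; \<And>i \<phi> \<phi>'. F i = Some \<phi> \<Longrightarrow> F' i = Some \<phi>' \<Longrightarrow> subst \<sigma> \<phi> \<phi>'\<rbrakk>
   \<Longrightarrow> subst \<sigma> (Conj F) (Conj F')"
| "\<lbrakk>dom F = dom F'; \<And>i \<phi> \<phi>'. F i = Some \<phi> \<Longrightarrow> F' i = Some \<phi>' \<Longrightarrow> subst \<sigma> \<phi> \<phi>'\<rbrakk>
   \<Longrightarrow> subst \<sigma> (Disj F) (Disj F')"
| "\<lbrakk>inj_on \<rho> (bvars X); \<And>v. v \<in> bvars X \<Longrightarrow> fst (\<rho> v) = fst v;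
    \<And>w. w \<in> FV \<phi> - bvars X \<Longrightarrow> tvars (\<sigma> w) \<inter> \<rho> ` bvars X = {};
    subst (\<lambda>v. if v \<in> bvars X then Var (\<rho> v) else \<sigma> v) \<phi> \<phi>'\<rbrakk>
   \<Longrightarrow> subst \<sigma> (Quant q X \<phi>) (Quant q (\<lambda>a. map_option ((`) \<rho>) (X a)) \<phi>')"

text \<open>
  In \<open>(\<forall>\<exists>)\<^sub>\<beta>\<^sub>\<le>\<^sub>\<alpha>\<^sub><\<^sub>\<gamma> x\<^sub>\<alpha> \<phi>\<close> the block \<open>x\<^sub>\<alpha>\<close> is to keep the quantifier that it has in
  \<open>(\<forall>\<exists>)\<^sub>\<alpha>\<^sub><\<^sub>\<gamma> x\<^sub>\<alpha> \<phi>\<close>. For even \<open>\<beta>\<close> this is what \<open>(\<forall>\<exists>)\<^sub>\<alpha>\<^sub><\<^sub>\<gamma>\<^sub>-\<^sub>\<beta> x\<^sub>\<beta>\<^sub>+\<^sub>\<alpha> \<phi>\<close> says. For odd \<open>\<beta>\<close> the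
  formula \<open>(\<exists>\<forall>)\<^sub>\<alpha>\<^sub><\<^sub>\<gamma>\<^sub>-\<^sub>\<beta> x\<^sub>\<beta>\<^sub>+\<^sub>\<alpha> \<phi>\<close> says this for the stages \<open>\<alpha> < \<omega>\<close>, but not for \<open>\<alpha> \<ge> \<omega>\<close>, where
  \<open>\<beta> + \<alpha>\<close> and \<open>\<alpha>\<close> have the same parity: the block \<open>x\<^sub>\<beta>\<^sub>+\<^sub>\<omega>\<close> would change from \<open>\<forall>\<close> to \<open>\<exists>\<close>.
  \<open>realign\<close> restores the parity by inserting an empty block at every limit stage; it changes
  nothing if \<open>\<gamma> - \<beta> \<le> \<omega>\<close>. It is meant for sequences of limit length, which it preserves.
\<close>

definition shift :: "'k::wellorder \<Rightarrow> ('k \<rightharpoonup> 'x) \<Rightarrow> ('k \<rightharpoonup> 'x)" where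
  "shift b X = (\<lambda>a. X (oplus b a))"

definition realign :: "('k::wellorder \<rightharpoonup> ('s, 'k) block) \<Rightarrow> ('k \<rightharpoonup> ('s, 'k) block)" where
  "realign X = (\<lambda>a. if finite {..<a} then X a
                    else if is_lim a then map_option (\<lambda>_. {}) (X a)
                    else X (THE b. osuc b = a))"

definition tail_AE ::
    "'k::wellorder \<Rightarrow> ('k \<rightharpoonup> ('s, 'k) block) \<Rightarrow> ('k, 's, 'f, 'r) fm \<Rightarrow> ('k, 's, 'f, 'r) fm" where
  "tail_AE b X \<phi> = (if ord_even b then AE (shift b X) \<phi> else EA (realign (shift b X)) \<phi>)"

definition tail_EA ::
    "'k::wellorder \<Rightarrow> ('k \<rightharpoonup> ('s, 'k) block) \<Rightarrow> ('k, 's, 'f, 'r) fm \<Rightarrow> ('k, 's, 'f, 'r) fm" where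
  "tail_EA b X \<phi> = (if ord_even b then EA (shift b X) \<phi> else AE (realign (shift b X)) \<phi>)"


section \<open>Proof system\<close>

text \<open>The sequent \<open>(\<phi>, x, \<psi>)\<close> is \<open>\<phi> \<turnstile>\<^sub>x \<psi>\<close>.\<close>

type_synonym ('k, 's, 'f, 'r) sequent =
  "('k, 's, 'f, 'r) fm \<times> ('s, 'k) block \<times> ('k, 's, 'f, 'r) fm"

definition wf_sequent ::
    "('k::wellorder, 's, 'f, 'r) signature \<Rightarrow> ('k, 's, 'f, 'r) fm set \<Rightarrow> ('k, 's, 'f, 'r) sequent \<Rightarrow> bool"
  where
  "wf_sequent Sg C = (\<lambda>(\<phi>, x, \<psi>).
     wf_fm Sg C \<phi> \<and> wf_fm Sg C \<psi> \<and> wf_context Sg x \<and> FV \<phi> \<union> FV \<psi> \<subseteq> x)"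

definition is_theory ::
    "('k::wellorder, 's, 'f, 'r) signature \<Rightarrow> ('k, 's, 'f, 'r) fm set \<Rightarrow> ('k, 's, 'f, 'r) sequent set \<Rightarrow> bool"
  where
  "is_theory Sg C T \<longleftrightarrow> (\<forall>s\<in>T. wf_sequent Sg C s)"

text \<open>The axiom schemes are instantiated exactly when the result is a sequent of formulas.\<close>

inductive_set heterogeneous_axioms ::
    "('k::wellorder, 's, 'f, 'r) signature \<Rightarrow> ('k, 's, 'f, 'r) fm set \<Rightarrow> ('k, 's, 'f, 'r) sequent set"
  for Sg C where
  "\<lbrakk>\<phi> \<in> C; is_lim g; dom X = {..<g};
    s = (AE X \<phi>, x, Forall [ozero \<mapsto> the (X ozero)] (tail_AE (osuc ozero) X \<phi>)); wf_sequent Sg C s\<rbrakk>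
   \<Longrightarrow> s \<in> heterogeneous_axioms Sg C"
| "\<lbrakk>\<phi> \<in> C; is_lim g; dom X = {..<g};
    s = (EA X (Neg \<phi>), x, Exists [ozero \<mapsto> the (X ozero)] (tail_EA (osuc ozero) X (Neg \<phi>)));
    wf_sequent Sg C s\<rbrakk>
   \<Longrightarrow> s \<in> heterogeneous_axioms Sg C"
| "\<lbrakk>\<phi> \<in> C; is_lim b; b < g; is_lim g; dom X = {..<g};
    s = (AE X \<phi>, x, AE (X |` {..<b}) (tail_AE b X \<phi>)); wf_sequent Sg C s\<rbrakk>
   \<Longrightarrow> s \<in> heterogeneous_axioms Sg C"
| "\<lbrakk>\<phi> \<in> C; is_lim b; b < g; is_lim g; dom X = {..<g};
    s = (EA X (Neg \<phi>), x, EA (X |` {..<b}) (tail_EA b X (Neg \<phi>))); wf_sequent Sg C s\<rbrakk>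
   \<Longrightarrow> s \<in> heterogeneous_axioms Sg C"

text \<open>
  In the preservation axioms, \<open>\<rho>\<close> renames the variables of each \<open>x\<^sub>\<alpha>\<close> to those of \<open>y\<^sub>\<alpha>\<close>, and \<open>\<psi> \<beta>\<close>
  is \<open>\<phi>(x, y\<^sub>0, y\<^sub>1, \<dots>, x\<^sub>\<beta>, x\<^sub>\<beta>\<^sub>+\<^sub>1, \<dots>)\<close>.
\<close>

definition partial_renamings ::
    "'k::wellorder \<Rightarrow> ('k \<rightharpoonup> ('s, 'k) block) \<Rightarrow> ('s, 'k) block \<Rightarrow> (('s, 'k) var \<Rightarrow> ('s, 'k) var) \<Rightarrow>
     ('k, 's, 'f, 'r) fm \<Rightarrow> ('k \<Rightarrow> ('k, 's, 'f, 'r) fm) \<Rightarrow> bool" where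
  "partial_renamings g X x \<rho> \<phi> \<psi> \<longleftrightarrow>
     inj_on \<rho> (bvars X) \<and> (\<forall>v\<in>bvars X. fst (\<rho> v) = fst v) \<and>
     x \<inter> bvars X = {} \<and> \<rho> ` bvars X \<inter> (x \<union> bvars X) = {} \<and>
     (\<forall>b\<le>g. subst (\<lambda>v. Var (if v \<in> bvars (X |` {..<b}) then \<rho> v else v)) \<phi> (\<psi> b))"

inductive_set preservation_axioms ::
    "('k::wellorder, 's, 'f, 'r) signature \<Rightarrow> ('k, 's, 'f, 'r) fm set \<Rightarrow> ('k, 's, 'f, 'r) sequent set"
  for Sg C where
  "\<lbrakk>\<phi> \<in> C; wf_fm Sg C \<phi>; is_lim g; dom X = {..<g}; partial_renamings g X x \<rho> \<phi> \<psi>;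
    s = (Conj (\<lambda>b. if b < g then Some (tail_AE b X (\<psi> b)) else None), x \<union> \<rho> ` bvars X, \<psi> g);
    wf_sequent Sg C s\<rbrakk>
   \<Longrightarrow> s \<in> preservation_axioms Sg C"
| "\<lbrakk>\<phi> \<in> C; wf_fm Sg C \<phi>; is_lim g; dom X = {..<g}; partial_renamings g X x \<rho> \<phi> \<psi>;
    s = (Conj (\<lambda>b. if b < g then Some (tail_EA b X (Neg (\<psi> b))) else None),
         x \<union> \<rho> ` bvars X, Neg (\<psi> g));
    wf_sequent Sg C s\<rbrakk>
   \<Longrightarrow> s \<in> preservation_axioms Sg C"

inductive_set determinacy_axioms ::
    "('k::wellorder, 's, 'f, 'r) signature \<Rightarrow> ('k, 's, 'f, 'r) fm set \<Rightarrow> ('k, 's, 'f, 'r) sequent set"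
  for Sg C where
  "\<lbrakk>\<phi> \<in> C; is_lim g; dom X = {..<g}; s = (Top, x, Or (AE X \<phi>) (EA X (Neg \<phi>))); wf_sequent Sg C s\<rbrakk>
   \<Longrightarrow> s \<in> determinacy_axioms Sg C"

text \<open>
  The tree \<open>\<Gamma>\<^sup><\<^sup>\<kappa>\<close>, for \<open>\<Gamma>\<close> a cardinal \<open>\<le> \<kappa>\<close>, that is, an initial segment of \<open>\<kappa>\<close> all of whose proper
  initial segments have smaller cardinality.
\<close>

definition is_cardinal_le_kappa :: "'k::wellorder set \<Rightarrow> bool" where
  "is_cardinal_le_kappa \<Gamma> \<longleftrightarrow> (\<forall>a\<in>\<Gamma>. {..<a} \<subseteq> \<Gamma> \<and> |{..<a}| <o |\<Gamma>| )"

definition nodes :: "'k::wellorder set \<Rightarrow> ('k \<rightharpoonup> 'k) set" where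
  "nodes \<Gamma> = {f. (\<exists>b. dom f = {..<b}) \<and> ran f \<subseteq> \<Gamma>}"

definition is_bar :: "'k::wellorder set \<Rightarrow> ('k \<rightharpoonup> 'k) set \<Rightarrow> bool" where
  "is_bar \<Gamma> B \<longleftrightarrow> B \<subseteq> nodes \<Gamma> \<and> (\<forall>f::'k \<Rightarrow> 'k. range f \<subseteq> \<Gamma> \<longrightarrow> (\<exists>b. (Some \<circ> f) |` {..<b} \<in> B))"

definition minimal_nodes :: "('k::wellorder \<rightharpoonup> 'k) set \<Rightarrow> ('k \<rightharpoonup> 'k) set" where
  "minimal_nodes B = {f \<in> B. \<forall>a<len f. f |` {..<a} \<notin> B}"

text \<open>
  In rule \<open>transfinite_transitivity\<close>, the set \<open>minimal_nodes B\<close> of disjuncts of the conclusion is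
  enumerated by the bijection \<open>en\<close>, and \<open>f |` {..b}\<close> is the restriction of \<open>f\<close> to \<open>b + 1\<close>.
\<close>

inductive provable ::
    "('k::wellorder, 's, 'f, 'r) signature \<Rightarrow> ('k, 's, 'f, 'r) fm set \<Rightarrow> ('k, 's, 'f, 'r) sequent set \<Rightarrow>
     ('k, 's, 'f, 'r) sequent \<Rightarrow> bool"
  for Sg C T where
  ax: "\<lbrakk>s \<in> T; wf_sequent Sg C s\<rbrakk> \<Longrightarrow> provable Sg C T s"
| identity: "wf_sequent Sg C (\<phi>, x, \<phi>) \<Longrightarrow> provable Sg C T (\<phi>, x, \<phi>)"
| substitution:
    "\<lbrakk>provable Sg C T (\<phi>, x, \<psi>);
      \<And>v. v \<in> x \<Longrightarrow> wf_tm Sg (\<sigma> v) (fst v) \<and> tvars (\<sigma> v) \<subseteq> y;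
      subst \<sigma> \<phi> \<phi>'; subst \<sigma> \<psi> \<psi>'; wf_sequent Sg C (\<phi>', y, \<psi>')\<rbrakk>
     \<Longrightarrow> provable Sg C T (\<phi>', y, \<psi>')"
| cut: "\<lbrakk>provable Sg C T (\<phi>, x, \<psi>); provable Sg C T (\<psi>, x, \<theta>)\<rbrakk> \<Longrightarrow> provable Sg C T (\<phi>, x, \<theta>)"
| eq_refl: "wf_sequent Sg C (Top, {v}, Eq (Var v) (Var v))
     \<Longrightarrow> provable Sg C T (Top, {v}, Eq (Var v) (Var v))"
| eq_congruence:
    "\<lbrakk>dom ws = {..<g}; inj_on ws (dom ws);
      \<And>i. i < g \<Longrightarrow> fst (xs i) = fst (the (ws i)) \<and> fst (ys i) = fst (the (ws i));
      \<And>i. i < g \<Longrightarrow> \<sigma> (the (ws i)) = Var (xs i) \<and> \<tau> (the (ws i)) = Var (ys i);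
      \<And>v. v \<notin> ran ws \<Longrightarrow> \<sigma> v = Var v \<and> \<tau> v = Var v;
      wf_fm Sg C \<phi>; subst \<sigma> \<phi> \<phi>\<^sub>x; subst \<tau> \<phi> \<phi>\<^sub>y;
      s = (And (Conj (\<lambda>i. if i < g then Some (Eq (Var (xs i)) (Var (ys i))) else None)) \<phi>\<^sub>x, z, \<phi>\<^sub>y);
      wf_sequent Sg C s\<rbrakk>
     \<Longrightarrow> provable Sg C T s"
| conj_elim: "\<lbrakk>F j = Some \<phi>; wf_sequent Sg C (Conj F, x, \<phi>)\<rbrakk> \<Longrightarrow> provable Sg C T (Conj F, x, \<phi>)"
| conj_intro:
    "\<lbrakk>\<And>i \<psi>. F i = Some \<psi> \<Longrightarrow> provable Sg C T (\<phi>, x, \<psi>); wf_sequent Sg C (\<phi>, x, Conj F)\<rbrakk>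
     \<Longrightarrow> provable Sg C T (\<phi>, x, Conj F)"
| disj_intro: "\<lbrakk>F j = Some \<phi>; wf_sequent Sg C (\<phi>, x, Disj F)\<rbrakk> \<Longrightarrow> provable Sg C T (\<phi>, x, Disj F)"
| disj_elim:
    "\<lbrakk>\<And>i \<phi>. F i = Some \<phi> \<Longrightarrow> provable Sg C T (\<phi>, x, \<theta>); wf_sequent Sg C (Disj F, x, \<theta>)\<rbrakk>
     \<Longrightarrow> provable Sg C T (Disj F, x, \<theta>)"
| imp_intro: "provable Sg C T (And \<phi> \<psi>, x, \<eta>) \<Longrightarrow> wf_sequent Sg C (\<phi>, x, Imp \<psi> \<eta>)
     \<Longrightarrow> provable Sg C T (\<phi>, x, Imp \<psi> \<eta>)"
| imp_elim: "provable Sg C T (\<phi>, x, Imp \<psi> \<eta>) \<Longrightarrow> wf_sequent Sg C (And \<phi> \<psi>, x, \<eta>)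
     \<Longrightarrow> provable Sg C T (And \<phi> \<psi>, x, \<eta>)"
| ex_elim:
    "\<lbrakk>provable Sg C T (\<phi>, x \<union> bvars Y, \<psi>); x \<inter> bvars Y = {}; wf_sequent Sg C (Exists Y \<phi>, x, \<psi>)\<rbrakk>
     \<Longrightarrow> provable Sg C T (Exists Y \<phi>, x, \<psi>)"
| ex_intro:
    "\<lbrakk>provable Sg C T (Exists Y \<phi>, x, \<psi>); x \<inter> bvars Y = {}; wf_sequent Sg C (\<phi>, x \<union> bvars Y, \<psi>)\<rbrakk>
     \<Longrightarrow> provable Sg C T (\<phi>, x \<union> bvars Y, \<psi>)"
| all_intro:
    "\<lbrakk>provable Sg C T (\<phi>, x \<union> bvars Y, \<psi>); x \<inter> bvars Y = {}; wf_sequent Sg C (\<phi>, x, Forall Y \<psi>)\<rbrakk>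
     \<Longrightarrow> provable Sg C T (\<phi>, x, Forall Y \<psi>)"
| all_elim:
    "\<lbrakk>provable Sg C T (\<phi>, x, Forall Y \<psi>); x \<inter> bvars Y = {}; wf_sequent Sg C (\<phi>, x \<union> bvars Y, \<psi>)\<rbrakk>
     \<Longrightarrow> provable Sg C T (\<phi>, x \<union> bvars Y, \<psi>)"
| transfinite_transitivity:
    "\<lbrakk>is_cardinal_le_kappa \<Gamma>;
      \<And>f. f \<in> nodes \<Gamma> \<Longrightarrow>
        provable Sg C T (\<Phi> f, FV (\<Phi> f),
          Disj (\<lambda>i. if i \<in> \<Gamma> then Some (let g = f(len f \<mapsto> i) in Exists [ozero \<mapsto> X g] (\<Phi> g)) else None));
      \<And>f. f \<in> nodes \<Gamma> \<Longrightarrow> is_lim (len f) \<Longrightarrow>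
        provable Sg C T (\<Phi> f, FV (\<Phi> f),
          Conj (\<lambda>a. if a < len f then Some (\<Phi> (f |` {..<a})) else None));
      \<And>f. f \<in> nodes \<Gamma> \<Longrightarrow> is_lim (len f) \<Longrightarrow>
        provable Sg C T (Conj (\<lambda>a. if a < len f then Some (\<Phi> (f |` {..<a})) else None),
          FV (\<Phi> f), \<Phi> f);
      \<And>f i. f \<in> nodes \<Gamma> \<Longrightarrow> i \<in> \<Gamma> \<Longrightarrow>
        FV (\<Phi> (f(len f \<mapsto> i))) = FV (\<Phi> f) \<union> X (f(len f \<mapsto> i)) \<and>
        X (f(len f \<mapsto> i)) \<inter> FV (\<Phi> f) = {};
      \<And>f. f \<in> nodes \<Gamma> \<Longrightarrow> is_lim (len f) \<Longrightarrow> FV (\<Phi> f) = (\<Union>a\<in>{..<len f}. FV (\<Phi> (f |` {..<a})));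
      is_bar \<Gamma> B; bij_betw en I (minimal_nodes B);
      s = (\<Phi> Map.empty, FV (\<Phi> Map.empty),
           Disj (\<lambda>i. if i \<in> I
             then Some (Exists (\<lambda>b. if b < len (en i) then Some (X (en i |` {..b})) else None)
                         (Conj (\<lambda>b. if b < len (en i) then Some (\<Phi> (en i |` {..b})) else None)))
             else None));
      wf_sequent Sg C s\<rbrakk>
     \<Longrightarrow> provable Sg C T s"
| heterogeneous: "s \<in> heterogeneous_axioms Sg C \<Longrightarrow> provable Sg C T s"
| preservation: "s \<in> preservation_axioms Sg C \<Longrightarrow> provable Sg C T s"
| determinacy: "s \<in> determinacy_axioms Sg C \<Longrightarrow> provable Sg C T s"


section \<open>Categories and limits\<close>

record ('o, 'a) cat =
  Ob :: "'o set"
  Ar :: "'a set"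
  Dom :: "'a \<Rightarrow> 'o"
  Cod :: "'a \<Rightarrow> 'o"
  Idn :: "'o \<Rightarrow> 'a"
  Cmp :: "'a \<Rightarrow> 'a \<Rightarrow> 'a"

definition hom :: "('o, 'a) cat \<Rightarrow> 'o \<Rightarrow> 'o \<Rightarrow> 'a set" where
  "hom H A B = {f \<in> Ar H. Dom H f = A \<and> Cod H f = B}"

definition category :: "('o, 'a) cat \<Rightarrow> bool" where
  "category H \<longleftrightarrow>
     (\<forall>f\<in>Ar H. Dom H f \<in> Ob H \<and> Cod H f \<in> Ob H) \<and>
     (\<forall>A\<in>Ob H. Idn H A \<in> hom H A A) \<and>
     (\<forall>f\<in>Ar H. \<forall>g\<in>Ar H. Cod H f = Dom H g \<longrightarrow> Cmp H g f \<in> hom H (Dom H f) (Cod H g)) \<and>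
     (\<forall>f\<in>Ar H. Cmp H f (Idn H (Dom H f)) = f \<and> Cmp H (Idn H (Cod H f)) f = f) \<and>
     (\<forall>f\<in>Ar H. \<forall>g\<in>Ar H. \<forall>h\<in>Ar H. Cod H f = Dom H g \<longrightarrow> Cod H g = Dom H h \<longrightarrow>
        Cmp H h (Cmp H g f) = Cmp H (Cmp H h g) f)"

definition is_functor ::
    "('i, 'j) cat \<Rightarrow> ('o, 'a) cat \<Rightarrow> ('i \<Rightarrow> 'o) \<Rightarrow> ('j \<Rightarrow> 'a) \<Rightarrow> bool" where
  "is_functor J H Fo Fa \<longleftrightarrow>
     (\<forall>i\<in>Ob J. Fo i \<in> Ob H \<and> Fa (Idn J i) = Idn H (Fo i)) \<and>
     (\<forall>u\<in>Ar J. Fa u \<in> hom H (Fo (Dom J u)) (Fo (Cod J u))) \<and>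
     (\<forall>u\<in>Ar J. \<forall>v\<in>Ar J. Cod J u = Dom J v \<longrightarrow> Fa (Cmp J v u) = Cmp H (Fa v) (Fa u))"

text \<open>Cones over the diagram with objects \<open>F i\<close> (\<open>i \<in> I\<close>) and arrows \<open>E i j\<close> from \<open>F i\<close> to \<open>F j\<close>.\<close>

definition is_cone ::
    "('o, 'a) cat \<Rightarrow> 'i set \<Rightarrow> ('i \<Rightarrow> 'o) \<Rightarrow> ('i \<Rightarrow> 'i \<Rightarrow> 'a set) \<Rightarrow> 'o \<Rightarrow> ('i \<Rightarrow> 'a) \<Rightarrow> bool" where
  "is_cone H I F E L p \<longleftrightarrow> L \<in> Ob H \<and> (\<forall>i\<in>I. p i \<in> hom H L (F i)) \<and>
     (\<forall>i\<in>I. \<forall>j\<in>I. \<forall>u\<in>E i j. Cmp H u (p i) = p j)"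

definition is_limit ::
    "('o, 'a) cat \<Rightarrow> 'i set \<Rightarrow> ('i \<Rightarrow> 'o) \<Rightarrow> ('i \<Rightarrow> 'i \<Rightarrow> 'a set) \<Rightarrow> 'o \<Rightarrow> ('i \<Rightarrow> 'a) \<Rightarrow> bool" where
  "is_limit H I F E L p \<longleftrightarrow> is_cone H I F E L p \<and>
     (\<forall>K q. is_cone H I F E K q \<longrightarrow> (\<exists>!h. h \<in> hom H K L \<and> (\<forall>i\<in>I. Cmp H (p i) h = q i)))"

definition has_small_limits :: "'k itself \<Rightarrow> ('o, 'a) cat \<Rightarrow> bool" where
  "has_small_limits _ H \<longleftrightarrow>
     (\<forall>(J :: ('k, 'k) cat) Fo Fa. category J \<and> less_kappa TYPE('k) (Ar J) \<and> is_functor J H Fo Fa \<longrightarrow>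
        (\<exists>L p. is_limit H (Ob J) Fo (\<lambda>i j. Fa ` hom J i j) L p))"

definition is_product ::
    "('o, 'a) cat \<Rightarrow> 'i set \<Rightarrow> ('i \<Rightarrow> 'o) \<Rightarrow> 'o \<Rightarrow> ('i \<Rightarrow> 'a) \<Rightarrow> bool" where
  "is_product H I F L p \<longleftrightarrow> is_limit H I F (\<lambda>_ _. {}) L p"

definition prod_cone :: "('o, 'a) cat \<Rightarrow> 'i set \<Rightarrow> ('i \<Rightarrow> 'o) \<Rightarrow> 'o \<times> ('i \<Rightarrow> 'a)" where
  "prod_cone H I F = (SOME c. is_product H I F (fst c) (snd c))"

definition prod_ob :: "('o, 'a) cat \<Rightarrow> 'i set \<Rightarrow> ('i \<Rightarrow> 'o) \<Rightarrow> 'o" where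
  "prod_ob H I F = fst (prod_cone H I F)"

definition prod_pr :: "('o, 'a) cat \<Rightarrow> 'i set \<Rightarrow> ('i \<Rightarrow> 'o) \<Rightarrow> 'i \<Rightarrow> 'a" where
  "prod_pr H I F = snd (prod_cone H I F)"

definition tuple :: "('o, 'a) cat \<Rightarrow> 'i set \<Rightarrow> ('i \<Rightarrow> 'o) \<Rightarrow> 'o \<Rightarrow> ('i \<Rightarrow> 'a) \<Rightarrow> 'a" where
  "tuple H I F B g =
     (THE h. h \<in> hom H B (prod_ob H I F) \<and> (\<forall>i\<in>I. Cmp H (prod_pr H I F i) h = g i))"

definition is_pullback :: "('o, 'a) cat \<Rightarrow> 'a \<Rightarrow> 'a \<Rightarrow> 'a \<Rightarrow> 'a \<Rightarrow> bool" where
  "is_pullback H f g p q \<longleftrightarrow>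
     f \<in> Ar H \<and> g \<in> Ar H \<and> Cod H f = Cod H g \<and> p \<in> hom H (Dom H p) (Dom H f) \<and>
     q \<in> hom H (Dom H p) (Dom H g) \<and> Cmp H f p = Cmp H g q \<and>
     (\<forall>K. \<forall>a\<in>hom H K (Dom H f). \<forall>b\<in>hom H K (Dom H g). Cmp H f a = Cmp H g b \<longrightarrow>
        (\<exists>!h. h \<in> hom H K (Dom H p) \<and> Cmp H p h = a \<and> Cmp H q h = b))"


section \<open>Subobjects\<close>

text \<open>
  A subobject of \<open>A\<close>, represented by a mono \<open>m\<close>, is identified with the set of all arrows into \<open>A\<close>
  that factor through \<open>m\<close>. This set determines \<open>m\<close> up to isomorphism over \<open>A\<close>, and the order on
  subobjects becomes inclusion.
\<close>

definition monic :: "('o, 'a) cat \<Rightarrow> 'a \<Rightarrow> bool" where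
  "monic H m \<longleftrightarrow> m \<in> Ar H \<and>
     (\<forall>f\<in>Ar H. \<forall>g\<in>Ar H. Dom H f = Dom H g \<longrightarrow> Cod H f = Dom H m \<longrightarrow> Cod H g = Dom H m \<longrightarrow>
        Cmp H m f = Cmp H m g \<longrightarrow> f = g)"

definition sub_of :: "('o, 'a) cat \<Rightarrow> 'a \<Rightarrow> 'a set" where
  "sub_of H m = {g \<in> Ar H. \<exists>h \<in> hom H (Dom H g) (Dom H m). Cmp H m h = g}"

definition Sub :: "('o, 'a) cat \<Rightarrow> 'o \<Rightarrow> 'a set set" where
  "Sub H A = {sub_of H m | m. monic H m \<and> Cod H m = A}"

definition whole :: "('o, 'a) cat \<Rightarrow> 'o \<Rightarrow> 'a set" where
  "whole H A = {g \<in> Ar H. Cod H g = A}"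

definition is_least :: "'x set set \<Rightarrow> 'x set \<Rightarrow> bool" where
  "is_least \<S> J \<longleftrightarrow> J \<in> \<S> \<and> (\<forall>K\<in>\<S>. J \<subseteq> K)"

definition is_greatest :: "'x set set \<Rightarrow> 'x set \<Rightarrow> bool" where
  "is_greatest \<S> J \<longleftrightarrow> J \<in> \<S> \<and> (\<forall>K\<in>\<S>. K \<subseteq> J)"

text \<open>The inverse image \<open>f\<^sup>-\<^sup>1\<close>: if \<open>R\<close> is represented by \<open>m\<close>, this is the pullback of \<open>m\<close> along \<open>f\<close>.\<close>

definition pull :: "('o, 'a) cat \<Rightarrow> 'a \<Rightarrow> 'a set \<Rightarrow> 'a set" where
  "pull H f R = {g \<in> Ar H. Cod H g = Dom H f \<and> Cmp H f g \<in> R}"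

definition is_join :: "('o, 'a) cat \<Rightarrow> 'o \<Rightarrow> 'a set set \<Rightarrow> 'a set \<Rightarrow> bool" where
  "is_join H A \<R> = is_least {S \<in> Sub H A. \<forall>R\<in>\<R>. R \<subseteq> S}"

definition is_image :: "('o, 'a) cat \<Rightarrow> 'a \<Rightarrow> 'a set \<Rightarrow> bool" where
  "is_image H f = is_least {S \<in> Sub H (Cod H f). f \<in> S}"

definition is_ex :: "('o, 'a) cat \<Rightarrow> 'a \<Rightarrow> 'a set \<Rightarrow> 'a set \<Rightarrow> bool" where
  "is_ex H f R = is_least {S \<in> Sub H (Cod H f). R \<subseteq> pull H f S}"

definition is_all :: "('o, 'a) cat \<Rightarrow> 'a \<Rightarrow> 'a set \<Rightarrow> 'a set \<Rightarrow> bool" where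
  "is_all H f R = is_greatest {S \<in> Sub H (Cod H f). pull H f S \<subseteq> R}"

definition is_imp :: "('o, 'a) cat \<Rightarrow> 'o \<Rightarrow> 'a set \<Rightarrow> 'a set \<Rightarrow> 'a set \<Rightarrow> bool" where
  "is_imp H A R S = is_greatest {Q \<in> Sub H A. Q \<inter> R \<subseteq> S}"

definition join :: "('o, 'a) cat \<Rightarrow> 'o \<Rightarrow> 'a set set \<Rightarrow> 'a set" where
  "join H A \<R> = (THE J. is_join H A \<R> J)"

definition img :: "('o, 'a) cat \<Rightarrow> 'a \<Rightarrow> 'a set" where
  "img H f = (THE J. is_image H f J)"

definition ex_along :: "('o, 'a) cat \<Rightarrow> 'a \<Rightarrow> 'a set \<Rightarrow> 'a set" where
  "ex_along H f R = (THE J. is_ex H f R J)"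

definition all_along :: "('o, 'a) cat \<Rightarrow> 'a \<Rightarrow> 'a set \<Rightarrow> 'a set" where
  "all_along H f R = (THE J. is_all H f R J)"

definition imp_sub :: "('o, 'a) cat \<Rightarrow> 'o \<Rightarrow> 'a set \<Rightarrow> 'a set \<Rightarrow> 'a set" where
  "imp_sub H A R S = (THE J. is_imp H A R S J)"


section \<open>\<open>\<kappa>\<close>-Heyting categories\<close>

text \<open>
  Images, and stability under pullback of the covers, i.e. of the arrows whose image is the whole
  codomain; finite limits are part of \<open>has_small_limits\<close>.
\<close>

definition regular_images :: "('o, 'a) cat \<Rightarrow> bool" where
  "regular_images H \<longleftrightarrow>
     (\<forall>f\<in>Ar H. \<exists>J. is_image H f J) \<and>
     (\<forall>f g p q. is_pullback H f g p q \<and> is_image H f (whole H (Cod H f)) \<longrightarrow>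
        is_image H q (whole H (Cod H q)))"

definition stable_unions :: "'k itself \<Rightarrow> ('o, 'a) cat \<Rightarrow> bool" where
  "stable_unions _ H \<longleftrightarrow>
     (\<forall>A\<in>Ob H. \<forall>\<R>\<subseteq>Sub H A. |\<R>| \<le>o |UNIV :: 'k set| \<longrightarrow>
        (\<exists>J. is_join H A \<R> J \<and>
             (\<forall>f\<in>Ar H. Cod H f = A \<longrightarrow> is_join H (Dom H f) (pull H f ` \<R>) (pull H f J))))"

definition covering :: "'k itself \<Rightarrow> ('o, 'a) cat \<Rightarrow> 'o \<Rightarrow> 'i set \<Rightarrow> ('i \<Rightarrow> 'a) \<Rightarrow> bool" where
  "covering _ H A I u \<longleftrightarrow>
     |I| \<le>o |UNIV :: 'k set| \<and> (\<forall>i\<in>I. u i \<in> Ar H \<and> Cod H (u i) = A) \<and>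
     is_join H A ((\<lambda>i. img H (u i)) ` I) (whole H A)"

text \<open>
  A node of the tree at level \<open>\<beta>\<close> is named by the sequence \<open>s\<close> of length \<open>\<beta>\<close> of its choices of
  successors; \<open>D s\<close> is its object and \<open>p s \<alpha>\<close> the arrow to the object of its predecessor at level
  \<open>\<alpha>\<close>. A branch whose length is a limit below \<open>\<kappa>\<close> is closed off by a node carrying its limit, so that
  the branches \<open>b\<close> correspond to the leaves and \<open>D\<^sup>b\<close> is the object at the leaf.
\<close>

definition branching_tree :: "('k::wellorder \<rightharpoonup> 'k) set \<Rightarrow> bool" where
  "branching_tree N \<longleftrightarrow>
     Map.empty \<in> N \<and> (\<forall>s\<in>N. \<exists>b. dom s = {..<b}) \<and>
     (\<forall>s\<in>N. \<forall>a. s |` {..<a} \<in> N) \<and>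
     (\<forall>s b. dom s = {..<b} \<and> is_lim b \<and> (\<forall>a<b. s |` {..<a} \<in> N) \<longrightarrow> s \<in> N) \<and>
     (\<nexists>f :: 'k \<Rightarrow> 'k. \<forall>b. (Some \<circ> f) |` {..<b} \<in> N)"

definition succs :: "('k::wellorder \<rightharpoonup> 'k) set \<Rightarrow> ('k \<rightharpoonup> 'k) \<Rightarrow> 'k set" where
  "succs N s = {i. s(len s \<mapsto> i) \<in> N}"

definition tree_of_objects ::
    "('o, 'a) cat \<Rightarrow> ('k::wellorder \<rightharpoonup> 'k) set \<Rightarrow> (('k \<rightharpoonup> 'k) \<Rightarrow> 'o) \<Rightarrow> (('k \<rightharpoonup> 'k) \<Rightarrow> 'k \<Rightarrow> 'a) \<Rightarrow> bool"
  where
  "tree_of_objects H N D p \<longleftrightarrow>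
     (\<forall>s\<in>N. D s \<in> Ob H \<and> p s (len s) = Idn H (D s) \<and>
        (\<forall>b\<le>len s. p s b \<in> hom H (D s) (D (s |` {..<b})) \<and>
           (\<forall>a\<le>b. Cmp H (p (s |` {..<b}) a) (p s b) = p s a)) \<and>
        (is_lim (len s) \<longrightarrow>
           is_limit H {..<len s} (\<lambda>a. D (s |` {..<a}))
             (\<lambda>b a. if a \<le> b then {p (s |` {..<b}) a} else {}) (D s) (p s)))"

definition transfinite_transitive :: "'k::wellorder itself \<Rightarrow> ('o, 'a) cat \<Rightarrow> bool" where
  "transfinite_transitive K H \<longleftrightarrow>
     (\<forall>(N :: ('k \<rightharpoonup> 'k) set) D p.
        branching_tree N \<and> tree_of_objects H N D p \<and>
        (\<forall>s\<in>N. succs N s \<noteq> {} \<longrightarrow>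
           covering K H (D s) (succs N s) (\<lambda>i. p (s(len s \<mapsto> i)) (len s))) \<longrightarrow>
        covering K H (D Map.empty) {s \<in> N. succs N s = {}} (\<lambda>s. p s ozero))"

definition kappa_Heyting :: "'k::wellorder itself \<Rightarrow> ('o, 'a) cat \<Rightarrow> bool" where
  "kappa_Heyting K H \<longleftrightarrow>
     category H \<and> has_small_limits K H \<and> regular_images H \<and> stable_unions K H \<and>
     (\<forall>f\<in>Ar H. \<forall>R\<in>Sub H (Dom H f). \<exists>J. is_all H f R J) \<and>
     transfinite_transitive K H"


section \<open>The subobjects \<open>T\<^sup>\<gamma>\<^sup>,\<^sup>S\<close>\<close>

text \<open>
  A play above \<open>C\<close> is a continuous chain of objects: \<open>stage 0 = C\<close>, \<open>stage (\<alpha> + 1) = D\<^sub>\<alpha>\<close>, and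
  \<open>stage \<lambda>\<close> is the limit of the preceding chain for limit \<open>\<lambda>\<close>. So the move at stage \<open>\<alpha>\<close> is an arrow
  \<open>link (\<alpha> + 1) \<alpha> : D\<^sub>\<alpha> \<rightarrow> stage \<alpha>\<close> together with \<open>elt \<alpha> : D\<^sub>\<alpha> \<rightarrow> A\<^sub>\<alpha>\<close>. At the stages with \<open>cov \<alpha>\<close>,
  a strategy \<open>\<sigma>\<close> supplies a covering family of \<open>stage \<alpha>\<close> and its arrows to \<open>A\<^sub>\<alpha>\<close> as a function of the
  play so far, and \<open>idx \<alpha>\<close> is the member of the family taken by the branch.
\<close>

record ('o, 'a, 'k) play =
  stage :: "'k \<Rightarrow> 'o"
  link :: "'k \<Rightarrow> 'k \<Rightarrow> 'a"
  elt :: "'k \<Rightarrow> 'a"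
  idx :: "'k \<Rightarrow> 'k"

type_synonym ('o, 'a, 'k) strategy =
  "'k \<Rightarrow> ('o, 'a, 'k) play \<Rightarrow> 'k set \<times> ('k \<Rightarrow> 'a) \<times> ('k \<Rightarrow> 'a)"

definition history :: "'k::wellorder \<Rightarrow> ('o, 'a, 'k) play \<Rightarrow> ('o, 'a, 'k) play" where
  "history a r =
     \<lparr>stage = (\<lambda>b. if b \<le> a then stage r b else undefined),
      link = (\<lambda>b c. if c \<le> b \<and> b \<le> a then link r b c else undefined),
      elt = (\<lambda>b. if b < a then elt r b else undefined),
      idx = (\<lambda>b. if b < a then idx r b else undefined)\<rparr>"

definition is_chain :: "('o, 'a) cat \<Rightarrow> 'o \<Rightarrow> 'k::wellorder \<Rightarrow> ('o, 'a, 'k) play \<Rightarrow> bool" where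
  "is_chain H C g r \<longleftrightarrow>
     stage r ozero = C \<and>
     (\<forall>b\<le>g. stage r b \<in> Ob H \<and> link r b b = Idn H (stage r b) \<and>
        (\<forall>a\<le>b. link r b a \<in> hom H (stage r b) (stage r a) \<and>
           (\<forall>c\<le>a. Cmp H (link r a c) (link r b a) = link r b c)) \<and>
        (is_lim b \<longrightarrow>
           is_limit H {..<b} (stage r) (\<lambda>a c. if c \<le> a then {link r a c} else {})
             (stage r b) (link r b)))"

definition follows ::
    "('o, 'a) cat \<Rightarrow> ('k::wellorder \<Rightarrow> bool) \<Rightarrow> ('k \<Rightarrow> 'o) \<Rightarrow> ('o, 'a, 'k) strategy \<Rightarrow> 'k \<Rightarrow>
     ('o, 'a, 'k) play \<Rightarrow> bool" where
  "follows H cov As \<sigma> g r \<longleftrightarrow>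
     (\<forall>a<g. elt r a \<in> hom H (stage r (osuc a)) (As a) \<and>
        (cov a \<longrightarrow>
          (case \<sigma> a (history a r) of (I, u, e) \<Rightarrow>
             idx r a \<in> I \<and> link r (osuc a) a = u (idx r a) \<and> elt r a = e (idx r a))))"

definition covering_strategy ::
    "('o, 'a) cat \<Rightarrow> ('k::wellorder \<Rightarrow> bool) \<Rightarrow> ('k \<Rightarrow> 'o) \<Rightarrow> 'o \<Rightarrow> 'k \<Rightarrow> ('o, 'a, 'k) strategy \<Rightarrow> bool"
  where
  "covering_strategy H cov As C g \<sigma> \<longleftrightarrow>
     (\<forall>a<g. cov a \<longrightarrow> (\<forall>r. is_chain H C a r \<and> follows H cov As \<sigma> a r \<longrightarrow>
        (case \<sigma> a (history a r) of (I, u, e) \<Rightarrow>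
           covering TYPE('k) H (stage r a) I u \<and> (\<forall>i\<in>I. e i \<in> hom H (Dom H (u i)) (As a)))))"

text \<open>
  Below, \<open>Z\<close> with projections \<open>pA\<close> and \<open>pr \<alpha>\<close> (\<open>\<alpha> < \<gamma>\<close>) is the product \<open>A \<times> A\<^sub>\<gamma>\<close>, and \<open>S\<close> is a
  subobject of \<open>Z\<close>; \<open>w\<close> is the arrow \<open>(l f\<^sub>b, e\<^sub>0 \<pi>\<^sub>0, e\<^sub>1 \<pi>\<^sub>1, \<dots>)\<close>.
\<close>

definition in_T ::
    "('o, 'a) cat \<Rightarrow> ('k::wellorder \<Rightarrow> bool) \<Rightarrow> 'k \<Rightarrow> ('k \<Rightarrow> 'o) \<Rightarrow> 'a \<Rightarrow> ('k \<Rightarrow> 'a) \<Rightarrow> 'a set \<Rightarrow>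
     'a \<Rightarrow> bool" where
  "in_T H cov g As pA pr S l \<longleftrightarrow>
     (\<exists>\<sigma>. covering_strategy H cov As (Dom H l) g \<sigma> \<and>
        (\<forall>r. is_chain H (Dom H l) g r \<and> follows H cov As \<sigma> g r \<longrightarrow>
           (\<exists>w\<in>S. Dom H w = stage r g \<and> Cmp H pA w = Cmp H l (link r g ozero) \<and>
              (\<forall>a<g. Cmp H (pr a) w = Cmp H (elt r a) (link r g (osuc a))))))"

definition T_sub ::
    "('o, 'a) cat \<Rightarrow> ('k::wellorder \<Rightarrow> bool) \<Rightarrow> 'k \<Rightarrow> 'o \<Rightarrow> ('k \<Rightarrow> 'o) \<Rightarrow> 'a \<Rightarrow> ('k \<Rightarrow> 'a) \<Rightarrow>
     'a set \<Rightarrow> 'a set set" where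
  "T_sub H cov g A As pA pr S = {sub_of H l | l. monic H l \<and> Cod H l = A \<and> in_T H cov g As pA pr S l}"


section \<open>Semantics\<close>

record ('s, 'f, 'r, 'o, 'a) struc =
  sort_ob :: "'s \<Rightarrow> 'o"
  fun_ar :: "'f \<Rightarrow> 'a"
  rel_sub :: "'r \<Rightarrow> 'a set"

definition arity_ob :: "('o, 'a) cat \<Rightarrow> ('s, 'f, 'r, 'o, 'a) struc \<Rightarrow> ('k \<rightharpoonup> 's) \<Rightarrow> 'o" where
  "arity_ob H M ar = prod_ob H (dom ar) (\<lambda>i. sort_ob M (the (ar i)))"

definition is_structure ::
    "('k, 's, 'f, 'r) signature \<Rightarrow> ('o, 'a) cat \<Rightarrow> ('s, 'f, 'r, 'o, 'a) struc \<Rightarrow> bool" where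
  "is_structure Sg H M \<longleftrightarrow>
     (\<forall>s\<in>Sorts Sg. sort_ob M s \<in> Ob H) \<and>
     (\<forall>f\<in>Funs Sg. fun_ar M f \<in> hom H (arity_ob H M (fun_arity Sg f)) (sort_ob M (fun_sort Sg f))) \<and>
     (\<forall>r\<in>Rels Sg. rel_sub M r \<in> Sub H (arity_ob H M (rel_arity Sg r)))"

definition ctx_ob :: "('o, 'a) cat \<Rightarrow> ('s, 'f, 'r, 'o, 'a) struc \<Rightarrow> ('s, 'k) block \<Rightarrow> 'o" where
  "ctx_ob H M x = prod_ob H x (\<lambda>v. sort_ob M (fst v))"

definition ctx_pr :: "('o, 'a) cat \<Rightarrow> ('s, 'f, 'r, 'o, 'a) struc \<Rightarrow> ('s, 'k) block \<Rightarrow> ('s, 'k) var \<Rightarrow> 'a"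
  where
  "ctx_pr H M x = prod_pr H x (\<lambda>v. sort_ob M (fst v))"

text \<open>The projection \<open>[[x]] \<rightarrow> [[y]]\<close> for \<open>y \<subseteq> x\<close>.\<close>

definition proj ::
    "('o, 'a) cat \<Rightarrow> ('s, 'f, 'r, 'o, 'a) struc \<Rightarrow> ('s, 'k) block \<Rightarrow> ('s, 'k) block \<Rightarrow> 'a" where
  "proj H M x y = tuple H y (\<lambda>v. sort_ob M (fst v)) (ctx_ob H M x) (ctx_pr H M x)"

definition arity_tuple ::
    "('o, 'a) cat \<Rightarrow> ('s, 'f, 'r, 'o, 'a) struc \<Rightarrow> ('k \<rightharpoonup> 's) \<Rightarrow> ('s, 'k) block \<Rightarrow>
     ('k \<Rightarrow> 'a) \<Rightarrow> 'a" where
  "arity_tuple H M ar x = tuple H (dom ar) (\<lambda>i. sort_ob M (the (ar i))) (ctx_ob H M x)"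

primrec tsem ::
    "('k, 's, 'f, 'r) signature \<Rightarrow> ('o, 'a) cat \<Rightarrow> ('s, 'f, 'r, 'o, 'a) struc \<Rightarrow>
     ('k, 's, 'f) tm \<Rightarrow> ('s, 'k) block \<Rightarrow> 'a" where
  "tsem Sg H M (Var v) = (\<lambda>x. ctx_pr H M x v)"
| "tsem Sg H M (App f ts) = (\<lambda>x. Cmp H (fun_ar M f)
     (arity_tuple H M (fun_arity Sg f) x (\<lambda>i. the (map_option (tsem Sg H M) (ts i)) x)))"

definition het_family ::
    "('o, 'a) cat \<Rightarrow> ('s, 'f, 'r, 'o, 'a) struc \<Rightarrow> ('k::wellorder \<Rightarrow> bool) \<Rightarrow>
     ('k \<rightharpoonup> ('s, 'k) block) \<Rightarrow> ('s, 'k) block \<Rightarrow> 'a set \<Rightarrow> 'a set set" where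
  "het_family H M cov X x S =
     (let z = x \<union> bvars X
      in T_sub H cov (len X) (ctx_ob H M x) (\<lambda>a. ctx_ob H M (the (X a)))
           (proj H M z x) (\<lambda>a. proj H M z (the (X a))) S)"

text \<open>
  If \<open>x\<close> is disjoint from \<open>bvars X\<close>, then \<open>y = x\<close> in the clause for \<open>Quant\<close>. Otherwise the
  quantifier shadows some variables of the context; the interpretation is computed without them
  and then pulled back.
\<close>

primrec sem ::
    "('k::wellorder, 's, 'f, 'r) signature \<Rightarrow> ('o, 'a) cat \<Rightarrow> ('s, 'f, 'r, 'o, 'a) struc \<Rightarrow>
     ('k, 's, 'f, 'r) fm \<Rightarrow> ('s, 'k) block \<Rightarrow> 'a set" where
  "sem Sg H M (Eq s t) = (\<lambda>x. {g \<in> whole H (ctx_ob H M x).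
     Cmp H (tsem Sg H M s x) g = Cmp H (tsem Sg H M t x) g})"
| "sem Sg H M (Rel r ts) = (\<lambda>x.
     pull H (arity_tuple H M (rel_arity Sg r) x (\<lambda>i. tsem Sg H M (the (ts i)) x)) (rel_sub M r))"
| "sem Sg H M (Imp \<phi> \<psi>) = (\<lambda>x. imp_sub H (ctx_ob H M x) (sem Sg H M \<phi> x) (sem Sg H M \<psi> x))"
| "sem Sg H M (Conj F) = (\<lambda>x. whole H (ctx_ob H M x) \<inter>
     \<Inter> {R x | i R. map_option (sem Sg H M) (F i) = Some R})"
| "sem Sg H M (Disj F) = (\<lambda>x. join H (ctx_ob H M x)
     {R x | i R. map_option (sem Sg H M) (F i) = Some R})"
| "sem Sg H M (Quant q X \<phi>) = (\<lambda>x.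
     (let y = x - bvars X; z = y \<union> bvars X; S = sem Sg H M \<phi> z
      in pull H (proj H M x y)
          (case q of
             QAll \<Rightarrow> all_along H (proj H M z y) S
           | QEx \<Rightarrow> ex_along H (proj H M z y) S
           | QAE \<Rightarrow> join H (ctx_ob H M y) (het_family H M (\<lambda>a. \<not> ord_even a) X y S)
           | QEA \<Rightarrow> join H (ctx_ob H M y) (het_family H M ord_even X y S))))"

definition holds ::
    "('k::wellorder, 's, 'f, 'r) signature \<Rightarrow> ('o, 'a) cat \<Rightarrow> ('s, 'f, 'r, 'o, 'a) struc \<Rightarrow>
     ('k, 's, 'f, 'r) sequent \<Rightarrow> bool" where
  "holds Sg H M = (\<lambda>(\<phi>, x, \<psi>). sem Sg H M \<phi> x \<subseteq> sem Sg H M \<psi> x)"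

text \<open>
  The objects \<open>A\<close>, \<open>A\<^sub>\<alpha>\<close> are those that interpret contexts \<open>x\<close>, \<open>x\<^sub>\<alpha>\<close>, and \<open>S\<close> interprets a formula of
  \<open>C\<close> in the context \<open>x \<union> \<Union>\<^sub>\<alpha> x\<^sub>\<alpha>\<close>, so the notion depends on the structure.
\<close>

definition kappa_heterogeneous ::
    "('k::wellorder, 's, 'f, 'r) signature \<Rightarrow> ('k, 's, 'f, 'r) fm set \<Rightarrow> ('o, 'a) cat \<Rightarrow>
     ('s, 'f, 'r, 'o, 'a) struc \<Rightarrow> bool" where
  "kappa_heterogeneous Sg C H M \<longleftrightarrow>
     kappa_Heyting TYPE('k) H \<and>
     (\<forall>g X x \<phi>. is_lim g \<and> wf_blocks Sg X \<and> dom X = {..<g} \<and> wf_context Sg x \<and> x \<inter> bvars X = {} \<and>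
        \<phi> \<in> C \<and> wf_fm Sg C \<phi> \<and> FV \<phi> \<subseteq> x \<union> bvars X \<longrightarrow>
        (let z = x \<union> bvars X
         in (\<exists>J. is_join H (ctx_ob H M x)
                   (het_family H M (\<lambda>a. \<not> ord_even a) X x (sem Sg H M \<phi> z)) J) \<and>
            (\<exists>J. is_join H (ctx_ob H M x)
                   (het_family H M ord_even X x (sem Sg H M (Neg \<phi>) z)) J)))"

definition well_determined ::
    "('k::wellorder, 's, 'f, 'r) signature \<Rightarrow> ('k, 's, 'f, 'r) fm set \<Rightarrow> ('o, 'a) cat \<Rightarrow>
     ('s, 'f, 'r, 'o, 'a) struc \<Rightarrow> bool" where
  "well_determined Sg C H M \<longleftrightarrow>
     is_structure Sg H M \<and> (\<forall>s \<in> preservation_axioms Sg C \<union> determinacy_axioms Sg C. holds Sg H M s)"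

definition well_determined_model ::
    "('k::wellorder, 's, 'f, 'r) signature \<Rightarrow> ('k, 's, 'f, 'r) fm set \<Rightarrow> ('k, 's, 'f, 'r) sequent set \<Rightarrow>
     ('o, 'a) cat \<Rightarrow> ('s, 'f, 'r, 'o, 'a) struc \<Rightarrow> bool" where
  "well_determined_model Sg C T H M \<longleftrightarrow> well_determined Sg C H M \<and> (\<forall>s\<in>T. holds Sg H M s)"

unbundle no cardinal_syntax

end

theory Submission
 imports Defs
begin

text \<open>Subobjects are handled as sieves, so that the interpretation of every connective takes its Kripke--Joyal form and the
rules for the first-order connectives become statements about generalised elements. The point is the heterogeneous quantifiers.
If two players win the two opposite games on \<open>C\<close>, playing their strategies against each other yields a tree of plays which by
transfinite transitivity covers \<open>C\<close>, and at every leaf both \<open>S\<close> and \<open>~ S\<close> hold; hence the joins of the winning subobjects of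
the two games are disjoint. Winning subobjects are stable under restriction, so by determinacy the two joins, whose union
is everything, are complementary both before and after a change of base, and therefore commute with it. This gives
substitution for the quantifiers. Appending the empty block corrects the parity of a game, at the price of dummy covers, which are
postponed to the next genuine cover. The heterogeneous axioms hold because the part of a winning strategy following an
initial play is a winning strategy for the tail of the game.\<close>

unbundle cardinal_syntax

text \<open>The obstacle is that a heterogeneous quantifier comes only with the existence of a join.
  The family joined may have more than \<kappa> members, so nothing says that the join is stable,
  while substitution and the quantifier rules need Beck-Chevalley for it. Determinacy is the only
  source of stability, and its axioms have a narrow range: limit lengths, with a formula of the
  class as target of the player covering at odd stages. The other parity is reached by putting an
  empty block at stage 0 and at every limit, other lengths by padding with empty blocks up to a
  limit. If there is no limit below \<kappa>, games are finite and are solved by backward induction.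
  Strategies see the history of a play, so they cannot be edited stage by stage. Every transfer
  between two games has one form: a play of the new game is turned into a shadow play of the old
  one, the old strategy answers there, and the answer is carried back. The work lies in showing that
  shadows are plays, above all that their limit stages are limits.\<close>

lemma ozero_le [simp]: "ozero <= (a::'k::wellorder)"
 unfolding ozero_def by(rule Least_le) simp

lemma not_less_ozero [simp]: "~ a < (ozero::'k::wellorder)"
 by(simp add: not_less)

lemma le_ozero_iff [simp]: "a <= ozero \<longleftrightarrow> a = (ozero::'k::wellorder)"
 by(simp add: antisym)

lemma strict_mono_on_ge:
 fixes f :: "'k::wellorder => 'k"
 assumes "strict_mono_on {..<d} f" "a < d"
 shows "a <= f a"
 using assms(2)
proof(induction a rule: less_induct)
 case (less a)
 show ?case
 proof(rule ccontr)
  assume "~ a <= f a"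
  hence lt: "f a < a" by simp
  with less.prems have "f a < d" by simp
  hence "f (f a) < f a" using assms(1) lt less.prems
  by(auto simp: strict_mono_on_def)
  moreover have "f a <= f (f a)" using less.IH[OF lt] \<open>f a < d\<close> by blast
  ultimately show False by simp
 qed
qed

section \<open>Ordinals below \<kappa> and sets of fewer than \<kappa> elements\<close>

locale kappa =
 fixes K :: "'k::wellorder itself"
 assumes regular: "regular_kappa TYPE('k)"
begin

lemma kappa_card:
 "Cinfinite {(a, b). a <= (b::'k)}" "regularCard {(a, b). a <= (b::'k)}"
 "Field {(a, b). a <= (b::'k)} = UNIV" "|UNIV :: 'k set| =o {(a, b). a <= (b::'k)}"
proof -
 let ?r = "{(a, b). a <= (b::'k)}"
 show 1: "Cinfinite ?r" and "regularCard ?r" using regular by(auto simp: regular_kappa_def Let_def)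
 show 2: "Field ?r = UNIV" by(auto simp: Field_def)
 show "|UNIV :: 'k set| =o ?r" using card_of_Field_ordIso[of ?r] 1 2 by simp
qed

lemma infinite_kappa: "infinite (UNIV :: 'k set)"
 using kappa_card(1,3) by(simp add: cinfinite_def)

lemma less_kappa_iff: "|V| <o |UNIV :: 'k set| \<longleftrightarrow> |V| <o {(a, b). a <= (b::'k)}"
 using kappa_card(4) ordLess_ordIso_trans ordIso_symmetric by blast

lemma small_lessThan: "|{..<a::'k}| <o |UNIV :: 'k set|"
proof -
 have "|underS {(a, b). a <= (b::'k)} a| <o {(a, b). a <= (b::'k)}"
  using card_of_underS[of "{(a, b). a <= (b::'k)}" a] kappa_card by simp
 moreover have "underS {(a, b). a <= (b::'k)} a = {..<a}" by(auto simp: underS_def)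
 ultimately show ?thesis by(simp add: less_kappa_iff)
qed

lemma card_finite: "finite A ==> |A| <o |UNIV :: 'k set|"
 using finite_ordLess_infinite[of "|A|" "|UNIV :: 'k set|"] infinite_kappa
 by(metis card_of_Well_order Field_card_of)

lemma ex_greater: "EX b. (a::'k) < b"
proof(rule ccontr)
 assume "~ (EX b. a < b)"
 hence b: "!!c. c <= a" by(meson not_less)
 hence u: "(UNIV :: 'k set) = {a} Un {..<a}" by(auto simp: order.order_iff_strict)
 have "|{a} Un {..<a}| <o |UNIV :: 'k set|"
  using card_of_Un_ordLess_infinite[OF infinite_kappa card_finite[of "{a}"] small_lessThan] by simp
 thus False using u by(metis ordLess_irreflexive)
qed

text \<open>An unbounded set of ordinals is cofinal, and by regularity a cofinal set has full
  cardinality. This is how suprema and fresh indices below \<kappa> are obtained.\<close>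

lemma small_bounded:
 assumes "|V :: 'k set| <o |UNIV :: 'k set|"
 shows "EX b. ALL v:V. v < b"
proof(rule ccontr)
 assume n: "\<nexists>b. ALL v:V. v < b"
 have 0: "EX v:V. b <= v" for b using n by(meson not_less)
 have "ALL b::'k. EX c. b < c" using ex_greater by blast
 hence "ALL b::'k. EX v:V. b < v" using 0 by(meson order_less_le_trans)
 hence "cofinal V {(a, b). a <= (b::'k)}"
  unfolding cofinal_def using kappa_card(3) by(auto intro!: ballI) (metis order_less_imp_le less_irrefl)
 hence "|V| =o {(a, b). a <= (b::'k)}"
  using kappa_card(2,3) unfolding regularCard_def by auto
 with assms show False by(simp add: less_kappa_iff not_ordLess_ordIso)
qed

lemma less_osuc [simp]: "a < osuc (a::'k)"
 unfolding osuc_def using ex_greater by(rule LeastI_ex)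

lemma osuc_le_iff [simp]: "osuc a <= b \<longleftrightarrow> a < (b::'k)"
 using less_osuc[of a] Least_le[of "%b. a < b"] unfolding osuc_def by(meson order_less_le_trans)

lemma less_osuc_iff [simp]: "b < osuc a \<longleftrightarrow> b <= (a::'k)"
 using osuc_le_iff[of a b] by(meson not_le)

lemma osuc_inj [simp]: "osuc a = osuc b \<longleftrightarrow> a = (b::'k)"
 by(metis less_osuc_iff less_osuc antisym)

lemma osuc_less_iff [simp]: "osuc a < osuc b \<longleftrightarrow> a < (b::'k)"
 by simp

lemma osuc_neq_ozero [simp]: "osuc a ~= (ozero::'k)" "ozero ~= osuc (a::'k)"
 using less_osuc[of a] by(metis not_less_ozero)+

lemma osuc_neq [simp]: "osuc a ~= (a::'k)" "a ~= osuc (a::'k)"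
 using less_osuc[of a] by(metis less_irrefl)+

lemma is_lim_osuc [simp]: "~ is_lim (osuc (a::'k))"
 unfolding is_lim_def by(meson less_osuc less_osuc_iff not_le order_less_le_trans)

lemma is_lim_ozero [simp]: "~ is_lim (ozero::'k)"
 by(simp add: is_lim_def)

lemma is_lim_osuc_less: "is_lim l ==> a < l ==> osuc a < (l::'k)"
 unfolding is_lim_def by(meson osuc_le_iff le_less_trans)

lemma is_lim_ozero_less: "is_lim l ==> ozero < (l::'k)"
 by(metis is_lim_ozero ozero_le order.not_eq_order_implies_strict)

lemma is_lim_iff: "is_lim l \<longleftrightarrow> ozero < l & (ALL a<l. osuc a < (l::'k))"
 by(metis is_lim_def is_lim_osuc_less is_lim_ozero_less less_osuc)

lemma ord_cases:
 obtains (zero) "(a::'k) = ozero" | (succ) b where "a = osuc b" | (lim) "is_lim a"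
proof(cases "a = ozero \<or> is_lim a")
 case False
 then obtain b where b: "b < a" "~ osuc b < a"
  unfolding is_lim_iff by(metis order.not_eq_order_implies_strict ozero_le)
 hence "osuc b <= a" by simp
 with b(2) have "a = osuc b" by simp
 with that show ?thesis by blast
qed (use that in auto)

lemma ord_induct [case_names zero succ lim]:
 assumes "P ozero" "!!a. P a ==> P (osuc a)" "!!l. is_lim l ==> (!!a. a < l ==> P a) ==> P (l::'k)"
 shows "P a"
proof(induction a rule: less_induct)
 case (less a)
 show ?case by(cases a rule: ord_cases) (use assms less in auto)
qed

definition opred :: "'k => 'k" where "opred a = (THE b. osuc b = a)"

lemma opred_osuc [simp]: "opred (osuc a) = a"
 unfolding opred_def by auto

lemma wf_ord: "wf {(a, b). a < (b::'k)}"
 using wf_def less_induct by(metis (mono_tags, lifting) case_prodD case_prodI mem_Collect_eq wfUNIVI)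

subsubsection \<open>Parity\<close>

definition obase :: "'k => bool" where "obase l \<longleftrightarrow> is_lim l \<or> l = ozero"

lemma obase_osuc [simp]: "~ obase (osuc a)"
 by(simp add: obase_def)

lemma obase_ozero [simp]: "obase ozero"
 by(simp add: obase_def)

lemma ord_decomp: "EX l n. obase l & (a::'k) = (osuc ^^ n) l"
proof(induction a rule: ord_induct)
 case zero
 thus ?case by(intro exI[of _ ozero] exI[of _ 0]) auto
next
 case (succ a)
 then obtain l n where "obase l" "a = (osuc ^^ n) l" by blast
 thus ?case by(intro exI[of _ l] exI[of _ "Suc n"]) auto
next
 case (lim l)
 thus ?case by(intro exI[of _ l] exI[of _ 0]) (auto simp: obase_def)
qed

lemma ord_decomp_unique:
 assumes "obase l" "obase l'" "(osuc ^^ n) l = (osuc ^^ m) (l'::'k)"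
 shows "l = l' & n = m"
 using assms(3)
proof(induction n arbitrary: m)
 case 0
 show ?case
 proof(cases m)
  case (Suc k)
  hence "l = osuc ((osuc ^^ k) l')" using 0 by simp
  hence False using assms(1) obase_osuc by metis
  thus ?thesis ..
 qed (use 0 in simp)
next
 case (Suc n)
 show ?case
 proof(cases m)
  case 0
  hence "l' = osuc ((osuc ^^ n) l)" using Suc.prems by simp
  hence False using assms(2) obase_osuc by metis
  thus ?thesis ..
 next
  case (Suc k)
  thus ?thesis using Suc.IH[of k] Suc.prems by simp
 qed
qed

text \<open>Parity is well defined because an ordinal is in exactly one way a finite successor of
  \<open>ozero\<close> or of a limit.\<close>

lemma ord_even_iff: "obase l ==> ord_even ((osuc ^^ n) (l::'k)) \<longleftrightarrow> even n"
 unfolding ord_even_def using ord_decomp_unique by(metis obase_def)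

lemma ord_even_base: "obase l ==> ord_even (l::'k)"
 using ord_even_iff[of l 0] by simp

lemma ord_even_ozero [simp]: "ord_even (ozero::'k)"
 by(simp add: ord_even_base)

lemma ord_even_lim [simp]: "is_lim l ==> ord_even (l::'k)"
 by(simp add: ord_even_base obase_def)

lemma ord_even_osuc [simp]: "ord_even (osuc a) \<longleftrightarrow> ~ ord_even (a::'k)"
proof -
 obtain l n where l: "obase l" "a = (osuc ^^ n) l" using ord_decomp by blast
 show ?thesis using ord_even_iff[OF l(1), of n] ord_even_iff[OF l(1), of "Suc n"] l(2) by simp
qed

subsubsection \<open>Small sets\<close>

lemma less_kappa_Un: "less_kappa TYPE('k) A ==> less_kappa TYPE('k) B ==> less_kappa TYPE('k) (A Un B)"
 unfolding less_kappa_def using card_of_Un_ordLess_infinite infinite_kappa by blast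

lemma less_kappa_UN:
 "less_kappa TYPE('k) I ==> (!!i. i : I ==> less_kappa TYPE('k) (A i)) ==> less_kappa TYPE('k) (UN i:I. A i)"
 unfolding less_kappa_def
 using card_of_UNION_ordLess_infinite_Field_regularCard[of "{(a, b). a <= (b::'k)}" I A] kappa_card
 by(simp add: less_kappa_iff)

lemma less_kappa_subset: "less_kappa TYPE('k) B ==> A <= B ==> less_kappa TYPE('k) A"
 unfolding less_kappa_def using card_of_mono1 ordLeq_ordLess_trans by blast

lemma less_kappa_image: "less_kappa TYPE('k) A ==> less_kappa TYPE('k) (f ` A)"
 unfolding less_kappa_def using card_of_image ordLeq_ordLess_trans by blast

lemma less_kappa_Times: "less_kappa TYPE('k) A ==> less_kappa TYPE('k) B ==> less_kappa TYPE('k) (A \<times> B)"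
proof -
 assume "less_kappa TYPE('k) A" "less_kappa TYPE('k) B"
 hence "less_kappa TYPE('k) (UN a:A. Pair a ` B)" by(intro less_kappa_UN less_kappa_image)
 moreover have "(UN a:A. Pair a ` B) = A \<times> B" by auto
 ultimately show ?thesis by simp
qed

lemma less_kappa_finite: "finite A ==> less_kappa TYPE('k) A"
 unfolding less_kappa_def by(rule card_finite)

lemma less_kappa_lessThan: "less_kappa TYPE('k) {..<a::'k}"
 unfolding less_kappa_def by(rule small_lessThan)

lemma less_kappa_atMost: "less_kappa TYPE('k) {..a::'k}"
proof -
 have "{..a} = {..<osuc a}" by auto
 thus ?thesis using less_kappa_lessThan by metis
qed

lemma less_kappa_bounded: "less_kappa TYPE('k) V ==> EX b. ALL v:V. v < (b::'k)"
 unfolding less_kappa_def by(rule small_bounded)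

lemma less_kappa_inj: "less_kappa TYPE('k) V ==> EX f :: 'x => 'k. inj_on f (V :: 'x set)"
 unfolding less_kappa_def using card_of_ordLeq[of V "UNIV :: 'k set"] ordLess_imp_ordLeq by blast

text \<open>Arrows of a diagram and members of a covering family are indexed by elements of
  \<open>'k\<close>. A pairing keeps the indices there when pairs arise: for the arrows of a
  preorder, and for two covers merged into one.\<close>

lemma pair_code: "EX f :: 'k \<times> 'k => 'k. inj f"
proof -
 have "|(UNIV :: 'k set) \<times> (UNIV :: 'k set)| =o |UNIV :: 'k set|"
  using card_of_Times_same_infinite infinite_kappa by blast
 thus ?thesis using card_of_ordLeq[of "UNIV \<times> UNIV :: ('k \<times> 'k) set" "UNIV :: 'k set"]
  by(metis UNIV_Times_UNIV ordIso_iff_ordLeq)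
qed

text \<open>The supremum of the finite successors of \<open>g\<close> is below \<kappa> as soon as
  \<omega> < \<kappa>. One limit \<open>l\<close> certifies this, since \<open>{..<l}\<close> is
  infinite and has fewer than \<kappa> elements. For \<kappa> = \<omega> there is no limit at
  all.\<close>

lemma ex_lim_greater:
 assumes "is_lim (l::'k)"
 shows "EX l'. is_lim l' & g < (l'::'k)"
proof -
 have n: "infinite {..<l}"
 proof
  assume f: "finite {..<l}"
  have "{..<l} ~= {}" using is_lim_ozero_less[OF assms] by auto
  hence "Max {..<l} < l" using f Max_in by blast
  hence "osuc (Max {..<l}) <= Max {..<l}" using is_lim_osuc_less[OF assms] f by(intro Max_ge) auto
  thus False by simp
 qed
 hence "|UNIV :: nat set| <=o |{..<l}|" using infinite_iff_card_of_nat by blast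
 hence "less_kappa TYPE('k) (UNIV :: nat set)" unfolding less_kappa_def
  using small_lessThan ordLeq_ordLess_trans by blast
 hence "less_kappa TYPE('k) (range (%n. (osuc ^^ n) g))" by(rule less_kappa_image)
 then obtain b where b: "!!n. (osuc ^^ n) g < b" using less_kappa_bounded by blast
 define m where "m = (LEAST b. ALL n. (osuc ^^ n) g < b)"
 have m: "!!n. (osuc ^^ n) g < m" unfolding m_def using LeastI[of "%b. ALL n. (osuc ^^ n) g < b" b] b by blast
 have "is_lim m" unfolding is_lim_iff
 proof(intro conjI allI impI)
  show "ozero < m" using m[of 0] by(metis not_less_ozero ozero_le order.not_eq_order_implies_strict)
  fix a assume "a < m"
  hence "~ (ALL n. (osuc ^^ n) g < a)" unfolding m_def using not_less_Least by blast
  then obtain n where "a <= (osuc ^^ n) g" by(meson not_less)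
  hence "osuc a <= (osuc ^^ Suc n) g" by simp
  thus "osuc a < m" using m[of "Suc n"] by(rule le_less_trans)
 qed
 moreover have "g < m" using m[of 0] by simp
 ultimately show ?thesis by blast
qed

subsubsection \<open>Ordinal addition\<close>

text \<open>\<open>oplus\<close> is a description through order types and offers no recursion.
  \<open>shf b\<close> enumerates the ordinals from \<open>b\<close> on by well-founded recursion,
  and \<open>oplus_shf\<close> identifies the two.\<close>

definition shf :: "'k => 'k => 'k" where
 "shf b = wfrec {(x, y). x < y} (%f a. LEAST z. b <= z & (ALL a'<a. f a' < z))"

lemma shf_eq: "shf b a = (LEAST z. b <= z & (ALL a'<a. shf b a' < z))"
proof -
 have "shf b a = (LEAST z. b <= z & (ALL a'<a. cut (shf b) {(x, y). x < y} a a' < z))"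
  unfolding shf_def by(subst wfrec[OF wf_ord]) simp
 also have "(%z. b <= z & (ALL a'<a. cut (shf b) {(x, y). x < y} a a' < z)) =
  (%z. b <= z & (ALL a'<a. shf b a' < z))"
  by(auto simp: cut_apply fun_eq_iff)
 finally show ?thesis .
qed

lemma shf_props: "b <= shf b a" "a' < a ==> shf b a' < shf b a"
proof -
 have "less_kappa TYPE('k) (shf b ` {..<a})" by(intro less_kappa_image less_kappa_lessThan)
 then obtain c where c: "ALL v:shf b ` {..<a}. v < c" using less_kappa_bounded by blast
 have "b <= max b c & (ALL a'<a. shf b a' < max b c)" using c by(auto simp: less_max_iff_disj)
 hence "b <= shf b a & (ALL a'<a. shf b a' < shf b a)"
  unfolding shf_eq[of b a] by(rule LeastI)
 thus "b <= shf b a" "a' < a ==> shf b a' < shf b a" by auto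
qed

lemma shf_less_iff [simp]: "shf b a' < shf b a \<longleftrightarrow> a' < a"
 by(metis shf_props(2) linorder_neqE less_asym less_irrefl)

lemma shf_le_iff [simp]: "shf b a' <= shf b a \<longleftrightarrow> a' <= a"
 by(meson not_less shf_less_iff)

lemma shf_inj [simp]: "shf b a' = shf b a \<longleftrightarrow> a' = a"
 by(metis antisym shf_le_iff order_refl)

lemma shf_ge: "a <= shf b a"
proof -
 obtain d where "a < d" using ex_greater by blast
 moreover have "strict_mono_on {..<d} (shf b)" by(simp add: strict_mono_on_def)
 ultimately show ?thesis using strict_mono_on_ge by blast
qed

lemma shf_surj: assumes "b <= z" shows "EX a. z = shf b a"
proof -
 define a where "a = (LEAST a. z <= shf b a)"
 have 1: "z <= shf b a" unfolding a_def by(rule LeastI[of "%a. z <= shf b a" z]) (rule shf_ge)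
 have "ALL a'<a. shf b a' < z" unfolding a_def using not_less_Least by(metis not_less)
 hence "shf b a <= z" unfolding shf_eq[of b a] using assms by(intro Least_le) auto
 with 1 show ?thesis by(intro exI[of _ a]) auto
qed

lemma odiff_shf: "odiff (shf b a) b = a"
 unfolding odiff_def
proof(rule the_equality)
 have im: "shf b ` {..<a} = {b..<shf b a}"
 proof
  show "{b..<shf b a} <= shf b ` {..<a}"
  proof
  fix z assume z: "z : {b..<shf b a}"
  then obtain a' where "z = shf b a'" using shf_surj by auto
  thus "z : shf b ` {..<a}" using z by auto
  qed
 qed (auto simp: shf_props)
 show ex: "EX h. strict_mono_on {..<a} h & h ` {..<a} = {b..<shf b a}"
  using im by(intro exI[of _ "shf b"]) (auto simp: strict_mono_on_def)
 have le: "d' <= d" if "strict_mono_on {..<d} h" "h ` {..<d} = Z" "strict_mono_on {..<d'} h'" "h' ` {..<d'} = Z"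
  for d d' :: 'k and h h' :: "'k => 'k" and Z
 proof(rule ccontr)
  assume "~ d' <= d"
  hence dd: "d < d'" by simp
  \<comment> \<open>One enumeration of \<open>Z\<close> followed by the inverse of the other: a
    strictly increasing map of \<open>{..<d'}\<close> into \<open>{..<d}\<close>. A strictly
    increasing map never lowers its argument, which is violated at \<open>d\<close>.\<close>
  define f where "f x = (SOME y. y < d & h y = h' x)" for x
  have f: "f x < d & h (f x) = h' x" if "x < d'" for x
  proof -
  have "h' x : h ` {..<d}" using that \<open>h ` {..<d} = Z\<close> \<open>h' ` {..<d'} = Z\<close> by blast
  hence "EX y. y < d & h y = h' x" by auto
  thus ?thesis unfolding f_def by(rule someI_ex)
  qed
  have "strict_mono_on {..<d'} f"
  proof(rule strict_mono_onI)
  fix r s assume rs: "r : {..<d'}" "s : {..<d'}" "r < s"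
  have "h' r < h' s" using rs that(3) by(auto simp: strict_mono_on_def)
  hence "h (f r) < h (f s)" using f rs by auto
  thus "f r < f s" using that(1) f[of r] f[of s] rs
  by(metis lessThan_iff less_asym less_irrefl linorder_neqE strict_mono_onD)
  qed
  hence "d <= f d" using strict_mono_on_ge dd by blast
  with f[OF dd] show False by(meson not_le)
 qed
 fix d :: 'k assume "EX h. strict_mono_on {..<d} h & h ` {..<d} = {b..<shf b a}"
 with ex show "d = a" using le by(metis antisym)
qed

lemma oplus_shf: "oplus b a = shf b a"
 unfolding oplus_def
proof(rule the_equality)
 show "b <= shf b a & odiff (shf b a) b = a" by(simp add: shf_props odiff_shf)
 fix z assume "b <= z & odiff z b = a"
 thus "z = shf b a" using shf_surj odiff_shf by metis
qed

lemma oplus_ge [simp]: "b <= oplus b (a::'k)"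
 by(simp add: oplus_shf shf_props)

lemma oplus_less_iff [simp]: "oplus b a' < oplus b a \<longleftrightarrow> a' < (a::'k)"
 by(simp add: oplus_shf)

lemma oplus_le_iff [simp]: "oplus b a' <= oplus b a \<longleftrightarrow> a' <= (a::'k)"
 by(simp add: oplus_shf)

lemma oplus_inj [simp]: "oplus b a' = oplus b a \<longleftrightarrow> a' = (a::'k)"
 by(simp add: oplus_shf)

lemma oplus_surj: "b <= (z::'k) ==> EX a. z = oplus b a"
 by(simp add: oplus_shf shf_surj)

lemma odiff_oplus [simp]: "odiff (oplus b a) b = (a::'k)"
 by(simp add: oplus_shf odiff_shf)

lemma oplus_odiff [simp]: "b <= (z::'k) ==> oplus b (odiff z b) = z"
 using oplus_surj by force

lemma oplus_less_odiff: "b <= g ==> oplus b a < g \<longleftrightarrow> a < odiff g (b::'k)"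
 by(metis oplus_less_iff oplus_odiff)

lemma odiff_less_iff: "b <= z ==> b <= z' ==> odiff z b < odiff z' b \<longleftrightarrow> z < (z'::'k)"
 by(metis oplus_less_iff oplus_odiff)

lemma odiff_le_iff: "b <= z ==> b <= z' ==> odiff z b <= odiff z' b \<longleftrightarrow> z <= (z'::'k)"
 by(metis oplus_le_iff oplus_odiff)

lemma oplus_ozero [simp]: "oplus b ozero = (b::'k)"
proof -
 obtain a where "b = oplus b a" using oplus_surj by blast
 thus ?thesis by(metis antisym oplus_ge oplus_le_iff ozero_le)
qed

lemma odiff_self [simp]: "odiff b b = (ozero::'k)"
 by(metis odiff_oplus oplus_ozero)

lemma oplus_osuc [simp]: "oplus b (osuc a) = osuc (oplus b (a::'k))"
proof -
 have "b <= osuc (oplus b a)" using oplus_ge[of b a] by(meson less_osuc less_imp_le order_trans)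
 then obtain c where c: "osuc (oplus b a) = oplus b c" using oplus_surj by blast
 have "a < c" using c by(metis less_osuc oplus_less_iff)
 hence "osuc a <= c" by simp
 hence "oplus b (osuc a) <= osuc (oplus b a)" using c by simp
 moreover have "osuc (oplus b a) <= oplus b (osuc a)" by simp
 ultimately show ?thesis by(rule antisym)
qed

lemma is_lim_oplus: "is_lim a ==> is_lim (oplus b (a::'k))"
 unfolding is_lim_iff
proof(intro conjI allI impI)
 assume a: "ozero < a & (ALL c<a. osuc c < a)"
 show "ozero < oplus b a" using a by(metis oplus_less_iff not_less_ozero ozero_le order.not_eq_order_implies_strict)
 fix c assume c: "c < oplus b a"
 show "osuc c < oplus b a"
 proof(cases "b <= c")
  case True
  then obtain d where "c = oplus b d" using oplus_surj by blast
  thus ?thesis using a c by(metis oplus_less_iff oplus_osuc)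
 next
  case False
  hence "osuc c <= b" by simp
  also have "b < oplus b a" using a by(metis oplus_less_iff oplus_ozero)
  finally show ?thesis .
 qed
qed

lemma ord_even_oplus: "obase b ==> ord_even (oplus b a) \<longleftrightarrow> ord_even (a::'k)"
 by(induction a rule: ord_induct) (auto simp: ord_even_base is_lim_oplus obase_def)

lemma is_lim_odiff: "is_lim g ==> b < g ==> is_lim (odiff g (b::'k))"
proof -
 assume a: "is_lim g" "b < g"
 hence g: "g = oplus b (odiff g b)" by simp
 show "is_lim (odiff g b)"
 proof(cases "odiff g b" rule: ord_cases)
  case (succ c)
  thus ?thesis using g a by(metis is_lim_osuc oplus_osuc)
 next
  case zero
  thus ?thesis using g a by(metis less_irrefl oplus_ozero)
 qed
qed

lemma finite_lessThan_osuc [simp]: "finite {..<osuc a} \<longleftrightarrow> finite {..<a::'k}"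
proof -
 have "{..<osuc a} = insert a {..<a}" by auto
 thus ?thesis by simp
qed

lemma infinite_lim: "is_lim (l::'k) ==> infinite {..<l}"
proof
 assume l: "is_lim l" and f: "finite {..<l}"
 have "{..<l} ~= {}" using is_lim_ozero_less[OF l] by auto
 hence "Max {..<l} < l" using f Max_in by blast
 hence "osuc (Max {..<l}) <= Max {..<l}" using is_lim_osuc_less[OF l] f by(intro Max_ge) auto
 thus False by simp
qed

text \<open>Adding 1 on the left is absorbed from \<omega> on. Hence, in the tail of a game from
  stage 1, parities are reversed at finite stages only; this is the defect that
  \<open>realign\<close> repairs.\<close>

lemma oplus_one: "oplus (osuc ozero) a = (if finite {..<a::'k} then osuc a else a)"
proof(induction a rule: ord_induct)
 case zero
 have "{..<ozero::'k} = {}" by auto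
 thus ?case by simp
next
 case (succ a)
 thus ?case by simp
next
 case (lim l)
 let ?p = "oplus (osuc ozero) l"
 have "l <= ?p" using shf_ge by(simp add: oplus_shf)
 moreover have "~ l < ?p"
 proof
  assume lt: "l < ?p"
  have "osuc ozero <= l" using is_lim_ozero_less[OF lim(1)] by simp
  then obtain c where c: "l = oplus (osuc ozero) c" using oplus_surj by blast
  with lt have "c < l" by(metis oplus_less_iff)
  with lim(2)[of c] have "oplus (osuc ozero) c <= osuc c" by(auto simp: less_imp_le)
  with c \<open>c < l\<close> is_lim_osuc_less[OF lim(1)] show False by(metis not_le)
 qed
 ultimately show ?case using infinite_lim[OF lim(1)] by simp
qed

lemma len_eq: "dom s = {..<b::'k} ==> len s = b"
 unfolding len_def
proof(rule the_equality)
 fix c assume "dom s = {..<b}" "dom s = {..<c}"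
 thus "c = b" by(metis lessThan_iff not_less less_irrefl linorder_neqE)
qed

end

lemma is_limit_cong:
 assumes "!!i j. i : I ==> j : I ==> E i j = E' i j" "!!i. i : I ==> F i = F' i"
  "!!i. i : I ==> p i = p' i"
 shows "is_limit H I F E L p = is_limit H I F' E' L p'"
proof -
 have 1: "is_cone H I F E K q = is_cone H I F' E' K q" for K q
  unfolding is_cone_def using assms by auto
 have 2: "is_cone H I F' E' L p = is_cone H I F' E' L p'"
  unfolding is_cone_def using assms by auto
 have 3: "(EX! h. h : hom H K L & (ALL i:I. Cmp H (p i) h = q i)) = (EX! h. h : hom H K L & (ALL i:I. Cmp H (p' i) h = q i))" for K q
  using assms(3) by simp
 show ?thesis unfolding is_limit_def 1 2 3 ..
qed

lemma is_least_unique: "is_least S J ==> is_least S J' ==> J = J'"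
 unfolding is_least_def by blast

lemma is_greatest_unique: "is_greatest S J ==> is_greatest S J' ==> J = J'"
 unfolding is_greatest_def by blast

section \<open>Calculus of arrows in a \<kappa>-Heyting category\<close>

locale kcat = kappa K for K :: "'k::wellorder itself" +
 fixes H :: "('o, 'a) cat"
 assumes kH: "kappa_Heyting TYPE('k) H"
begin

abbreviation cmp :: "'a => 'a => 'a" (infixr "oo" 70) where "g oo f == Cmp H g f"

lemma cat: "category H" and small_limits: "has_small_limits TYPE('k) H" and reg_images: "regular_images H"
 and st_unions: "stable_unions TYPE('k) H" and all_ex: "ALL f:Ar H. ALL R:Sub H (Dom H f). EX J. is_all H f R J"
 and tr_trans: "transfinite_transitive TYPE('k) H"
 using kH by(auto simp: kappa_Heyting_def)

lemma Dom_Ob [simp]: "f : Ar H ==> Dom H f : Ob H" and Cod_Ob [simp]: "f : Ar H ==> Cod H f : Ob H"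
 using cat by(auto simp: category_def)

lemma Idn_Ar [simp]: "A : Ob H ==> Idn H A : Ar H" and Dom_Idn [simp]: "A : Ob H ==> Dom H (Idn H A) = A"
 and Cod_Idn [simp]: "A : Ob H ==> Cod H (Idn H A) = A"
 using cat by(auto simp: category_def hom_def)

lemma Cmp_Ar [simp]: "f : Ar H ==> g : Ar H ==> Cod H f = Dom H g ==> g oo f : Ar H"
 and Dom_Cmp [simp]: "f : Ar H ==> g : Ar H ==> Cod H f = Dom H g ==> Dom H (g oo f) = Dom H f"
 and Cod_Cmp [simp]: "f : Ar H ==> g : Ar H ==> Cod H f = Dom H g ==> Cod H (g oo f) = Cod H g"
 using cat by(auto simp: category_def hom_def)

lemma Cmp_Idn_right [simp]: "f : Ar H ==> Dom H f = A ==> f oo Idn H A = f"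
 and Cmp_Idn_left [simp]: "f : Ar H ==> Cod H f = A ==> Idn H A oo f = f"
 using cat by(auto simp: category_def)

lemma Cmp_assoc [simp]: "f : Ar H ==> g : Ar H ==> h : Ar H ==> Cod H f = Dom H g ==> Cod H g = Dom H h ==>
  (h oo g) oo f = h oo (g oo f)"
 using cat by(auto simp: category_def)

lemma homI: "f : Ar H ==> Dom H f = A ==> Cod H f = B ==> f : hom H A B"
 by(simp add: hom_def)

lemma homD: "f : hom H A B ==> f : Ar H" "f : hom H A B ==> Dom H f = A" "f : hom H A B ==> Cod H f = B"
 "f : hom H A B ==> A : Ob H" "f : hom H A B ==> B : Ob H"
 by(auto simp: hom_def)

lemma Cmp_hom: "g : hom H B C ==> f : hom H A B ==> g oo f : hom H A C"
 by(auto simp: hom_def)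

lemma Idn_hom: "A : Ob H ==> Idn H A : hom H A A"
 by(simp add: hom_def)

lemma comp_assoc: "f : hom H A B ==> g : hom H B C ==> h : hom H C D ==> (h oo g) oo f = h oo (g oo f)"
 by(simp add: hom_def)

subsubsection \<open>Limits of small diagrams\<close>

text \<open>\<open>has_small_limits\<close> speaks only of index categories whose objects and arrows
  are elements of \<open>'k\<close>. The arrow from i to j of the preorder is therefore coded by a
  pairing.\<close>

lemma preorder_limit:
 fixes I :: "'k set"
 assumes I: "less_kappa TYPE('k) I"
  and refl: "!!i. i : I ==> le i i"
  and trans: "!!i j k. i : I ==> j : I ==> k : I ==> le i j ==> le j k ==> le i k"
  and Fo: "!!i. i : I ==> Fo i : Ob H"
  and Fa: "!!i j. i : I ==> j : I ==> le i j ==> Fa i j : hom H (Fo i) (Fo j)"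
  and Fid: "!!i. i : I ==> Fa i i = Idn H (Fo i)"
  and Fcmp: "!!i j k. i : I ==> j : I ==> k : I ==> le i j ==> le j k ==> Fa j k oo Fa i j = Fa i k"
 shows "EX L p. is_limit H I Fo (%i j. if le i j then {Fa i j} else {}) L p"
proof -
 obtain c :: "'k \<times> 'k => 'k" where c: "inj c" using pair_code by blast
 define d where "d = inv c"
 have d [simp]: "d (c x) = x" for x using c by(simp add: d_def)
 define J :: "('k, 'k) cat" where "J = \<lparr>Ob = I, Ar = {c (i, j) | i j. i : I & j : I & le i j},
  Dom = (%a. fst (d a)), Cod = (%a. snd (d a)), Idn = (%i. c (i, i)),
  Cmp = (%g f. c (fst (d f), snd (d g)))\<rparr>"
 define Fa' where "Fa' a = Fa (fst (d a)) (snd (d a))" for a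
 have "category J" unfolding category_def
 proof(intro conjI ballI impI)
  fix f g assume "f : Ar J" "g : Ar J" "Cod J f = Dom J g"
  thus "Cmp J g f : hom J (Dom J f) (Cod J g)"
  by(clarsimp simp: J_def hom_def) (blast intro: trans)
 next
  fix i assume "i : Ob J"
  thus "Idn J i : hom J i i" by(clarsimp simp: J_def hom_def) (blast intro: refl)
 qed (clarsimp simp: J_def hom_def)+
 moreover have "less_kappa TYPE('k) (Ar J)"
 proof -
  have "Ar J <= c ` (I \<times> I)" by(auto simp: J_def)
  thus ?thesis by(rule less_kappa_subset[rotated]) (intro less_kappa_image less_kappa_Times I)
 qed
 moreover have "is_functor J H Fo Fa'"
  unfolding is_functor_def
 proof(intro conjI ballI impI)
  fix u v assume "u : Ar J" "v : Ar J" "Cod J u = Dom J v"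
  thus "Fa' (Cmp J v u) = Fa' v oo Fa' u"
  by(clarsimp simp: J_def Fa'_def) (rule Fcmp[symmetric])
 next
  fix u assume "u : Ar J"
  thus "Fa' u : hom H (Fo (Dom J u)) (Fo (Cod J u))"
  by(clarsimp simp: J_def Fa'_def) (rule Fa)
 qed (simp_all add: J_def Fa'_def Fo Fid)
 ultimately obtain L p where L: "is_limit H (Ob J) Fo (%i j. Fa' ` hom J i j) L p"
  using small_limits unfolding has_small_limits_def by blast
 have "is_limit H I Fo (%i j. if le i j then {Fa i j} else {}) L p"
 proof(rule is_limit_cong[THEN iffD1, OF _ _ _ L[unfolded J_def, simplified, folded J_def]])
  fix i j assume ij: "i : I" "j : I"
  have "hom J i j = (if le i j then {c (i, j)} else {})"
  using ij by(auto simp: hom_def J_def)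
  thus "Fa' ` hom J i j = (if le i j then {Fa i j} else {})" by(simp add: Fa'_def)
 qed auto
 thus ?thesis by blast
qed

abbreviation Dom where "Dom == cat.Dom H"
abbreviation Cod where "Cod == cat.Cod H"
abbreviation Ar where "Ar == cat.Ar H"
abbreviation Ob where "Ob == cat.Ob H"
abbreviation hom where "hom == Defs.hom H"
abbreviation Sub where "Sub == Defs.Sub H"
abbreviation pull where "pull == Defs.pull H"
abbreviation Idn where "Idn == cat.Idn H"
abbreviation is_chain where "is_chain == Defs.is_chain H"
abbreviation follows where "follows == Defs.follows H"
abbreviation sub_of where "sub_of == Defs.sub_of H"
abbreviation whole where "whole == Defs.whole H"
abbreviation monic where "monic == Defs.monic H"
abbreviation in_T where "in_T == Defs.in_T H"
abbreviation all_along where "all_along == Defs.all_along H"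
abbreviation ex_along where "ex_along == Defs.ex_along H"
abbreviation is_limit where "is_limit == Defs.is_limit H"
abbreviation is_join where "is_join == Defs.is_join H"
abbreviation covering_strategy where "covering_strategy == Defs.covering_strategy H"
abbreviation img where "img == Defs.img H"
abbreviation is_pullback where "is_pullback == Defs.is_pullback H"
abbreviation join where "join == Defs.join H"

lemma chain_limit:
 assumes st: "!!b. b < l ==> Fo b : Ob"
  and lk: "!!a b. b < l ==> a <= b ==> Fa b a : hom (Fo b) (Fo a)"
  and idl: "!!b. b < l ==> Fa b b = Idn (Fo b)"
  and cm: "!!a b c. b < l ==> a <= b ==> c <= a ==> Fa a c oo Fa b a = Fa b c"
 shows "EX L p. is_limit {..<l::'k} Fo (%b a. if a <= b then {Fa b a} else {}) L p"
 by(rule preorder_limit[OF less_kappa_lessThan]) (use assms in auto)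

text \<open>A product is a limit over a discrete preorder. \<open>V\<close> has a type of its own,
  so it is first carried into \<open>'k\<close> by an injection.\<close>

lemma product_ex:
 assumes V: "less_kappa TYPE('k) (V :: 'x set)" and F: "!!v. v : V ==> F v : Ob"
 shows "EX L p. is_product H V F L p"
proof -
 obtain f :: "'x => 'k" where f: "inj_on f V" using less_kappa_inj[OF V] by blast
 define Fo where "Fo i = F (the_inv_into V f i)" for i
 have Fo [simp]: "v : V ==> Fo (f v) = F v" for v using f by(simp add: Fo_def the_inv_into_f_f)
 have "EX L p. is_limit (f ` V) Fo (%i j. if i = j then {Idn (Fo i)} else {}) L p"
  by(rule preorder_limit[OF less_kappa_image[OF V]]) (insert F, auto simp: hom_def)
 then obtain L p where "is_limit (f ` V) Fo (%i j. if i = j then {Idn (Fo i)} else {}) L p"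
  by blast
 hence c: "is_cone H (f ` V) Fo (%i j. if i = j then {Idn (Fo i)} else {}) L p"
  and u: "!!K q. is_cone H (f ` V) Fo (%i j. if i = j then {Idn (Fo i)} else {}) K q ==>
  (EX! h. h : hom K L & (ALL i:f ` V. p i oo h = q i))"
  by(auto simp: is_limit_def)
 have "is_product H V F L (p \<circ> f)" unfolding is_product_def is_limit_def
 proof(intro conjI allI impI)
  show "is_cone H V F (%_ _. {}) L (p \<circ> f)" using c by(auto simp: is_cone_def)
  fix K q assume q: "is_cone H V F (%_ _. {}) K q"
  have "is_cone H (f ` V) Fo (%i j. if i = j then {Idn (Fo i)} else {}) K (%i. q (the_inv_into V f i))"
  using q f F by(auto simp: is_cone_def the_inv_into_f_f hom_def inj_on_eq_iff)
  from u[OF this] show "EX! h. h : hom K L & (ALL i:V. (p \<circ> f) i oo h = q i)"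
  using f by(simp add: the_inv_into_f_f)
 qed
 thus ?thesis by blast
qed

lemma prod_cone_is_product:
 assumes "less_kappa TYPE('k) (V :: 'x set)" "!!v. v : V ==> F v : Ob"
 shows "is_product H V F (prod_ob H V F) (prod_pr H V F)"
proof -
 obtain L p where "is_product H V F L p" using product_ex[of V F] assms by blast
 hence "is_product H V F (fst (L, p)) (snd (L, p))" by simp
 thus ?thesis unfolding prod_ob_def prod_pr_def prod_cone_def
  by(rule someI[where P = "%c. is_product H V F (fst c) (snd c)"])
qed

lemma prod_facts:
 assumes "less_kappa TYPE('k) (V :: 'x set)" "!!v. v : V ==> F v : Ob"
 shows prod_ob_Ob: "prod_ob H V F : Ob"
  and prod_pr_hom: "v : V ==> prod_pr H V F v : hom (prod_ob H V F) (F v)"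
  and prod_ex1: "B : Ob ==> (!!v. v : V ==> q v : hom B (F v)) ==>
  EX! h. h : hom B (prod_ob H V F) & (ALL v:V. prod_pr H V F v oo h = q v)"
 using prod_cone_is_product[of V F] assms
 by(auto simp: is_product_def is_limit_def is_cone_def)

lemma tuple_facts:
 assumes "less_kappa TYPE('k) (V :: 'x set)" "!!v. v : V ==> F v : Ob"
  "B : Ob" "!!v. v : V ==> q v : hom B (F v)"
 shows tuple_hom: "tuple H V F B q : hom B (prod_ob H V F)"
  and tuple_pr: "v : V ==> prod_pr H V F v oo tuple H V F B q = q v"
 using theI'[OF prod_ex1[of V F B q]] assms by(auto simp: tuple_def)

lemma prod_eqI:
 assumes "less_kappa TYPE('k) (V :: 'x set)" "!!v. v : V ==> F v : Ob"
  "f : hom B (prod_ob H V F)" "g : hom B (prod_ob H V F)"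
  "!!v. v : V ==> prod_pr H V F v oo f = prod_pr H V F v oo g"
 shows "f = g"
proof -
 have "EX! h. h : hom B (prod_ob H V F) & (ALL v:V. prod_pr H V F v oo h = prod_pr H V F v oo f)"
  using assms homD(4)[OF assms(3)]
  by(intro prod_ex1) (auto intro!: Cmp_hom prod_pr_hom)
 moreover have "ALL v:V. prod_pr H V F v oo g = prod_pr H V F v oo f" using assms(5) by simp
 ultimately show ?thesis using assms(3,4) by blast
qed

text \<open>The limit over \<open>I\<close>, taken discretely, with a new top element carrying the
  common codomain. The arrow \<open>d\<close> to the codomain is kept explicit so that the universal
  property is also right for empty \<open>I\<close>.\<close>

lemma wide_pullback:
 fixes I :: "'k set"
 assumes I: "less_kappa TYPE('k) I" and A: "A : Ob"
  and f: "!!i. i : I ==> f i : Ar & Cod (f i) = A"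
 shows "EX L p d. d : hom L A & (ALL i:I. p i : hom L (Dom (f i)) & f i oo p i = d) &
  (ALL K q e. e : hom K A --> (ALL i:I. q i : hom K (Dom (f i)) & f i oo q i = e) -->
  (EX! h. h : hom K L & d oo h = e & (ALL i:I. p i oo h = q i)))"
proof -
 \<comment> \<open>\<open>I\<close> is bounded, so an index outside it is free to carry the
   codomain.\<close>
 obtain t where "ALL i:I. i < t" using less_kappa_bounded[OF I] by blast
 hence t: "t ~: I" by auto
 define Fo where "Fo i = (if i = t then A else Dom (f i))" for i
 define Fa where "Fa i j = (if i = j then Idn (Fo i) else f i)" for i j
 have "EX L p. is_limit (insert t I) Fo (%i j. if i = j \<or> j = t then {Fa i j} else {}) L p"
  by(rule preorder_limit)
  (insert t f A less_kappa_Un[OF less_kappa_finite[of "{t}"] I], auto simp: Fo_def Fa_def hom_def)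
 then obtain L p where L: "is_limit (insert t I) Fo (%i j. if i = j \<or> j = t then {Fa i j} else {}) L p" by blast
 hence c: "p t : hom L A" "!!i. i : I ==> p i : hom L (Dom (f i)) & f i oo p i = p t"
  using t by(auto simp: is_limit_def is_cone_def Fo_def Fa_def split: if_splits)
 have u: "EX! h. h : hom K L & p t oo h = e & (ALL i:I. p i oo h = q i)"
  if "e : hom K A" "ALL i:I. q i : hom K (Dom (f i)) & f i oo q i = e" for K q e
 proof -
  have "is_cone H (insert t I) Fo (%i j. if i = j \<or> j = t then {Fa i j} else {}) K (q(t := e))"
  using that t f by(auto simp: is_cone_def Fo_def Fa_def hom_def)
  hence "EX! h. h : hom K L & (ALL i:insert t I. p i oo h = (q(t := e)) i)"
  using L unfolding is_limit_def by blast
  moreover have "(ALL i:insert t I. p i oo h = (q(t := e)) i) \<longleftrightarrow> p t oo h = e & (ALL i:I. p i oo h = q i)" for h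
  using t by auto
  ultimately show ?thesis by simp
 qed
 show ?thesis using c u by(intro exI[of _ L] exI[of _ p] exI[of _ "p t"]) blast
qed

lemma pullback_ex:
 assumes f: "f : Ar" "g : Ar" "Cod f = Cod g"
 shows "EX p q. is_pullback f g p q"
proof -
 define F where "F i = (if i = (ozero::'k) then f else g)" for i
 have "EX L p d. d : hom L (Cod f) & (ALL i:{ozero, osuc ozero}. p i : hom L (Dom (F i)) & F i oo p i = d) &
  (ALL K q e. e : hom K (Cod f) --> (ALL i:{ozero, osuc ozero}. q i : hom K (Dom (F i)) & F i oo q i = e) -->
  (EX! h. h : hom K L & d oo h = e & (ALL i:{ozero, osuc ozero}. p i oo h = q i)))"
  by(rule wide_pullback) (insert f, auto simp: F_def intro: less_kappa_finite)
 then obtain L p d where d: "d : hom L (Cod f)"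
  and p: "ALL i:{ozero, osuc ozero}. p i : hom L (Dom (F i)) & F i oo p i = d"
  and u: "!!K q e. e : hom K (Cod f) ==> (ALL i:{ozero, osuc ozero}. q i : hom K (Dom (F i)) & F i oo q i = e) ==>
  (EX! h. h : hom K L & d oo h = e & (ALL i:{ozero, osuc ozero}. p i oo h = q i))"
  by blast
 have "is_pullback f g (p ozero) (p (osuc ozero))" unfolding is_pullback_def
 proof(intro conjI allI ballI impI)
  fix K a b assume ab: "a : hom K (Dom f)" "b : hom K (Dom g)" "f oo a = g oo b"
  define q where "q i = (if i = (ozero::'k) then a else b)" for i
  have "EX! h. h : hom K L & d oo h = f oo a & (ALL i:{ozero, osuc ozero}. p i oo h = q i)"
  using u[of "f oo a" K q] ab f by(auto simp: q_def F_def hom_def)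
  moreover have "d oo h = f oo a" if "h : hom K L" "p ozero oo h = a" for h
  using that p f d by(auto simp: F_def hom_def)
  ultimately show "EX! h. h : hom K (Dom (p ozero)) & p ozero oo h = a & p (osuc ozero) oo h = b"
  using p by(simp add: q_def F_def hom_def) (metis (no_types, lifting))
 qed (insert f p, auto simp: F_def hom_def)
 thus ?thesis by blast
qed

lemma pullbackD:
 assumes "is_pullback f g p q"
 shows "f : Ar" "g : Ar" "p : Ar" "q : Ar" "Cod f = Cod g" "Dom q = Dom p" "Cod p = Dom f"
  "Cod q = Dom g" "f oo p = g oo q"
 using assms by(auto simp: is_pullback_def hom_def)

lemma pullback_lift:
 assumes "is_pullback f g p q" "a : Ar" "b : Ar" "Cod a = Dom f" "Cod b = Dom g" "Dom a = Dom b"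
  "f oo a = g oo b"
 obtains h where "h : Ar" "Dom h = Dom a" "Cod h = Dom p" "p oo h = a" "q oo h = b"
proof -
 have "a : hom (Dom a) (Dom f)" "b : hom (Dom a) (Dom g)" using assms by(auto simp: hom_def)
 hence "EX h. h : hom (Dom a) (Dom p) & p oo h = a & q oo h = b"
  using assms(1,7) unfolding is_pullback_def by blast
 thus ?thesis using that by(auto simp: hom_def)
qed

lemma pullback_eqI:
 assumes "is_pullback f g p q" "h : Ar" "k : Ar" "Cod h = Dom p" "Cod k = Dom p" "Dom h = Dom k"
  "p oo h = p oo k" "q oo h = q oo k"
 shows "h = k"
proof -
 note pb = pullbackD[OF assms(1)]
 have "f oo (p oo h) = g oo (q oo h)" using pb assms by(metis Cmp_assoc)
 moreover have "p oo h : hom (Dom h) (Dom f)" "q oo h : hom (Dom h) (Dom g)"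
  using pb assms by(auto simp: hom_def)
 ultimately have "EX! x. x : hom (Dom h) (Dom p) & p oo x = p oo h & q oo x = q oo h"
  using assms(1) unfolding is_pullback_def by blast
 thus ?thesis using assms by(auto simp: hom_def)
qed

subsubsection \<open>Subobjects\<close>

lemma monicD: "monic m ==> m : Ar" "monic m ==> f : Ar ==> g : Ar ==> Dom f = Dom g ==>
  Cod f = Dom m ==> Cod g = Dom m ==> m oo f = m oo g ==> f = g"
 by(auto simp: monic_def)

lemma monic_Idn: "A : Ob ==> monic (Idn A)"
 by(auto simp: monic_def)

lemma monic_Cmp: "monic m ==> monic n ==> Cod n = Dom m ==> monic (m oo n)"
proof -
 assume a: "monic m" "monic n" "Cod n = Dom m"
 hence mn: "m : Ar" "n : Ar" by(auto simp: monic_def)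
 show "monic (m oo n)" unfolding monic_def
 proof(intro conjI ballI impI)
  fix f g assume fg: "f : Ar" "g : Ar" "Dom f = Dom g" "Cod f = Dom (m oo n)" "Cod g = Dom (m oo n)"
  "(m oo n) oo f = (m oo n) oo g"
  have "m oo (n oo f) = m oo (n oo g)" using fg a(3) mn by simp
  hence "n oo f = n oo g" using fg a(3) mn by - (rule monicD(2)[OF a(1)], auto)
  thus "f = g" using fg a(3) mn by - (rule monicD(2)[OF a(2)], auto)
 qed (use a mn in auto)
qed

lemma sub_of_Sub: "monic m ==> Cod m = A ==> sub_of m : Sub A"
 by(auto simp: Sub_def)

lemma SubE:
 assumes "R : Sub A"
 obtains m where "monic m" "m : Ar" "Cod m = A" "R = sub_of m"
 using assms by(auto simp: Sub_def monic_def)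

lemma Sub_Ob: "R : Sub A ==> A : Ob"
 by(metis SubE Cod_Ob)

lemma mem_sub_of: "m : Ar ==> g : sub_of m \<longleftrightarrow> (EX h:Ar. Cod h = Dom m & g = m oo h)"
 by(auto simp: sub_of_def hom_def)

lemma sub_ofI: "m : Ar ==> h : Ar ==> Cod h = Dom m ==> g = m oo h ==> g : sub_of m"
 by(auto simp: mem_sub_of)

lemma sub_of_self: "m : Ar ==> m : sub_of m"
 by(auto simp: mem_sub_of intro!: bexI[of _ "Idn (Dom m)"])

lemma Sub_whole: "R : Sub A ==> R <= whole A"
 by(auto simp: whole_def mem_sub_of elim!: SubE)

lemma SubD: assumes "R : Sub A" "g : R" shows "g : Ar" "Cod g = A"
 using assms Sub_whole[of R A] by(auto simp: whole_def)

lemma Sub_comp: "R : Sub A ==> g : R ==> h : Ar ==> Cod h = Dom g ==> g oo h : R"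
proof -
 assume a: "R : Sub A" "g : R" "h : Ar" "Cod h = Dom g"
 obtain m where m: "m : Ar" "R = sub_of m" using a(1) by(elim SubE)
 then obtain k where "k : Ar" "Cod k = Dom m" "g = m oo k" using a(2) by(auto simp: mem_sub_of)
 thus ?thesis using m a by(auto simp: mem_sub_of intro!: bexI[of _ "k oo h"])
qed

lemma whole_Sub: "A : Ob ==> whole A : Sub A"
proof -
 assume A: "A : Ob"
 have "sub_of (Idn A) = whole A"
  using A by(auto simp: whole_def mem_sub_of) (metis Cmp_Idn_left)
 thus ?thesis using A monic_Idn sub_of_Sub[of "Idn A" A] by simp
qed

lemma mem_whole: "g : whole A \<longleftrightarrow> g : Ar & Cod g = A"
 by(simp add: whole_def)

lemma Sub_whole_iff: "R : Sub A ==> R = whole A \<longleftrightarrow> Idn A : R"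
proof
 assume R: "R : Sub A" "Idn A : R"
 have "g : R" if "g : whole A" for g
  using Sub_comp[OF R, of g] that Sub_Ob[OF R(1)] by(simp add: mem_whole)
 thus "R = whole A" using Sub_whole[OF R(1)] by blast
qed (insert Sub_Ob, auto simp: mem_whole)

lemma mem_pull: "g : pull f R \<longleftrightarrow> g : Ar & Cod g = Dom f & f oo g : R"
 by(simp add: pull_def)

lemma pull_pb:
 assumes "is_pullback f m p q" "monic m"
 shows "monic p" "sub_of p = pull f (sub_of m)"
proof -
 note pb = pullbackD[OF assms(1)]
 show "monic p" unfolding monic_def
 proof(intro conjI ballI impI)
  fix h k assume hk: "h : Ar" "k : Ar" "Dom h = Dom k" "Cod h = Dom p" "Cod k = Dom p" "p oo h = p oo k"
  have "m oo (q oo h) = f oo (p oo h)" "m oo (q oo k) = f oo (p oo k)" using pb hk by(metis Cmp_assoc)+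
  hence "m oo (q oo h) = m oo (q oo k)" using hk by simp
  hence "q oo h = q oo k" using pb hk by - (rule monicD(2)[OF assms(2)], auto)
  thus "h = k" using hk by - (rule pullback_eqI[OF assms(1)], auto)
 qed (use pb in auto)
 show "sub_of p = pull f (sub_of m)"
 proof(intro equalityI subsetI)
  fix g assume "g : sub_of p"
  then obtain h where h: "h : Ar" "Cod h = Dom p" "g = p oo h" using pb by(auto simp: mem_sub_of)
  have "f oo g = m oo (q oo h)" using h pb by(metis Cmp_assoc)
  moreover have "q oo h : Ar" "Cod (q oo h) = Dom m" using h pb by auto
  ultimately have "f oo g : sub_of m" using pb by - (rule sub_ofI)
  thus "g : pull f (sub_of m)" using h pb by(auto simp: mem_pull)
 next
  fix g assume "g : pull f (sub_of m)"
  then obtain k where k: "g : Ar" "Cod g = Dom f" "k : Ar" "Cod k = Dom m" "f oo g = m oo k"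
  using pb by(auto simp: mem_pull mem_sub_of)
  have "Dom g = Dom k" using k pb by(metis Dom_Cmp)
  with k obtain h where "h : Ar" "Cod h = Dom p" "p oo h = g" by(meson pullback_lift[OF assms(1)])
  thus "g : sub_of p" using pb by(auto simp: mem_sub_of)
 qed
qed

lemma pull_Sub:
 assumes "f : Ar" "R : Sub (Cod f)"
 shows "pull f R : Sub (Dom f)"
proof -
 obtain m where m: "monic m" "m : Ar" "Cod m = Cod f" "R = sub_of m" using assms(2) by(elim SubE)
 obtain p q where pb: "is_pullback f m p q" using pullback_ex assms m by metis
 show ?thesis using pull_pb[OF pb m(1)] pullbackD[OF pb] m by(metis sub_of_Sub)
qed

lemma pull_whole: "f : Ar ==> pull f (whole (Cod f)) = whole (Dom f)"
 by(auto simp: mem_pull mem_whole)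

lemma pull_Cmp: "f : Ar ==> g : Ar ==> Cod f = Dom g ==> pull f (pull g R) = pull (g oo f) R"
 by(auto simp: mem_pull)

lemma pull_Idn: "R : Sub A ==> pull (Idn A) R = R"
proof -
 assume R: "R : Sub A"
 have "g : pull (Idn A) R \<longleftrightarrow> g : R" for g
  using Sub_Ob[OF R] SubD[OF R, of g] by(cases "g : Ar & Cod g = A") (auto simp: mem_pull)
 thus ?thesis by blast
qed

lemma pull_mono: "R <= S ==> pull f R <= pull f S"
 by(auto simp: mem_pull)

text \<open>The arrow from a wide pullback of monos to their codomain is monic and represents the
  intersection. The factor \<open>whole A\<close> matters when \<open>I\<close> is empty.\<close>

lemma Inter_Sub:
 fixes I :: "'k set"
 assumes "less_kappa TYPE('k) I" "A : Ob" "!!i. i : I ==> R i : Sub A"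
 shows "whole A Int (INT i:I. R i) : Sub A"
proof -
 have "ALL i:I. EX m. monic m & m : Ar & Cod m = A & R i = sub_of m" using assms(3) by(metis SubE)
 then obtain m where m: "!!i. i : I ==> monic (m i) & m i : Ar & Cod (m i) = A & R i = sub_of (m i)" by metis
 then obtain L p d where d: "d : hom L A" and p: "!!i. i : I ==> p i : hom L (Dom (m i)) & m i oo p i = d"
  and u: "!!K q e. e : hom K A ==> (ALL i:I. q i : hom K (Dom (m i)) & m i oo q i = e) ==>
  (EX! h. h : hom K L & d oo h = e & (ALL i:I. p i oo h = q i))"
  using wide_pullback[of I A m] assms by blast
 have "monic d" unfolding monic_def
 proof(intro conjI ballI impI)
  fix f g assume fg: "f : Ar" "g : Ar" "Dom f = Dom g" "Cod f = Dom d" "Cod g = Dom d" "d oo f = d oo g"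
  have eq: "p i oo f = p i oo g" if i: "i : I" for i
  proof(rule monicD(2)[of "m i"])
  have "m i oo (p i oo f) = d oo f" "m i oo (p i oo g) = d oo g" using fg p[OF i] m[OF i] d
  by(metis Cmp_assoc homD(1,2,3))+
  thus "m i oo (p i oo f) = m i oo (p i oo g)" using fg by simp
  qed (insert fg m[OF i] p[OF i] d, auto simp: hom_def)
  have "EX! h. h : hom (Dom f) L & d oo h = d oo f & (ALL i:I. p i oo h = p i oo f)"
  proof(rule u)
  show "ALL i:I. p i oo f : hom (Dom f) (Dom (m i)) & m i oo (p i oo f) = d oo f"
  proof(intro ballI conjI)
  fix i assume i: "i : I"
  show "m i oo (p i oo f) = d oo f" using fg p[OF i] m[OF i] d by(metis Cmp_assoc homD(1,2,3))
  qed (insert fg p m d, auto simp: hom_def)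
  qed (insert fg d, auto simp: hom_def)
  moreover have "f : hom (Dom f) L" "g : hom (Dom f) L" using fg d by(auto simp: hom_def)
  moreover have "d oo g = d oo f" "ALL i:I. p i oo g = p i oo f" using fg eq by auto
  ultimately show "f = g" by blast
 qed (insert d, auto simp: hom_def)
 moreover have "sub_of d = whole A Int (INT i:I. R i)"
 proof(intro equalityI subsetI)
  fix g assume "g : sub_of d"
  then obtain h where h: "h : Ar" "Cod h = L" "g = d oo h" using d by(auto simp: mem_sub_of hom_def)
  have "g : R i" if i: "i : I" for i
  proof -
  have "g = m i oo (p i oo h)" using h p[OF i] m[OF i] d by(metis Cmp_assoc homD(1,2,3))
  hence "g : sub_of (m i)" using h p[OF i] m[OF i] by - (rule sub_ofI, auto simp: hom_def)
  thus ?thesis using m[OF i] by simp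
  qed
  thus "g : whole A Int (INT i:I. R i)" using h d by(auto simp: mem_whole hom_def)
 next
  fix g assume g: "g : whole A Int (INT i:I. R i)"
  hence "ALL i:I. EX h:Ar. Cod h = Dom (m i) & g = m i oo h" using m by(auto simp: mem_sub_of)
  then obtain q where q: "!!i. i : I ==> q i : Ar & Cod (q i) = Dom (m i) & g = m i oo q i" by metis
  have "EX! h. h : hom (Dom g) L & d oo h = g & (ALL i:I. p i oo h = q i)"
  proof(rule u)
  show "ALL i:I. q i : hom (Dom g) (Dom (m i)) & m i oo q i = g"
  proof
  fix i assume i: "i : I"
  hence "Dom g = Dom (q i)" using q[OF i] m[OF i] by(metis Dom_Cmp)
  thus "q i : hom (Dom g) (Dom (m i)) & m i oo q i = g" using q[OF i] by(auto simp: hom_def)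
  qed
  qed (insert g, auto simp: mem_whole hom_def)
  thus "g : sub_of d" using d by(auto simp: mem_sub_of hom_def)
 qed
 ultimately show ?thesis using d by(metis homD(3) sub_of_Sub)
qed

text \<open>The equalizer is the inverse image of the diagonal of \<open>B\<close> under the pairing
  of \<open>f\<close> and \<open>g\<close>; the diagonal is monic because a projection splits it.
  Products indexed by \<open>bool\<close> serve as binary products.\<close>

lemma equalizer_Sub:
 assumes f: "f : hom A B" and g: "g : hom A B"
 shows "{h : whole A. f oo h = g oo h} : Sub A"
proof -
 let ?V = "UNIV :: bool set" and ?F = "%_ :: bool. B"
 have V: "less_kappa TYPE('k) ?V" by(rule less_kappa_finite) simp
 have AB: "A : Ob" "B : Ob" using homD(4,5)[OF f] by auto
 let ?P = "prod_ob H ?V ?F" and ?p = "prod_pr H ?V ?F"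
 define t where "t = tuple H ?V ?F A (%b. if b then f else g)"
 define dg where "dg = tuple H ?V ?F B (%b. Idn B)"
 have p: "?p b : hom ?P B" for b by(rule prod_pr_hom[OF V]) (auto simp: AB)
 have t: "t : hom A ?P" "!!b. ?p b oo t = (if b then f else g)"
  unfolding t_def using tuple_hom[OF V, of ?F A "%b. if b then f else g"]
  tuple_pr[OF V, of ?F A "%b. if b then f else g"] AB f g by auto
 have dg: "dg : hom B ?P" "!!b. ?p b oo dg = Idn B"
  unfolding dg_def using tuple_hom[OF V, of ?F B "%b. Idn B"]
  tuple_pr[OF V, of ?F B "%b. Idn B"] AB Idn_hom by auto
 have "monic dg" unfolding monic_def
 proof(intro conjI ballI impI)
  fix h k assume hk: "h : Ar" "k : Ar" "Dom h = Dom k" "Cod h = Dom dg" "Cod k = Dom dg" "dg oo h = dg oo k"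
  have pd: "?p True oo (dg oo x) = x" if "x : Ar" "Cod x = Dom dg" for x
  proof -
  have "?p True oo (dg oo x) = (?p True oo dg) oo x"
  by(rule Cmp_assoc[symmetric]) (use that homD(1-3)[OF dg(1)] homD(1-3)[OF p[of True]] in auto)
  thus ?thesis using dg(2)[of True] that homD(2)[OF dg(1)] by simp
  qed
  have "?p True oo (dg oo h) = h" "?p True oo (dg oo k) = k" using pd hk by blast+
  thus "h = k" using hk(6) by metis
 qed (insert dg, auto simp: hom_def)
 hence "pull t (sub_of dg) : Sub A"
  using pull_Sub[of t "sub_of dg"] sub_of_Sub[of dg ?P] t(1) dg(1) by(auto simp: hom_def)
 moreover have "pull t (sub_of dg) = {h : whole A. f oo h = g oo h}"
 proof(intro equalityI subsetI)
  fix h assume "h : pull t (sub_of dg)"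
  then obtain k where k: "h : Ar" "Cod h = A" "k : Ar" "Cod k = B" "t oo h = dg oo k"
  using t dg by(auto simp: mem_pull mem_sub_of hom_def)
  have "(?p b oo t) oo h = (?p b oo dg) oo k" for b
  proof -
  have "(?p b oo t) oo h = ?p b oo (t oo h)"
  by(rule Cmp_assoc) (use k homD[OF t(1)] homD[OF p[of b]] in auto)
  also have "\<dots> = (?p b oo dg) oo k" unfolding k(5)
  by(rule Cmp_assoc[symmetric]) (use k homD[OF dg(1)] homD[OF p[of b]] in auto)
  finally show ?thesis .
  qed
  from this[of True] this[of False] show "h : {h : whole A. f oo h = g oo h}"
  using k t dg by(simp add: mem_whole)
 next
  fix h assume h: "h : {h : whole A. f oo h = g oo h}"
  hence hA: "h : hom (Dom h) A" and eq: "f oo h = g oo h" by(auto simp: mem_whole hom_def)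
  have fh: "f oo h : hom (Dom h) B" by(rule Cmp_hom[OF f hA])
  have "t oo h = dg oo (f oo h)"
  proof(rule prod_eqI[OF V AB(2)])
  show "t oo h : hom (Dom h) ?P" "dg oo (f oo h) : hom (Dom h) ?P"
  using Cmp_hom[OF t(1) hA] Cmp_hom[OF dg(1) fh] by auto
  fix b
  have "?p b oo (t oo h) = (?p b oo t) oo h" by(rule comp_assoc[OF hA t(1) p, symmetric])
  also have "\<dots> = f oo h" using t(2) eq by simp
  also have "\<dots> = Idn B oo (f oo h)" using homD[OF fh] by simp
  also have "\<dots> = ?p b oo (dg oo (f oo h))" using dg(2)[of b] comp_assoc[OF fh dg(1) p[of b]] by metis
  finally show "?p b oo (t oo h) = ?p b oo (dg oo (f oo h))" .
  qed
  hence "t oo h : sub_of dg" using homD[OF fh] homD[OF dg(1)] by - (rule sub_ofI, auto)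
  thus "h : pull t (sub_of dg)" using homD[OF hA] homD[OF t(1)] by(auto simp: mem_pull)
 qed
 ultimately show ?thesis by simp
qed


subsubsection \<open>Covers\<close>

definition covers :: "'o => 'i set => ('i => 'a) => bool" where
 "covers A I u \<longleftrightarrow> A : Ob & (ALL i:I. u i : Ar & Cod (u i) = A) &
  (ALL R:Sub A. (ALL i:I. u i : R) --> R = whole A)"

abbreviation cover :: "'a => bool" where "cover e == covers (Cod e) {()} (%_. e)"

lemma img_is_image: "f : Ar ==> is_image H f (img f)"
proof -
 assume "f : Ar"
 then obtain J where J: "is_image H f J" using reg_images unfolding regular_images_def by blast
 have "img f = J" unfolding img_def
  by(rule the_equality[of "is_image H f", OF J]) (insert J, auto simp: is_image_def dest: is_least_unique)
 with J show ?thesis by simp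
qed

lemma img_subset_iff: "f : Ar ==> R : Sub (Cod f) ==> img f <= R \<longleftrightarrow> f : R"
 using img_is_image[of f] by(auto simp: is_image_def is_least_def)

lemma img_Sub: "f : Ar ==> img f : Sub (Cod f)" and img_self: "f : Ar ==> f : img f"
 using img_is_image[of f] by(auto simp: is_image_def is_least_def)

lemma covering_iff:
 assumes "A : Ob"
 shows "covering TYPE('k) H A I u \<longleftrightarrow> |I| <=o |UNIV :: 'k set| & covers A I u"
proof -
 have "is_join A ((%i. img (u i)) ` I) (whole A) \<longleftrightarrow> (ALL R:Sub A. (ALL i:I. u i : R) --> R = whole A)"
  if "ALL i:I. u i : Ar & Cod (u i) = A"
 proof -
  have "(ALL R:(%i. img (u i)) ` I. R <= S) \<longleftrightarrow> (ALL i:I. u i : S)" if "S : Sub A" for S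
  using that \<open>ALL i:I. u i : Ar & Cod (u i) = A\<close> img_subset_iff by auto
  hence "{S : Sub A. ALL R:(%i. img (u i)) ` I. R <= S} = {S : Sub A. ALL i:I. u i : S}"
  by blast
  moreover have "is_least {S : Sub A. ALL i:I. u i : S} (whole A) \<longleftrightarrow>
  (ALL R:Sub A. (ALL i:I. u i : R) --> R = whole A)"
  proof -
  have "whole A : {S : Sub A. ALL i:I. u i : S}" using that whole_Sub[OF assms] by(simp add: mem_whole)
  moreover have "(whole A <= R) = (R = whole A)" if "R : Sub A" for R using Sub_whole[OF that] by blast
  ultimately show ?thesis unfolding is_least_def by auto
  qed
  ultimately show ?thesis unfolding is_join_def by simp
 qed
 thus ?thesis unfolding covering_def covers_def using assms by blast
qed

lemma covers_k: "A : Ob ==> covering TYPE('k) H A (I :: 'k set) u \<longleftrightarrow> covers A I u"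
 using covering_iff[of A I u] card_of_mono1[of I UNIV] by simp

lemma coversD: "covers A I u ==> A : Ob" "covers A I u ==> i : I ==> u i : Ar"
 "covers A I u ==> i : I ==> Cod (u i) = A"
 by(auto simp: covers_def)

lemma covers_whole: "covers A I u ==> R : Sub A ==> (!!i. i : I ==> u i : R) ==> R = whole A"
 by(auto simp: covers_def)

text \<open>The inverse image of \<open>R\<close> under \<open>g\<close> contains the whole covering
  family, hence is everything. This local character of membership is behind all the Kripke-Joyal
  clauses below.\<close>

lemma covers_local:
 assumes "covers B I u" "R : Sub A" "g : Ar" "Cod g = A" "Dom g = B"
  "!!i. i : I ==> g oo u i : R"
 shows "g : R"
proof -
 have "pull g R : Sub B" using pull_Sub[of g R] assms by simp
 moreover have "u i : pull g R" if "i : I" for i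
  using that assms coversD[OF assms(1)] by(auto simp: mem_pull)
 ultimately have "Idn B : pull g R" using covers_whole[OF assms(1)] Sub_whole_iff by metis
 thus ?thesis using assms by(simp add: mem_pull)
qed

lemma cover_local: "cover e ==> R : Sub (Cod g) ==> g : Ar ==> Dom g = Cod e ==> g oo e : R ==> g : R"
 using covers_local[of "Cod e" "{()}" "%_. e" R "Cod g" g] by simp

lemma covers_Idn: "A : Ob ==> i : I ==> covers A I (%_. Idn A)"
 unfolding covers_def using Sub_whole_iff by auto

text \<open>The image is the least subobject containing \<open>f\<close>. If \<open>e\<close> lay in
  a proper subobject of the image, a smaller subobject would contain \<open>f\<close>; so
  \<open>e\<close> is a cover.\<close>

lemma image_factor:
 assumes "f : Ar"
 obtains m e where "monic m" "m : Ar" "e : Ar" "cover e" "Cod e = Dom m" "Cod m = Cod f" "f = m oo e"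
  "img f = sub_of m"
proof -
 obtain m where m: "monic m" "m : Ar" "Cod m = Cod f" "img f = sub_of m"
  using img_Sub[OF assms] by(elim SubE)
 then obtain e where e: "e : Ar" "Cod e = Dom m" "f = m oo e" using img_self[OF assms] by(auto simp: mem_sub_of)
 have "cover e" unfolding covers_def
 proof(intro conjI ballI impI)
  fix R assume R: "R : Sub (Cod e)" "ALL i:{()}. e : R"
  obtain n where n: "monic n" "n : Ar" "Cod n = Dom m" "R = sub_of n" using R(1) e by(elim SubE) auto
  obtain k where k: "k : Ar" "Cod k = Dom n" "e = n oo k" using R n by(auto simp: mem_sub_of)
  have "f : sub_of (m oo n)" using k n m e by(auto simp: mem_sub_of intro!: bexI[of _ k])
  hence "img f <= sub_of (m oo n)"
  using img_subset_iff[OF assms] sub_of_Sub[OF monic_Cmp[OF m(1) n(1)]] n m by simp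
  hence "m : sub_of (m oo n)" using m sub_of_self by auto
  then obtain h where h: "h : Ar" "Cod h = Dom n" "m = m oo (n oo h)" using m n by(auto simp: mem_sub_of)
  have "Dom h = Dom m" using h m n by(metis Dom_Cmp Cmp_Ar Cod_Cmp)
  hence "n oo h = Idn (Dom m)" using h m n
  by - (rule monicD(2)[OF m(1)], auto)
  hence "Idn (Cod e) : R" using h n m e by(auto simp: mem_sub_of)
  thus "R = whole (Cod e)" using Sub_whole_iff[OF R(1)] by simp
 qed (use e Cod_Ob[OF e(1)] in auto)
 with m e that show ?thesis by blast
qed

lemma cover_iff_image: "e : Ar ==> cover e \<longleftrightarrow> is_image H e (whole (Cod e))"
 unfolding covers_def is_image_def is_least_def
 using whole_Sub[of "Cod e"] Sub_whole[of _ "Cod e"] by(auto simp: mem_whole)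

lemma cover_pb:
 assumes "is_pullback f g p q" "cover f"
 shows "cover q"
 using assms reg_images pullbackD[OF assms(1)] cover_iff_image unfolding regular_images_def by metis

subsubsection \<open>Universal quantification\<close>

lemma all_is_all: "f : Ar ==> R : Sub (Dom f) ==> is_all H f R (all_along f R)"
proof -
 assume "f : Ar" "R : Sub (Dom f)"
 then obtain J where J: "is_all H f R J" using all_ex by blast
 have "all_along f R = J" unfolding all_along_def
  by(rule the_equality[of "is_all H f R", OF J]) (insert J, auto simp: is_all_def dest: is_greatest_unique)
 with J show ?thesis by simp
qed

lemma all_Sub: "f : Ar ==> R : Sub (Dom f) ==> all_along f R : Sub (Cod f)"
 using all_is_all[of f R] by(auto simp: is_all_def is_greatest_def)

lemma all_adj: "f : Ar ==> R : Sub (Dom f) ==> S : Sub (Cod f) ==> S <= all_along f R \<longleftrightarrow> pull f S <= R"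
 using all_is_all[of f R] pull_mono[of S "all_along f R" f] unfolding is_all_def is_greatest_def by blast

text \<open>The adjunction compares subobjects only, so \<open>g\<close> is replaced by its image.
  An arrow into the image lifts to \<open>g\<close> after pulling back the cover onto the image, and
  membership in \<open>R\<close> descends along that cover.\<close>

lemma mem_all:
 assumes f: "f : Ar" and R: "R : Sub (Dom f)"
 shows "g : all_along f R \<longleftrightarrow> g : Ar & Cod g = Cod f &
  (ALL h t. h : Ar --> t : Ar --> Cod h = Dom f --> Cod t = Dom g --> Dom h = Dom t -->
  f oo h = g oo t --> h : R)"
  (is "_ \<longleftrightarrow> ?R")
proof
 assume g: "g : all_along f R"
 note S = all_Sub[OF f R]
 have "pull f (all_along f R) <= R" using all_adj[OF f R S] by simp
 thus ?R using SubD[OF S g] Sub_comp[OF S g] by(auto simp: mem_pull)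
next
 assume g: ?R
 hence gA: "g : Ar" by blast
 have "pull f (img g) <= R"
 proof
  fix h assume "h : pull f (img g)"
  hence h: "h : Ar" "Cod h = Dom f" "f oo h : img g" by(auto simp: mem_pull)
  obtain m e where m: "monic m" "m : Ar" "e : Ar" "cover e" "Cod e = Dom m" "Cod m = Cod g" "g = m oo e"
  "img g = sub_of m" by(rule image_factor[OF gA])
  obtain k where k: "k : Ar" "Cod k = Dom m" "f oo h = m oo k" using h m by(auto simp: mem_sub_of)
  have dk: "Dom k = Dom h" using k h f m by(metis Dom_Cmp)
  obtain p q where pb: "is_pullback e k p q" using pullback_ex m k by metis
  note pbD = pullbackD[OF pb]
  have "cover q" by(rule cover_pb[OF pb m(4)])
  moreover have "h oo q : R"
  proof -
  have "f oo (h oo q) = (m oo k) oo q" using pbD h f dk k by(metis Cmp_assoc)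
  also have "\<dots> = m oo (e oo p)" using pbD k m by(metis Cmp_assoc)
  also have "\<dots> = g oo p" using pbD m by simp
  finally have "f oo (h oo q) = g oo p" .
  thus ?thesis using g pbD h dk f m by auto
  qed
  ultimately show "h : R" using R h pbD dk by(intro cover_local[of q R h]) auto
 qed
 hence "img g <= all_along f R" using all_adj[OF f R] img_Sub[OF gA] g by simp
 thus "g : all_along f R" using img_self[OF gA] by blast
qed

text \<open>Beck-Chevalley. Through \<open>mem_all\<close> both sides test the same data, the
  pullback property turning test arrows into \<open>Dom \<pi>\<close> into test arrows into
  \<open>Dom F'\<close>.\<close>

lemma pull_all:
 assumes "is_pullback f \<pi> F' p" and R: "R : Sub (Dom \<pi>)"
 shows "pull f (all_along \<pi> R) = all_along F' (pull p R)"
proof -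
 note pb = pullbackD[OF assms(1)]
 have R': "pull p R : Sub (Dom F')" using pull_Sub[of p R] pb R by simp
 have "g : pull f (all_along \<pi> R) \<longleftrightarrow> g : all_along F' (pull p R)" for g
 proof
  assume g: "g : pull f (all_along \<pi> R)"
  hence gA: "g : Ar" "Cod g = Dom f" by(auto simp: mem_pull)
  show "g : all_along F' (pull p R)" unfolding mem_all[OF pb(3) R']
  proof(intro conjI allI impI)
  fix h t assume ht: "h : Ar" "t : Ar" "Cod h = Dom F'" "Cod t = Dom g" "Dom h = Dom t" "F' oo h = g oo t"
  have "\<pi> oo (p oo h) = f oo (F' oo h)" using ht pb by(metis Cmp_assoc)
  also have "\<dots> = (f oo g) oo t" using ht gA pb by simp
  finally have "\<pi> oo (p oo h) = (f oo g) oo t" .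
  hence "p oo h : R" using g ht gA pb unfolding mem_pull mem_all[OF pb(2) R] by auto
  thus "h : pull p R" using ht pb by(auto simp: mem_pull)
  qed (use gA pb in auto)
 next
  assume g: "g : all_along F' (pull p R)"
  hence gA: "g : Ar" "Cod g = Dom f" unfolding mem_all[OF pb(3) R'] using pb by auto
  show "g : pull f (all_along \<pi> R)" unfolding mem_pull mem_all[OF pb(2) R]
  proof(intro conjI allI impI)
  fix h t assume ht: "h : Ar" "t : Ar" "Cod h = Dom \<pi>" "Cod t = Dom (f oo g)" "Dom h = Dom t" "\<pi> oo h = (f oo g) oo t"
  have "f oo (g oo t) = \<pi> oo h" "g oo t : Ar" "Cod (g oo t) = Dom f" "Dom (g oo t) = Dom h"
  using ht gA pb by auto
  then obtain l where l: "l : Ar" "Dom l = Dom h" "Cod l = Dom F'" "F' oo l = g oo t" "p oo l = h"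
  using pullback_lift[OF assms(1), of "g oo t" h] ht by metis
  hence "l : pull p R" using g ht gA pb unfolding mem_all[OF pb(3) R'] by auto
  thus "h : R" using l by(auto simp: mem_pull)
  qed (use gA pb in auto)
 qed
 thus ?thesis by blast
qed

lemma covers_pb:
 assumes "covers A I u" "f : Ar" "Cod f = A" "!!i. i : I ==> is_pullback f (u i) (p i) (q i)"
 shows "covers (Dom f) I p"
 unfolding covers_def
proof(intro conjI ballI impI)
 fix R assume R: "R : Sub (Dom f)" "ALL i:I. p i : R"
 have "u i : all_along f R" if i: "i : I" for i
  unfolding mem_all[OF assms(2) R(1)]
 proof(intro conjI allI impI)
  fix h t assume ht: "h : Ar" "t : Ar" "Cod h = Dom f" "Cod t = Dom (u i)" "Dom h = Dom t" "f oo h = u i oo t"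
  obtain l where l: "l : Ar" "Dom l = Dom h" "Cod l = Dom (p i)" "p i oo l = h"
  using pullback_lift[OF assms(4)[OF i], of h t] ht by metis
  thus "h : R" using R i Sub_comp[OF R(1), of "p i" l] by auto
 qed (use coversD[OF assms(1)] i assms in auto)
 hence "all_along f R = whole A" using covers_whole[OF assms(1)] all_Sub[OF assms(2) R(1)] assms(3) by auto
 hence "f : all_along f R" using assms(2,3) by(simp add: mem_whole)
 hence "f oo Idn (Dom f) = f oo Idn (Dom f) ==> Idn (Dom f) : R"
  using assms(2) unfolding mem_all[OF assms(2) R(1)] by(metis Cod_Idn Dom_Ob Idn_Ar)
 hence "Idn (Dom f) : R" by simp
 thus "R = whole (Dom f)" using Sub_whole_iff[OF R(1)] by simp
qed (use assms pullbackD[OF assms(4)] in auto)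

lemma covers_comp:
 assumes "covers A I u" "!!i. i : I ==> covers (Dom (u i)) (J i) (v i)"
  "!!i j. i : I ==> j : J i ==> EX k:Ks. w k = u i oo v i j" "!!k. k : Ks ==> w k : Ar & Cod (w k) = A"
 shows "covers A Ks w"
 unfolding covers_def
proof(intro conjI ballI impI)
 fix R assume R: "R : Sub A" "ALL k:Ks. w k : R"
 show "R = whole A"
 proof(rule covers_whole[OF assms(1) R(1)])
  fix i assume i: "i : I"
  show "u i : R"
  proof(rule covers_local[OF assms(2)[OF i] R(1)])
  fix j assume "j : J i"
  thus "u i oo v i j : R" using assms(3)[OF i] R by metis
  qed (use coversD[OF assms(1) ] i in auto)
 qed
qed (use assms coversD in auto)

subsubsection \<open>Implication\<close>

text \<open>The implication is universal quantification, along a mono representing \<open>R\<close>,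
  of the inverse image of \<open>S\<close>.\<close>

lemma imp_is_imp:
 assumes R: "R : Sub A" and S: "S : Sub A"
 shows "is_imp H A R S (imp_sub H A R S)"
proof -
 obtain m where m: "monic m" "m : Ar" "Cod m = A" "R = sub_of m" using R by(elim SubE)
 have S': "pull m S : Sub (Dom m)" using pull_Sub[of m S] S m by simp
 have "is_imp H A R S (all_along m (pull m S))" unfolding is_imp_def is_greatest_def
 proof(intro conjI ballI)
  have iff: "Q <= all_along m (pull m S) \<longleftrightarrow> Q Int R <= S" if Q: "Q : Sub A" for Q
  proof -
  have "pull m Q <= pull m S \<longleftrightarrow> Q Int R <= S"
  proof
  assume a: "pull m Q <= pull m S"
  show "Q Int R <= S"
  proof
  fix x assume x: "x : Q Int R"
  then obtain h where h: "h : Ar" "Cod h = Dom m" "x = m oo h" using m by(auto simp: mem_sub_of)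
  hence "h : pull m Q" using x by(simp add: mem_pull)
  thus "x : S" using a h by(auto simp: mem_pull)
  qed
  next
  assume a: "Q Int R <= S"
  show "pull m Q <= pull m S" using a m sub_ofI[of m] by(auto simp: mem_pull)
  qed
  thus ?thesis using all_adj[OF m(2) S', of Q] Q m by simp
  qed
  show "all_along m (pull m S) : {Q : Sub A. Q Int R <= S}"
  using iff[of "all_along m (pull m S)"] all_Sub[OF m(2) S'] m by simp
  fix Q assume "Q : {Q : Sub A. Q Int R <= S}"
  thus "Q <= all_along m (pull m S)" using iff by simp
 qed
 note J = this
 have "imp_sub H A R S = all_along m (pull m S)" unfolding imp_sub_def
  by(rule the_equality[of "is_imp H A R S", OF J]) (insert J, auto simp: is_imp_def dest: is_greatest_unique)
 with J show ?thesis by simp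
qed

lemma imp_Sub: "R : Sub A ==> S : Sub A ==> imp_sub H A R S : Sub A"
 using imp_is_imp[of R A S] by(auto simp: is_imp_def is_greatest_def)

lemma imp_adj: "R : Sub A ==> S : Sub A ==> Q : Sub A ==> Q <= imp_sub H A R S \<longleftrightarrow> Q Int R <= S"
 using imp_is_imp[of R A S] unfolding is_imp_def is_greatest_def by auto

text \<open>As in \<open>mem_all\<close>, an arbitrary \<open>g\<close> is replaced by its image,
  and the conclusion descends along a cover.\<close>

lemma mem_imp:
 assumes R: "R : Sub A" and S: "S : Sub A"
 shows "g : imp_sub H A R S \<longleftrightarrow> g : Ar & Cod g = A &
  (ALL h. h : Ar --> Cod h = Dom g --> g oo h : R --> g oo h : S)"
proof
 assume g: "g : imp_sub H A R S"
 note I = imp_Sub[OF R S]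
 show "g : Ar & Cod g = A & (ALL h. h : Ar --> Cod h = Dom g --> g oo h : R --> g oo h : S)"
  using SubD[OF I g] Sub_comp[OF I g] imp_adj[OF R S I] by blast
next
 assume g: "g : Ar & Cod g = A & (ALL h. h : Ar --> Cod h = Dom g --> g oo h : R --> g oo h : S)"
 hence gA: "g : Ar" by blast
 have "img g Int R <= S"
 proof
  fix k assume k: "k : img g Int R"
  obtain m e where m: "monic m" "m : Ar" "e : Ar" "cover e" "Cod e = Dom m" "Cod m = Cod g" "g = m oo e"
  "img g = sub_of m" by(rule image_factor[OF gA])
  obtain l where l: "l : Ar" "Cod l = Dom m" "k = m oo l" using k m by(auto simp: mem_sub_of)
  obtain p q where pb: "is_pullback e l p q" using pullback_ex m l by metis
  note pbD = pullbackD[OF pb]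
  have "cover q" by(rule cover_pb[OF pb m(4)])
  moreover have "k oo q : S"
  proof -
  have "k oo q = m oo (l oo q)" using l m pbD by simp
  also have "\<dots> = g oo p" using pbD m by simp
  finally have "k oo q = g oo p" .
  moreover have "k oo q : R" using Sub_comp[OF R, of k q] k pbD l m by simp
  ultimately show ?thesis using g pbD m by auto
  qed
  ultimately show "k : S" using S l m g pbD by(intro cover_local[of q S k]) auto
 qed
 hence "img g <= imp_sub H A R S" using imp_adj[OF R S] img_Sub[OF gA] g by simp
 thus "g : imp_sub H A R S" using img_self[OF gA] by blast
qed

lemma pull_imp:
 assumes "R : Sub A" "S : Sub A" "f : Ar" "Cod f = A"
 shows "pull f (imp_sub H A R S) = imp_sub H (Dom f) (pull f R) (pull f S)"
proof -
 have "pull f R : Sub (Dom f)" "pull f S : Sub (Dom f)" using pull_Sub assms by auto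
 thus ?thesis using assms by(auto simp: mem_pull mem_imp)
qed

subsubsection \<open>Existential quantification\<close>

text \<open>With \<open>m\<close> a mono representing \<open>R\<close>, a subobject has inverse
  image above \<open>R\<close> exactly when it contains \<open>f oo m\<close>. The least one is thus
  the image of \<open>f oo m\<close>.\<close>

lemma ex_is_ex:
 assumes f: "f : Ar" and R: "R : Sub (Dom f)"
 shows "is_ex H f R (ex_along f R)"
proof -
 obtain m where m: "monic m" "m : Ar" "Cod m = Dom f" "R = sub_of m" using R by(elim SubE)
 have "R <= pull f S \<longleftrightarrow> f oo m : S" if S: "S : Sub (Cod f)" for S
 proof
  assume "R <= pull f S"
  thus "f oo m : S" using sub_of_self[OF m(2)] m by(auto simp: mem_pull)
 next
  assume fm: "f oo m : S"
  show "R <= pull f S"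
  proof
  fix g assume "g : R"
  then obtain h where "h : Ar" "Cod h = Dom m" "g = m oo h" using m by(auto simp: mem_sub_of)
  thus "g : pull f S" using Sub_comp[OF S fm, of h] m f by(auto simp: mem_pull)
  qed
 qed
 hence "{S : Sub (Cod f). R <= pull f S} = {S : Sub (Cod (f oo m)). f oo m : S}" using m f by auto
 hence "is_ex H f R (img (f oo m))" using img_is_image[of "f oo m"] m f unfolding is_ex_def is_image_def by simp
 note J = this
 have "ex_along f R = img (f oo m)" unfolding ex_along_def
  by(rule the_equality[of "is_ex H f R", OF J]) (insert J, auto simp: is_ex_def dest: is_least_unique)
 with J show ?thesis by simp
qed

lemma ex_Sub: "f : Ar ==> R : Sub (Dom f) ==> ex_along f R : Sub (Cod f)"
 using ex_is_ex[of f R] by(auto simp: is_ex_def is_least_def)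

lemma ex_adj: "f : Ar ==> R : Sub (Dom f) ==> S : Sub (Cod f) ==> ex_along f R <= S \<longleftrightarrow> R <= pull f S"
 using ex_is_ex[of f R] pull_mono[of "ex_along f R" S f] unfolding is_ex_def is_least_def by blast

lemma ex_mem: "f : Ar ==> R : Sub (Dom f) ==> h : R ==> f oo h : ex_along f R"
 using ex_adj[of f R "ex_along f R"] ex_Sub[of f R] by(auto simp: mem_pull)

text \<open>Witnesses exist only locally: the existential subobject is the image of
  \<open>f oo m\<close>, and the cover onto that image is pulled back to the domain of
  \<open>g\<close>.\<close>

lemma mem_ex:
 assumes f: "f : Ar" and R: "R : Sub (Dom f)" and g: "g : ex_along f R"
 obtains e h where "cover e" "e : Ar" "Cod e = Dom g" "h : R" "Dom h = Dom e" "f oo h = g oo e"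
proof -
 obtain m where m: "monic m" "m : Ar" "Cod m = Dom f" "R = sub_of m" using R by(elim SubE)
 have fm: "f oo m : Ar" using f m by simp
 have "R <= pull f (img (f oo m))"
 proof
  fix x assume "x : R"
  then obtain h where "h : Ar" "Cod h = Dom m" "x = m oo h" using m by(auto simp: mem_sub_of)
  thus "x : pull f (img (f oo m))"
  using Sub_comp[OF img_Sub[OF fm] img_self[OF fm], of h] m f by(auto simp: mem_pull)
 qed
 hence "ex_along f R <= img (f oo m)" using ex_adj[OF f R] img_Sub[OF fm] f m by simp
 hence g': "g : img (f oo m)" using g by blast
 obtain n e where n: "monic n" "n : Ar" "e : Ar" "cover e" "Cod e = Dom n" "Cod n = Cod (f oo m)" "f oo m = n oo e"
  "img (f oo m) = sub_of n" by(rule image_factor[OF fm])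
 obtain l where l: "l : Ar" "Cod l = Dom n" "g = n oo l" using g' n by(auto simp: mem_sub_of)
 obtain p q where pb: "is_pullback e l p q" using pullback_ex n l by metis
 note pbD = pullbackD[OF pb]
 have de: "Dom e = Dom m" using n m f fm by(metis Dom_Cmp)
 have "f oo (m oo p) = (f oo m) oo p" using f m pbD de by simp
 also have "\<dots> = n oo (l oo q)" using n pbD by simp
 also have "\<dots> = g oo q" using l n pbD by simp
 finally have eq: "f oo (m oo p) = g oo q" .
 show ?thesis
 proof(rule that)
  show "cover q" by(rule cover_pb[OF pb n(4)])
  show "m oo p : R" using m pbD de by(auto simp: mem_sub_of)
 qed (use eq pbD l n m de in auto)
qed

text \<open>Beck-Chevalley. One inclusion is commutativity of the square; for the other a local
  witness is lifted into the pullback and the result descends along the cover on which the witness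
  lives.\<close>

lemma pull_ex:
 assumes "is_pullback f \<pi> F' p" and R: "R : Sub (Dom \<pi>)"
 shows "pull f (ex_along \<pi> R) = ex_along F' (pull p R)"
proof -
 note pb = pullbackD[OF assms(1)]
 have R': "pull p R : Sub (Dom F')" using pull_Sub[of p R] pb R by simp
 have S: "pull f (ex_along \<pi> R) : Sub (Cod F')" using pull_Sub[of f] ex_Sub[of \<pi> R] pb R by auto
 have "pull p R <= pull F' (pull f (ex_along \<pi> R))"
 proof
  fix h assume "h : pull p R"
  hence h: "h : Ar" "Cod h = Dom F'" "p oo h : R" using pb by(auto simp: mem_pull)
  have "f oo (F' oo h) = \<pi> oo (p oo h)" using h pb by(metis Cmp_assoc)
  thus "h : pull F' (pull f (ex_along \<pi> R))" using ex_mem[OF pb(2) R h(3)] h pb by(auto simp: mem_pull)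
 qed
 hence 1: "ex_along F' (pull p R) <= pull f (ex_along \<pi> R)" using ex_adj[OF pb(3) R' S] by simp
 have "g : ex_along F' (pull p R)" if g: "g : pull f (ex_along \<pi> R)" for g
 proof -
  have gA: "g : Ar" "Cod g = Dom f" "f oo g : ex_along \<pi> R" using g by(auto simp: mem_pull)
  obtain e h where e: "cover e" "e : Ar" "Cod e = Dom (f oo g)" "h : R" "Dom h = Dom e" "\<pi> oo h = (f oo g) oo e"
  by(rule mem_ex[OF pb(2) R gA(3)])
  have hA: "h : Ar" "Cod h = Dom \<pi>" using SubD[OF R e(4)] by auto
  have "f oo (g oo e) = \<pi> oo h" "g oo e : Ar" "Cod (g oo e) = Dom f" "Dom (g oo e) = Dom h"
  using e gA pb by auto
  then obtain l where l: "l : Ar" "Cod l = Dom F'" "F' oo l = g oo e" "p oo l = h"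
  using pullback_lift[OF assms(1), of "g oo e" h] hA by metis
  hence "l : pull p R" using e pb by(auto simp: mem_pull)
  from ex_mem[OF pb(3) R' this] l have "g oo e : ex_along F' (pull p R)" by simp
  moreover have "Cod e = Dom g" using e gA pb by simp
  moreover have "ex_along F' (pull p R) : Sub (Cod g)" using ex_Sub[OF pb(3) R'] pb gA by simp
  ultimately show ?thesis using cover_local[OF e(1), of _ g] gA by simp
 qed
 with 1 show ?thesis by blast
qed

subsubsection \<open>Joins\<close>

lemma is_joinD: "is_join A RR J ==> J : Sub A" "is_join A RR J ==> R : RR ==> R <= J"
 "is_join A RR J ==> S : Sub A ==> (!!R. R : RR ==> R <= S) ==> J <= S"
 by(auto simp: is_join_def is_least_def)

lemma is_joinI: "J : Sub A ==> (!!R. R : RR ==> R <= J) ==> (!!S. S : Sub A ==> (!!R. R : RR ==> R <= S) ==> J <= S) ==>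
 is_join A RR J"
 by(auto simp: is_join_def is_least_def)

lemma join_eq: "is_join A RR J ==> join A RR = J"
 unfolding join_def is_join_def by(rule the_equality) (auto dest: is_least_unique)

lemma join_is_join:
 assumes "A : Ob" "RR <= Sub A" "|RR| <=o |UNIV :: 'k set|"
 shows "is_join A RR (join A RR)"
 using st_unions assms join_eq unfolding stable_unions_def by metis

lemma pull_join:
 assumes "f : Ar" "RR <= Sub (Cod f)" "|RR| <=o |UNIV :: 'k set|"
 shows "pull f (join (Cod f) RR) = join (Dom f) (pull f ` RR)"
proof -
 obtain J where J: "is_join (Cod f) RR J" "is_join (Dom f) (pull f ` RR) (pull f J)"
  using st_unions assms unfolding stable_unions_def by(metis Cod_Ob)
 thus ?thesis using join_eq by metis
qed

lemma card_image_k: "|g ` (I :: 'k set)| <=o |UNIV :: 'k set|"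
 using card_of_image[of g I] card_of_mono1[of I UNIV] ordLeq_transitive by blast

definition bot :: "'o => 'a set" where "bot A = join A {}"

lemma bot_Sub: "A : Ob ==> bot A : Sub A" and bot_least: "S : Sub A ==> bot A <= S"
proof -
 have j: "is_join A {} (bot A)" if "A : Ob" for A unfolding bot_def
  by(rule join_is_join) (use that card_of_empty in auto)
 show "A : Ob ==> bot A : Sub A" using j is_joinD(1) by blast
 show "S : Sub A ==> bot A <= S" using is_joinD(3)[OF j[OF Sub_Ob]] by blast
qed

lemma pull_bot: "f : Ar ==> pull f (bot (Cod f)) = bot (Dom f)"
 using pull_join[of f "{}"] by(simp add: bot_def card_of_empty)

text \<open>The stages that force falsity. By \<open>mem_bot\<close>, whether an arrow lies in the
  bottom subobject depends on its domain alone.\<close>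

definition degenerate :: "'o => bool" where "degenerate A \<longleftrightarrow> A : Ob & bot A = whole A"

lemma degenerate_iff: "A : Ob ==> degenerate A \<longleftrightarrow> Idn A : bot A"
 unfolding degenerate_def using Sub_whole_iff bot_Sub by blast

lemma mem_bot: "g : Ar ==> g : bot (Cod g) \<longleftrightarrow> degenerate (Dom g)"
proof -
 assume g: "g : Ar"
 have "g : bot (Cod g) \<longleftrightarrow> Idn (Dom g) : pull g (bot (Cod g))" using g by(simp add: mem_pull)
 also have "\<dots> \<longleftrightarrow> degenerate (Dom g)" using g by(simp add: pull_bot degenerate_iff)
 finally show ?thesis .
qed

lemma degenerate_mem: "degenerate (Dom g) ==> g : Ar ==> R : Sub (Cod g) ==> g : R"
 using mem_bot bot_least by blast

text \<open>A join of two subobjects is stable: pulled back along \<open>f\<close> they still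
  exhaust the domain, and as the second has become bottom the first is everything.\<close>

lemma Or_pull:
 assumes "is_join A {J1, J2} (whole A)" "J1 : Sub A" "J2 : Sub A" "f : Ar" "Cod f = A"
  "pull f J2 <= bot (Dom f)"
 shows "f : J1"
proof -
 have c: "|{J1, J2}| <=o |UNIV :: 'k set|"
  using card_image_k[of "%i. if i = ozero then J1 else J2" "{ozero, osuc ozero}"] by(simp add: insert_commute)
 have "is_join (Dom f) {pull f J1, pull f J2} (join (Dom f) (pull f ` {J1, J2}))"
  using join_is_join[of "Dom f" "pull f ` {J1, J2}"] pull_Sub assms
  card_image_k[of "%i. if i = ozero then pull f J1 else pull f J2" "{ozero, osuc ozero}"]
  by(simp add: insert_commute)
 moreover have "join (Dom f) (pull f ` {J1, J2}) = whole (Dom f)"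
  using pull_join[of f "{J1, J2}"] assms c join_eq[OF assms(1)] pull_whole[of f] by simp
 ultimately have "whole (Dom f) <= pull f J1"
  using is_joinD(3)[of "Dom f" "{pull f J1, pull f J2}" "whole (Dom f)" "pull f J1"]
  pull_Sub[of f J1] assms bot_least[of "pull f J1" "Dom f"] by auto
 hence "Idn (Dom f) : pull f J1" using assms by(auto simp: mem_whole)
 thus ?thesis using assms by(simp add: mem_pull)
qed

end

section \<open>Histories, chains and their limits\<close>

lemma history_eq_iff:
 "history a r = history a r' \<longleftrightarrow>
  (ALL b<=a. stage r b = stage r' b & (ALL c<=b. link r b c = link r' b c)) &
  (ALL b<a. elt r b = elt r' b & idx r b = idx r' b)"
 unfolding history_def by(auto simp: fun_eq_iff)

lemma history_history: "b <= a ==> history b (history a r) = history b r"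
 unfolding history_eq_iff by(auto simp: history_def)

lemma history_mono: "history a r = history a r' ==> b <= a ==> history b r = history b r'"
 by(metis history_history)

context kcat
begin

abbreviation "sI sg a r == fst (sg a (history a r))"
abbreviation "sU sg a r == fst (snd (sg a (history a r)))"
abbreviation "sE sg a r == snd (snd (sg a (history a r)))"
abbreviation "chainE lk == (%b a. if a <= b then {lk b a} else {})"

text \<open>A chain without a fixed start and without continuity at limit stages: just the diagram
  whose limits are to be compared.\<close>

definition chn :: "'k => ('k => 'o) => ('k => 'k => 'a) => bool" where
 "chn l st lk \<longleftrightarrow> (ALL b<l. st b : Ob & lk b b = Idn (st b) &
  (ALL a<=b. lk b a : hom (st b) (st a) & (ALL c<=a. lk a c oo lk b a = lk b c)))"

lemma chainD:
 assumes "is_chain C (g::'k) r" "b <= g"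
 shows "stage r b : Ob" "link r b b = Idn (stage r b)" "a <= b ==> link r b a : hom (stage r b) (stage r a)"
  "a <= b ==> c <= a ==> link r a c oo link r b a = link r b c"
  "is_lim b ==> is_limit {..<b} (stage r) (chainE (link r)) (stage r b) (link r b)"
 using assms unfolding is_chain_def by blast+

lemma chain_zero: "is_chain C (g::'k) r ==> stage r ozero = C"
 by(simp add: is_chain_def)

lemma chain_Ob: "is_chain C (g::'k) r ==> C : Ob"
 using chainD(1)[of C g r ozero] chain_zero by auto

lemma chain_mono: "is_chain C (g::'k) r ==> g' <= g ==> is_chain C g' r"
 unfolding is_chain_def by(meson order_trans)

lemma chain_chn: "is_chain C g r ==> l <= g ==> chn l (stage r) (link r)"
 unfolding chn_def using chainD[of C g r] by(meson order_less_imp_le order_trans)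

lemma chain_cong:
 assumes "history (g::'k) r = history g r'"
 shows "is_chain C g r \<longleftrightarrow> is_chain C g r'"
proof -
 have st: "!!b. b <= g ==> stage r b = stage r' b" and lk: "!!b c. b <= g ==> c <= b ==> link r b c = link r' b c"
  using assms unfolding history_eq_iff by auto
 have 1: "is_limit {..<b} (stage r) (chainE (link r)) (stage r b) (link r b) \<longleftrightarrow>
  is_limit {..<b} (stage r') (chainE (link r')) (stage r' b) (link r' b)" if b: "b <= g" for b
  unfolding st[OF b] by(rule is_limit_cong) (insert st lk b, auto simp: less_imp_le order.strict_implies_order)
 show ?thesis unfolding is_chain_def using st lk 1 by(simp cong: conj_cong)
qed

text \<open>All links are composites of one-step links and projections of limit cones, so only these
  need checking. The premises may assume that the chain is correct below the stage in question,
  which makes the induction available to every construction of plays.\<close>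

lemma is_chainI:
 assumes C: "C : Ob" "stage r (ozero::'k) = C"
  and id: "!!b. b <= g ==> link r b b = Idn (stage r b)"
  and sc: "!!a. a < g ==> is_chain C a r ==> link r (osuc a) a : hom (stage r (osuc a)) (stage r a)"
  and cm: "!!a c. a < g ==> is_chain C a r ==> c <= a ==> link r (osuc a) c = link r a c oo link r (osuc a) a"
  and lm: "!!b. is_lim b ==> b <= g ==> (!!a. a < b ==> is_chain C a r) ==>
  is_limit {..<b} (stage r) (chainE (link r)) (stage r b) (link r b)"
 shows "is_chain C g r"
proof -
 have "b <= g ==> is_chain C b r" for b
 proof(induction b rule: less_induct)
  case (less b)
  have IH: "is_chain C a r" if "a < b" for a using less that by auto
  have top: "stage r b : Ob & (ALL a<=b. link r b a : hom (stage r b) (stage r a) &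
  (ALL c<=a. link r a c oo link r b a = link r b c)) & (is_lim b -->
  is_limit {..<b} (stage r) (chainE (link r)) (stage r b) (link r b))"
  proof(cases b rule: ord_cases)
  case zero
  thus ?thesis using C id[of ozero] by(auto simp: hom_def)
  next
  case (succ a)
  hence a: "a < b" "a < g" using less.prems by auto
  note ch = IH[OF a(1)]
  have 1: "link r b a : hom (stage r b) (stage r a)" using sc[OF a(2) ch] succ by simp
  have ob: "stage r b : Ob" using homD(4)[OF 1] .
  have 2: "link r b c = link r a c oo link r b a" if "c <= a" for c using cm[OF a(2) ch that] succ by simp
  have 3: "link r b c : hom (stage r b) (stage r c)" if "c <= a" for c
  unfolding 2[OF that] by(rule Cmp_hom[OF chainD(3)[OF ch] 1]) (use that in auto)
  have 4: "link r c d oo link r b c = link r b d" if "c <= a" "d <= c" for c d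
  proof -
  have "link r c d oo link r b c = link r c d oo (link r a c oo link r b a)" unfolding 2[OF that(1)] ..
  also have "\<dots> = (link r c d oo link r a c) oo link r b a"
  by(rule comp_assoc[OF 1, symmetric]) (use chainD(3)[OF ch] that in auto)
  also have "link r c d oo link r a c = link r a d" using chainD(4)[OF ch] that by auto
  finally show ?thesis using 2[of d] that by(metis order_trans)
  qed
  have le: "c <= b \<longleftrightarrow> c = b \<or> c <= a" for c using succ by(metis less_osuc_iff order.order_iff_strict)
  have 5: "link r b d : hom (stage r b) (stage r d)" if "d <= b" for d
  using that 3[of d] id[OF less.prems] ob unfolding le by(auto simp: hom_def)
  have 6: "link r b d oo link r b b = link r b d" if "d <= b" for d
  using 5[OF that] id[OF less.prems] by(simp add: hom_def)
  have 7: "link r c d oo link r b c = link r b d" if "c <= b" "d <= c" for c d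
  using that 4[of c d] 6[of d] le[of c] by auto
  have "~ is_lim b" using succ by simp
  thus ?thesis using ob 5 7 by blast
  next
  case lim
  have L: "is_limit {..<b} (stage r) (chainE (link r)) (stage r b) (link r b)" using lm[OF lim less.prems IH] .
  hence c: "stage r b : Ob" "!!a. a < b ==> link r b a : hom (stage r b) (stage r a)"
  "!!a c. a < b ==> c <= a ==> link r a c oo link r b a = link r b c"
  by(auto simp: is_limit_def is_cone_def)
  have d: "link r b a : hom (stage r b) (stage r a)" if "a <= b" for a
  using c(1,2) that id[OF less.prems] by(cases "a = b") (auto simp: hom_def)
  have "link r a e oo link r b a = link r b e" if "a <= b" "e <= a" for a e
  using c(3) that d[of e] id[OF less.prems] by(cases "a = b") (auto simp: hom_def)
  thus ?thesis using c(1) d L by blast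
  qed
  show ?case unfolding is_chain_def
  proof(intro conjI allI impI)
  fix c assume c: "c <= b"
  show "stage r c : Ob" using top chainD(1)[OF IH[of c] order_refl] c by(cases "c = b") auto
  show "link r c c = Idn (stage r c)" using id c less.prems by auto
  { fix a assume "a <= c"
  thus "link r c a : hom (stage r c) (stage r a)" using top chainD(3)[OF IH[of c] order_refl] c by(cases "c = b") auto
  fix d assume "d <= a"
  thus "link r a d oo link r c a = link r c d" using top chainD(4)[OF IH[of c] order_refl] c \<open>a <= c\<close> by(cases "c = b") auto }
  assume "is_lim c"
  thus "is_limit {..<c} (stage r) (chainE (link r)) (stage r c) (link r c)"
  using top chainD(5)[OF IH[of c] order_refl] c by(cases "c = b") auto
  qed (use C in auto)
 qed
 thus ?thesis by blast
qed

text \<open>Two chains that agree, through \<open>q\<close>, on a cofinal set \<open>Reg\<close> of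
  stages have the same limits; \<open>q\<close> may collapse stages. Concatenating, patching,
  reindexing and delaying plays all settle their limit stages by this comparison.\<close>

lemma cofinal_limit:
 assumes s: "chn l' st' lk'" and r: "chn l st lk"
  and Reg: "!!c. c < l' ==> EX d:Reg. c <= d & d < l'"
  and q: "!!d. d : Reg ==> d < l' ==> q d < l" "!!e. e < l ==> EX d:Reg. d < l' & e <= q d"
  "!!c d. c : Reg ==> d : Reg ==> c <= d ==> d < l' ==> q c <= q d"
  and st: "!!d. d : Reg ==> d < l' ==> st' d = st (q d)"
  and lk: "!!c d. c : Reg ==> d : Reg ==> c <= d ==> d < l' ==> lk' d c = lk (q d) (q c)"
  and L: "is_limit {..<l} st (chainE lk) L p"
  and p: "!!c. c : Reg ==> c < l' ==> p' c = p (q c)" "!!c d. c <= d ==> d < l' ==> d : Reg ==> lk' d c oo p' d = p' c"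
 shows "is_limit {..<l'} st' (chainE lk') L p'"
proof -
 have pc: "!!e. e < l ==> p e : hom L (st e)" "!!e f. f < l ==> e <= f ==> lk f e oo p f = p e" "L : Ob"
  using L by(auto simp: is_limit_def is_cone_def)
 have lk'h: "d < l' ==> c <= d ==> lk' d c : hom (st' d) (st' c)" for c d using s by(auto simp: chn_def)
 have lkh: "d < l ==> c <= d ==> lk d c : hom (st d) (st c)" for c d using r by(auto simp: chn_def)
 have p'R: "p' d : hom L (st' d)" if "d : Reg" "d < l'" for d using p(1)[OF that] pc(1) q(1)[OF that] st[OF that] by simp
 have p'h: "p' c : hom L (st' c)" if c: "c < l'" for c
 proof -
  obtain d where d: "d : Reg" "c <= d" "d < l'" using Reg[OF c] by blast
  thus ?thesis using Cmp_hom[OF lk'h[OF d(3,2)] p'R[OF d(1,3)]] p(2)[OF d(2,3,1)] by simp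
 qed
 have cone: "lk' d c oo p' d = p' c" if cd: "c <= d" "d < l'" for c d
 proof -
  obtain e where e: "e : Reg" "d <= e" "e < l'" using Reg[OF cd(2)] by blast
  have "lk' d c oo p' d = lk' d c oo (lk' e d oo p' e)" using p(2)[OF e(2,3,1)] by simp
  also have "\<dots> = (lk' d c oo lk' e d) oo p' e"
  by(rule comp_assoc[OF p'h[OF e(3)] lk'h lk'h, symmetric]) (use e cd in auto)
  also have "lk' d c oo lk' e d = lk' e c" using s e cd unfolding chn_def by(meson order_trans)
  finally show ?thesis using p(2)[OF _ e(3,1), of c] cd e by simp
 qed
 have "is_cone H {..<l'} st' (chainE lk') L p'" using pc(3) p'h cone by(auto simp: is_cone_def)
 moreover have "EX! h. h : hom X L & (ALL i:{..<l'}. p' i oo h = y i)" if y: "is_cone H {..<l'} st' (chainE lk') X y" for X y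
 proof -
  have yh: "!!c. c < l' ==> y c : hom X (st' c)" "!!c d. d < l' ==> c <= d ==> lk' d c oo y d = y c" "X : Ob"
  using y by(auto simp: is_cone_def)
  have ind1: "lk (q d2) e oo y d2 = lk (q d1) e oo y d1"
  if d: "d1 : Reg" "d2 : Reg" "d1 <= d2" "d2 < l'" "e <= q d1" for d1 d2 e
  proof -
  have qq: "q d1 <= q d2" "q d2 < l" using q d by auto
  have y2: "y d2 : hom X (st (q d2))" using yh(1)[OF d(4)] st[OF d(2,4)] by simp
  have "lk (q d1) e oo y d1 = lk (q d1) e oo (lk (q d2) (q d1) oo y d2)"
  using yh(2)[OF d(4,3)] lk[OF d(1-4)] by simp
  also have "\<dots> = (lk (q d1) e oo lk (q d2) (q d1)) oo y d2"
  by(rule comp_assoc[OF y2 lkh lkh, symmetric]) (use qq d in auto)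
  also have "lk (q d1) e oo lk (q d2) (q d1) = lk (q d2) e" using r qq d(5) unfolding chn_def by blast
  finally show ?thesis by simp
  qed
  \<comment> \<open>A cone over the primed chain is carried over: its component at \<open>e\<close>
    is taken from some regular stage whose image reaches \<open>e\<close>, and by
    \<open>ind1\<close> the choice makes no difference.\<close>
  define dd where "dd e = (SOME d. d : Reg & d < l' & e <= q d)" for e
  have dd: "dd e : Reg" "dd e < l'" "e <= q (dd e)" if "e < l" for e
  using someI_ex[of "%d. d : Reg & d < l' & e <= q d"] q(2)[OF that] unfolding dd_def by blast+
  define z where "z e = lk (q (dd e)) e oo y (dd e)" for e
  have zi: "z e = lk (q d) e oo y d" if "d : Reg" "d < l'" "e <= q d" "e < l" for d e
  proof(cases "d <= dd e")
  case True
  thus ?thesis unfolding z_def using ind1[of d "dd e" e] dd[OF that(4)] that by simp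
  next
  case False
  thus ?thesis unfolding z_def using ind1[of "dd e" d e] dd[OF that(4)] that by simp
  qed
  have zh: "z e : hom X (st e)" if e: "e < l" for e
  unfolding z_def by(rule Cmp_hom[OF lkh]) (use dd[OF e] q yh(1)[OF dd(2)[OF e]] st[OF dd(1,2)[OF e]] in auto)
  have "is_cone H {..<l} st (chainE lk) X z" unfolding is_cone_def
  proof(intro conjI ballI)
  fix f e u assume fe: "f : {..<l}" "e : {..<l}" "u : chainE lk f e"
  hence fe: "f < l" "e <= f" "u = lk f e" by(auto split: if_splits)
  note d = dd[OF fe(1)]
  have qd: "q (dd f) < l" using q d by auto
  have "u oo z f = lk f e oo (lk (q (dd f)) f oo y (dd f))" using fe by(simp add: z_def)
  also have "\<dots> = (lk f e oo lk (q (dd f)) f) oo y (dd f)"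
  by(rule comp_assoc[OF _ lkh lkh, symmetric, of _ X]) (use yh(1)[OF d(2)] st[OF d(1,2)] d fe qd in auto)
  also have "lk f e oo lk (q (dd f)) f = lk (q (dd f)) e" using r qd d(3) fe unfolding chn_def by blast
  also have "lk (q (dd f)) e oo y (dd f) = z e" by(rule zi[symmetric]) (use d fe in auto)
  finally show "u oo z f = z e" .
  qed (use zh yh in auto)
  hence ex: "EX! h. h : hom X L & (ALL i:{..<l}. p i oo h = z i)" using L by(auto simp: is_limit_def)
  have iff: "(ALL i:{..<l'}. p' i oo h = y i) \<longleftrightarrow> (ALL i:{..<l}. p i oo h = z i)" if h: "h : hom X L" for h
  proof
  assume a: "ALL i:{..<l'}. p' i oo h = y i"
  show "ALL i:{..<l}. p i oo h = z i"
  proof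
  fix e assume "e : {..<l}"
  hence e: "e < l" by simp
  note d = dd[OF e]
  have qd: "q (dd e) < l" using q d by auto
  have "p e oo h = (lk (q (dd e)) e oo p (q (dd e))) oo h" using pc(2)[OF qd d(3)] by simp
  also have "\<dots> = lk (q (dd e)) e oo (p (q (dd e)) oo h)"
  by(rule comp_assoc[OF h pc(1) lkh]) (use qd d in auto)
  also have "p (q (dd e)) oo h = y (dd e)"
  proof -
  have "p' (dd e) oo h = y (dd e)" using a d(2) by simp
  thus ?thesis by(simp add: p(1)[OF d(1,2)])
  qed
  finally show "p e oo h = z e" by(simp add: z_def)
  qed
  next
  assume a: "ALL i:{..<l}. p i oo h = z i"
  have R: "p' d oo h = y d" if d: "d : Reg" "d < l'" for d
  proof -
  have "p' d oo h = z (q d)" using a p(1)[OF d] q(1)[OF d] by simp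
  also have "\<dots> = lk (q d) (q d) oo y d" by(rule zi) (use d q in auto)
  also have "\<dots> = y d" using r q(1)[OF d] yh(1)[OF d(2)] st[OF d] unfolding chn_def by(auto simp: hom_def)
  finally show ?thesis .
  qed
  show "ALL i:{..<l'}. p' i oo h = y i"
  proof
  fix c assume "c : {..<l'}"
  then obtain d where d: "d : Reg" "c <= d" "d < l'" using Reg by auto
  have "p' c oo h = (lk' d c oo p' d) oo h" using cone d by simp
  also have "\<dots> = lk' d c oo (p' d oo h)" by(rule comp_assoc[OF h p'h lk'h]) (use d in auto)
  also have "\<dots> = y c" using R[OF d(1,3)] yh(2) d by simp
  finally show "p' c oo h = y c" .
  qed
  qed
  from ex obtain h where h: "h : hom X L" "ALL i:{..<l}. p i oo h = z i"
  and u: "!!k. k : hom X L ==> ALL i:{..<l}. p i oo k = z i ==> k = h" by blast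
  show ?thesis
  proof(rule ex1I[of _ h])
  show "h : hom X L & (ALL i:{..<l'}. p' i oo h = y i)" using h iff[OF h(1)] by simp
  fix k assume "k : hom X L & (ALL i:{..<l'}. p' i oo k = y i)"
  thus "k = h" using u[of k] iff[of k] by simp
  qed
 qed
 ultimately show ?thesis unfolding is_limit_def by blast
qed

subsubsection \<open>Strategies\<close>

lemma covering_strategy_iff:
 "covering_strategy cov As C (g::'k) sg \<longleftrightarrow>
  (ALL a<g. cov a --> (ALL r. is_chain C a r --> follows cov As sg a r -->
  covers (stage r a) (sI sg a r) (sU sg a r) & (ALL i:sI sg a r. sE sg a r i : hom (Dom (sU sg a r i)) (As a))))"
 unfolding covering_strategy_def split_beta using covers_k[OF chainD(1)[of C, OF _ order_refl]]
 by(simp cong: conj_cong imp_cong) blast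

lemma follows_iff:
 "follows cov As sg (g::'k) r \<longleftrightarrow>
  (ALL a<g. elt r a : hom (stage r (osuc a)) (As a) &
  (cov a --> idx r a : sI sg a r & link r (osuc a) a = sU sg a r (idx r a) & elt r a = sE sg a r (idx r a)))"
 unfolding follows_def split_beta by blast

lemma follows_mono: "follows cov As sg (g::'k) r ==> g' <= g ==> follows cov As sg g' r"
 unfolding follows_def by(meson order_less_le_trans)

lemma follows_cong:
 assumes "history (g::'k) r = history g r'"
 shows "follows cov As sg g r \<longleftrightarrow> follows cov As sg g r'"
proof -
 have "history a r = history a r'" if "a < g" for a using history_mono[OF assms] that by simp
 moreover have "stage r (osuc a) = stage r' (osuc a)" "elt r a = elt r' a" "idx r a = idx r' a"
  "link r (osuc a) a = link r' (osuc a) a" if "a < g" for a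
  using assms osuc_le_iff[of a g] that less_osuc[of a] unfolding history_eq_iff by(simp_all add: less_imp_le)
 ultimately show ?thesis unfolding follows_iff by(auto 0 0)
qed

text \<open>A game seen through its outcome: at the end of a play only the arrow to \<open>C\<close>
  and the elements restricted to the last object matter. Keeping the winning condition abstract lets
  it be changed while the strategy stays, as in truncation, peeling and the removal of the last
  move.\<close>

definition wins :: "('k => bool) => ('k => 'o) => 'k => 'o => ('a => ('k => 'a) => bool) => bool" where
 "wins cov As g C W \<longleftrightarrow> (EX sg. covering_strategy cov As C g sg &
  (ALL r. is_chain C g r --> follows cov As sg g r -->
  W (link r g ozero) (%a. elt r a oo link r g (osuc a))))"

definition valid :: "('k => 'o) => 'k => 'o => 'a => ('k => 'a) => bool" where
 "valid As g C k e \<longleftrightarrow> k : Ar & Cod k = C & (ALL a<g. e a : hom (Dom k) (As a))"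

lemma play_valid:
 assumes "is_chain C g r" "follows cov As sg g r"
 shows "valid As g C (link r g ozero) (%a. elt r a oo link r g (osuc a))"
proof -
 have l: "link r g ozero : hom (stage r g) C" using chainD(3)[OF assms(1), of g ozero] chain_zero[OF assms(1)] by simp
 have "elt r a oo link r g (osuc a) : hom (stage r g) (As a)" if "a < g" for a
  by(rule Cmp_hom) (insert that assms(2) chainD(3)[OF assms(1), of g "osuc a"], auto simp: follows_iff)
 thus ?thesis using l by(auto simp: valid_def hom_def)
qed

lemma wins_mono:
 assumes "wins cov As g C W" "!!k e. valid As g C k e ==> W k e ==> W' k e"
 shows "wins cov As g C W'"
 using assms play_valid unfolding wins_def by blast

lemma in_T_iff:
 "in_T cov g As pA pr S l \<longleftrightarrow>
  wins cov As g (Dom l) (%k e. EX w:S. Dom w = Dom k & pA oo w = l oo k & (ALL a<g. pr a oo w = e a))"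
proof -
 have "Dom (link r g ozero) = stage r g" if "is_chain C g r" for C r
  using chainD(3)[OF that, of g ozero] by(auto simp: hom_def)
 thus ?thesis unfolding in_T_def wins_def by(metis (no_types, lifting))
qed

text \<open>A member of a covering family is in particular an arbitrary arrow. So if each stage is
  answered by the player who has to cover it, the resulting play follows both strategies.\<close>

lemma wins_both:
 assumes "wins cov As g C W1" "wins (%a. ~ cov a) As g C W2"
 shows "wins (%_. True) As g C (%k e. W1 k e & W2 k e)"
proof -
 obtain sg1 where 1: "covering_strategy cov As C g sg1"
  "!!r. is_chain C g r ==> follows cov As sg1 g r ==> W1 (link r g ozero) (%a. elt r a oo link r g (osuc a))"
  using assms(1) unfolding wins_def by blast
 obtain sg2 where 2: "covering_strategy (%a. ~ cov a) As C g sg2"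
  "!!r. is_chain C g r ==> follows (%a. ~ cov a) As sg2 g r ==> W2 (link r g ozero) (%a. elt r a oo link r g (osuc a))"
  using assms(2) unfolding wins_def by blast
 define tt where "tt a h = (if cov a then sg1 a h else sg2 a h)" for a h
 have f: "follows cov As sg1 a r & follows (%a. ~ cov a) As sg2 a r" if "follows (%_. True) As tt a r" for a r
  using that unfolding follows_iff tt_def by auto
 show ?thesis unfolding wins_def
 proof(intro exI[of _ tt] conjI allI impI)
  show "covering_strategy (%_. True) As C g tt" unfolding covering_strategy_iff
  proof(intro allI impI)
  fix a r assume "a < g" "is_chain C a r" "follows (%_. True) As tt a r"
  thus "covers (stage r a) (sI tt a r) (sU tt a r) & (ALL i:sI tt a r. sE tt a r i : hom (Dom (sU tt a r i)) (As a))"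
  using f[of a r] 1(1) 2(1) unfolding covering_strategy_iff by(cases "cov a") (auto simp: tt_def)
  qed
 qed (use 1 2 f in blast)+
qed

subsubsection \<open>Plays determined by their indices\<close>

text \<open>A play as a sequence of columns: column \<open>b\<close> holds stage \<open>b\<close>,
  the links down from it and the element chosen just before it. If every stage is a cover, the
  columns are determined by the indices, by recursion on \<open>b\<close>.\<close>

definition mk_play :: "('k => 'o \<times> ('k => 'a) \<times> 'a) => ('k => 'k) => ('o, 'a, 'k) play" where
 "mk_play cols ix = \<lparr>stage = %b. fst (cols b), link = %b. fst (snd (cols b)),
  elt = %a. snd (snd (cols (osuc a))), idx = ix\<rparr>"

definition tree_step :: "'o => ('o, 'a, 'k) strategy => 'k => ('o, 'a, 'k) play => 'o \<times> ('k => 'a) \<times> 'a" where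
 "tree_step C tt b r =
  (if b = ozero then (C, %_. Idn C, undefined)
  else if is_lim b then
  (let Lp = (SOME Lp. is_limit {..<b} (stage r) (chainE (link r)) (fst Lp) (snd Lp))
  in (fst Lp, (snd Lp)(b := Idn (fst Lp)), undefined))
  else
  (let a = opred b; u = sU tt a r (idx r a)
  in (Dom u, (%c. if c = b then Idn (Dom u) else link r a c oo u), sE tt a r (idx r a))))"

definition tree_cols where
 "tree_cols C tt ix = wfrec {(a, b). a < (b::'k)} (%cols b. tree_step C tt b (mk_play cols ix))"

lemma history_mk_play:
 assumes "!!c. c <= a ==> cols c = cols' c" "!!c. c < a ==> ix c = ix' c"
 shows "history a (mk_play cols ix) = history a (mk_play cols' ix')"
 unfolding history_eq_iff by(auto simp: mk_play_def assms)

text \<open>A column consults only earlier columns and indices. This validates the recursion and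
  makes the history up to \<open>b\<close> a function of the indices below \<open>b\<close>.\<close>

lemma tree_step_cong:
 assumes "!!c. c < b ==> cols c = cols' c" "!!c. c < b ==> ix c = ix' c"
 shows "tree_step C tt b (mk_play cols ix) = tree_step C tt b (mk_play cols' ix')"
proof(cases b rule: ord_cases)
 case (succ a)
 have "history a (mk_play cols ix) = history a (mk_play cols' ix')"
  by(rule history_mk_play) (use assms succ in auto)
 moreover have "link (mk_play cols ix) a = link (mk_play cols' ix') a" "idx (mk_play cols ix) a = idx (mk_play cols' ix') a"
  using assms[of a] succ by(auto simp: mk_play_def)
 ultimately show ?thesis using succ by(simp add: tree_step_def Let_def cong: if_cong)
next
 case lim
 have "is_limit {..<b} (stage (mk_play cols ix)) (chainE (link (mk_play cols ix))) L p =
  is_limit {..<b} (stage (mk_play cols' ix')) (chainE (link (mk_play cols' ix'))) L p" for L p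
  by(rule is_limit_cong) (insert assms, auto simp: mk_play_def)
 thus ?thesis using lim by(simp add: tree_step_def)
qed (simp add: tree_step_def)

definition tree_play where "tree_play C tt ix = mk_play (tree_cols C tt ix) ix"

lemma tree_cols_eq: "tree_cols C tt ix b = tree_step C tt b (tree_play C tt ix)"
proof -
 have "tree_cols C tt ix b = tree_step C tt b (mk_play (cut (tree_cols C tt ix) {(a, b). a < b} b) ix)"
  unfolding tree_cols_def by(subst wfrec[OF wf_ord]) simp
 also have "\<dots> = tree_step C tt b (mk_play (tree_cols C tt ix) ix)"
  by(rule tree_step_cong) (auto simp: cut_apply)
 finally show ?thesis by(simp add: tree_play_def)
qed

lemma tree_cols_cong:
 assumes "!!a. a < b ==> ix a = ix' a"
 shows "c <= b ==> tree_cols C tt ix c = tree_cols C tt ix' c"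
proof(induction c rule: less_induct)
 case (less c)
 show ?case unfolding tree_cols_eq[of C tt _ c] tree_play_def
  by(rule tree_step_cong) (use less assms in auto)
qed

lemma tree_play_cong:
 assumes "!!a. a < b ==> ix a = ix' a"
 shows "history b (tree_play C tt ix) = history b (tree_play C tt ix')"
 unfolding tree_play_def by(rule history_mk_play) (use tree_cols_cong[of b ix ix'] assms in auto)

lemma tree_play_sel:
 "stage (tree_play C tt ix) b = fst (tree_step C tt b (tree_play C tt ix))"
 "link (tree_play C tt ix) b = fst (snd (tree_step C tt b (tree_play C tt ix)))"
 "elt (tree_play C tt ix) a = snd (snd (tree_step C tt (osuc a) (tree_play C tt ix)))"
 "idx (tree_play C tt ix) = ix"
 unfolding tree_cols_eq[symmetric] by(simp_all add: tree_play_def mk_play_def)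

lemma tree_play_play:
 assumes cs: "covering_strategy (%_. True) As C g tt" and C: "C : Ob"
 shows "b <= g ==> (!!a. a < b ==> ix a : sI tt a (tree_play C tt ix)) ==>
  is_chain C b (tree_play C tt ix) & follows (%_. True) As tt b (tree_play C tt ix)"
proof(induction b rule: less_induct)
 case (less b)
 let ?r = "tree_play C tt ix"
 have IH: "is_chain C a ?r" "follows (%_. True) As tt a ?r" if "a < b" for a
  using less.IH[OF that] less.prems that by(auto intro: order_less_trans)
 have cv: "covers (stage ?r a) (sI tt a ?r) (sU tt a ?r)" "sE tt a ?r (ix a) : hom (Dom (sU tt a ?r (ix a))) (As a)"
  if "a < b" for a
  using cs IH[OF that] less.prems that unfolding covering_strategy_iff by(auto intro: order_less_le_trans)
 have sc: "stage ?r (osuc a) = Dom (sU tt a ?r (ix a))" "link ?r (osuc a) a = link ?r a a oo sU tt a ?r (ix a)"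
  "elt ?r a = sE tt a ?r (ix a)" "c <= a ==> link ?r (osuc a) c = link ?r a c oo sU tt a ?r (ix a)" for a c
  by(auto simp: tree_play_sel(1-3)[of C tt ix "osuc a"] tree_play_sel(3)[of C tt ix a] tree_step_def tree_play_sel(4) Let_def)
 have u: "sU tt a ?r (ix a) : Ar" "Cod (sU tt a ?r (ix a)) = stage ?r a" if "a < b" for a
  using coversD[OF cv(1)[OF that]] less.prems(2)[OF that] by auto
 have lk: "link ?r (osuc a) a = sU tt a ?r (ix a)" if "a < b" for a
  unfolding sc(2) using chainD(2)[OF IH(1)[OF that], of a] u[OF that] by simp
 have "is_chain C b ?r"
 proof(rule is_chainI[OF C])
  show "stage ?r ozero = C" by(simp add: tree_play_sel(1) tree_step_def)
  fix c assume "c <= b"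
  show "link ?r c c = Idn (stage ?r c)"
  unfolding tree_play_sel(1,2)[of C tt ix c]
  by(cases c rule: ord_cases) (simp_all add: tree_step_def Let_def)
 next
  fix a assume a: "a < b"
  show "link ?r (osuc a) a : hom (stage ?r (osuc a)) (stage ?r a)"
  using u[OF a] lk[OF a] sc(1) by(simp add: hom_def)
  fix c assume "c <= a"
  thus "link ?r (osuc a) c = link ?r a c oo link ?r (osuc a) a" using lk[OF a] sc(4) by simp
 next
  fix l assume l: "is_lim l" "l <= b" "!!a. a < l ==> is_chain C a ?r"
  have "EX L p. is_limit {..<l} (stage ?r) (chainE (link ?r)) L p"
  by(rule chain_limit) (use l(3) chainD in \<open>blast intro: order_refl\<close>)+
  hence "EX Lp. is_limit {..<l} (stage ?r) (chainE (link ?r)) (fst Lp) (snd Lp)" by auto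
  from someI_ex[OF this] have L: "is_limit {..<l} (stage ?r) (chainE (link ?r)) (stage ?r l)
  (snd (SOME Lp. is_limit {..<l} (stage ?r) (chainE (link ?r)) (fst Lp) (snd Lp)))"
  using l(1) by(auto simp: tree_play_sel(1)[of C tt ix l] tree_step_def Let_def)
  show "is_limit {..<l} (stage ?r) (chainE (link ?r)) (stage ?r l) (link ?r l)"
  by(rule is_limit_cong[THEN iffD1, OF _ _ _ L]) (insert l(1), auto simp: tree_play_sel(2)[of C tt ix l] tree_step_def Let_def)
 qed
 moreover have "follows (%_. True) As tt b ?r" unfolding follows_iff
  using cv lk sc less.prems(2) by(auto simp: tree_play_sel(4))
 ultimately show ?case by blast
qed

text \<open>A node of the tree is the sequence of indices chosen so far, and its object is the last
  stage of the play they determine. Limit nodes carry limits because plays are continuous.\<close>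

theorem strategy_covers:
 assumes cs: "covering_strategy (%_. True) As C (g::'k) tt" and R: "R : Sub C"
  and win: "!!r. is_chain C g r ==> follows (%_. True) As tt g r ==> link r g ozero : R"
 shows "R = whole C"
proof -
 have C: "C : Ob" by(rule Sub_Ob[OF R])
 define P where "P s = tree_play C tt (%a. the (s a))" for s :: "'k \<rightharpoonup> 'k"
 \<comment> \<open>Every entry must be offered by the strategy along the play that the earlier
   entries determine. Outside the domain \<open>the\<close> yields an arbitrary index, which is
   harmless by \<open>agree\<close>.\<close>
 define N where "N = {s :: 'k \<rightharpoonup> 'k. EX b<=g. dom s = {..<b} & (ALL a<b. the (s a) : sI tt a (P s))}"
 have agree: "history b (P s) = history b (P s')" if "!!a. a < b ==> s a = s' a" for b s s'
  unfolding P_def by(rule tree_play_cong) (use that in simp)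
 have restr: "history b (P (s |` {..<b})) = history b (P s)" for b s by(rule agree) simp
 have NI: "s : N" if "b <= g" "dom s = {..<b}" "!!a. a < b ==> the (s a) : sI tt a (P s)" for s b
  using that unfolding N_def by blast
 have ND: "len s <= g" "dom s = {..<len s}" "!!a. a < len s ==> the (s a) : sI tt a (P s)" if "s : N" for s
  using that len_eq unfolding N_def by auto
 have play: "is_chain C (len s) (P s)" "follows (%_. True) As tt (len s) (P s)" if "s : N" for s
  using tree_play_play[OF cs C ND(1)[OF that], of "%a. the (s a)"] ND(3)[OF that] unfolding P_def by auto
 have rl: "dom (s |` {..<b}) = {..<b}" "len (s |` {..<b}) = b" if "s : N" "b <= len s" for s b
 proof -
  show "dom (s |` {..<b}) = {..<b}" using ND(2)[OF that(1)] that(2) by auto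
  thus "len (s |` {..<b}) = b" by(rule len_eq)
 qed
 have rN: "s |` {..<b} : N" if s: "s : N" for s b
 proof(cases "b <= len s")
  case True
  show ?thesis
  proof(rule NI[OF _ rl(1)[OF s True]])
  show "b <= g" using True ND(1)[OF s] by simp
  fix a assume a: "a < b"
  have "history a (P (s |` {..<b})) = history a (P s)" by(rule agree) (use a in auto)
  thus "the ((s |` {..<b}) a) : sI tt a (P (s |` {..<b}))" using a True ND(3)[OF s, of a] by simp
  qed
 next
  case False
  have "s x = None" if "~ x < b" for x
  proof -
  have "x ~: dom s" using False that ND(2)[OF s] by auto
  thus ?thesis by auto
  qed
  hence "s |` {..<b} = s" by(intro ext) (simp add: restrict_map_def)
  thus ?thesis using s by simp
 qed
 have ext: "s(len s |-> i) : N \<longleftrightarrow> len s < g & i : sI tt (len s) (P s)" if s: "s : N" for s i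
 proof -
  have d: "dom (s(len s |-> i)) = {..<osuc (len s)}" using ND(2)[OF s] by auto
  have h: "history a (P (s(len s |-> i))) = history a (P s)" if "a <= len s" for a
  by(rule agree) (use that in auto)
  show ?thesis
  proof
  assume n: "s(len s |-> i) : N"
  have l: "len (s(len s |-> i)) = osuc (len s)" by(rule len_eq[OF d])
  show "len s < g & i : sI tt (len s) (P s)" using ND(1)[OF n] ND(3)[OF n, of "len s"] l h[of "len s"] by simp
  next
  assume a: "len s < g & i : sI tt (len s) (P s)"
  show "s(len s |-> i) : N"
  proof(rule NI[OF _ d])
  fix c assume "c < osuc (len s)"
  thus "the ((s(len s |-> i)) c) : sI tt c (P (s(len s |-> i)))"
  using h[of c] a ND(3)[OF s, of c] by(cases "c = len s") auto
  qed (use a in simp)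
  qed
 qed
 have E: "Map.empty : N" by(rule NI[of ozero]) auto
 have br: "branching_tree N" unfolding branching_tree_def
 proof(intro conjI ballI allI impI)
  fix s :: "'k \<rightharpoonup> 'k" and b assume a: "dom s = {..<b} & is_lim b & (ALL a<b. s |` {..<a} : N)"
  have l: "dom (s |` {..<c}) = {..<c}" "len (s |` {..<c}) = c" if "c < b" for c
  proof -
  show "dom (s |` {..<c}) = {..<c}" using a that by auto
  thus "len (s |` {..<c}) = c" by(rule len_eq)
  qed
  show "s : N"
  proof(rule NI)
  show "b <= g"
  proof(rule ccontr)
  assume "~ b <= g"
  hence "osuc g < b" using is_lim_osuc_less a by auto
  thus False using a ND(1)[of "s |` {..<osuc g}"] l(2)[of "osuc g"] by auto
  qed
  fix c assume c: "c < b"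
  hence oc: "osuc c < b" using is_lim_osuc_less a by auto
  hence n: "s |` {..<osuc c} : N" using a by blast
  have "history c (P (s |` {..<osuc c})) = history c (P s)" by(rule agree) auto
  thus "the (s c) : sI tt c (P s)" using ND(3)[OF n, of c] l(2)[OF oc] by simp
  qed (use a in simp)
 next
  show "\<nexists>f. ALL b. (Some \<circ> f) |` {..<b} : N"
  proof
  assume "EX f. ALL b. (Some \<circ> f) |` {..<b} : N"
  then obtain f :: "'k => 'k" where f: "(Some \<circ> f) |` {..<osuc g} : N" by blast
  have "dom ((Some \<circ> f) |` {..<osuc g}) = {..<osuc g}" by auto
  hence "len ((Some \<circ> f) |` {..<osuc g}) = osuc g" by(rule len_eq)
  thus False using ND(1)[OF f] by simp
  qed
 qed (use E rN ND(2) in auto)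
 define D where "D s = stage (P s) (len s)" for s
 define p where "p s b = link (P s) (len s) b" for s b
 have Dr: "D (s |` {..<b}) = stage (P s) b" "a <= b ==> p (s |` {..<b}) a = link (P s) b a" if "s : N" "b <= len s" for s b a
  using restr[of b s] rl(2)[OF that] unfolding D_def p_def history_eq_iff by auto
 have to: "tree_of_objects H N D p" unfolding tree_of_objects_def
 proof(intro ballI conjI allI impI)
  fix s assume s: "s : N"
  note ch = play(1)[OF s]
  show "D s : Ob" "p s (len s) = Idn (D s)" using chainD(1,2)[OF ch order_refl] by(auto simp: D_def p_def)
  { fix b assume b: "b <= len s"
  show "p s b : hom (D s) (D (s |` {..<b}))" using chainD(3)[OF ch order_refl b] Dr(1)[OF s b] by(simp add: D_def p_def)
  fix a assume "a <= b"
  thus "p (s |` {..<b}) a oo p s b = p s a" using chainD(4)[OF ch order_refl b] Dr(2)[OF s b] by(simp add: p_def) }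
  assume lim: "is_lim (len s)"
  show "is_limit {..<len s} (%a. D (s |` {..<a})) (%b a. if a <= b then {p (s |` {..<b}) a} else {}) (D s) (p s)"
  by(rule is_limit_cong[THEN iffD1, OF _ _ _ chainD(5)[OF ch order_refl lim, folded D_def]])
  (insert Dr[OF s], auto simp: p_def)
 qed
 have sc: "succs N s = (if len s < g then sI tt (len s) (P s) else {})" if "s : N" for s
  using ext[OF that] by(auto simp: succs_def)
 have "covering TYPE('k) H (D Map.empty) {s : N. succs N s = {}} (%s. p s ozero)"
 proof(rule tr_trans[unfolded transfinite_transitive_def, rule_format, OF conjI, OF br conjI, OF to], intro ballI impI)
  fix s assume s: "s : N" "succs N s ~= {}"
  hence l: "len s < g" using sc by(auto split: if_splits)
  have cv: "covers (stage (P s) (len s)) (sI tt (len s) (P s)) (sU tt (len s) (P s))"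
  using cs play[OF s(1)] l unfolding covering_strategy_iff by blast
  have pe: "p (s(len s |-> i)) (len s) = sU tt (len s) (P s) i" if i: "i : succs N s" for i
  proof -
  have n: "s(len s |-> i) : N" using i by(simp add: succs_def)
  have "dom (s(len s |-> i)) = {..<osuc (len s)}" using ND(2)[OF s(1)] by auto
  hence ll: "len (s(len s |-> i)) = osuc (len s)" by(rule len_eq)
  have h: "history (len s) (P (s(len s |-> i))) = history (len s) (P s)" by(rule agree) auto
  have "link (P (s(len s |-> i))) (osuc (len s)) (len s) = sU tt (len s) (P (s(len s |-> i))) (idx (P (s(len s |-> i))) (len s))"
  using play(2)[OF n] unfolding ll follows_iff by auto
  thus ?thesis unfolding p_def ll h by(simp add: P_def tree_play_sel(4))
  qed
  have "covers (D s) (succs N s) (%i. p (s(len s |-> i)) (len s))"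
  using cv pe l sc[OF s(1)] unfolding covers_def D_def by auto
  thus "covering TYPE('k) H (D s) (succs N s) (%i. p (s(len s |-> i)) (len s))"
  using covers_k coversD(1) by blast
 qed
 moreover have l0: "len Map.empty = (ozero :: 'k)" by(rule len_eq) auto
 have DE: "D Map.empty = C" unfolding D_def l0 using chain_zero[OF play(1)[OF E]] .
 ultimately have "covering TYPE('k) H C {s : N. succs N s = {}} (%s. p s ozero)" by simp
 hence cv: "covers C {s : N. succs N s = {}} (%s. p s ozero)" by(rule covering_iff[OF C, THEN iffD1, THEN conjunct2])
 show ?thesis
 proof(rule covers_whole[OF cv R])
  fix s assume "s : {s : N. succs N s = {}}"
  hence s: "s : N" "succs N s = {}" by auto
  show "p s ozero : R"
  proof(cases "len s < g")
  \<comment> \<open>A leaf shorter than \<open>g\<close> comes from an empty covering family. Its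
    object is then degenerate, and arrows out of it lie in every subobject.\<close>
  case True
  hence "sI tt (len s) (P s) = {}" using sc s by auto
  moreover have "covers (stage (P s) (len s)) (sI tt (len s) (P s)) (sU tt (len s) (P s))"
  using cs play[OF s(1)] True unfolding covering_strategy_iff by blast
  ultimately have cv: "covers (D s) {} (sU tt (len s) (P s))" by(simp add: D_def)
  have "bot (D s) = whole (D s)" by(rule covers_whole[OF cv bot_Sub[OF coversD(1)[OF cv]]]) simp
  moreover have "p s ozero : hom (D s) C"
  using chainD(3)[OF play(1)[OF s(1)] order_refl, of ozero] chain_zero[OF play(1)[OF s(1)]] by(simp add: D_def p_def)
  ultimately show ?thesis using degenerate_mem[of "p s ozero" R] R coversD(1)[OF cv] by(auto simp: hom_def degenerate_def)
  next
  case False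
  hence "len s = g" using ND(1)[OF s(1)] by simp
  thus ?thesis using win play[OF s(1)] by(simp add: p_def)
  qed
 qed
qed

end

unbundle no cardinal_syntax

context kcat
begin

section \<open>Extending a play by one move\<close>

definition ext_play :: "('o, 'a, 'k) play => 'k => 'a => 'a => 'k => ('o, 'a, 'k) play" where
 "ext_play r a d e i = \<lparr>stage = (stage r)(osuc a := Dom d),
  link = (link r)(osuc a := (%c. if c = osuc a then Idn (Dom d) else link r a c oo d)),
  elt = (elt r)(a := e), idx = (idx r)(a := i)\<rparr>"

lemma ext_history: "history a (ext_play r a d e i) = history a r"
 unfolding history_eq_iff by(auto simp: ext_play_def)

lemma ext_chain:
 assumes r: "is_chain C a r" and d: "d : Ar" "Cod d = stage r a"
 shows "is_chain C (osuc a) (ext_play r a d e i)"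
proof -
 let ?e = "ext_play r a d e i"
 have ch: "is_chain C a ?e" using r chain_cong[OF ext_history] by blast
 have le: "b <= a" if "b <= osuc a" "b ~= osuc a" for b using that by(metis less_osuc_iff order.order_iff_strict)
 have da: "link ?e (osuc a) a = d" using chainD(2)[OF r order_refl] d by(simp add: ext_play_def)
 show ?thesis
 proof(rule is_chainI)
  show "C : Ob" by(rule chain_Ob[OF r])
  show "stage ?e ozero = C" using chain_zero[OF ch] .
 next
  fix b assume "b <= osuc a"
  thus "link ?e b b = Idn (stage ?e b)"
  using chainD(2)[OF ch le[of b]] by(cases "b = osuc a") (auto simp: ext_play_def)
 next
  fix b assume b: "b < osuc a"
  hence ba: "b <= a" by simp
  show "link ?e (osuc b) b : hom (stage ?e (osuc b)) (stage ?e b)"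
  proof(cases "b = a")
  case True
  thus ?thesis using da d by(simp add: ext_play_def hom_def)
  next
  case False
  thus ?thesis using chainD(3)[OF ch, of "osuc b" b] ba by(simp add: less_imp_le)
  qed
  fix c assume c: "c <= b"
  show "link ?e (osuc b) c = link ?e b c oo link ?e (osuc b) b"
  proof(cases "b = a")
  case True
  thus ?thesis using da c by(auto simp: ext_play_def)
  next
  case False
  thus ?thesis using chainD(4)[OF ch, of "osuc b" b c] ba c by(simp add: less_imp_le)
  qed
 next
  fix b assume b: "is_lim b" "b <= osuc a"
  hence "b <= a" using le[of b] by(cases "b = osuc a") auto
  thus "is_limit {..<b} (stage ?e) (chainE (link ?e)) (stage ?e b) (link ?e b)" using chainD(5)[OF ch] b by blast
 qed
qed

lemma ext_follows:
 assumes r: "is_chain C a r" "follows cov As sg a r" and d: "d : Ar" "Cod d = stage r a"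
  and e: "e : hom (Dom d) (As a)"
  and c: "cov a ==> i : sI sg a r & d = sU sg a r i & e = sE sg a r i"
 shows "follows cov As sg (osuc a) (ext_play r a d e i)"
proof -
 let ?e = "ext_play r a d e i"
 have f: "follows cov As sg a ?e" using r(2) follows_cong[OF ext_history] by blast
 have da: "link ?e (osuc a) a = d" using chainD(2)[OF r(1) order_refl] d by(simp add: ext_play_def)
 show ?thesis unfolding follows_iff
 proof(intro allI impI)
  fix b assume b: "b < osuc a"
  show "elt ?e b : hom (stage ?e (osuc b)) (As b) & (cov b --> idx ?e b : sI sg b ?e &
  link ?e (osuc b) b = sU sg b ?e (idx ?e b) & elt ?e b = sE sg b ?e (idx ?e b))"
  proof(cases "b = a")
  case True
  thus ?thesis using e c da unfolding True ext_history by(auto simp: ext_play_def)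
  next
  case False
  thus ?thesis using f b unfolding follows_iff by auto
  qed
 qed
qed

definition triv_play :: "'o => ('o, 'a, 'k) play" where
 "triv_play C = \<lparr>stage = %_. C, link = %_ _. Idn C, elt = undefined, idx = undefined\<rparr>"

lemma triv_chain: "C : Ob ==> is_chain C ozero (triv_play C)"
 by(rule is_chainI) (auto simp: triv_play_def)

lemma triv_follows: "follows cov As sg (ozero::'k) r"
 by(simp add: follows_iff)

subsubsection \<open>Concatenation of plays\<close>

text \<open>\<open>r'\<close> is meant to be a play above the last object of \<open>r\<close>, so
  links that cross the joint \<open>b\<close> pass through that object.\<close>

definition cat_play :: "'k => ('o, 'a, 'k) play => ('o, 'a, 'k) play => ('o, 'a, 'k) play" where
 "cat_play b r r' = \<lparr>stage = (%c. if c <= b then stage r c else stage r' (odiff c b)),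
  link = (%c d. if c <= b then link r c d else if b <= d then link r' (odiff c b) (odiff d b)
  else link r b d oo link r' (odiff c b) ozero),
  elt = (%a. if a < b then elt r a else elt r' (odiff a b)),
  idx = (%a. if a < b then idx r a else idx r' (odiff a b))\<rparr>"

lemma odiff_osuc: "b <= a ==> odiff (osuc a) b = osuc (odiff a (b::'k))"
 by(metis odiff_oplus oplus_odiff oplus_osuc)

lemma cat_history_le: "a <= b ==> history a (cat_play b r r') = history a r"
 unfolding history_eq_iff by(auto simp: cat_play_def)

text \<open>A strategy for the second part sees only its own history; nothing else of
  \<open>r'\<close> enters the history of the concatenation.\<close>

lemma cat_history: "history (oplus b a) (cat_play b r (history a r')) = history (oplus b a) (cat_play b r r')"
proof -
 have 1: "odiff c b <= a" if "~ c <= b" "c <= oplus b a" for c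
  using that odiff_le_iff[of b c "oplus b a"] by simp
 have 2: "odiff c b < a" if "~ c < b" "c < oplus b a" for c
  using that odiff_less_iff[of b c "oplus b a"] by simp
 have 3: "odiff d b <= odiff c b" if "b <= d" "d <= c" for c d
  using that odiff_le_iff[of b d c] by simp
 show ?thesis unfolding history_eq_iff using 1 2 3 by(auto simp: cat_play_def history_def)
qed

context
 fixes C and b g' :: 'k and r r' :: "('o, 'a, 'k) play"
 assumes r: "is_chain C b r" and r': "is_chain (stage r b) g' r'"
begin

lemma cat_stage: "b <= c ==> stage (cat_play b r r') c = stage r' (odiff c b)"
 using chain_zero[OF r'] by(cases "c = b") (auto simp: cat_play_def)

lemma cat_link: "b <= d ==> d <= c ==> link (cat_play b r r') c d = link r' (odiff c b) (odiff d b)"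
 using chain_zero[OF r'] chainD(2)[OF r, of b] chainD(2)[OF r', of ozero] by(cases "c = b") (auto simp: cat_play_def)

lemma cat_link_low:
 assumes "d <= b" "b <= c" "c <= oplus b g'"
 shows "link (cat_play b r r') c d = link r b d oo link r' (odiff c b) ozero"
proof(cases "c = b")
 case True
 thus ?thesis using chainD(3)[OF r order_refl assms(1)] chainD(2)[OF r', of ozero] chain_zero[OF r']
  by(auto simp: cat_play_def hom_def)
next
 case False
 hence cb: "~ c <= b" using assms by auto
 have "odiff c b <= g'" using odiff_le_iff[of b c "oplus b g'"] assms by simp
 hence h: "link r' (odiff c b) ozero : hom (stage r' (odiff c b)) (stage r b)"
  using chainD(3)[OF r', of "odiff c b" ozero] chain_zero[OF r'] by simp
 show ?thesis
 proof(cases "d = b")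
  case True
  thus ?thesis using cb h chainD(2)[OF r order_refl] by(simp add: cat_play_def hom_def)
 next
  case False
  thus ?thesis using cb assms by(auto simp: cat_play_def)
 qed
qed

lemma cat_chain: "is_chain C (oplus b g') (cat_play b r r')"
proof -
 let ?s = "cat_play b r r'"
 have ch: "is_chain C b ?s" using r chain_cong[OF cat_history_le[OF order_refl]] by blast
 have od: "odiff c b <= g'" if "b <= c" "c <= oplus b g'" for c using odiff_le_iff[of b c "oplus b g'"] that by simp
 show ?thesis
 proof(rule is_chainI)
  show "C : Ob" by(rule chain_Ob[OF r])
  show "stage ?s ozero = C" using chain_zero[OF ch] .
 next
  fix c assume c: "c <= oplus b g'"
  show "link ?s c c = Idn (stage ?s c)"
  proof(cases "b <= c")
  case True
  thus ?thesis using cat_link[of c c] cat_stage[of c] chainD(2)[OF r' od[OF True c]] by simp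
  next
  case False
  thus ?thesis using chainD(2)[OF ch, of c] by simp
  qed
 next
  fix a assume a: "a < oplus b g'"
  show "link ?s (osuc a) a : hom (stage ?s (osuc a)) (stage ?s a)"
  proof(cases "b <= a")
  case True
  hence "b <= osuc a" by(meson less_osuc less_imp_le order_trans)
  thus ?thesis using True cat_link[of a "osuc a"] cat_stage[of a] cat_stage[of "osuc a"]
  chainD(3)[OF r' od[of "osuc a"], of "odiff a b"] a odiff_osuc[OF True] by(simp add: less_imp_le)
  next
  case False
  thus ?thesis using chainD(3)[OF ch, of "osuc a" a] by(simp add: less_imp_le)
  qed
  fix c assume c: "c <= a"
  show "link ?s (osuc a) c = link ?s a c oo link ?s (osuc a) a"
  proof(cases "b <= a")
  case True
  hence ba: "b <= osuc a" by(meson less_osuc less_imp_le order_trans)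
  have o: "odiff (osuc a) b <= g'" "odiff a b <= g'" using od ba True a by(auto simp: less_imp_le)
  have l1: "link ?s (osuc a) a = link r' (odiff (osuc a) b) (odiff a b)" using cat_link[of a "osuc a"] True by(simp add: less_imp_le)
  have oo: "odiff a b <= odiff (osuc a) b" using odiff_osuc[OF True] by(simp add: less_imp_le)
  show ?thesis
  proof(cases "b <= c")
  case True
  have "odiff c b <= odiff a b" using odiff_le_iff[of b c a] True c \<open>b <= a\<close> by simp
  hence "link r' (odiff a b) (odiff c b) oo link r' (odiff (osuc a) b) (odiff a b) = link r' (odiff (osuc a) b) (odiff c b)"
  using chainD(4)[OF r' o(1) oo] by simp
  moreover have "c <= osuc a" using c by(meson less_osuc less_imp_le order_trans)
  ultimately show ?thesis using True c l1 cat_link by simp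
  next
  case False
  hence cb: "c <= b" by simp
  have "link ?s a c oo link ?s (osuc a) a = (link r b c oo link r' (odiff a b) ozero) oo link r' (odiff (osuc a) b) (odiff a b)"
  using cat_link_low[OF cb True] a l1 by simp
  also have "\<dots> = link r b c oo (link r' (odiff a b) ozero oo link r' (odiff (osuc a) b) (odiff a b))"
  by(rule comp_assoc[OF chainD(3)[OF r' o(1) oo] chainD(3)[OF r' o(2) ozero_le] chainD(3)[OF r order_refl cb, folded chain_zero[OF r']]])
  also have "\<dots> = link r b c oo link r' (odiff (osuc a) b) ozero" using chainD(4)[OF r' o(1) oo ozero_le] by simp
  also have "\<dots> = link ?s (osuc a) c" using cat_link_low[OF cb ba] a by simp
  finally show ?thesis by simp
  qed
  next
  case False
  thus ?thesis using chainD(4)[OF ch, of "osuc a" a c] c by(simp add: less_imp_le)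
  qed
 next
  fix l assume l: "is_lim l" "l <= oplus b g'" "!!a. a < l ==> is_chain C a ?s"
  show "is_limit {..<l} (stage ?s) (chainE (link ?s)) (stage ?s l) (link ?s l)"
  proof(cases "b < l")
  case False
  thus ?thesis using chainD(5)[OF ch, of l] l(1) by simp
  next
  case True
  let ?l = "odiff l b"
  have bl: "b <= l" using True by simp
  have lm: "is_lim ?l" using is_lim_odiff[OF l(1) True] .
  have lg: "?l <= g'" using od[OF bl l(2)] .
  have L: "is_limit {..<?l} (stage r') (chainE (link r')) (stage r' ?l) (link r' ?l)" using chainD(5)[OF r' lg lm] .
  have dl: "odiff d b < ?l" if "b <= d" "d < l" for d using odiff_less_iff[of b d l] that bl by simp
  have "is_limit {..<l} (stage ?s) (chainE (link ?s)) (stage r' ?l) (link ?s l)"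
  \<comment> \<open>From the joint on, the stages of the concatenation are those of
    \<open>r'\<close>, and they are cofinal below \<open>l\<close>.\<close>
  proof(rule cofinal_limit[where Reg = "{b..}" and q = "%c. odiff c b", OF _ _ _ _ _ _ _ _ L])
  show "chn l (stage ?s) (link ?s)" unfolding chn_def using l(3) chainD by(meson order_refl)
  show "chn ?l (stage r') (link r')" by(rule chain_chn[OF r' lg])
  show "EX d:{b..}. c <= d & d < l" if "c < l" for c using that True by(intro bexI[of _ "max b c"]) auto
  show "d < l ==> d : {b..} ==> odiff d b < ?l" for d using dl by simp
  show "EX d:{b..}. d < l & e <= odiff d b" if "e < ?l" for e
  using that bl by(intro bexI[of _ "oplus b e"]) (auto simp: oplus_less_odiff)
  show "odiff c b <= odiff d b" if "c : {b..}" "d : {b..}" "c <= d" for c d using that by(simp add: odiff_le_iff)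
  show "stage ?s d = stage r' (odiff d b)" if "d : {b..}" for d using that cat_stage by simp
  show "link ?s d c = link r' (odiff d b) (odiff c b)" if "c : {b..}" "c <= d" for c d using that cat_link by simp
  show "link ?s l c = link r' ?l (odiff c b)" if "c : {b..}" "c < l" for c using that cat_link[of c l] by simp
  fix c d assume cd: "c <= d" "d < l" "d : {b..}"
  have dd: "odiff d b <= ?l" using dl[of d] cd by(simp add: less_imp_le)
  show "link ?s d c oo link ?s l d = link ?s l c"
  proof(cases "b <= c")
  case True
  have "odiff c b <= odiff d b" using odiff_le_iff[of b c d] cd True by simp
  thus ?thesis using cat_link[of c d] cat_link[of d l] cat_link[of c l] True cd chainD(4)[OF r' lg dd] by simp
  next
  case False
  hence cb: "c <= b" by simp
  have o: "odiff d b <= g'" using dd lg by simp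
  have "link ?s d c oo link ?s l d = (link r b c oo link r' (odiff d b) ozero) oo link r' ?l (odiff d b)"
  using cat_link_low[OF cb, of d] cat_link[of d l] cd l(2) by simp
  also have "\<dots> = link r b c oo (link r' (odiff d b) ozero oo link r' ?l (odiff d b))"
  by(rule comp_assoc[OF chainD(3)[OF r' lg dd] chainD(3)[OF r' o ozero_le] chainD(3)[OF r order_refl cb, folded chain_zero[OF r']]])
  also have "\<dots> = link r b c oo link r' ?l ozero" using chainD(4)[OF r' lg dd ozero_le] by simp
  also have "\<dots> = link ?s l c" using cat_link_low[OF cb bl l(2)] by simp
  finally show ?thesis .
  qed
  qed
  thus ?thesis using cat_stage[OF bl] by simp
  qed
 qed
qed

text \<open>The strategy in \<open>f'\<close> asks \<open>sg\<close> about the concatenation with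
  the history of the tail. By \<open>cat_history\<close> this is what \<open>sg\<close> says about
  the whole play.\<close>

lemma cat_follows:
 assumes f: "follows cov As sg b r"
  and f': "follows (%a. cov (oplus b a)) (%a. As (oplus b a)) (%a h. sg (oplus b a) (history (oplus b a) (cat_play b r h))) g' r'"
 shows "follows cov As sg (oplus b g') (cat_play b r r')"
 unfolding follows_iff
proof(intro allI impI)
 let ?s = "cat_play b r r'"
 fix a assume a: "a < oplus b g'"
 show "elt ?s a : hom (stage ?s (osuc a)) (As a) & (cov a --> idx ?s a : sI sg a ?s &
  link ?s (osuc a) a = sU sg a ?s (idx ?s a) & elt ?s a = sE sg a ?s (idx ?s a))"
 proof(cases "b <= a")
  case False
  hence "follows cov As sg b ?s" using f follows_cong[OF cat_history_le[OF order_refl]] by blast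
  thus ?thesis using False unfolding follows_iff by auto
 next
  case True
  let ?a = "odiff a b"
  have ag: "?a < g'" using odiff_less_iff[of b a "oplus b g'"] True a by simp
  have ba: "b <= osuc a" using True by(meson less_osuc less_imp_le order_trans)
  have h: "history (oplus b ?a) (cat_play b r (history ?a r')) = history a ?s" using cat_history[of b ?a r r'] True by simp
  have e: "elt ?s a = elt r' ?a" "idx ?s a = idx r' ?a" "stage ?s (osuc a) = stage r' (osuc ?a)" "link ?s (osuc a) a = link r' (osuc ?a) ?a"
  using True cat_stage[OF ba] cat_link[OF True, of "osuc a"] odiff_osuc[OF True] by(auto simp: cat_play_def less_imp_le)
  show ?thesis using f' ag True unfolding follows_iff e h[symmetric] by auto
 qed
qed

end

text \<open>The residual strategy: answer in the tail as \<open>sg\<close> would after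
  \<open>r\<close>. In the outcome the elements already played are restricted along the new arrow
  \<open>k\<close>, and the later ones are renumbered by \<open>odiff\<close>.\<close>

lemma wins_peel:
 assumes cs: "covering_strategy cov As C (oplus b g') sg"
  and win: "!!r. is_chain C (oplus b g') r ==> follows cov As sg (oplus b g') r ==>
  W (link r (oplus b g') ozero) (%a. elt r a oo link r (oplus b g') (osuc a))"
  and Wc: "!!k e e'. (!!a. a < oplus b g' ==> e a = e' a) ==> W k e ==> W k e'"
  and r: "is_chain C b r" "follows cov As sg b r"
 shows "wins (%a. cov (oplus b a)) (%a. As (oplus b a)) g' (stage r b)
  (%k e. W (link r b ozero oo k) (%a. if a < b then elt r a oo (link r b (osuc a) oo k) else e (odiff a b)))"
proof -
 let ?tt = "%a h. sg (oplus b a) (history (oplus b a) (cat_play b r h))"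
 show ?thesis unfolding wins_def
 proof(intro exI[of _ ?tt] conjI allI impI)
  show "covering_strategy (%a. cov (oplus b a)) (%a. As (oplus b a)) (stage r b) g' ?tt"
  unfolding covering_strategy_iff
  proof(intro allI impI)
  fix a r' assume a: "a < g'" "cov (oplus b a)" and r': "is_chain (stage r b) a r'"
  "follows (%a. cov (oplus b a)) (%a. As (oplus b a)) ?tt a r'"
  have "stage (cat_play b r r') (oplus b a) = stage r' a" using cat_stage[OF r(1) r'(1), of "oplus b a"] by simp
  thus "covers (stage r' a) (sI ?tt a r') (sU ?tt a r') & (ALL i:sI ?tt a r'. sE ?tt a r' i : hom (Dom (sU ?tt a r' i)) (As (oplus b a)))"
  using cs cat_chain[OF r(1) r'(1)] cat_follows[OF r(1) r'(1) r(2) r'(2)] a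
  unfolding covering_strategy_iff cat_history by(metis oplus_less_iff)
  qed
 next
  fix r' assume r': "is_chain (stage r b) g' r'" "follows (%a. cov (oplus b a)) (%a. As (oplus b a)) ?tt g' r'"
  let ?s = "cat_play b r r'" and ?g = "oplus b g'" and ?k = "link r' g' ozero"
  have w: "W (link ?s ?g ozero) (%a. elt ?s a oo link ?s ?g (osuc a))"
  by(rule win[OF cat_chain[OF r(1) r'(1)] cat_follows[OF r(1) r'(1) r(2) r'(2)]])
  have l: "link ?s ?g d = link r b d oo ?k" if "d <= b" for d using cat_link_low[OF r(1) r'(1) that] by simp
  show "W (link r b ozero oo ?k) (%a. if a < b then elt r a oo (link r b (osuc a) oo ?k) else elt r' (odiff a b) oo link r' g' (osuc (odiff a b)))"
  proof(rule Wc)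
  show "W (link r b ozero oo ?k) (%a. elt ?s a oo link ?s ?g (osuc a))" using w l[of ozero] by simp
  fix a assume a: "a < ?g"
  show "elt ?s a oo link ?s ?g (osuc a) =
  (if a < b then elt r a oo (link r b (osuc a) oo ?k) else elt r' (odiff a b) oo link r' g' (osuc (odiff a b)))"
  proof(cases "a < b")
  case True
  thus ?thesis using l[of "osuc a"] by(simp add: cat_play_def)
  next
  case False
  hence ba: "b <= a" by simp
  hence "b <= osuc a" by(meson less_osuc less_imp_le order_trans)
  thus ?thesis using False cat_link[OF r(1) r'(1), of "osuc a" ?g] a odiff_osuc[OF ba] by(simp add: cat_play_def)
  qed
  qed
 qed
qed

text \<open>At the stages of the opponent let the object stay and a point be played, which exists by
  \<open>pt\<close>. All stages are then covers, and \<open>strategy_covers\<close> applies.\<close>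

theorem wins_whole:
 assumes w: "wins cov As g C W" and R: "R : Sub C"
  and W: "!!k e. valid As g C k e ==> W k e ==> k : R"
  and pt: "!!a X. a < g ==> ~ cov a ==> X : Ob ==> EX t. t : hom X (As a)"
 shows "R = whole C"
proof -
 obtain sg where sg: "covering_strategy cov As C g sg"
  "!!r. is_chain C g r ==> follows cov As sg g r ==> W (link r g ozero) (%a. elt r a oo link r g (osuc a))"
  using w unfolding wins_def by blast
 define tt where "tt a h = (if cov a then sg a h
  else ({ozero}, %_. Idn (stage h a), %_. SOME t. t : hom (stage h a) (As a)))" for a h
 have f: "follows cov As sg a r" if "follows (%_. True) As tt a r" for a r
  using that unfolding follows_iff tt_def by auto
 show ?thesis
 proof(rule strategy_covers[OF _ R])
  show "covering_strategy (%_. True) As C g tt" unfolding covering_strategy_iff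
  proof(intro allI impI)
  fix a r assume a: "a < g" and r: "is_chain C a r" "follows (%_. True) As tt a r"
  show "covers (stage r a) (sI tt a r) (sU tt a r) & (ALL i:sI tt a r. sE tt a r i : hom (Dom (sU tt a r i)) (As a))"
  proof(cases "cov a")
  case True
  thus ?thesis using sg(1) f[OF r(2)] r(1) a unfolding covering_strategy_iff by(auto simp: tt_def)
  next
  case False
  have ob: "stage r a : Ob" using chainD(1)[OF r(1) order_refl] .
  have "(SOME t. t : hom (stage r a) (As a)) : hom (stage r a) (As a)" using pt[OF a False ob] by(rule someI_ex)
  thus ?thesis using False covers_Idn[OF ob, of ozero "{ozero}"] ob by(simp add: tt_def history_def)
  qed
  qed
 next
  fix r assume r: "is_chain C g r" "follows (%_. True) As tt g r"
  show "link r g ozero : R" using W[OF play_valid[OF r(1) f[OF r(2)]] sg(2)[OF r(1) f[OF r(2)]]] .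
 qed
qed

text \<open>Trailing stages at which the opponent has a point cannot change the outcome. After
  \<open>g\<close> moves \<open>W\<close> follows once a certain subobject \<open>R\<close> of the
  current object is everything; the residual strategy wins the remaining stages, its outcomes lie in
  \<open>R\<close>, and \<open>wins_whole\<close> applies.\<close>

lemma wins_truncate:
 assumes w: "wins cov As g' C W'" and g: "g <= g'"
  and pt: "!!a X. g <= a ==> a < g' ==> ~ cov a ==> X : Ob ==> EX t. t : hom X (As a)"
  and Wc: "!!k e e'. (!!a. a < g' ==> e a = e' a) ==> W' k e ==> W' k e'"
  and loc: "!!k e. valid As g C k e ==> EX R:Sub (Dom k). (Idn (Dom k) : R --> W k e) &
  (ALL h e'. h : Ar --> Cod h = Dom k --> (ALL a<g. e' a = e a oo h) --> W' (k oo h) e' --> h : R)"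
 shows "wins cov As g C W"
proof -
 obtain sg where sg: "covering_strategy cov As C g' sg"
  "!!r. is_chain C g' r ==> follows cov As sg g' r ==> W' (link r g' ozero) (%a. elt r a oo link r g' (osuc a))"
  using w unfolding wins_def by blast
 have gg: "oplus g (odiff g' g) = g'" using g by simp
 show ?thesis unfolding wins_def
 proof(intro exI[of _ sg] conjI allI impI)
  show "covering_strategy cov As C g sg" using sg(1) g unfolding covering_strategy_iff by(meson order_less_le_trans)
 next
  fix r assume r: "is_chain C g r" "follows cov As sg g r"
  let ?k = "link r g ozero" and ?e = "%a. elt r a oo link r g (osuc a)"
  note v = play_valid[OF r]
  have kd: "Dom ?k = stage r g" using chainD(3)[OF r(1) order_refl, of ozero] by(simp add: hom_def)
  obtain R where R: "R : Sub (stage r g)" "Idn (stage r g) : R ==> W ?k ?e"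
  "!!h e'. h : Ar ==> Cod h = stage r g ==> ALL a<g. e' a = ?e a oo h ==> W' (?k oo h) e' ==> h : R"
  using loc[OF v] unfolding kd by blast
  have "R = whole (stage r g)"
  proof(rule wins_whole[OF wins_peel[where b = g and g' = "odiff g' g" and W = W' and r = r, unfolded gg, OF sg Wc r] R(1)])
  fix h e assume h: "valid (%a. As (oplus g a)) (odiff g' g) (stage r g) h e"
  and w: "W' (?k oo h) (%a. if a < g then elt r a oo (link r g (osuc a) oo h) else e (odiff a g))"
  have hA: "h : Ar" "Cod h = stage r g" using h by(auto simp: valid_def)
  have "elt r a oo (link r g (osuc a) oo h) = ?e a oo h" if a: "a < g" for a
  by(rule comp_assoc[symmetric, of h "Dom h" "stage r g" _ "stage r (osuc a)" _ "As a"])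
  (insert hA a r(2) chainD(3)[OF r(1) order_refl, of "osuc a"], auto simp: hom_def follows_iff)
  thus "h : R" using R(3)[OF hA _ w] by simp
  next
  fix a X assume a: "a < odiff g' g" "~ cov (oplus g a)" "X : Ob"
  have "oplus g a < g'" using oplus_less_odiff[OF g] a(1) by simp
  thus "EX t. t : hom X (As (oplus g a))" using pt[of "oplus g a" X] a by simp
  qed
  thus "W ?k ?e" using R(2) Sub_whole_iff[OF R(1)] by simp
 qed
qed


subsubsection \<open>Restriction along an arrow\<close>

lemma ozero_less: "a < b ==> ozero < (b::'k)"
 by(meson le_less_trans ozero_le)

lemma ozero_less_iff [simp]: "ozero < b \<longleftrightarrow> b ~= (ozero::'k)"
 by(metis less_irrefl order.not_eq_order_implies_strict ozero_le)

lemma le_cases2: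
 obtains "(b::'k) = ozero" | "b = osuc ozero" | "osuc ozero < b"
 by(metis le_ozero_iff less_osuc_iff linorder_neqE not_less osuc_le_iff ozero_le)

text \<open>A change of base touches a play only at its first two stages. The arrow \<open>v\<close>
  leads from the old stage 1 to the new one; objects and moves after that are kept.\<close>

definition patch :: "'a => 'a => 'a => ('o, 'a, 'k) play => ('o, 'a, 'k) play" where
 "patch u v e r = \<lparr>stage = (%b. if b = ozero then Cod u else if b = osuc ozero then Dom u else stage r b),
  link = (%b c. if b = ozero then Idn (Cod u)
  else if b = osuc ozero then (if c = ozero then u else Idn (Dom u))
  else if c = ozero then u oo (v oo link r b (osuc ozero))
  else if c = osuc ozero then v oo link r b (osuc ozero) else link r b c),
  elt = (elt r)(ozero := e), idx = idx r\<rparr>"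

lemma patch_chain:
 assumes r: "is_chain P g r" and u: "u : Ar" and v: "osuc ozero < g ==> v : hom (stage r (osuc ozero)) (Dom u)"
 shows "is_chain (Cod u) g (patch u v e r)"
proof(rule is_chainI)
 let ?s = "patch u v e r" and ?one = "osuc ozero :: 'k"
 show "Cod u : Ob" "stage ?s ozero = Cod u" using u by(auto simp: patch_def)
 show "link ?s b b = Idn (stage ?s b)" if b: "b <= g" for b
  using chainD(2)[OF r b] by(auto simp: patch_def)
 have lh: "v oo link r b ?one : hom (stage r b) (Dom u)" if "?one < b" "b <= g" for b
  by(rule Cmp_hom[OF v chainD(3)[OF r that(2)]]) (use that ozero_less in auto)
 show "link ?s (osuc a) a : hom (stage ?s (osuc a)) (stage ?s a)" if a: "a < g" for a
  by(cases a rule: le_cases2)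
  (insert u a lh[of "osuc a"] chainD(3)[OF r, of "osuc a" a], auto simp: patch_def hom_def less_imp_le)
 have cmp: "link ?s d c oo link r b d = link ?s b c" if "?one < d" "d <= b" "b <= g" "c <= d" for b c d
 proof -
  have b1: "?one < b" using that by auto
  have hd: "link r b d : hom (stage r b) (stage r d)" by(rule chainD(3)[OF r]) (use that in auto)
  have dn: "d ~= ozero" using that(1) by auto
  have h1: "link r d ?one : hom (stage r d) (stage r ?one)" by(rule chainD(3)[OF r]) (use that in auto)
  have v': "v : hom (stage r ?one) (Dom u)" using v that by auto
  have e: "link r d ?one oo link r b d = link r b ?one" by(rule chainD(4)[OF r that(3,2)]) (use that in auto)
  have e2: "(v oo link r d ?one) oo link r b d = v oo link r b ?one" using comp_assoc[OF hd h1 v'] e by simp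
  have e3: "(u oo (v oo link r d ?one)) oo link r b d = u oo (v oo link r b ?one)"
  using comp_assoc[OF hd Cmp_hom[OF v' h1] homI[OF u refl refl]] e2 by simp
  show ?thesis
  by(cases c rule: le_cases2) (insert that b1 e2 e3 chainD(4)[OF r that(3,2,4)], auto simp: patch_def)
 qed
 show "link ?s (osuc a) c = link ?s a c oo link ?s (osuc a) a" if a: "a < g" "c <= a" for a c
 proof(cases a rule: le_cases2)
  case 1
  thus ?thesis using a u by(simp add: patch_def)
 next
  case 2
  have h: "v oo link r (osuc a) ?one : hom (stage r (osuc a)) (Dom u)" using lh[of "osuc a"] 2 a by auto
  have "c = ozero \<or> c = ?one" using a 2 by(metis le_cases2 not_le)
  thus ?thesis using 2 h u by(auto simp: patch_def hom_def)
 next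
  case 3
  hence "link ?s (osuc a) a = link r (osuc a) a" by(auto simp: patch_def)
  thus ?thesis using cmp[of a "osuc a" c] 3 a by(simp add: less_imp_le)
 qed
 fix l assume l: "is_lim l" "l <= g" "!!a. a < l ==> is_chain (Cod u) a ?s"
 hence l1: "?one < l" using is_lim_osuc_less is_lim_ozero_less by blast
 have "is_limit {..<l} (stage ?s) (chainE (link ?s)) (stage r l) (link ?s l)"
 proof(rule cofinal_limit[where Reg = "{b. ?one < b}" and q = "%c. c", OF _ _ _ _ _ _ _ _ chainD(5)[OF r l(2,1)]])
  show "chn l (stage ?s) (link ?s)" unfolding chn_def using l(3) chainD by(meson order_refl)
  show "chn l (stage r) (link r)" by(rule chain_chn[OF r l(2)])
  have nx: "EX d:{b. ?one < b}. c <= d & d < l" if "c < l" for c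
  using that is_lim_osuc_less[OF l(1) that] is_lim_osuc_less[OF l(1) l1]
  by(intro bexI[of _ "osuc (max ?one c)"]) (auto simp: max_def less_imp_le)
  thus "EX d:{b. ?one < b}. c <= d & d < l" if "c < l" for c using that by blast
  show "EX d:{b. ?one < b}. d < l & c <= d" if "c < l" for c using nx[OF that] by blast
  fix c d assume cd: "c <= d" "d < l" "d : {b. ?one < b}"
  show "link ?s d c oo link ?s l d = link ?s l c"
  using cmp[of d l c] cd l by(auto simp: patch_def)
 qed (insert l1, auto simp: patch_def)
 thus "is_limit {..<l} (stage ?s) (chainE (link ?s)) (stage ?s l) (link ?s l)" using l1 by(auto simp: patch_def)
qed

text \<open>If the first move is the opponent's, it is composed with \<open>p\<close>. If it is a
  cover, the answer is the pullback of the original family; the projection from a pullback to the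
  original member then separates the two plays at stage 1, and the opponent's next move absorbs it.
  Two covers in a row would leave the second one on the wrong object, hence
  \<open>nc\<close>.\<close>

theorem wins_restrict:
 assumes w: "wins cov As g C W" and p: "p : hom P C" and nc: "~ (cov ozero & cov (osuc ozero))"
  and g: "ozero < g"
  and Wp: "!!k e h. valid As g C k e ==> W k e ==> h : Ar ==> Cod h = Dom k ==> W (k oo h) (%a. e a oo h)"
  and Wc: "!!k e e'. (!!a. a < g ==> e a = e' a) ==> W k e ==> W k e'"
 shows "wins cov As g P (%k e. W (p oo k) e)"
proof -
 let ?one = "osuc ozero :: 'k"
 obtain sg where sg: "covering_strategy cov As C g sg"
  "!!r. is_chain C g r ==> follows cov As sg g r ==> W (link r g ozero) (%a. elt r a oo link r g (osuc a))"
  using w unfolding wins_def by blast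
 have PC: "P : Ob" "C : Ob" and pA: "p : Ar" "Dom p = P" "Cod p = C" using homD[OF p] by auto
 define h0 where "h0 = triv_play C"
 have h0: "history ozero s = history ozero h0" if "is_chain C b s" for s b
  using chain_zero[OF that] chainD(2)[OF that, of ozero] unfolding history_eq_iff by(auto simp: h0_def triv_play_def)
 define I U E where "I = sI sg ozero h0" and "U = sU sg ozero h0" and "E = sE sg ozero h0"
 have IUE: "covers C I U & (ALL i:I. E i : hom (Dom (U i)) (As ozero))" if "cov ozero"
 proof -
  have s0: "stage h0 ozero = C" by(simp add: h0_def triv_play_def)
  have "covers (stage h0 ozero) I U & (ALL i:I. E i : hom (Dom (U i)) (As ozero))"
  using sg(1) that triv_chain[OF PC(2)] triv_follows[where cov = cov and As = As and sg = sg and r = h0] g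
  unfolding covering_strategy_iff I_def U_def E_def h0_def by blast
  thus ?thesis unfolding s0 .
 qed
 define PQ where "PQ i = (SOME pq. is_pullback p (U i) (fst pq) (snd pq))" for i
 define PP QQ where "PP i = fst (PQ i)" and "QQ i = snd (PQ i)" for i
 have pb: "is_pullback p (U i) (PP i) (QQ i)" if "cov ozero" "i : I" for i
 proof -
  have "U i : Ar" "Cod (U i) = C" using IUE[OF that(1)] that(2) coversD by auto
  hence "EX pq. is_pullback p (U i) (fst pq) (snd pq)" using pullback_ex[of p "U i"] pA by auto
  thus ?thesis unfolding PP_def QQ_def PQ_def by(rule someI_ex)
 qed
 \<comment> \<open>The first move of the shadow play above \<open>C\<close>, the comparison arrow
   into its object, and the first element.\<close>
 define ru rv re where "ru r = (if cov ozero then U (idx r ozero) else p oo link r ?one ozero)"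
  and "rv r = (if cov ozero then QQ (idx r ozero) else Idn (stage r ?one))"
  and "re r = (if cov ozero then E (idx r ozero) else elt r ozero)" for r :: "('o, 'a, 'k) play"
 define sh where "sh r = patch (ru r) (rv r) (re r) r" for r :: "('o, 'a, 'k) play"
 have sh_hist: "history a (sh (history a r)) = history a (sh r)" if a: "?one <= a" for a r
 proof -
  have a0: "ozero < a" using a by simp
  have "ru (history a r) = ru r" "rv (history a r) = rv r" "re (history a r) = re r"
  using a a0 by(auto simp: ru_def rv_def re_def history_def)
  thus ?thesis unfolding sh_def history_eq_iff using a a0
  by(auto simp: patch_def history_def)
 qed
 define tt where "tt a h = (if a = ozero then (I, PP, %i. E i oo QQ i) else sg a (history a (sh h)))" for a h
 have tau: "tt a (history a r) = (if a = ozero then (I, PP, %i. E i oo QQ i) else sg a (history a (sh r)))" for a r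
  using sh_hist[of a r] unfolding tt_def by(metis le_ozero_iff not_less osuc_le_iff)
 have main: "ru r : Ar & Cod (ru r) = C & rv r : hom (stage r ?one) (Dom (ru r)) & ru r oo rv r = p oo link r ?one ozero &
  re r : hom (Dom (ru r)) (As ozero) & re r oo rv r = elt r ozero &
  is_chain C a (sh r) & follows cov As sg a (sh r)"
  if a: "?one <= a" "a <= g" and r: "is_chain P a r" "follows cov As tt a r" for a r
 proof -
  have a0: "ozero < a" using a by simp
  have l0: "link r ?one ozero : hom (stage r ?one) P" using chainD(3)[OF r(1) a(1), of ozero] chain_zero[OF r(1)] by simp
  have e0: "elt r ozero : hom (stage r ?one) (As ozero)" using r(2) a0 unfolding follows_iff by blast
  have 1: "ru r : Ar & Cod (ru r) = C & rv r : hom (stage r ?one) (Dom (ru r)) & ru r oo rv r = p oo link r ?one ozero &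
  re r : hom (Dom (ru r)) (As ozero) & re r oo rv r = elt r ozero"
  proof(cases "cov ozero")
  case True
  let ?i = "idx r ozero"
  have "?i : fst (tt ozero (history ozero r))" "link r ?one ozero = fst (snd (tt ozero (history ozero r))) ?i"
  "elt r ozero = snd (snd (tt ozero (history ozero r))) ?i"
  using r(2) a0 True unfolding follows_iff by auto
  hence f: "?i : I" "link r ?one ozero = PP ?i" "elt r ozero = E ?i oo QQ ?i" unfolding tau by auto
  note b = pb[OF True f(1)]
  note bD = pullbackD[OF b]
  have "stage r ?one = Dom (PP ?i)" using l0 f(2) by(auto simp: hom_def)
  thus ?thesis using True f bD IUE[OF True] coversD(2,3)[of C I U ?i]
  unfolding ru_def rv_def re_def by(auto simp: hom_def)
  next
  case False
  have "p oo link r ?one ozero : hom (stage r ?one) C" by(rule Cmp_hom[OF p l0])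
  thus ?thesis using False e0 homD(4)[OF l0] unfolding ru_def rv_def re_def by(auto simp: hom_def)
  qed
  have ch: "is_chain C a (sh r)" unfolding sh_def using patch_chain[OF r(1), of "ru r" "rv r" "re r"] 1 by auto
  have "follows cov As sg a (sh r)" unfolding follows_iff
  proof(intro allI impI)
  fix b assume b: "b < a"
  show "elt (sh r) b : hom (stage (sh r) (osuc b)) (As b) & (cov b --> idx (sh r) b : sI sg b (sh r) &
  link (sh r) (osuc b) b = sU sg b (sh r) (idx (sh r) b) & elt (sh r) b = sE sg b (sh r) (idx (sh r) b))"
  proof(cases "b = ozero")
  case True
  have i: "idx r ozero : I" if c0: "cov ozero"
  proof -
  have "idx r ozero : fst (tt ozero (history ozero r))" using r(2) a0 c0 unfolding follows_iff by auto
  thus ?thesis unfolding tau by simp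
  qed
  show ?thesis unfolding True h0[OF ch] I_def[symmetric] U_def[symmetric] E_def[symmetric]
  using 1 i by(auto simp: sh_def patch_def ru_def re_def)
  next
  case False
  hence ob: "osuc b ~= ?one" "osuc b ~= ozero" by auto
  have f: "elt r b : hom (stage r (osuc b)) (As b)" "cov b ==> idx r b : sI sg b (sh r) &
  link r (osuc b) b = sU sg b (sh r) (idx r b) & elt r b = sE sg b (sh r) (idx r b)"
  using r(2) b False unfolding follows_iff tau by auto
  have "link (sh r) (osuc b) b = link r (osuc b) b" if "cov b"
  proof(cases "b = ?one")
  case True
  hence "~ cov ozero" using nc that by auto
  hence "rv r = Idn (stage r ?one)" by(simp add: rv_def)
  moreover have "link r (osuc b) ?one : hom (stage r (osuc b)) (stage r ?one)"
  using chainD(3)[OF r(1), of "osuc b" ?one] b True by(simp add: less_imp_le)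
  ultimately show ?thesis using True by(auto simp: sh_def patch_def hom_def)
  qed (insert False, auto simp: sh_def patch_def)
  thus ?thesis using f False ob by(auto simp: sh_def patch_def)
  qed
  qed
  with 1 ch show ?thesis by blast
 qed
 show ?thesis unfolding wins_def
 proof(intro exI[of _ tt] conjI allI impI)
  show "covering_strategy cov As P g tt" unfolding covering_strategy_iff
  proof(intro allI impI)
  fix a r assume a: "a < g" "cov a" and r: "is_chain P a r" "follows cov As tt a r"
  show "covers (stage r a) (sI tt a r) (sU tt a r) & (ALL i:sI tt a r. sE tt a r i : hom (Dom (sU tt a r i)) (As a))"
  proof(cases "a = ozero")
  case True
  hence c0: "cov ozero" using a by simp
  have "covers (Dom p) I PP" by(rule covers_pb[of C I U]) (use IUE[OF c0] pA pb[OF c0] in auto)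
  moreover have "E i oo QQ i : hom (Dom (PP i)) (As ozero)" if "i : I" for i
  by(rule Cmp_hom[of _ "Dom (U i)"]) (insert IUE[OF c0] that pullbackD[OF pb[OF c0 that]], auto simp: hom_def)
  ultimately show ?thesis unfolding tau True using chain_zero[OF r(1)] pA True by simp
  next
  case False
  hence a1: "?one <= a" by(metis le_ozero_iff not_less osuc_le_iff)
  note m = main[OF a1 less_imp_le[OF a(1)] r]
  have "stage (sh r) a = stage r a"
  proof(cases "a = ?one")
  case True
  hence "~ cov ozero" using nc a by auto
  hence rv: "rv r = Idn (stage r ?one)" by(simp add: rv_def)
  have rvh: "rv r : hom (stage r ?one) (Dom (ru r))" using m by blast
  have "Dom (ru r) = stage r ?one" using homD(3)[OF rvh] homD(4)[OF rvh] unfolding rv by simp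
  thus ?thesis using True by(simp add: sh_def patch_def)
  qed (insert False, auto simp: sh_def patch_def)
  moreover have "covers (stage (sh r) a) (sI sg a (sh r)) (sU sg a (sh r)) &
  (ALL i:sI sg a (sh r). sE sg a (sh r) i : hom (Dom (sU sg a (sh r) i)) (As a))"
  using sg(1) m a unfolding covering_strategy_iff by blast
  ultimately show ?thesis using False by(simp add: tau)
  qed
  qed
 next
  fix r assume r: "is_chain P g r" "follows cov As tt g r"
  have g1: "?one <= g" using g by simp
  note m = main[OF g1 order_refl r]
  have sc: "is_chain C g (sh r)" and sf: "follows cov As sg g (sh r)" using m by auto
  let ?k = "link (sh r) g ozero" and ?e = "%a. elt (sh r) a oo link (sh r) g (osuc a)"
  have W: "W ?k ?e" by(rule sg(2)[OF sc sf])
  note v = play_valid[OF sc sf]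
  show "W (p oo link r g ozero) (%a. elt r a oo link r g (osuc a))"
  proof(cases "g = ?one")
  \<comment> \<open>With a single stage no later move absorbs the comparison arrow; the outcome
    itself is restricted along \<open>rv r\<close>.\<close>
  case True
  have "W (?k oo rv r) (%a. ?e a oo rv r)"
  by(rule Wp[OF v W]) (insert m True, auto simp: hom_def sh_def patch_def)
  moreover have "?k oo rv r = p oo link r g ozero" using m True by(simp add: sh_def patch_def)
  moreover have "?e a oo rv r = elt r a oo link r g (osuc a)" if "a < g" for a
  proof -
  have a: "a = ozero" using that True by simp
  have "elt r ozero : hom (stage r ?one) (As ozero)" using r(2) True unfolding follows_iff by auto
  thus ?thesis using m chainD(2)[OF r(1) order_refl] True unfolding a by(auto simp: sh_def patch_def hom_def)
  qed
  ultimately show ?thesis using Wc by(metis (no_types, lifting))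
  next
  case False
  hence g2: "?one < g" by(rule order.not_eq_order_implies_strict[OF not_sym g1])
  hence gn: "g ~= ozero" by auto
  have lh: "link r g ?one : hom (stage r g) (stage r ?one)" by(rule chainD(3)[OF r(1) order_refl g1])
  have l0: "link r ?one ozero : hom (stage r ?one) P" using chainD(3)[OF r(1) g1, of ozero] chain_zero[OF r(1)] by simp
  have l10: "link r ?one ozero oo link r g ?one = link r g ozero" by(rule chainD(4)[OF r(1) order_refl g1]) simp
  have rv: "rv r : hom (stage r ?one) (Dom (ru r))" and ruh: "ru r : hom (Dom (ru r)) C"
  and reh: "re r : hom (Dom (ru r)) (As ozero)" using m by(auto simp: hom_def)
  have "?k = ru r oo (rv r oo link r g ?one)" using False gn by(simp add: sh_def patch_def)
  also have "\<dots> = (ru r oo rv r) oo link r g ?one" by(rule comp_assoc[OF lh rv ruh, symmetric])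
  also have "\<dots> = (p oo link r ?one ozero) oo link r g ?one" using m by simp
  also have "\<dots> = p oo link r g ozero" using comp_assoc[OF lh l0 p] l10 by simp
  finally have k: "?k = p oo link r g ozero" .
  have e: "?e a = elt r a oo link r g (osuc a)" if "a < g" for a
  proof(cases "a = ozero")
  case True
  have "?e a = re r oo (rv r oo link r g ?one)" using False gn True by(simp add: sh_def patch_def)
  also have "\<dots> = (re r oo rv r) oo link r g ?one" by(rule comp_assoc[OF lh rv reh, symmetric])
  finally show ?thesis using m True by simp
  next
  case F: False
  thus ?thesis using False gn by(simp add: sh_def patch_def)
  qed
  show ?thesis by(rule Wc[OF e]) (use W k in simp_all)
  qed
 qed
qed

subsubsection \<open>Reindexing\<close>

text \<open>\<open>q\<close> collapses the dummy stages \<open>Dm\<close> of the old game, and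
  \<open>rd\<close> picks the real stage over a new one. A play of the new game is blown up by
  repeating its object at each dummy, with an identity link and some point as element. This is
  impossible where the old player covers, since the family need not contain the identity; such
  covers have to be moved away by \<open>wins_delay\<close> first. \<theta> and \<theta>' translate
  elements between the two games.\<close>

theorem wins_reindex:
 fixes q rd :: "'k => 'k" and Dm :: "'k => bool"
 assumes w: "wins cov'' As'' g'' C W''"
  and q0: "q ozero = ozero" and qg: "q g'' = g" and qm: "!!c d. c <= d ==> q c <= q d"
  and qd: "!!c. c < g'' ==> Dm c ==> q (osuc c) = q c & ~ cov'' c & (ALL X:Ob. EX t. t : hom X (As'' c))"
  and qr: "!!c. c < g'' ==> ~ Dm c ==> q (osuc c) = osuc (q c) & (cov'' c \<longleftrightarrow> cov (q c)) & rd (q c) = c &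
  \<theta> c : hom (As (q c)) (As'' c) & \<theta>' c : hom (As'' c) (As (q c)) & \<theta> c oo \<theta>' c = Idn (As'' c)"
  and ql: "!!c. is_lim c ==> c <= g'' ==> is_lim (q c) & (ALL e<q c. EX d<c. e <= q d) & (ALL d<c. q d < q c)"
  and rd: "!!a. a < g ==> rd a < g'' & ~ Dm (rd a) & q (rd a) = a"
  and W: "!!k e e''. valid As g C k e ==> W'' k e'' ==> (!!c. c < g'' ==> ~ Dm c ==> e'' c = \<theta> c oo e (q c)) ==> W k e"
 shows "wins cov As g C W"
proof -
 obtain sg where sg: "covering_strategy cov'' As'' C g'' sg"
  "!!r. is_chain C g'' r ==> follows cov'' As'' sg g'' r ==> W'' (link r g'' ozero) (%a. elt r a oo link r g'' (osuc a))"
  using w unfolding wins_def by blast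
 define sh where "sh r = \<lparr>stage = (%c. stage r (q c)), link = (%c d. link r (q c) (q d)),
  elt = (%c. if Dm c then (SOME t. t : hom (stage r (q c)) (As'' c)) else \<theta> c oo elt r (q c)), idx = (%c. if Dm c then undefined else idx r (q c))\<rparr>"
  for r :: "('o, 'a, 'k) play"
 have qlt: "q b < q c" if "b < c" "c <= g''" "~ Dm b" for b c
 proof -
  have "osuc (q b) <= q c" using qr[of b] qm[of "osuc b" c] that by auto
  thus ?thesis by simp
 qed
 have qle: "q c <= g" if "c <= g''" for c using qm[OF that] qg by simp
 have sh_hist: "history c (sh (history (q c) r)) = history c (sh r)" if c: "c <= g''" for c r
  unfolding history_eq_iff using qm qlt[OF _ c] by(auto simp: sh_def history_def)
 have sh_ch: "is_chain C c (sh r)" if c: "c <= g''" and r: "is_chain C (q c) r" for c r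
 proof(rule is_chainI)
  let ?s = "sh r"
  show "C : Ob" by(rule chain_Ob[OF r])
  show "stage ?s ozero = C" using chain_zero[OF r] q0 by(simp add: sh_def)
  show "link ?s b b = Idn (stage ?s b)" if "b <= c" for b using chainD(2)[OF r qm[OF that]] by(simp add: sh_def)
  show "link ?s (osuc a) a : hom (stage ?s (osuc a)) (stage ?s a)" if "a < c" for a
  using chainD(3)[OF r qm[of "osuc a" c] qm[of a "osuc a"]] that by(simp add: sh_def less_imp_le)
  show "link ?s (osuc a) d = link ?s a d oo link ?s (osuc a) a" if "a < c" "d <= a" for a d
  using chainD(4)[OF r qm[of "osuc a" c] qm[of a "osuc a"] qm[OF that(2)]] that by(simp add: sh_def less_imp_le)
  fix l assume l: "is_lim l" "l <= c" "!!a. a < l ==> is_chain C a ?s"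
  have lg: "l <= g''" using l(2) c by simp
  note q = ql[OF l(1) lg]
  have "is_limit {..<l} (stage ?s) (chainE (link ?s)) (stage r (q l)) (link ?s l)"
  proof(rule cofinal_limit[where Reg = UNIV and q = q, OF _ _ _ _ _ _ _ _ chainD(5)[OF r qm[OF l(2)]]])
  show "chn l (stage ?s) (link ?s)" unfolding chn_def using l(3) chainD by(meson order_refl)
  show "chn (q l) (stage r) (link r)" by(rule chain_chn[OF r qm[OF l(2)]])
  show "link ?s d e oo link ?s l d = link ?s l e" if "e <= d" "d < l" for e d
  using chainD(4)[OF r qm[OF l(2)] qm[of d l] qm[OF that(1)]] that by(simp add: sh_def less_imp_le)
  qed (insert q qm, auto simp: sh_def)
  thus "is_limit {..<l} (stage ?s) (chainE (link ?s)) (stage ?s l) (link ?s l)" by(simp add: sh_def)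
 qed
 define tt where "tt a h = (let c = rd a; s = sh h in (sI sg c s, sU sg c s, %i. \<theta>' c oo sE sg c s i))" for a h
 have tau: "tt a (history a r) = (sI sg (rd a) (sh r), sU sg (rd a) (sh r), %i. \<theta>' (rd a) oo sE sg (rd a) (sh r) i)"
  if "a < g" for a r
  using sh_hist[of "rd a" r] rd[OF that] by(simp add: tt_def Let_def less_imp_le)
 have main: "follows cov'' As'' sg c (sh r)" if "c <= g''" "is_chain C (q c) r" "follows cov As tt (q c) r" for c r
  using that
 proof(induction c rule: less_induct)
  case (less c)
  show ?case unfolding follows_iff
  proof(intro allI impI)
  fix b assume b: "b < c"
  have bg: "b < g''" using b less.prems by simp
  have obc: "osuc b <= c" using b by simp
  show "elt (sh r) b : hom (stage (sh r) (osuc b)) (As'' b) & (cov'' b --> idx (sh r) b : sI sg b (sh r) &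
  link (sh r) (osuc b) b = sU sg b (sh r) (idx (sh r) b) & elt (sh r) b = sE sg b (sh r) (idx (sh r) b))"
  proof(cases "Dm b")
  case True
  have ob: "stage r (q b) : Ob" using chainD(1)[OF less.prems(2) qm[of b c]] b by simp
  hence "(SOME t. t : hom (stage r (q b)) (As'' b)) : hom (stage r (q b)) (As'' b)"
  using qd[OF bg True] by(metis (full_types) someI_ex)
  thus ?thesis using qd[OF bg True] True by(simp add: sh_def)
  next
  case False
  note Q = qr[OF bg False]
  have qb: "q b < q c" by(rule qlt[OF b less.prems(1) False])
  have qg: "q b < g" using qb qle[OF less.prems(1)] by simp
  have f: "elt r (q b) : hom (stage r (osuc (q b))) (As (q b))" using less.prems(3) qb unfolding follows_iff by blast
  have "\<theta> b oo elt r (q b) : hom (stage r (osuc (q b))) (As'' b)" by(rule Cmp_hom[OF _ f]) (use Q in blast)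
  moreover have "idx (sh r) b : sI sg b (sh r) &
  link (sh r) (osuc b) b = sU sg b (sh r) (idx (sh r) b) & elt (sh r) b = sE sg b (sh r) (idx (sh r) b)" if cv: "cov'' b"
  proof -
  have g: "idx r (q b) : sI sg b (sh r)" "link r (osuc (q b)) (q b) = sU sg b (sh r) (idx r (q b))"
  "elt r (q b) = \<theta>' b oo sE sg b (sh r) (idx r (q b))"
  using less.prems(3) qb cv Q unfolding follows_iff by(auto simp: tau[OF qg])
  have ib: "is_chain C b (sh r)" "follows cov'' As'' sg b (sh r)"
  using sh_ch[of b r] less.IH[OF b] chain_mono[OF less.prems(2), of "q b"] follows_mono[OF less.prems(3), of "q b"] qb bg
  by(auto simp: less_imp_le)
  hence E: "sE sg b (sh r) (idx r (q b)) : hom (Dom (sU sg b (sh r) (idx r (q b)))) (As'' b)"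
  using sg(1) bg cv g(1) unfolding covering_strategy_iff by blast
  have "\<theta> b oo elt r (q b) = (\<theta> b oo \<theta>' b) oo sE sg b (sh r) (idx r (q b))"
  unfolding g(3) by(rule comp_assoc[OF E, symmetric]) (use Q in auto)
  hence "\<theta> b oo elt r (q b) = sE sg b (sh r) (idx r (q b))" using Q E by(simp add: hom_def)
  thus ?thesis using g Q False by(simp add: sh_def)
  qed
  ultimately show ?thesis using Q False by(simp add: sh_def)
  qed
  qed
 qed
 show ?thesis unfolding wins_def
 proof(intro exI[of _ tt] conjI allI impI)
  show "covering_strategy cov As C g tt" unfolding covering_strategy_iff
  proof(intro allI impI)
  fix a r assume a: "a < g" "cov a" and r: "is_chain C a r" "follows cov As tt a r"
  note R = rd[OF a(1)]
  have Q: "cov'' (rd a)" "\<theta>' (rd a) : hom (As'' (rd a)) (As a)" using qr[of "rd a"] R a by auto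
  have "is_chain C (rd a) (sh r)" "follows cov'' As'' sg (rd a) (sh r)"
  using sh_ch[of "rd a" r] main[of "rd a" r] R r by(auto simp: less_imp_le)
  hence c: "covers (stage (sh r) (rd a)) (sI sg (rd a) (sh r)) (sU sg (rd a) (sh r)) &
  (ALL i:sI sg (rd a) (sh r). sE sg (rd a) (sh r) i : hom (Dom (sU sg (rd a) (sh r) i)) (As'' (rd a)))"
  using sg(1) R Q unfolding covering_strategy_iff by blast
  have "stage (sh r) (rd a) = stage r a" using R by(simp add: sh_def)
  thus "covers (stage r a) (sI tt a r) (sU tt a r) & (ALL i:sI tt a r. sE tt a r i : hom (Dom (sU tt a r i)) (As a))"
  using c Cmp_hom[OF Q(2)] by(simp add: tau[OF a(1)])
  qed
 next
  fix r assume r: "is_chain C g r" "follows cov As tt g r"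
  have s: "is_chain C g'' (sh r)" "follows cov'' As'' sg g'' (sh r)" using sh_ch[of g'' r] main[of g'' r] r qg by auto
  have w: "W'' (link r g ozero) (%c. elt (sh r) c oo link r g (q (osuc c)))" using sg(2)[OF s] qg q0 by(simp add: sh_def)
  show "W (link r g ozero) (%a. elt r a oo link r g (osuc a))"
  proof(rule W[OF play_valid[OF r] w])
  fix c assume c: "c < g''" "~ Dm c"
  note Q = qr[OF c]
  have qc: "q c < g" using qlt[OF c(1) order_refl c(2)] qg by simp
  have "\<theta> c oo elt r (q c) oo link r g (osuc (q c)) = (\<theta> c oo elt r (q c)) oo link r g (osuc (q c))"
  by(rule comp_assoc[symmetric, of _ "stage r g" "stage r (osuc (q c))" _ "As (q c)" _ "As'' c"])
  (insert chainD(3)[OF r(1) order_refl, of "osuc (q c)"] qc r(2) Q, auto simp: follows_iff)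
  thus "elt (sh r) c oo link r g (q (osuc c)) = \<theta> c oo elt r (q c) oo link r g (osuc (q c))"
  using Q c by(simp add: sh_def)
  qed
 qed
qed


subsubsection \<open>Delaying covers\<close>

abbreviation "suc2 c == osuc (osuc c)"
abbreviation "suc3 c == osuc (suc2 c)"

lemma osuc_lessD: "osuc c < d ==> c < (d::'k)" by(rule order_less_trans[OF less_osuc])
lemma le_osuc [simp]: "c <= osuc (c::'k)" by(rule less_imp_le) simp
lemma osuc2_less [simp]: "c < osuc (osuc (c::'k))" by(rule order_less_trans[of _ "osuc c"]) simp_all
lemma osuc3_less [simp]: "c < osuc (osuc (osuc (c::'k)))" by(rule order_less_trans[of _ "suc2 c"]) simp_all
lemma osuc2_le [simp]: "c <= osuc (osuc (c::'k))" by(rule less_imp_le) simp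
lemma osuc3_le [simp]: "c <= osuc (osuc (osuc (c::'k)))" by(rule less_imp_le) simp

context
 fixes Bs :: "'k => bool" and dec :: "'k => 'k \<times> 'k"
 assumes Bs_base: "ALL c. Bs c --> obase c"
begin

text \<open>At a stage \<open>c\<close> in \<open>Bs\<close> the old player covers, at
  \<open>c + 1\<close> the opponent moves, at \<open>c + 2\<close> the player covers again. In the
  new game the cover at \<open>c\<close> is dropped and both covers are given together at
  \<open>c + 2\<close>. The objects of a play and of its shadow in the old game differ only at the
  stages \<open>c + 1\<close> (\<open>is1\<close>) and \<open>c + 2\<close>
  (\<open>is2\<close>).\<close>

definition "is1 b \<longleftrightarrow> (EX c. b = osuc c & Bs c)"
definition "is2 b \<longleftrightarrow> (EX c. b = suc2 c & Bs c)"
definition "regp b \<longleftrightarrow> ~ is1 b & ~ is2 b"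

lemma is1_osuc [simp]: "is1 (osuc c) \<longleftrightarrow> Bs c" by(auto simp: is1_def)
lemma is2_osuc [simp]: "is2 (osuc c) \<longleftrightarrow> is1 c" by(auto simp: is1_def is2_def)
lemma Bs_osuc [simp]: "~ Bs (osuc c)" using Bs_base by fastforce
lemma base_not: "obase b ==> ~ is1 b" "obase b ==> ~ is2 b" by(auto simp: is1_def is2_def)
lemma Bs_not: "Bs b ==> ~ is1 b" "Bs b ==> ~ is2 b" using base_not Bs_base by auto
lemma is12: "is1 b ==> ~ is2 b" "is1 b ==> ~ Bs b" "is2 b ==> ~ Bs b" "is2 b ==> ~ is1 b"
 using Bs_not by(metis is1_def is2_osuc)+

lemma regp_base: "obase b ==> regp b" "Bs b ==> regp b"
 using base_not Bs_base by(auto simp: regp_def)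

lemma regp_gap:
 assumes "Bs c" "c < b" "regp b"
 shows "suc2 c < b"
proof -
 have "osuc c <= b" "b ~= osuc c" "b ~= suc2 c" using assms by(auto simp: regp_def)
 thus ?thesis by(metis osuc_le_iff order.not_eq_order_implies_strict)
qed

text \<open>The index at \<open>c + 2\<close> codes a pair. Its first component selects
  \<open>u1\<close> in the family answered at \<open>c\<close>; pulling \<open>u1\<close> back along
  the link from stage \<open>c + 2\<close> to stage \<open>c\<close> gives \<open>pp\<close> and
  \<open>qq\<close>. The second component selects \<open>v1\<close> in the family answered at
  \<open>c + 2\<close>, which covers the domain of \<open>pp\<close>.\<close>

definition u1 :: "('k => 'k set \<times> ('k => 'a) \<times> ('k => 'a)) => ('o, 'a, 'k) play => 'k => 'a" where
 "u1 B r c = fst (snd (B c)) (fst (dec (idx r (suc2 c))))"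
definition "pq B r c = (SOME pq. is_pullback (link r (suc2 c) c) (u1 B r c) (fst pq) (snd pq))"
definition "pp B r c = fst (pq B r c)"
definition "qq B r c = snd (pq B r c)"
definition v1 :: "('k => 'k set \<times> ('k => 'a) \<times> ('k => 'a)) => ('o, 'a, 'k) play => 'k => 'a" where
 "v1 B r c = fst (snd (B (suc2 c))) (snd (dec (idx r (suc2 c))))"
definition "row B r b a = (if is1 a then qq B r (opred a) oo (v1 B r (opred a) oo link r b (suc2 a))
 else if is2 a then v1 B r (opred (opred a)) oo link r b (osuc a) else link r b a)"
text \<open>\<open>B\<close> stands for the answers of the old strategy. The shadow takes the member
  of the first family at \<open>c + 1\<close> and the pullback at \<open>c + 2\<close>, and the
  opponent's element at \<open>c + 1\<close> is restricted along \<open>pp\<close>.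
  \<open>row\<close> collects the links that start at an unaltered stage.\<close>

definition mk :: "('k => 'k set \<times> ('k => 'a) \<times> ('k => 'a)) => ('o, 'a, 'k) play => ('o, 'a, 'k) play" where
 "mk B r = \<lparr>stage = (%b. if is1 b then Dom (u1 B r (opred b)) else if is2 b then Dom (pp B r (opred (opred b))) else stage r b),
 link = (%b a. if is1 b then (if a = b then Idn (Dom (u1 B r (opred b))) else row B r (opred b) a oo u1 B r (opred b))
  else if is2 b then (if a = b then Idn (Dom (pp B r (opred (opred b))))
  else if a = opred b then qq B r (opred (opred b))
  else row B r (opred (opred b)) a oo (u1 B r (opred (opred b)) oo qq B r (opred (opred b))))
  else row B r b a),
 elt = (%a. if Bs a then snd (snd (B a)) (fst (dec (idx r (suc2 a)))) else if is1 a then elt r a oo pp B r (opred a) else elt r a),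
 idx = (%a. if Bs a then fst (dec (idx r (suc2 a))) else if is2 a then snd (dec (idx r a)) else idx r a)\<rparr>"
text \<open>Answers and shadow define each other: the answer at \<open>b\<close> needs the shadow up
  to \<open>b\<close>, which needs only the answers below \<open>b\<close>.\<close>

definition "ans sg r = wfrec {(a, b). a < (b::'k)} (%B b. sg b (history b (mk B r)))"
definition "shad sg r = mk (ans sg r) r"

text \<open>The shadow looks ahead: its stage \<open>c + 1\<close> depends on an index chosen only
  at \<open>c + 2\<close>. Agreement of histories up to \<open>b\<close> therefore does not fix the
  shadow up to \<open>b\<close>; the first components of indices still pending at \<open>b\<close>
  must agree as well.\<close>

definition hyp :: "'k => ('o, 'a, 'k) play => ('o, 'a, 'k) play => bool" where
 "hyp b r r' \<longleftrightarrow> history b r = history b r' &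
  (ALL c<b. Bs c --> fst (dec (idx r (suc2 c))) = fst (dec (idx r' (suc2 c))))"

lemma hyp_mono: "hyp b r r' ==> a <= b ==> hyp a r r'"
 unfolding hyp_def using history_mono[of b r r' a] by auto

lemma mk_cong:
 assumes h: "hyp b r r'" and B: "!!c. c < b ==> B c = B' c"
 shows "history b (mk B r) = history b (mk B' r')"
  and "Bs c ==> suc2 c <= b ==> pp B r c = pp B' r' c"
proof -
 have hh: "!!c. c <= b ==> stage r c = stage r' c" "!!c d. c <= b ==> d <= c ==> link r c d = link r' c d"
  "!!c. c < b ==> elt r c = elt r' c" "!!c. c < b ==> idx r c = idx r' c"
  "!!c. c < b ==> Bs c ==> fst (dec (idx r (suc2 c))) = fst (dec (idx r' (suc2 c)))"
  using h unfolding hyp_def history_eq_iff by auto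
 have u: "u1 B r c = u1 B' r' c" if "Bs c" "c < b" for c
  using hh(5)[OF that(2,1)] B[OF that(2)] by(simp add: u1_def)
 have up: "c < suc2 c" for c :: 'k by simp
 have pqe: "pq B r c = pq B' r' c" if "Bs c" "suc2 c <= b" for c
 proof -
  have "c < b" by(rule order_less_le_trans[OF osuc2_less that(2)])
  thus ?thesis using u[OF that(1)] hh(2)[OF that(2)] up[of c] by(simp add: pq_def less_imp_le)
 qed
 thus "Bs c ==> suc2 c <= b ==> pp B r c = pp B' r' c" for c by(simp add: pp_def)
 have p: "pp B r c = pp B' r' c" "qq B r c = qq B' r' c" if "Bs c" "suc2 c <= b" for c
  using pqe[OF that] by(auto simp: pp_def qq_def)
 have v: "v1 B r c = v1 B' r' c" if "suc2 c < b" for c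
  using B[OF that] hh(4)[OF that] by(simp add: v1_def)
 have row: "row B r d a = row B' r' d a" if d: "d <= b" "regp d" "a <= d" for d a
 proof(cases "is1 a")
  case True
  then obtain c where c: "a = osuc c" "Bs c" by(auto simp: is1_def)
  hence "c < d" using d by simp
  hence g: "suc2 c < d" using regp_gap c d by blast
  hence g': "suc2 c < b" using d by simp
  hence g1: "osuc c < b" by(rule order_less_trans[rotated]) simp
  have "suc3 c <= d" using g by simp
  thus ?thesis using g1 c p[OF c(2)] v[OF g'] g' hh(2)[OF d(1)] by(simp add: row_def less_imp_le)
 next
  case F: False
  show ?thesis
  proof(cases "is2 a")
  case True
  then obtain c where c: "a = suc2 c" "Bs c" by(auto simp: is2_def)
  hence "c < d" using d by(auto dest: osuc_lessD)
  hence g: "suc2 c < d" using regp_gap c d by blast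
  hence g': "suc2 c < b" using d by simp
  have "suc3 c <= d" using g by simp
  thus ?thesis using c F v[OF g'] hh(2)[OF d(1)] by(simp add: row_def)
  qed (insert F hh(2)[OF d(1,3)], simp add: row_def)
 qed
 show "history b (mk B r) = history b (mk B' r')" unfolding history_eq_iff
 proof(intro conjI allI impI)
  fix d assume d: "d <= b"
  have one: "stage (mk B r) d = stage (mk B' r') d & (a <= d --> link (mk B r) d a = link (mk B' r') d a)" for a
  proof(cases "is1 d")
  case True
  then obtain c where c: "d = osuc c" "Bs c" by(auto simp: is1_def)
  have cb: "c < b" using c d by simp
  have "a <= c" if "a <= d" "a ~= d" using that c by(metis less_osuc_iff order.not_eq_order_implies_strict)
  thus ?thesis using c u[OF c(2) cb] row[of c a] cb regp_base(2)[OF c(2)] by(auto simp: mk_def)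
  next
  case F: False
  show ?thesis
  proof(cases "is2 d")
  case True
  then obtain c where c: "d = suc2 c" "Bs c" by(auto simp: is2_def)
  have cb: "c < b" using c d by(auto dest: osuc_lessD)
  have "a <= c" if "a <= d" "a ~= d" "a ~= osuc c" using that c by(metis less_osuc_iff order.not_eq_order_implies_strict)
  thus ?thesis using c F u[OF c(2) cb] p[OF c(2)] d row[of c a] cb regp_base(2)[OF c(2)] by(auto simp: mk_def)
  next
  case False
  thus ?thesis using F d row[of d a] hh(1)[OF d] by(auto simp: mk_def regp_def)
  qed
  qed
  show "stage (mk B r) d = stage (mk B' r') d" using one by blast
  show "link (mk B r) d a = link (mk B' r') d a" if "a <= d" for a using one that by blast
 next
  fix d assume d: "d < b"
  show "elt (mk B r) d = elt (mk B' r') d" "idx (mk B r) d = idx (mk B' r') d"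
  using d hh B[OF d] p by(auto simp: mk_def is1_def)
 qed
qed

lemma ans_eq: "ans sg r b = sg b (history b (shad sg r))"
proof -
 have "ans sg r b = sg b (history b (mk (cut (ans sg r) {(a, b). a < b} b) r))"
  unfolding ans_def by(subst wfrec[OF wf_ord]) simp
 also have "history b (mk (cut (ans sg r) {(a, b). a < b} b) r) = history b (mk (ans sg r) r)"
  by(rule mk_cong(1)) (auto simp: cut_apply hyp_def)
 finally show ?thesis by(simp add: shad_def)
qed

lemma shad_cong: "hyp b r r' ==> history b (shad sg r) = history b (shad sg r')"
proof(induction b rule: less_induct)
 case (less b)
 have "ans sg r c = ans sg r' c" if "c < b" for c
  unfolding ans_eq using less.IH[OF that hyp_mono[OF less.prems]] that by simp
 thus ?case unfolding shad_def using mk_cong(1)[OF less.prems] by blast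
qed

lemma pp_cong: "hyp b r r' ==> Bs c ==> suc2 c <= b ==> pp (ans sg r) r c = pp (ans sg r') r' c"
proof -
 assume h: "hyp b r r'" "Bs c" "suc2 c <= b"
 have "ans sg r d = ans sg r' d" if "d < b" for d
  unfolding ans_eq using shad_cong[OF hyp_mono[OF h(1)]] that by(simp add: less_imp_le)
 thus ?thesis using mk_cong(2)[OF h(1) _ h(2,3)] by blast
qed

text \<open>At \<open>c + 2\<close> the shadow depends on the very index about to be chosen. So
  every candidate \<open>k\<close> is written into the play, the shadow is built with it, and
  \<open>k\<close> is offered if both of its components turn out to be legal.\<close>

definition delay_st :: "('o, 'a, 'k) strategy => ('o, 'a, 'k) strategy" where
 "delay_st sg a h = (if is2 a then
  let c = opred (opred a); rk = (%k. h\<lparr>idx := (idx h)(a := k)\<rparr>)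
  in ({k. fst (dec k) : sI sg c (shad sg (rk k)) & snd (dec k) : sI sg a (shad sg (rk k))},
  %k. pp (ans sg (rk k)) (rk k) c oo sU sg a (shad sg (rk k)) (snd (dec k)),
  %k. sE sg a (shad sg (rk k)) (snd (dec k)))
 else sg a (history a (shad sg h)))"

text \<open>At an unaltered stage no index is pending, by \<open>regp_gap\<close>, so the history
  alone determines the shadow.\<close>

lemma delay_reg: "regp a ==> delay_st sg a (history a r) = sg a (history a (shad sg r))"
proof -
 assume a: "regp a"
 have "hyp a (history a r) r" unfolding hyp_def using regp_gap[OF _ _ a] history_history[of a a r] by(auto simp: history_def)
 thus ?thesis using a shad_cong by(auto simp: delay_st_def regp_def)
qed

lemma delay_is2:
 assumes c: "Bs c" and a: "a = suc2 c"
 shows "delay_st sg a (history a r) =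
  (let rk = (%k. r\<lparr>idx := (idx r)(a := k)\<rparr>)
  in ({k. fst (dec k) : sI sg c (shad sg (rk k)) & snd (dec k) : sI sg a (shad sg (rk k))},
  %k. pp (ans sg (rk k)) (rk k) c oo sU sg a (shad sg (rk k)) (snd (dec k)),
  %k. sE sg a (shad sg (rk k)) (snd (dec k))))"
proof -
 have is2: "is2 a" using c a by simp
 have ca: "c <= a" "opred (opred a) = c" using a by auto
 have hy: "hyp a ((history a r)\<lparr>idx := (idx (history a r))(a := k)\<rparr>) (r\<lparr>idx := (idx r)(a := k)\<rparr>)" for k
  unfolding hyp_def
 proof(intro conjI allI impI)
  show "history a ((history a r)\<lparr>idx := (idx (history a r))(a := k)\<rparr>) = history a (r\<lparr>idx := (idx r)(a := k)\<rparr>)"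
  unfolding history_eq_iff by(auto simp: history_def)
  fix d assume d: "d < a" "Bs d"
  show "fst (dec (idx ((history a r)\<lparr>idx := (idx (history a r))(a := k)\<rparr>) (suc2 d))) =
  fst (dec (idx (r\<lparr>idx := (idx r)(a := k)\<rparr>) (suc2 d)))"
  proof(cases "d = c")
  case False
  hence "d < c" using d a by(metis Bs_osuc less_osuc_iff order.not_eq_order_implies_strict)
  hence "suc2 d < c" using regp_gap[OF d(2) _ regp_base(2)[OF c]] by blast
  hence "suc2 d < a" using ca by simp
  thus ?thesis by(simp add: history_def)
  qed (simp add: a)
 qed
 have 1: "history a (shad sg ((history a r)\<lparr>idx := (idx (history a r))(a := k)\<rparr>)) = history a (shad sg (r\<lparr>idx := (idx r)(a := k)\<rparr>))" for k
  by(rule shad_cong[OF hy])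
 have 2: "history c (shad sg ((history a r)\<lparr>idx := (idx (history a r))(a := k)\<rparr>)) = history c (shad sg (r\<lparr>idx := (idx r)(a := k)\<rparr>))" for k
  by(rule history_mono[OF 1 ca(1)])
 have 3: "pp (ans sg ((history a r)\<lparr>idx := (idx (history a r))(a := k)\<rparr>)) ((history a r)\<lparr>idx := (idx (history a r))(a := k)\<rparr>) c
  = pp (ans sg (r\<lparr>idx := (idx r)(a := k)\<rparr>)) (r\<lparr>idx := (idx r)(a := k)\<rparr>) c" for k
  by(rule pp_cong[OF hy c]) (simp add: a)
 show ?thesis using is2 by(simp add: delay_st_def Let_def ca 1 2 3)
qed

context
 fixes cov As g C and sg :: "('o, 'a, 'k) strategy"
 assumes cs: "covering_strategy cov As C g sg"
  and Bsg': "ALL c. Bs c --> cov c & ~ cov (osuc c) & cov (suc2 c) & suc2 c < g"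
begin

lemma Bsg: "Bs c ==> cov c & ~ cov (osuc c) & cov (suc2 c) & suc2 c < g"
 using Bsg' by blast

text \<open>At the stages \<open>c + 1\<close> and \<open>c + 2\<close> the pending index is not yet
  constrained by the rules of the game, so its legality is demanded separately.\<close>

definition "goodp b r \<longleftrightarrow> is_chain C b r & follows (%a. cov a & ~ Bs a) As (delay_st sg) b r &
 (ALL c<b. Bs c --> fst (dec (idx r (suc2 c))) : sI sg c (shad sg r))"

lemma delay_follows_is2:
 assumes "Bs c" "follows (%a. cov a & ~ Bs a) As (delay_st sg) b r" "suc2 c < b"
 shows "fst (dec (idx r (suc2 c))) : sI sg c (shad sg r)"
  "snd (dec (idx r (suc2 c))) : sI sg (suc2 c) (shad sg r)"
  "link r (suc3 c) (suc2 c) = pp (ans sg r) r c oo v1 (ans sg r) r c"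
  "elt r (suc2 c) = sE sg (suc2 c) (shad sg r) (snd (dec (idx r (suc2 c))))"
proof -
 let ?a = "suc2 c"
 have rk: "r\<lparr>idx := (idx r)(?a := idx r ?a)\<rparr> = r" by simp
 have "idx r ?a : sI (delay_st sg) ?a r & link r (osuc ?a) ?a = sU (delay_st sg) ?a r (idx r ?a) & elt r ?a = sE (delay_st sg) ?a r (idx r ?a)"
  using assms(2,3) Bsg[OF assms(1)] unfolding follows_iff by auto
 thus "fst (dec (idx r ?a)) : sI sg c (shad sg r)" "snd (dec (idx r ?a)) : sI sg ?a (shad sg r)"
  "link r (osuc ?a) ?a = pp (ans sg r) r c oo v1 (ans sg r) r c" "elt r ?a = sE sg ?a (shad sg r) (snd (dec (idx r ?a)))"
  unfolding delay_is2[OF assms(1) refl] Let_def v1_def ans_eq[of sg r ?a] using rk by auto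
qed

lemma goodp_mono: "goodp b r ==> a <= b ==> goodp a r"
 unfolding goodp_def using chain_mono follows_mono by(auto intro: order_less_le_trans)

text \<open>The reason is the pullback square at each delayed cover: by \<open>uqv\<close> the
  detour of the shadow through \<open>c + 2\<close> and \<open>c + 1\<close> composes to the
  original link from \<open>c + 3\<close> to \<open>c\<close>. The facts about \<open>pp\<close> and
  \<open>v1\<close> are exported for comparing outcomes.\<close>

lemma shad_play: "goodp b r ==> b <= g ==> is_chain C b (shad sg r) & follows cov As sg b (shad sg r) &
 (ALL c. Bs c --> suc2 c < b --> pp (ans sg r) r c : hom (Dom (pp (ans sg r) r c)) (stage r (suc2 c)) &
  v1 (ans sg r) r c : hom (stage r (suc3 c)) (Dom (pp (ans sg r) r c)))"
proof(induction b rule: less_induct)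
 case (less b)
 let ?s = "shad sg r" and ?B = "ans sg r"
 let ?u = "u1 ?B r" and ?p = "pp ?B r" and ?q = "qq ?B r" and ?v = "v1 ?B r" and ?row = "row ?B r"
 have r: "is_chain C b r" "follows (%a. cov a & ~ Bs a) As (delay_st sg) b r"
  "!!c. c < b ==> Bs c ==> fst (dec (idx r (suc2 c))) : sI sg c ?s"
  using less.prems(1) by(auto simp: goodp_def)
 have IH: "is_chain C a ?s" "follows cov As sg a ?s" if "a < b" for a
  using less.IH[OF that goodp_mono[OF less.prems(1)]] that less.prems(2) by auto
 have up: "c < suc2 c" "c < suc3 c" "osuc c < suc3 c" for c :: 'k
  by simp_all
 have cv: "covers (stage ?s a) (sI sg a ?s) (sU sg a ?s) & (ALL i:sI sg a ?s. sE sg a ?s i : hom (Dom (sU sg a ?s i)) (As a))"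
  if "a < b" "cov a" for a using cs IH[OF that(1)] that less.prems(2) unfolding covering_strategy_iff by auto
 have sreg: "stage ?s a = stage r a" if "regp a" for a using that by(simp add: shad_def mk_def regp_def)
 have sone: "stage ?s (osuc c) = Dom (?u c)" if "Bs c" for c using that by(simp add: shad_def mk_def)
 have stwo: "stage ?s (suc2 c) = Dom (?p c)" if "Bs c" for c using that is12 by(simp add: shad_def mk_def)
 have lreg: "link ?s a = ?row a" if "regp a" for a using that by(auto simp: shad_def mk_def regp_def fun_eq_iff)
 have lone: "link ?s (osuc c) a = (if a = osuc c then Idn (Dom (?u c)) else ?row c a oo ?u c)" if "Bs c" for c a
  using that by(simp add: shad_def mk_def)
 have ltwo: "link ?s (suc2 c) a = (if a = suc2 c then Idn (Dom (?p c)) else if a = osuc c then ?q c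
  else ?row c a oo (?u c oo ?q c))" if "Bs c" for c a
  using that is12 by(simp add: shad_def mk_def)
 have ui: "?u c = sU sg c ?s (idx ?s c)" "idx ?s c : sI sg c ?s" "elt ?s c = sE sg c ?s (idx ?s c)" if "c < b" "Bs c" for c
  using that r(3)[OF that] ans_eq[of sg r c] by(auto simp: u1_def shad_def mk_def)
 have uh: "?u c : hom (Dom (?u c)) (stage r c)" and ue: "elt ?s c : hom (Dom (?u c)) (As c)" if "c < b" "Bs c" for c
  using cv[OF that(1)] Bsg[OF that(2)] ui[OF that] sreg[OF regp_base(2)[OF that(2)]] coversD(2,3)[of "stage ?s c" _ "sU sg c ?s"]
  by(auto simp: hom_def)
 have lh: "link r d c : hom (stage r d) (stage r c)" if "d <= b" "c <= d" for c d by(rule chainD(3)[OF r(1) that])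
 have pb: "is_pullback (link r (suc2 c) c) (?u c) (?p c) (?q c)" if "suc2 c <= b" "Bs c" for c
 proof -
  have "c < b" by(rule order_less_le_trans[OF osuc2_less that(1)])
  hence "EX pq. is_pullback (link r (suc2 c) c) (?u c) (fst pq) (snd pq)"
  using pullback_ex[of "link r (suc2 c) c" "?u c"] lh[OF that(1), of c] uh[of c] up(1)[of c] that
  by(auto simp: hom_def less_imp_le)
  thus ?thesis unfolding pp_def qq_def pq_def by(rule someI_ex)
 qed
 have pq: "?p c : hom (Dom (?p c)) (stage r (suc2 c))" "?q c : hom (Dom (?p c)) (Dom (?u c))"
  "?u c oo ?q c = link r (suc2 c) c oo ?p c" "?u c oo ?q c : hom (Dom (?p c)) (stage r c)"
  if "suc2 c <= b" "Bs c" for c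
  using pullbackD[OF pb[OF that]] lh[OF that(1), of c] up(1)[of c] by(auto simp: hom_def less_imp_le)
 have vv: "?v c : hom (stage r (suc3 c)) (Dom (?p c))" "?p c oo ?v c = link r (suc3 c) (suc2 c)"
  "elt r (suc2 c) = sE sg (suc2 c) ?s (snd (dec (idx r (suc2 c))))"
  "snd (dec (idx r (suc2 c))) : sI sg (suc2 c) ?s"
  "?v c = sU sg (suc2 c) ?s (snd (dec (idx r (suc2 c))))" if "suc2 c < b" "Bs c" for c
 proof -
  let ?a = "suc2 c"
  note f = delay_follows_is2[OF that(2) r(2) that(1)]
  show v: "?v c = sU sg ?a ?s (snd (dec (idx r ?a)))" by(simp add: v1_def ans_eq[of sg r ?a])
  have "?v c : Ar" "Cod (?v c) = Dom (?p c)"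
  using cv[OF that(1)] Bsg[OF that(2)] f(2) stwo[OF that(2)] coversD(2,3)[of "stage ?s ?a" _ "sU sg ?a ?s"] unfolding v by auto
  moreover have "Dom (link r (osuc ?a) ?a) = stage r (osuc ?a)" using lh[of "osuc ?a" ?a] that by(simp add: hom_def less_imp_le)
  ultimately show "?v c : hom (stage r (osuc ?a)) (Dom (?p c))" using f(3) pq(1)[OF less_imp_le[OF that(1)] that(2)] by(simp add: hom_def)
 qed (use delay_follows_is2[OF that(2) r(2) that(1)] in auto)
 have uqv: "?u c oo (?q c oo ?v c) = link r (suc3 c) c" if "suc2 c < b" "Bs c" for c
 proof -
  have le: "suc2 c <= b" "suc3 c <= b" using that(1) by(auto dest: osuc_lessD)
  have cl: "c <= suc2 c" "suc2 c <= suc3 c" using up[of c] by(auto simp: less_imp_le)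
  have cb: "c < b" by(rule order_less_le_trans[OF osuc2_less le(1)])
  have "?u c oo (?q c oo ?v c) = (?u c oo ?q c) oo ?v c"
  by(rule comp_assoc[OF vv(1)[OF that] pq(2)[OF le(1) that(2)] uh[OF cb that(2)], symmetric])
  also have "\<dots> = (link r (suc2 c) c oo ?p c) oo ?v c" using pq(3)[OF le(1) that(2)] by simp
  also have "\<dots> = link r (suc2 c) c oo (?p c oo ?v c)"
  by(rule comp_assoc[OF vv(1)[OF that] pq(1)[OF le(1) that(2)] lh[OF le(1) cl(1)]])
  also have "\<dots> = link r (suc3 c) c" unfolding vv(2)[OF that] by(rule chainD(4)[OF r(1) le(2) cl(2,1)])
  finally show ?thesis .
 qed
 \<comment> \<open>Links starting at unaltered stages compose with the links of \<open>r\<close>,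
   even when they end at an altered stage.\<close>
 have rowc: "?row e c = ?row d c oo link r e d" if de: "regp d" "d <= e" "e <= b" "c <= d" for c d e
 proof(cases "is1 c")
  case True
  then obtain c' where c': "c = osuc c'" "Bs c'" by(auto simp: is1_def)
  have cd: "c' < d" using c' de by simp
  hence gd: "suc2 c' < d" using regp_gap c' de by blast
  hence gb: "suc2 c' < b" and g1: "suc3 c' <= d" using de by auto
  have db: "d <= b" using de by simp
  have "?row d c oo link r e d = (?q c' oo (?v c' oo link r d (suc3 c'))) oo link r e d" using c' by(simp add: row_def)
  also have "\<dots> = ?q c' oo ((?v c' oo link r d (suc3 c')) oo link r e d)"
  by(rule comp_assoc[OF lh[OF de(3,2)] Cmp_hom[OF vv(1)[OF gb c'(2)] lh[OF db g1]] pq(2)[OF less_imp_le[OF gb] c'(2)]])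
  also have "(?v c' oo link r d (suc3 c')) oo link r e d = ?v c' oo (link r d (suc3 c') oo link r e d)"
  by(rule comp_assoc[OF lh[OF de(3,2)] lh[OF db g1] vv(1)[OF gb c'(2)]])
  also have "link r d (suc3 c') oo link r e d = link r e (suc3 c')" by(rule chainD(4)[OF r(1) de(3,2) g1])
  finally show ?thesis using c' by(simp add: row_def)
 next
  case F: False
  show ?thesis
  proof(cases "is2 c")
  case True
  then obtain c' where c': "c = suc2 c'" "Bs c'" by(auto simp: is2_def)
  have cd: "c' < d" using c' de by(auto dest: osuc_lessD)
  hence gd: "suc2 c' < d" using regp_gap c' de by blast
  hence gb: "suc2 c' < b" and g1: "suc3 c' <= d" using de by auto
  have db: "d <= b" using de by simp
  have "?row d c oo link r e d = (?v c' oo link r d (suc3 c')) oo link r e d" using c' F by(simp add: row_def)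
  also have "\<dots> = ?v c' oo (link r d (suc3 c') oo link r e d)"
  by(rule comp_assoc[OF lh[OF de(3,2)] lh[OF db g1] vv(1)[OF gb c'(2)]])
  also have "link r d (suc3 c') oo link r e d = link r e (suc3 c')" by(rule chainD(4)[OF r(1) de(3,2) g1])
  finally show ?thesis using c' F by(simp add: row_def)
  next
  case False
  thus ?thesis using F chainD(4)[OF r(1) de(3,2,4)] by(simp add: row_def)
  qed
 qed
 have rowh: "?row d c : hom (stage r d) (stage ?s c)" if de: "regp d" "d <= b" "c <= d" for c d
 proof(cases "is1 c")
  case True
  then obtain c' where c': "c = osuc c'" "Bs c'" by(auto simp: is1_def)
  have cd: "c' < d" using c' de by simp
  hence gd: "suc2 c' < d" using regp_gap c' de by blast
  hence gb: "suc2 c' < b" and g1: "suc3 c' <= d" using de by auto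
  show ?thesis using Cmp_hom[OF pq(2)[OF less_imp_le[OF gb] c'(2)] Cmp_hom[OF vv(1)[OF gb c'(2)] lh[OF de(2) g1]]] c' sone[OF c'(2)]
  by(simp add: row_def)
 next
  case F: False
  show ?thesis
  proof(cases "is2 c")
  case True
  then obtain c' where c': "c = suc2 c'" "Bs c'" by(auto simp: is2_def)
  have cd: "c' < d" using c' de by(auto dest: osuc_lessD)
  hence gd: "suc2 c' < d" using regp_gap c' de by blast
  hence gb: "suc2 c' < b" and g1: "suc3 c' <= d" using de by auto
  show ?thesis using Cmp_hom[OF vv(1)[OF gb c'(2)] lh[OF de(2) g1]] c' F stwo[OF c'(2)] by(simp add: row_def)
  next
  case False
  thus ?thesis using F lh[OF de(2,3)] sreg[of c] by(simp add: row_def regp_def)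
  qed
 qed
 have rowid: "?row d d = Idn (stage r d)" if "regp d" "d <= b" for d
  using that chainD(2)[OF r(1) that(2)] by(simp add: row_def regp_def)
 have "is_chain C b ?s"
 proof(rule is_chainI)
  show "C : Ob" by(rule chain_Ob[OF r(1)])
  show "stage ?s ozero = C" using chain_zero[OF r(1)] sreg[OF regp_base(1)] by simp
  show "link ?s d d = Idn (stage ?s d)" if d: "d <= b" for d
  proof(cases "regp d")
  case True
  thus ?thesis using lreg[OF True] rowid[OF True d] sreg[OF True] by simp
  next
  case False
  hence "(EX c. d = osuc c & Bs c) \<or> (EX c. d = suc2 c & Bs c)" by(auto simp: regp_def is1_def is2_def)
  thus ?thesis using lone ltwo sone stwo by auto
  qed
 next
  fix a assume a: "a < b"
  have main: "link ?s (osuc a) a : hom (stage ?s (osuc a)) (stage ?s a) &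
  (ALL c<=a. link ?s (osuc a) c = link ?s a c oo link ?s (osuc a) a)"
  proof(cases "Bs a")
  case True
  note ra = regp_base(2)[OF True]
  have l: "link ?s (osuc a) a = ?u a" using lone[OF True, of a] rowid[OF ra] a uh[OF a True] by(simp add: hom_def)
  show ?thesis unfolding l using uh[OF a True] lone[OF True] sone[OF True] sreg[OF ra] lreg[OF ra]
  by(auto simp: less_imp_le)
  next
  case nB: False
  show ?thesis
  proof(cases "is1 a")
  case True
  then obtain c where c: "a = osuc c" "Bs c" by(auto simp: is1_def)
  have cb: "c < b" using a c by(metis less_osuc order_less_trans)
  have le: "suc2 c <= b" using a c by simp
  have l: "link ?s (osuc a) a = ?q c" using ltwo[OF c(2), of a] c by simp
  have "link ?s (osuc a) d = link ?s a d oo ?q c" if d: "d <= a" for d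
  proof(cases "d = osuc c")
  case True
  thus ?thesis using l c lone[OF c(2)] pq(2)[OF le c(2)] by(auto simp: hom_def)
  next
  case False
  hence dc: "d <= c" using d c by(metis less_osuc_iff order.not_eq_order_implies_strict)
  hence "d ~= suc2 c" by(metis not_le osuc2_less)
  hence "link ?s (osuc a) d = ?row c d oo (?u c oo ?q c)" using ltwo[OF c(2), of d] False c by simp
  also have "\<dots> = (?row c d oo ?u c) oo ?q c"
  by(rule comp_assoc[OF pq(2)[OF le c(2)] uh[OF cb c(2)] rowh[OF regp_base(2)[OF c(2)] less_imp_le[OF cb] dc], symmetric])
  finally show ?thesis using lone[OF c(2), of d] False c by simp
  qed
  thus ?thesis unfolding l using pq(2)[OF le c(2)] c sone[OF c(2)] stwo[OF c(2)] by simp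
  next
  case n1: False
  show ?thesis
  proof(cases "is2 a")
  case True
  then obtain c where c: "a = suc2 c" "Bs c" by(auto simp: is2_def)
  have cb: "c < b" using a c by(auto dest: osuc_lessD)
  have lt: "suc2 c < b" using a c by simp
  have ro: "regp (osuc a)" using n1 True is12(3)[OF True] nB by(auto simp: regp_def)
  have oab: "osuc a <= b" using a by simp
  have l3: "link r (osuc a) (osuc a) = Idn (stage r (osuc a))" by(rule chainD(2)[OF r(1) oab])
  note v = vv(1)[OF lt c(2), folded c(1)]
  have l: "link ?s (osuc a) a = ?v c" using lreg[OF ro] n1 True l3 c v by(simp add: row_def hom_def)
  have "link ?s (osuc a) d = link ?s a d oo ?v c" if d: "d <= a" for d
  proof -
  consider "d = suc2 c" | "d = osuc c" | "d <= c" using d c by(metis less_osuc_iff order.not_eq_order_implies_strict)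
  thus ?thesis
  proof cases
  case 1
  thus ?thesis using l c ltwo[OF c(2)] v by(simp add: hom_def)
  next
  case 2
  thus ?thesis using lreg[OF ro] l3 c v ltwo[OF c(2), of d] by(simp add: row_def hom_def)
  next
  case 3
  have rc: "regp c" by(rule regp_base(2)[OF c(2)])
  have "link ?s (osuc a) d = ?row c d oo link r (osuc a) c" unfolding lreg[OF ro]
  by(rule rowc[OF rc _ oab 3]) (insert c up(2)[of c], simp add: less_imp_le)
  also have "\<dots> = ?row c d oo (?u c oo (?q c oo ?v c))" using uqv[OF lt c(2)] c by simp
  also have "?u c oo (?q c oo ?v c) = (?u c oo ?q c) oo ?v c"
  by(rule comp_assoc[OF v pq(2)[OF less_imp_le[OF lt] c(2)] uh[OF cb c(2)], symmetric])
  also have "?row c d oo ((?u c oo ?q c) oo ?v c) = (?row c d oo (?u c oo ?q c)) oo ?v c"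
  by(rule comp_assoc[OF v pq(4)[OF less_imp_le[OF lt] c(2)] rowh[OF rc less_imp_le[OF cb] 3], symmetric])
  moreover have "d ~= osuc c" "d ~= suc2 c" using 3 by(metis not_le osuc2_less less_osuc)+
  ultimately show ?thesis using ltwo[OF c(2), of d] c by simp
  qed
  qed
  thus ?thesis unfolding l using v c stwo[OF c(2)] sreg[OF ro] by simp
  next
  case n2: False
  have ra: "regp a" "regp (osuc a)" using nB n1 n2 by(auto simp: regp_def)
  have oab: "osuc a <= b" using a by simp
  have l: "link ?s (osuc a) a = link r (osuc a) a" using lreg[OF ra(2)] n1 n2 by(simp add: row_def)
  show ?thesis unfolding l unfolding lreg[OF ra(2)] lreg[OF ra(1)]
  using lh[OF oab] sreg[OF ra(1)] sreg[OF ra(2)] rowc[OF ra(1) _ oab] by(simp add: less_imp_le)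
  qed
  qed
  qed
  thus "link ?s (osuc a) a : hom (stage ?s (osuc a)) (stage ?s a)" by blast
  show "link ?s (osuc a) c = link ?s a c oo link ?s (osuc a) a" if "c <= a" for c using main that by blast
 next
  fix l assume l: "is_lim l" "l <= b" "!!a. a < l ==> is_chain C a ?s"
  have rl: "regp l" using l(1) regp_base(1) by(simp add: obase_def)
  have "is_limit {..<l} (stage ?s) (chainE (link ?s)) (stage r l) (link ?s l)"
  \<comment> \<open>Among three consecutive stages at least one is unaltered, so these are cofinal
    below a limit.\<close>
  proof(rule cofinal_limit[where Reg = "{a. regp a}" and q = "%c. c", OF _ _ _ _ _ _ _ _ chainD(5)[OF r(1) l(2,1)]])
  show "chn l (stage ?s) (link ?s)" unfolding chn_def using l(3) chainD by(meson order_refl)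
  show "chn l (stage r) (link r)" by(rule chain_chn[OF r(1) l(2)])
  have nx: "EX d:{a. regp a}. c <= d & d < l" if c: "c < l" for c
  proof(cases "regp c")
  case False
  note ol = is_lim_osuc_less[OF l(1)]
  have "regp (osuc c) \<or> regp (suc2 c)" using False is12 by(auto simp: regp_def)
  moreover have "c <= osuc c" "c <= suc2 c" using up(1)[of c] by(auto simp: less_imp_le)
  ultimately show ?thesis using ol[OF c] ol[OF ol[OF c]] by blast
  qed (use c in auto)
  thus "EX d:{a. regp a}. c <= d & d < l" if "c < l" for c using that by blast
  show "EX d:{a. regp a}. d < l & c <= d" if "c < l" for c using nx[OF that] by blast
  show "link ?s d c = link r d c" if "c : {a. regp a}" "d : {a. regp a}" for c d
  using that lreg[of d] by(auto simp: row_def regp_def)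
  show "link ?s l c = link r l c" if "c : {a. regp a}" for c
  using that lreg[OF rl] by(auto simp: row_def regp_def)
  show "link ?s d c oo link ?s l d = link ?s l c" if "c <= d" "d < l" "d : {a. regp a}" for c d
  using that rowc[of d l c] l(2) lreg[of d] lreg[OF rl] by(auto simp: row_def regp_def less_imp_le)
  qed (use sreg in auto)
  thus "is_limit {..<l} (stage ?s) (chainE (link ?s)) (stage ?s l) (link ?s l)" using sreg[OF rl] by simp
 qed
 moreover have "follows cov As sg b ?s" unfolding follows_iff
 proof(intro allI impI)
  fix a assume a: "a < b"
  have ra: "elt r a : hom (stage r (osuc a)) (As a)" using r(2) a unfolding follows_iff by blast
  show "elt ?s a : hom (stage ?s (osuc a)) (As a) & (cov a --> idx ?s a : sI sg a ?s &
  link ?s (osuc a) a = sU sg a ?s (idx ?s a) & elt ?s a = sE sg a ?s (idx ?s a))"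
  proof(cases "Bs a")
  case True
  note rga = regp_base(2)[OF True]
  have "link ?s (osuc a) a = ?u a" using lone[OF True, of a] rowid[OF rga] a uh[OF a True] by(simp add: hom_def)
  thus ?thesis using ui[OF a True] ue[OF a True] sone[OF True] by simp
  next
  case nB: False
  show ?thesis
  proof(cases "is1 a")
  case True
  then obtain c where c: "a = osuc c" "Bs c" by(auto simp: is1_def)
  have le: "suc2 c <= b" using a c by simp
  have "elt ?s a = elt r a oo ?p c" using c by(simp add: shad_def mk_def)
  moreover have "elt r a oo ?p c : hom (Dom (?p c)) (As a)" by(rule Cmp_hom[OF ra]) (use pq(1)[OF le c(2)] c in simp)
  ultimately show ?thesis using stwo[OF c(2)] c Bsg[OF c(2)] by simp
  next
  case n1: False
  hence es: "elt ?s a = elt r a" using nB by(simp add: shad_def mk_def)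
  have ro: "regp (osuc a)" using n1 nB by(auto simp: regp_def)
  show ?thesis
  proof(cases "is2 a")
  case True
  then obtain c where c: "a = suc2 c" "Bs c" by(auto simp: is2_def)
  have lt: "suc2 c < b" using a c by simp
  have oab: "osuc a <= b" using a by simp
  have l3: "link r (osuc a) (osuc a) = Idn (stage r (osuc a))" by(rule chainD(2)[OF r(1) oab])
  note v = vv[OF lt c(2), folded c(1)]
  have l: "link ?s (osuc a) a = ?v c" using lreg[OF ro] n1 True l3 c v(1) by(simp add: row_def hom_def)
  have "idx ?s a = snd (dec (idx r a))" using True nB by(simp add: shad_def mk_def)
  thus ?thesis using l v es ra sreg[OF ro] by simp
  next
  case n2: False
  have rga: "regp a" using n1 n2 by(auto simp: regp_def)
  have l: "link ?s (osuc a) a = link r (osuc a) a" using lreg[OF ro] n1 n2 by(simp add: row_def)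
  have i: "idx ?s a = idx r a" using nB n2 by(simp add: shad_def mk_def)
  have "cov a --> idx r a : sI sg a ?s & link r (osuc a) a = sU sg a ?s (idx r a) & elt r a = sE sg a ?s (idx r a)"
  using r(2) a nB unfolding follows_iff delay_reg[OF rga, symmetric] by auto
  thus ?thesis unfolding es i l sreg[OF ro] using ra by blast
  qed
  qed
  qed
 qed
 ultimately show ?case using pq(1)[OF less_imp_le] vv(1) by blast
qed

end

end

text \<open>A play and its shadow have different elements at the stages of \<open>Bs\<close>, so
  \<open>W'\<close> may rely only on the others. At \<open>c + 2\<close> the family offered is a
  composite: the family for \<open>c\<close> pulled back, and then, on each member, the family for
  \<open>c + 2\<close>.\<close>

theorem wins_delay:
 assumes w: "wins cov As g C W"
  and Bs: "!!c. Bs c ==> obase c & cov c & ~ cov (osuc c) & cov (suc2 c) & suc2 c < g"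
  and W: "!!k e e'. W k e ==> (!!a. a < g ==> ~ Bs a ==> e a = e' a) ==> W' k e'"
 shows "wins (%a. cov a & ~ Bs a) As g C W'"
proof -
 obtain sg where sg: "covering_strategy cov As C g sg"
  "!!r. is_chain C g r ==> follows cov As sg g r ==> W (link r g ozero) (%a. elt r a oo link r g (osuc a))"
  using w unfolding wins_def by blast
 obtain pr :: "'k \<times> 'k => 'k" where pr: "inj pr" using pair_code by blast
 define dec where "dec = inv pr"
 have dec: "dec (pr x) = x" for x using pr by(simp add: dec_def)
 have Bb: "ALL c. Bs c --> obase c" using Bs by blast
 have Bg: "ALL c. Bs c --> cov c & ~ cov (osuc c) & cov (suc2 c) & suc2 c < g" using Bs by blast
 let ?cov = "%a. cov a & ~ Bs a"
 let ?tt = "delay_st Bs dec sg" and ?sh = "shad Bs dec sg" and ?reg = "regp Bs"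
 note SP = shad_play[where Bs = Bs and dec = dec and cov = cov and As = As and C = C and g = g and sg = sg, OF Bb sg(1) Bg]
 note GD = goodp_def[where Bs = Bs and dec = dec and cov = cov and As = As and C = C and g = g and sg = sg, OF Bb sg(1) Bg]
 have up: "c < suc2 c" for c :: 'k by(rule order_less_trans[of _ "osuc c"]) simp_all
 have good: "goodp Bs dec cov As C sg a r" if "?reg a" "is_chain C a r" "follows ?cov As ?tt a r" for a r
  unfolding GD
  using that regp_gap[OF Bb _ _ that(1)] delay_follows_is2(1)[OF Bb sg(1) Bg _ that(3)] by blast
 \<comment> \<open>At \<open>c + 2\<close> a legal index first has to be written into the play
   before its shadow makes sense.\<close>
 have goodk: "goodp Bs dec cov As C sg a (r\<lparr>idx := (idx r)(a := k)\<rparr>)"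
  if c: "Bs c" "a = suc2 c" and r: "is_chain C a r" "follows ?cov As ?tt a r"
  and k: "fst (dec k) : sI sg c (?sh r)" for a c k r
 proof -
  let ?r = "r\<lparr>idx := (idx r)(a := k)\<rparr>"
  have h: "history a ?r = history a r" unfolding history_eq_iff by auto
  have hc: "hyp Bs dec c ?r r" if "Bs c" "c < a" for c
  unfolding hyp_def[OF Bb]
  proof(intro conjI allI impI)
  show "history c ?r = history c r" by(rule history_mono[OF h]) (use that in simp)
  fix d assume "d < c" "Bs d"
  hence "suc2 d < c" using regp_gap[OF Bb, of d c] regp_base(2)[OF Bb \<open>Bs c\<close>] by blast
  hence "suc2 d ~= a" using that by auto
  thus "fst (dec (idx ?r (suc2 d))) = fst (dec (idx r (suc2 d)))" by simp
  qed
  have "is_chain C a ?r" "follows ?cov As ?tt a ?r" using r chain_cong[OF h] follows_cong[OF h] by auto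
  moreover have "fst (dec (idx ?r (suc2 d))) : sI sg d (?sh ?r)" if d: "d < a" "Bs d" for d
  proof -
  have e: "history d (?sh ?r) = history d (?sh r)" by(rule shad_cong[OF Bb hc[OF d(2,1)]])
  show ?thesis
  proof(cases "d = c")
  case True
  thus ?thesis using e k c by simp
  next
  case False
  hence "d < c" using d c Bs_osuc[OF Bb] by(metis less_osuc_iff order.not_eq_order_implies_strict)
  hence "suc2 d < c" using regp_gap[OF Bb, of d c] regp_base(2)[OF Bb c(1)] d by blast
  hence da: "suc2 d < a" using c by(metis order_less_trans osuc2_less)
  have "fst (dec (idx r (suc2 d))) : sI sg d (?sh r)"
  by(rule delay_follows_is2(1)[OF Bb sg(1) Bg d(2) r(2) da])
  thus ?thesis using e da by auto
  qed
  qed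
  ultimately show ?thesis unfolding GD by blast
 qed
 show ?thesis unfolding wins_def
 proof(intro exI[of _ ?tt] conjI allI impI)
  show "covering_strategy ?cov As C g ?tt" unfolding covering_strategy_iff
  proof(intro allI impI)
  fix a r assume a: "a < g" "cov a & ~ Bs a" and r: "is_chain C a r" "follows ?cov As ?tt a r"
  show "covers (stage r a) (sI ?tt a r) (sU ?tt a r) & (ALL i:sI ?tt a r. sE ?tt a r i : hom (Dom (sU ?tt a r i)) (As a))"
  proof(cases "?reg a")
  case True
  have s: "is_chain C a (?sh r)" "follows cov As sg a (?sh r)"
  using SP[OF good[OF True r] less_imp_le[OF a(1)]] by auto
  have "stage (?sh r) a = stage r a" using True by(simp add: shad_def[OF Bb] mk_def[OF Bb] regp_def[OF Bb])
  moreover have "covers (stage (?sh r) a) (sI sg a (?sh r)) (sU sg a (?sh r)) &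
  (ALL i:sI sg a (?sh r). sE sg a (?sh r) i : hom (Dom (sU sg a (?sh r) i)) (As a))"
  using sg(1) s a unfolding covering_strategy_iff by blast
  ultimately show ?thesis unfolding delay_reg[OF Bb True] by simp
  next
  case False
  have "~ is1 Bs a" using a Bs by(auto simp: is1_def[OF Bb])
  hence "is2 Bs a" using False by(simp add: regp_def[OF Bb])
  then obtain c where c: "a = suc2 c" "Bs c" by(auto simp: is2_def[OF Bb])
  have ca: "c < a" using c up by simp
  let ?rk = "%k. r\<lparr>idx := (idx r)(a := k)\<rparr>"
  let ?I = "sI sg c (?sh r)"
  have hk: "history a (?rk k) = history a r" for k unfolding history_eq_iff by auto
  have hyc: "hyp Bs dec c (?rk k) r" for k
  unfolding hyp_def[OF Bb]
  proof(intro conjI allI impI)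
  show "history c (?rk k) = history c r" by(rule history_mono[OF hk]) (use ca in simp)
  fix d assume "d < c" "Bs d"
  hence "suc2 d < c" using regp_gap[OF Bb, of d c] regp_base(2)[OF Bb c(2)] by blast
  hence "suc2 d ~= a" using ca by auto
  thus "fst (dec (idx (?rk k) (suc2 d))) = fst (dec (idx r (suc2 d)))" by simp
  qed
  have Ic: "history c (?sh (?rk k)) = history c (?sh r)" for k by(rule shad_cong[OF Bb hyc])
  have hya: "hyp Bs dec a (?rk k) (?rk k')" if "fst (dec k) = fst (dec k')" for k k'
  unfolding hyp_def[OF Bb] using hk that by auto
  have tau: "?tt a (history a r) = ({k. fst (dec k) : ?I & snd (dec k) : sI sg a (?sh (?rk k))},
  %k. pp dec (ans Bs dec sg (?rk k)) (?rk k) c oo sU sg a (?sh (?rk k)) (snd (dec k)),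
  %k. sE sg a (?sh (?rk k)) (snd (dec k)))"
  unfolding delay_is2[OF Bb c(2,1)] Let_def Ic by simp
  have gk: "is_chain C a (?sh (?rk k))" "follows cov As sg a (?sh (?rk k))" if "fst (dec k) : ?I" for k
  using SP[OF goodk[OF c(2,1) r that] less_imp_le[OF a(1)]] by auto
  have sa: "stage (?sh (?rk k)) a = Dom (pp dec (ans Bs dec sg (?rk k)) (?rk k) c)" for k
  using c Bs by(simp add: shad_def[OF Bb] mk_def[OF Bb] is1_osuc[OF Bb] is2_osuc[OF Bb] Bs_osuc[OF Bb])
  have cvk: "covers (stage (?sh (?rk k)) a) (sI sg a (?sh (?rk k))) (sU sg a (?sh (?rk k))) &
  (ALL i:sI sg a (?sh (?rk k)). sE sg a (?sh (?rk k)) i : hom (Dom (sU sg a (?sh (?rk k)) i)) (As a))"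
  if "fst (dec k) : ?I" for k
  using sg(1) gk[OF that] a unfolding covering_strategy_iff by blast
  have sc: "is_chain C c (?sh r)" "follows cov As sg c (?sh r)"
  using SP[OF good[OF regp_base(2)[OF Bb c(2)], of r]] chain_mono[OF r(1)] follows_mono[OF r(2)] ca a by(auto simp: less_imp_le)
  have stc: "stage (?sh r) c = stage r c" using regp_base(2)[OF Bb c(2)] by(simp add: shad_def[OF Bb] mk_def[OF Bb] regp_def[OF Bb])
  have cvc: "covers (stage r c) ?I (sU sg c (?sh r))"
  proof -
  have "c < g" using ca a(1) by simp
  hence "covers (stage (?sh r) c) ?I (sU sg c (?sh r))"
  using sg(1) sc Bs[OF c(2)] unfolding covering_strategy_iff by blast
  thus ?thesis unfolding stc .
  qed
  have lh: "link r a c : hom (stage r a) (stage r c)" by(rule chainD(3)[OF r(1) order_refl]) (use ca in simp)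
  \<comment> \<open>\<open>pp\<close> depends only on the first component of the index;
    \<open>ozero\<close> merely fills the second.\<close>
  let ?ki = "%i. pr (i, ozero)"
  let ?P = "%i. pp dec (ans Bs dec sg (?rk (?ki i))) (?rk (?ki i)) c"
  have pbi: "is_pullback (link r a c) (sU sg c (?sh r) i) (?P i) (qq dec (ans Bs dec sg (?rk (?ki i))) (?rk (?ki i)) c)" if i: "i : ?I" for i
  proof -
  let ?k = "?ki i"
  have u: "u1 dec (ans Bs dec sg (?rk ?k)) (?rk ?k) c = sU sg c (?sh r) i"
  by(simp add: u1_def[OF Bb] ans_eq[OF Bb] Ic c(1)[symmetric] dec)
  have "EX pq. is_pullback (link r a c) (sU sg c (?sh r) i) (fst pq) (snd pq)"
  using pullback_ex[of "link r a c" "sU sg c (?sh r) i"] lh coversD(2,3)[OF cvc] i by(auto simp: hom_def)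
  moreover have lk: "link (?rk ?k) = link r" by simp
  ultimately show ?thesis unfolding pp_def[OF Bb] qq_def[OF Bb] pq_def[OF Bb] u c(1)[symmetric] lk by - (rule someI_ex)
  qed
  have cvP: "covers (stage r a) ?I ?P" using covers_pb[OF cvc _ _ pbi] lh by(auto simp: hom_def)
  have "covers (stage r a) (sI ?tt a r) (sU ?tt a r)"
  proof(rule covers_comp[OF cvP])
  show "covers (Dom (?P i)) (sI sg a (?sh (?rk (?ki i)))) (sU sg a (?sh (?rk (?ki i))))" if "i : ?I" for i
  using cvk[of "?ki i"] that dec sa[of "?ki i"] by simp
  fix i j assume ij: "i : ?I" "j : sI sg a (?sh (?rk (?ki i)))"
  have hy: "hyp Bs dec a (?rk (pr (i, j))) (?rk (?ki i))" by(rule hya) (simp add: dec)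
  note e = shad_cong[OF Bb hy] pp_cong[OF Bb hy c(2), of sg]
  have "pr (i, j) : sI ?tt a r" "sU ?tt a r (pr (i, j)) = ?P i oo sU sg a (?sh (?rk (?ki i))) j"
  unfolding tau using ij e c(1) by(auto simp: dec)
  thus "EX k:sI ?tt a r. sU ?tt a r k = ?P i oo sU sg a (?sh (?rk (?ki i))) j" by blast
  next
  fix k assume "k : sI ?tt a r"
  hence k: "fst (dec k) : ?I" "snd (dec k) : sI sg a (?sh (?rk k))" unfolding tau by auto
  let ?i = "fst (dec k)"
  have hy: "hyp Bs dec a (?rk k) (?rk (?ki ?i))" by(rule hya) (simp add: dec)
  have pe: "pp dec (ans Bs dec sg (?rk k)) (?rk k) c = ?P ?i" using pp_cong[OF Bb hy c(2), of sg] c(1) by simp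
  have "sU sg a (?sh (?rk k)) (snd (dec k)) : Ar & Cod (sU sg a (?sh (?rk k)) (snd (dec k))) = Dom (?P ?i)"
  using cvk[OF k(1)] k(2) sa[of k] pe coversD(2,3)[of "stage (?sh (?rk k)) a"] by auto
  thus "sU ?tt a r k : Ar & Cod (sU ?tt a r k) = stage r a"
  unfolding tau using pe coversD(2,3)[OF cvP k(1)] by simp
  qed
  moreover have "sE ?tt a r k : hom (Dom (sU ?tt a r k)) (As a)" if "k : sI ?tt a r" for k
  proof -
  have k: "fst (dec k) : ?I" "snd (dec k) : sI sg a (?sh (?rk k))" using that unfolding tau by auto
  have hy: "hyp Bs dec a (?rk k) (?rk (?ki (fst (dec k))))" by(rule hya) (simp add: dec)
  have pe: "pp dec (ans Bs dec sg (?rk k)) (?rk k) c = ?P (fst (dec k))" using pp_cong[OF Bb hy c(2), of sg] c(1) by simp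
  have "sU sg a (?sh (?rk k)) (snd (dec k)) : Ar & Cod (sU sg a (?sh (?rk k)) (snd (dec k))) = Dom (?P (fst (dec k)))"
  using cvk[OF k(1)] k(2) sa[of k] pe coversD(2,3)[of "stage (?sh (?rk k)) a"] by auto
  thus ?thesis unfolding tau using pe coversD(2,3)[OF cvP k(1)] cvk[OF k(1)] k(2) by simp
  qed
  ultimately show ?thesis by blast
  qed
  qed
 next
  fix r assume r: "is_chain C g r" "follows ?cov As ?tt g r"
  \<comment> \<open>Since \<open>suc2 c < g\<close> for every \<open>c\<close> in \<open>Bs\<close>,
    the end of the play is an unaltered stage and its shadow has the same last object.\<close>
  have rg: "?reg g" using Bs by(auto simp: regp_def[OF Bb] is1_def[OF Bb] is2_def[OF Bb]) (metis less_irrefl less_osuc order_less_trans)+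
  have gd: "goodp Bs dec cov As C sg g r" by(rule good[OF rg r])
  have s: "is_chain C g (?sh r)" "follows cov As sg g (?sh r)" using SP[OF gd order_refl] by auto
  have w: "W (link (?sh r) g ozero) (%a. elt (?sh r) a oo link (?sh r) g (osuc a))" by(rule sg(2)[OF s])
  note simps = shad_def[OF Bb] mk_def[OF Bb] regp_def[OF Bb] row_def[OF Bb] is1_osuc[OF Bb] is2_osuc[OF Bb] Bs_osuc[OF Bb]
  have l0: "link (?sh r) g ozero = link r g ozero" using rg base_not[OF Bb, of ozero] by(simp add: simps)
  show "W' (link r g ozero) (%a. elt r a oo link r g (osuc a))"
  proof(rule W[OF w[unfolded l0]])
  fix a assume a: "a < g" "~ Bs a"
  show "elt (?sh r) a oo link (?sh r) g (osuc a) = elt r a oo link r g (osuc a)"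
  proof(cases "is1 Bs a")
  case True
  then obtain c where c: "a = osuc c" "Bs c" by(auto simp: is1_def[OF Bb])
  let ?p = "pp dec (ans Bs dec sg r) r c" and ?v = "v1 dec (ans Bs dec sg r) r c"
  have lt: "suc2 c < g" using Bs[OF c(2)] by simp
  have le: "suc3 c <= g" using lt by simp
  have c2: "suc2 c <= suc3 c" by(simp add: less_imp_le)
  have pv: "link r (suc3 c) (suc2 c) = ?p oo ?v"
  by(rule delay_follows_is2(3)[OF Bb sg(1) Bg c(2) r(2) lt])
  have lo: "link (?sh r) g (osuc a) = ?v oo link r g (suc3 c)" using rg c a by(simp add: simps)
  have ea: "elt (?sh r) a = elt r a oo ?p" using c a by(simp add: simps)
  have pvh: "?p : hom (Dom ?p) (stage r (suc2 c))" "?v : hom (stage r (suc3 c)) (Dom ?p)"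
  using SP[OF gd order_refl] c(2) lt by blast+
  have lgh: "link r g (suc3 c) : hom (stage r g) (stage r (suc3 c))"
  by(rule chainD(3)[OF r(1) order_refl le])
  have eah: "elt r a : hom (stage r (suc2 c)) (As a)" using r(2) a c(1) unfolding follows_iff by blast
  have "elt (?sh r) a oo link (?sh r) g (osuc a) = (elt r a oo ?p) oo (?v oo link r g (suc3 c))"
  using ea lo by simp
  also have "\<dots> = elt r a oo (?p oo (?v oo link r g (suc3 c)))"
  by(rule comp_assoc[OF Cmp_hom[OF pvh(2) lgh] pvh(1) eah])
  also have "?p oo (?v oo link r g (suc3 c)) = (?p oo ?v) oo link r g (suc3 c)"
  by(rule comp_assoc[OF lgh pvh(2) pvh(1), symmetric])
  also have "\<dots> = link r g (suc2 c)" unfolding pv[symmetric] by(rule chainD(4)[OF r(1) order_refl le c2])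
  finally show ?thesis using c(1) by simp
  next
  case n1: False
  have ea: "elt (?sh r) a = elt r a" using n1 a by(simp add: simps)
  have "~ is1 Bs (osuc a)" "~ is2 Bs (osuc a)" using n1 a is1_osuc[OF Bb] is2_osuc[OF Bb] by auto
  hence "link (?sh r) g (osuc a) = link r g (osuc a)" using rg by(simp add: simps)
  thus ?thesis using ea by simp
  qed
  qed
 qed
qed


subsubsection \<open>Determined families\<close>

text \<open>The universal property of the ambient product, its second factor spread over the stages.
  Existence and uniqueness of tuples are separate clauses because they are used separately.\<close>

definition is_prodZ :: "'o => 'k => ('k => 'o) => 'o => 'a => ('k => 'a) => bool" where
 "is_prodZ A g As Z pA pr \<longleftrightarrow> pA : hom Z A & (ALL a<g. pr a : hom Z (As a)) &
  (ALL X k e. k : hom X A --> (ALL a<g. e a : hom X (As a)) -->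
  (EX w : hom X Z. pA oo w = k & (ALL a<g. pr a oo w = e a))) &
  (ALL X. ALL w:hom X Z. ALL w':hom X Z. pA oo w = pA oo w' --> (ALL a<g. pr a oo w = pr a oo w') --> w = w')"

lemma prodZ_D:
 assumes "is_prodZ A g As Z pA pr"
 shows "pA : hom Z A" "a < g ==> pr a : hom Z (As a)"
  "k : hom X A ==> (!!a. a < g ==> e a : hom X (As a)) ==> EX w : hom X Z. pA oo w = k & (ALL a<g. pr a oo w = e a)"
  "w : hom X Z ==> w' : hom X Z ==> pA oo w = pA oo w' ==> (!!a. a < g ==> pr a oo w = pr a oo w') ==> w = w'"
 using assms unfolding is_prodZ_def by blast+

text \<open>Winning arrows form a sieve. That outcomes survive restriction, as
  \<open>wins_restrict\<close> demands, is closure of the target \<open>S\<close> under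
  composition.\<close>

lemma in_T_restrict:
 assumes l: "in_T cov g As pA pr S l" "l : Ar" and p: "p : Ar" "Cod p = Dom l"
  and Z: "is_prodZ (Cod l) g As Z pA pr" and S: "S : Sub Z"
  and nc: "~ (cov ozero & cov (osuc ozero))" and g: "ozero < g"
 shows "in_T cov g As pA pr S (l oo p)"
proof -
 let ?W = "%k e. EX w:S. Dom w = Dom k & pA oo w = l oo k & (ALL a<g. pr a oo w = e a)"
 have "wins cov As g (Dom p) (%k e. ?W (p oo k) e)"
 proof(rule wins_restrict[OF l(1)[unfolded in_T_iff] _ nc g])
  show "p : hom (Dom p) (Dom l)" using p by(simp add: hom_def)
 next
  fix k e h assume v: "valid As g (Dom l) k e" and W: "?W k e" and h: "h : Ar" "Cod h = Dom k"
  then obtain w where w: "w : S" "Dom w = Dom k" "pA oo w = l oo k" "ALL a<g. pr a oo w = e a" by blast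
  have wA: "w : Ar" "Cod w = Z" using SubD[OF S w(1)] by auto
  have kA: "k : Ar" "Cod k = Dom l" using v by(auto simp: valid_def)
  have wS: "w oo h : S" by(rule Sub_comp[OF S w(1)]) (use h w in auto)
  have pa: "pA oo (w oo h) = (pA oo w) oo h"
  by(rule comp_assoc[of h _ "Dom k" w Z pA "Cod l", symmetric]) (insert wA h w prodZ_D(1)[OF Z], auto simp: hom_def)
  have "(l oo k) oo h = l oo (k oo h)"
  by(rule comp_assoc[of h _ "Dom k" k "Dom l" l "Cod l"]) (insert kA h l(2), auto simp: hom_def)
  hence "pA oo (w oo h) = l oo (k oo h)" using pa w(3) by(simp only:)
  moreover note wS
  moreover have "pr a oo (w oo h) = e a oo h" if "a < g" for a
  proof -
  have "pr a oo (w oo h) = (pr a oo w) oo h" using wA h w prodZ_D(2)[OF Z that] by(simp add: hom_def)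
  thus ?thesis using w that by simp
  qed
  ultimately show "?W (k oo h) (%a. e a oo h)" using wA h w kA by(intro bexI[of _ "w oo h"]) auto
 next
  fix k :: 'a and e e' :: "'k => 'a"
  assume "!!a. a < g ==> e a = e' a" "?W k e"
  thus "?W k e'" by auto
 qed
 thus ?thesis unfolding in_T_iff
  using l p by(auto simp: valid_def elim!: wins_mono)
qed

text \<open>At the end of a joint play the two winning arrows have the same components, so they
  coincide and lie in both targets. Every end is thus degenerate, and the ends cover the
  start.\<close>

lemma in_T_disjoint:
 assumes 1: "in_T cov g As pA pr S1 l" and 2: "in_T (%a. ~ cov a) g As pA pr S2 l" and l: "l : Ar"
  and Z: "is_prodZ (Cod l) g As Z pA pr" and S: "S1 : Sub Z" "S2 : Sub Z" "S1 Int S2 <= bot Z"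
 shows "degenerate (Dom l)"
proof -
 have "bot (Dom l) = whole (Dom l)"
 proof(rule wins_whole[OF wins_both[OF 1[unfolded in_T_iff] 2[unfolded in_T_iff]]])
  show "bot (Dom l) : Sub (Dom l)" using bot_Sub l by simp
  fix k e assume v: "valid As g (Dom l) k e"
  and w: "(EX w:S1. Dom w = Dom k & pA oo w = l oo k & (ALL a<g. pr a oo w = e a)) &
  (EX w:S2. Dom w = Dom k & pA oo w = l oo k & (ALL a<g. pr a oo w = e a))"
  then obtain w1 w2 where w1: "w1 : S1" "Dom w1 = Dom k" "pA oo w1 = l oo k" "ALL a<g. pr a oo w1 = e a"
  and w2: "w2 : S2" "Dom w2 = Dom k" "pA oo w2 = l oo k" "ALL a<g. pr a oo w2 = e a" by blast
  have wh: "w1 : hom (Dom k) Z" "w2 : hom (Dom k) Z" using SubD[OF S(1) w1(1)] SubD[OF S(2) w2(1)] w1 w2 by(auto simp: hom_def)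
  have "w1 = w2" by(rule prodZ_D(4)[OF Z wh]) (use w1 w2 in auto)
  hence "w1 : bot Z" using S w1 w2 by auto
  hence "degenerate (Dom k)" using mem_bot[of w1] wh(1) by(simp add: hom_def)
  thus "k : bot (Dom l)" using v mem_bot[of k] by(simp add: valid_def)
 qed simp
 thus ?thesis using l by(simp add: degenerate_def)
qed

text \<open>Disjointness from each member of \<open>RR\<close> passes to the join although the join
  is not known to be stable: each member, and hence the join, lies below \<open>all_along k\<close>
  of bottom.\<close>

lemma mem_of_disjoint:
 assumes j: "is_join A RR J2" and jj: "is_join A {J1, J2} (whole A)" and J1: "J1 : Sub A" and RR: "RR <= Sub A"
  and k: "k : Ar" "Cod k = A"
  and d: "!!R h. R : RR ==> h : Ar ==> Cod h = Dom k ==> k oo h : R ==> degenerate (Dom h)"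
 shows "k : J1"
proof(rule Or_pull[OF jj J1 is_joinD(1)[OF j] k])
 have b: "bot (Dom k) : Sub (Dom k)" using bot_Sub k by simp
 have "J2 <= all_along k (bot (Dom k))"
 proof(rule is_joinD(3)[OF j])
  show "all_along k (bot (Dom k)) : Sub A" using all_Sub[OF k(1) b] k by simp
  fix R assume R: "R : RR"
  hence RS: "R : Sub (Cod k)" using RR k by auto
  have "pull k R <= bot (Dom k)"
  proof
  fix h assume "h : pull k R"
  hence h: "h : Ar" "Cod h = Dom k" "k oo h : R" by(auto simp: mem_pull)
  thus "h : bot (Dom k)" using d[OF R h] mem_bot[OF h(1)] by simp
  qed
  thus "R <= all_along k (bot (Dom k))" using all_adj[OF k(1) b RS] by simp
 qed
 thus "pull k J2 <= bot (Dom k)" using all_adj[OF k(1) b] is_joinD(1)[OF j] k by simp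
qed

text \<open>Stability is built in: along every \<open>f\<close> the inverse image of
  \<open>J\<close> is the join of the subobjects that win after composition with \<open>f\<close>.
  At the identity this gives back the join used in the semantics.\<close>

definition goodJ where
 "goodJ cov g As A pA pr S J \<longleftrightarrow> J : Sub A & (ALL f:Ar. Cod f = A -->
  is_join (Dom f) {sub_of l | l. monic l & Cod l = Dom f & in_T cov g As pA pr S (f oo l)} (pull f J))"

lemma goodJ_mem:
 assumes J: "goodJ cov g As A pA pr S J" and k: "in_T cov g As pA pr S k" "k : Ar" "Cod k = A"
 shows "k : J"
proof -
 have j: "is_join (Dom k) {sub_of l | l. monic l & Cod l = Dom k & in_T cov g As pA pr S (k oo l)} (pull k J)"
  using J k unfolding goodJ_def by blast
 have "sub_of (Idn (Dom k)) <= pull k J"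
  by(rule is_joinD(2)[OF j]) (use k monic_Idn[of "Dom k"] in auto)
 hence "Idn (Dom k) : pull k J" using sub_of_self[of "Idn (Dom k)"] k by auto
 thus ?thesis using k by(simp add: mem_pull)
qed

lemma goodJ_T_sub:
 assumes J: "goodJ cov g As A pA pr S J"
 shows "is_join A (T_sub H cov g A As pA pr S) J"
proof -
 have A: "A : Ob" using J Sub_Ob unfolding goodJ_def by blast
 have "is_join (Dom (Idn A)) {sub_of l | l. monic l & Cod l = Dom (Idn A) & in_T cov g As pA pr S (Idn A oo l)} (pull (Idn A) J)"
  using J A unfolding goodJ_def by(elim conjE ballE[of _ _ "Idn A"]) auto
 hence "is_join A {sub_of l | l. monic l & Cod l = A & in_T cov g As pA pr S (Idn A oo l)} (pull (Idn A) J)"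
  using A by simp
 moreover have "{sub_of l | l. monic l & Cod l = A & in_T cov g As pA pr S (Idn A oo l)} = T_sub H cov g A As pA pr S"
  unfolding T_sub_def using monicD(1) by(metis (no_types, lifting) Cmp_Idn_left)
 ultimately show ?thesis using A pull_Idn J unfolding goodJ_def by simp
qed

text \<open>The families \<open>RR1\<close>, \<open>RR2\<close> need not consist of all winning subobjects: in the applications they come from
 a padded game.\<close>

definition det where
 "det cov g As A pA pr S1 S2 J1 J2 \<longleftrightarrow> (EX RR1 RR2. is_join A RR1 J1 & is_join A RR2 J2 & is_join A {J1, J2} (whole A) &
  (ALL R:RR1. EX l. R = sub_of l & monic l & Cod l = A & in_T cov g As pA pr S1 l) &
  (ALL R:RR2. EX l. R = sub_of l & monic l & Cod l = A & in_T (%a. ~ cov a) g As pA pr S2 l))"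

lemma det_swap: "det cov g As A pA pr S1 S2 J1 J2 ==> det (%a. ~ cov a) g As A pA pr S2 S1 J2 J1"
 unfolding det_def by(simp add: insert_commute) blast

lemma det_transfer:
 assumes "det cov g As A pA pr S1 S2 J1 J2"
  and "!!l. l : Ar ==> Cod l = A ==> in_T cov g As pA pr S1 l ==> in_T cov' g' As' pA' pr' S1 l"
  and "!!l. l : Ar ==> Cod l = A ==> in_T (%a. ~ cov a) g As pA pr S2 l ==> in_T (%a. ~ cov' a) g' As' pA' pr' S2 l"
 shows "det cov' g' As' A pA' pr' S1 S2 J1 J2"
 using assms unfolding det_def by(meson monicD(1))

text \<open>A winning arrow need not be monic nor factor through a member of \<open>RR1\<close>, so
  it is placed by complementation: where it meets a winning subobject of the other player, both can
  be restricted there, and by \<open>in_T_disjoint\<close> the stage is degenerate.\<close>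

lemma det_mem:
 assumes D: "det cov g As A pA pr S1 S2 J1 J2" and k: "in_T cov g As pA pr S1 k" "k : Ar" "Cod k = A"
  and Z: "is_prodZ A g As Z pA pr" and S: "S1 : Sub Z" "S2 : Sub Z" "S1 Int S2 <= bot Z"
  and nc: "~ (cov ozero & cov (osuc ozero))" "cov ozero \<or> cov (osuc ozero)" and g: "ozero < g"
 shows "k : J1"
proof -
 obtain RR1 RR2 where R: "is_join A RR1 J1" "is_join A RR2 J2" "is_join A {J1, J2} (whole A)"
  "!!R. R : RR1 ==> EX l. R = sub_of l & monic l & Cod l = A & in_T cov g As pA pr S1 l"
  "!!R. R : RR2 ==> EX l. R = sub_of l & monic l & Cod l = A & in_T (%a. ~ cov a) g As pA pr S2 l"
  using D unfolding det_def by(elim exE conjE) (rule that, assumption+, erule bspec, assumption, erule bspec, assumption)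
 show ?thesis
 proof(rule mem_of_disjoint[OF R(2,3) is_joinD(1)[OF R(1)] _ k(2,3)])
  show "RR2 <= Sub A" using R(5) sub_of_Sub by blast
  fix R h assume Rh: "R : RR2" "h : Ar" "Cod h = Dom k" "k oo h : R"
  obtain l where l: "R = sub_of l" "monic l" "Cod l = A" "in_T (%a. ~ cov a) g As pA pr S2 l" using R(5)[OF Rh(1)] by blast
  have lA: "l : Ar" using l(2) monicD(1) by blast
  obtain t where t: "t : Ar" "Cod t = Dom l" "k oo h = l oo t" using Rh(4) lA l(1) by(auto simp: mem_sub_of)
  have 1: "in_T cov g As pA pr S1 (k oo h)"
  using in_T_restrict[OF k(1,2) Rh(2,3) _ S(1) nc(1) g] Z k(3) by simp
  have "in_T (%a. ~ cov a) g As pA pr S2 (l oo t)"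
  by(rule in_T_restrict[OF l(4) lA t(1,2) _ S(2) _ g]) (use Z l(3) nc in auto)
  hence "degenerate (Dom (k oo h))" using in_T_disjoint[OF 1 _ _ _ S] t Rh(2,3) k Z lA l(3) by simp
  thus "degenerate (Dom h)" using Rh k by simp
 qed
qed

text \<open>Neither half pulls back a large join. That winners over \<open>f\<close> lie below is
  \<open>det_mem\<close>. For minimality the bound \<open>K\<close> is pushed down by
  \<open>all_along f\<close>, and it then suffices to restrict the members of \<open>RR1\<close>
  along \<open>f\<close>.\<close>

theorem det_good:
 assumes D: "det cov g As A pA pr S1 S2 J1 J2"
  and Z: "is_prodZ A g As Z pA pr" and S: "S1 : Sub Z" "S2 : Sub Z" "S1 Int S2 <= bot Z"
  and nc: "~ (cov ozero & cov (osuc ozero))" "cov ozero \<or> cov (osuc ozero)" and g: "ozero < g"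
 shows "goodJ cov g As A pA pr S1 J1"
proof -
 obtain RR1 where R: "is_join A RR1 J1"
  "!!R. R : RR1 ==> EX l. R = sub_of l & monic l & Cod l = A & in_T cov g As pA pr S1 l"
  using D unfolding det_def by(elim exE conjE) (rule that, assumption, erule bspec, assumption)
 note J1 = is_joinD(1)[OF R(1)]
 show ?thesis unfolding goodJ_def
 proof(intro conjI ballI impI)
  show "J1 : Sub A" by(rule J1)
  fix f assume f: "f : Ar" "Cod f = A"
  show "is_join (Dom f) {sub_of l | l. monic l & Cod l = Dom f & in_T cov g As pA pr S1 (f oo l)} (pull f J1)"
  proof(rule is_joinI)
  show p: "pull f J1 : Sub (Dom f)" using pull_Sub[OF f(1)] J1 f by simp
  fix R assume "R : {sub_of l | l. monic l & Cod l = Dom f & in_T cov g As pA pr S1 (f oo l)}"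
  then obtain l where l: "R = sub_of l" "monic l" "Cod l = Dom f" "in_T cov g As pA pr S1 (f oo l)" by blast
  have lA: "l : Ar" using l(2) monicD(1) by blast
  have "f oo l : J1" by(rule det_mem[OF D l(4) _ _ Z S nc g]) (use f l lA in auto)
  hence "l : pull f J1" using lA l by(simp add: mem_pull)
  thus "R <= pull f J1" using Sub_comp[OF p] lA l(1) by(auto simp: mem_sub_of)
  next
  fix K assume K: "K : Sub (Dom f)" "!!R. R : {sub_of l | l. monic l & Cod l = Dom f & in_T cov g As pA pr S1 (f oo l)} ==> R <= K"
  have "J1 <= all_along f K"
  proof(rule is_joinD(3)[OF R(1)])
  show "all_along f K : Sub A" using all_Sub[OF f(1) K(1)] f by simp
  fix R assume "R : RR1"
  then obtain l where l: "R = sub_of l" "monic l" "Cod l = A" "in_T cov g As pA pr S1 l" using R(2) by blast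
  have lA: "l : Ar" using l(2) monicD(1) by blast
  obtain p q where pb: "is_pullback f l p q" using pullback_ex f l lA by metis
  note pD = pullbackD[OF pb]
  have "in_T cov g As pA pr S1 (l oo q)"
  by(rule in_T_restrict[OF l(4) lA pD(4) pD(8) _ S(1) nc(1) g]) (use Z l(3) in simp)
  hence "in_T cov g As pA pr S1 (f oo p)" using pD by simp
  hence "sub_of p <= K" by(intro K(2)) (use pull_pb[OF pb l(2)] pD in blast)
  hence "pull f R <= K" using pull_pb(2)[OF pb l(2)] l(1) by simp
  thus "R <= all_along f K" using all_adj[OF f(1) K(1)] sub_of_Sub[OF l(2)] l f by simp
  qed
  thus "pull f J1 <= K" using all_adj[OF f(1) K(1)] J1 f by simp
  qed
 qed
qed

lemma wins_cong_obj:
 assumes w: "wins cov As (g::'k) C W" and As: "!!a. a < g ==> As a = As' a"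
 shows "wins cov As' g C W"
proof -
 have f: "follows cov As \<sigma> b r \<longleftrightarrow> follows cov As' \<sigma> b r" if "b <= g" for \<sigma> b and r :: "('o, 'a, 'k) play"
  unfolding follows_def using that As by(intro all_cong1) auto
 have "covering_strategy cov As C g \<sigma> = covering_strategy cov As' C g \<sigma>" for \<sigma>
  unfolding covering_strategy_def using As f by(intro all_cong1) auto
 thus ?thesis using w f[of g] unfolding wins_def by simp
qed

subsubsection \<open>Inserting and appending empty blocks\<close>

text \<open>\<open>insq z\<close> deletes the dummy stages of \<open>insD z\<close>: all limit stages and, if \<open>z\<close>, also the stage 0.\<close>

definition insD :: "bool => 'k => bool" where "insD z c \<longleftrightarrow> is_lim c \<or> (z & c = ozero)"
definition insq :: "bool => 'k => 'k" where
 "insq z c = (if obase c \<or> (~ z & finite {..<c}) then c else opred c)"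
definition insr :: "bool => 'k => 'k" where "insr z a = (if ~ z & finite {..<a} then a else osuc a)"

lemma insq_osuc: "insq z (osuc c) = (if ~ z & finite {..<c} then osuc c else c)"
 by(simp add: insq_def)

lemma insq_le: "insq z c <= c"
 by(cases c rule: ord_cases) (auto simp: insq_def obase_def)

lemma insq_mono: "c <= d ==> insq z c <= insq z d"
proof(cases d rule: ord_cases)
 case (succ e)
 assume cd: "c <= d"
 show ?thesis
 proof(cases "c = d")
  case False
  hence "c <= e" using cd succ by(metis less_osuc_iff order.not_eq_order_implies_strict)
  moreover have "e <= insq z d" using succ by(simp add: insq_osuc)
  ultimately show ?thesis using insq_le[of z c] by simp
 qed simp
qed (insert insq_le[of z c], auto simp: insq_def obase_def)

lemma insD_dummy: "insD z c ==> insq z (osuc c) = insq z c"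
 using infinite_lim by(auto simp: insD_def insq_def obase_def)

lemma insD_real: "~ insD z c ==> insq z (osuc c) = osuc (insq z c) & insr z (insq z c) = c"
proof -
 have "finite {..<(ozero::'k)}" by(simp add: lessThan_def)
 moreover assume "~ insD z c"
 ultimately show ?thesis by(cases c rule: ord_cases) (auto simp: insD_def insq_def insr_def obase_def)
qed

lemma insr_real: "~ insD z (insr z a) & insq z (insr z a) = a"
proof(cases "~ z & finite {..<a}")
 case True
 thus ?thesis using infinite_lim[of a] by(auto simp: insD_def insq_def insr_def)
next
 case False
 thus ?thesis by(auto simp: insD_def insq_def insr_def)
qed

text \<open>Dummies at which the player would have to cover first hand their cover on to the stage
  two later; afterwards all dummies can be deleted by reindexing. The limit length guarantees that
  the later stage exists.\<close>

lemma wins_ins: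
 assumes g: "is_lim g" and w: "wins cov'' As'' g C W''"
  and alt: "!!c. insD z c ==> cov'' c ==> ~ cov'' (osuc c) & cov'' (suc2 c)"
  and real: "!!c. ~ insD z c ==> cov'' c \<longleftrightarrow> cov (insq z c)"
  and As: "!!c. c < g ==> ~ insD z c ==> As'' c = As (insq z c) & As'' c : Ob"
  and pt: "!!c X. c < g ==> insD z c ==> X : Ob ==> EX t. t : hom X (As'' c)"
  and W: "!!k e e''. valid As g C k e ==> W'' k e'' ==> (!!c. c < g ==> ~ insD z c ==> e'' c = e (insq z c)) ==> W k e"
 shows "wins cov As g C W"
proof -
 define Bs where "Bs c \<longleftrightarrow> insD z c & c < g & cov'' c" for c
 \<comment> \<open>The delayed game says nothing about elements at the stages of \<open>Bs\<close>,
   so the condition only asks for some way of filling them in.\<close>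
 define W' where "W' k e \<longleftrightarrow> (EX e''. W'' k e'' & (ALL a<g. ~ Bs a --> e'' a = e a))" for k e
 have w': "wins (%a. cov'' a & ~ Bs a) As'' g C W'"
 proof(rule wins_delay[OF w])
  fix c assume "Bs c"
  hence c: "insD z c" "c < g" "cov'' c" by(auto simp: Bs_def)
  thus "obase c & cov'' c & ~ cov'' (osuc c) & cov'' (suc2 c) & suc2 c < g"
  using alt[OF c(1,3)] is_lim_osuc_less[OF g] by(auto simp: insD_def obase_def)
 qed (auto simp: W'_def)
 have lt: "insr z a < g" if "a < g" for a using is_lim_osuc_less[OF g that] that by(simp add: insr_def)
 show ?thesis
 proof(rule wins_reindex[OF w', where q = "insq z" and rd = "insr z" and Dm = "insD z" and \<theta> = "%c. Idn (As'' c)" and \<theta>' = "%c. Idn (As'' c)"])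
  show "insq z ozero = ozero" "insq z g = g" using g by(auto simp: insq_def obase_def)
  show "insq z c <= insq z d" if "c <= d" for c d using that by(rule insq_mono)
  show "insq z (osuc c) = insq z c & ~ (cov'' c & ~ Bs c) & (ALL X:Ob. EX t. t : hom X (As'' c))" if "c < g" "insD z c" for c
  using insD_dummy[OF that(2)] pt[OF that] that by(auto simp: Bs_def)
  show "insq z (osuc c) = osuc (insq z c) & (cov'' c & ~ Bs c) = cov (insq z c) & insr z (insq z c) = c &
  Idn (As'' c) : hom (As (insq z c)) (As'' c) & Idn (As'' c) : hom (As'' c) (As (insq z c)) &
  Idn (As'' c) oo Idn (As'' c) = Idn (As'' c)" if "c < g" "~ insD z c" for c
  using insD_real[OF that(2)] real[OF that(2)] As[OF that] that Idn_hom[of "As'' c"] by(auto simp: Bs_def)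
  show "is_lim (insq z c) & (ALL e<insq z c. EX d<c. e <= insq z d) & (ALL d<c. insq z d < insq z c)" if c: "is_lim c" for c
  proof -
  have "insq z c = c" using c by(simp add: insq_def obase_def)
  moreover have "EX d<c. e <= insq z d" if "e < c" for e
  by(rule exI[of _ "osuc e"]) (insert is_lim_osuc_less[OF c that], auto simp: insq_osuc)
  moreover have "insq z d < c" if "d < c" for d using insq_le[of z d] that by simp
  ultimately show ?thesis using c by simp
  qed
  show "insr z a < g & ~ insD z (insr z a) & insq z (insr z a) = a" if "a < g" for a using lt[OF that] insr_real by blast
  fix k e e'' assume v: "valid As g C k e" and w: "W' k e''" and r: "!!c. c < g ==> ~ insD z c ==> e'' c = Idn (As'' c) oo e (insq z c)"
  obtain e3 where e3: "W'' k e3" "!!a. a < g ==> ~ Bs a ==> e3 a = e'' a" using w by(auto simp: W'_def)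
  show "W k e"
  proof(rule W[OF v e3(1)])
  fix c assume c: "c < g" "~ insD z c"
  have "insq z c < g" using insq_le[of z c] c by simp
  hence "e (insq z c) : hom (Dom k) (As'' c)" using v As[OF c] by(auto simp: valid_def)
  thus "e3 c = e (insq z c)" using e3(2)[of c] r[OF c] c by(auto simp: Bs_def hom_def)
  qed
 qed
qed

end

section \<open>Contexts as products, and games indexed by blocks of variables\<close>

locale kstr = kcat K H for K :: "'k::wellorder itself" and H :: "('o, 'a) cat" +
 fixes Sg :: "('k, 's::wellorder, 'f, 'r) signature" and M :: "('s, 'f, 'r, 'o, 'a) struc"
 assumes wfS: "wf_signature Sg" and str: "is_structure Sg H M"
begin

abbreviation "ctx == ctx_ob H M"
abbreviation "cpr == ctx_pr H M"
abbreviation "prj == proj H M"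
abbreviation "wfc x == wf_context Sg (x :: ('s, 'k) block)"
abbreviation "sob == (%v. sort_ob M (fst v))"

lemma sort_Ob: "s : Sorts Sg ==> sort_ob M s : Ob"
 using str by(auto simp: is_structure_def)

lemma wfcD: "wfc x ==> less_kappa TYPE('k) x" "wfc x ==> v : x ==> sort_ob M (fst v) : Ob"
 using sort_Ob by(auto simp: wf_context_def)

lemma wfc_subset: "wfc x ==> y <= x ==> wfc y"
 unfolding wf_context_def using less_kappa_subset by blast

lemma wfc_Un: "wfc x ==> wfc y ==> wfc (x Un y)"
 unfolding wf_context_def using less_kappa_Un by auto

lemma wfc_empty: "wfc {}"
 unfolding wf_context_def using less_kappa_finite by auto

lemma ctx_Ob: "wfc x ==> ctx x : Ob"
 unfolding ctx_ob_def using wfcD by(intro prod_ob_Ob) auto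

lemma cpr_hom: "wfc x ==> v : x ==> cpr x v : hom (ctx x) (sort_ob M (fst v))"
 unfolding ctx_ob_def ctx_pr_def using wfcD[of x] prod_pr_hom[of x sob v] by auto

lemma ctx_eqI:
 assumes "wfc x" "f : hom B (ctx x)" "g : hom B (ctx x)" "!!v. v : x ==> cpr x v oo f = cpr x v oo g"
 shows "f = g"
 using prod_eqI[of x sob f B g] wfcD[OF assms(1)] assms(2-4) unfolding ctx_ob_def ctx_pr_def by auto

definition ctup :: "('s, 'k) block => 'o => (('s, 'k) var => 'a) => 'a" where
 "ctup x B q = tuple H x sob B q"

lemma ctup:
 assumes "wfc x" "B : Ob" "!!v. v : x ==> q v : hom B (sort_ob M (fst v))"
 shows "ctup x B q : hom B (ctx x)" "v : x ==> cpr x v oo ctup x B q = q v"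
 unfolding ctup_def ctx_ob_def ctx_pr_def
 using tuple_hom[of x sob B q] tuple_pr[of x sob B q v] wfcD[OF assms(1)] assms by auto

lemma prj_ctup: "prj x y = ctup y (ctx x) (cpr x)"
 by(simp add: proj_def ctup_def)

lemma prj_hom: "wfc x ==> y <= x ==> prj x y : hom (ctx x) (ctx y)"
 unfolding prj_ctup using wfc_subset ctx_Ob cpr_hom by(intro ctup(1)) auto

lemma cpr_prj: "wfc x ==> y <= x ==> v : y ==> cpr y v oo prj x y = cpr x v"
 unfolding prj_ctup using wfc_subset ctx_Ob cpr_hom by(intro ctup(2)) auto

lemma cpr_prj_comp: "wfc x ==> y <= x ==> v : y ==> f : hom B (ctx x) ==> cpr y v oo (prj x y oo f) = cpr x v oo f"
proof -
 assume a: "wfc x" "y <= x" "v : y" "f : hom B (ctx x)"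
 have "cpr y v oo (prj x y oo f) = (cpr y v oo prj x y) oo f"
  by(rule comp_assoc[OF a(4) prj_hom[OF a(1,2)] cpr_hom[OF wfc_subset[OF a(1,2)] a(3)], symmetric])
 thus ?thesis using cpr_prj[OF a(1-3)] by simp
qed

lemma prj_prj: "wfc x ==> y <= x ==> z <= y ==> prj y z oo prj x y = prj x z"
proof -
 assume a: "wfc x" "y <= x" "z <= y"
 have wy: "wfc y" and wz: "wfc z" using a wfc_subset by blast+
 show ?thesis
 proof(rule ctx_eqI[OF wz Cmp_hom[OF prj_hom[OF wy a(3)] prj_hom[OF a(1,2)]] prj_hom[OF a(1)]])
  fix v assume v: "v : z"
  have "cpr z v oo (prj y z oo prj x y) = cpr y v oo prj x y" by(rule cpr_prj_comp[OF wy a(3) v prj_hom[OF a(1,2)]])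
  also have "\<dots> = cpr x v" using cpr_prj[of x y v] a v by auto
  also have "\<dots> = cpr z v oo prj x z" using cpr_prj[of x z v] a v by auto
  finally show "cpr z v oo (prj y z oo prj x y) = cpr z v oo prj x z" .
 qed (use a in auto)
qed

lemma prj_Idn: "wfc x ==> prj x x = Idn (ctx x)"
 by(rule ctx_eqI) (auto intro: prj_hom Idn_hom ctx_Ob simp: cpr_prj homD(1,2)[OF cpr_hom])

definition blen :: "('k \<rightharpoonup> ('s, 'k) block) => 'k => bool" where
 "blen X g \<longleftrightarrow> wf_blocks Sg X & dom X = {..<g}"

lemma blenD:
 assumes "blen X g"
 shows "wf_blocks Sg X" "dom X = {..<g}" "len X = g" "a < g ==> X a = Some (the (X a))" "~ a < g ==> X a = None"
  "a < g ==> wfc (the (X a))" "a < g ==> the (X a) <= bvars X" "wfc (bvars X)" "bvars X = (UN a:{..<g}. the (X a))"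
  "a < g ==> b < g ==> a ~= b ==> the (X a) Int the (X b) = {}"
proof -
 show 1: "wf_blocks Sg X" and 2: "dom X = {..<g}" using assms by(auto simp: blen_def)
 show "len X = g" by(rule len_eq[OF 2])
 show 3: "a < g ==> X a = Some (the (X a))" for a using 2 by(metis domIff lessThan_iff option.collapse)
 show 4: "~ a < g ==> X a = None" for a using 2 by(metis domIff lessThan_iff)
 have rn: "a < g ==> the (X a) : ran X" for a using 3 by(metis ranI)
 thus 5: "a < g ==> wfc (the (X a))" for a using 1 by(auto simp: wf_blocks_def)
 show "a < g ==> the (X a) <= bvars X" for a using rn by(auto simp: bvars_def)
 show 6: "bvars X = (UN a:{..<g}. the (X a))"
 proof(intro equalityI subsetI)
  fix v assume "v : bvars X"
  then obtain a B where "X a = Some B" "v : B" by(auto simp: bvars_def ran_def)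
  thus "v : (UN a:{..<g}. the (X a))" using 4[of a] by(intro UN_I[of a]) auto
 qed (insert rn, auto simp: bvars_def)
 have "less_kappa TYPE('k) (UN a:{..<g}. the (X a))"
  by(rule less_kappa_UN[OF less_kappa_lessThan]) (insert 5, auto simp: wf_context_def)
 thus "wfc (bvars X)" unfolding 6 using 5 by(auto simp: wf_context_def)
 show "the (X a) Int the (X b) = {}" if "a < g" "b < g" "a ~= b"
  using 1 3[OF that(1)] 3[OF that(2)] that(3) unfolding wf_blocks_def by blast
qed

abbreviation "bob X == (%a. ctx (the (X a)))"
abbreviation "bpr z X == (%a. prj z (the (X a)))"

text \<open>Blocks are disjoint from \<open>x\<close> and from each other, so every variable of the
  large context has exactly one factor from which its component is read; \<open>ia\<close> finds the
  block.\<close>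

lemma ctx_prodZ:
 assumes x: "wfc x" and X: "blen X g" and d: "x Int bvars X = {}"
 shows "is_prodZ (ctx x) g (bob X) (ctx (x Un bvars X)) (prj (x Un bvars X) x) (bpr (x Un bvars X) X)"
proof -
 let ?z = "x Un bvars X"
 note B = blenD[OF X]
 have z: "wfc ?z" using wfc_Un[OF x B(8)] .
 have sub: "a < g ==> the (X a) <= ?z" for a using B(7) by blast
 show ?thesis unfolding is_prodZ_def
 proof(intro conjI allI impI ballI)
  show "prj ?z x : hom (ctx ?z) (ctx x)" by(rule prj_hom[OF z]) simp
  show "prj ?z (the (X a)) : hom (ctx ?z) (ctx (the (X a)))" if "a < g" for a by(rule prj_hom[OF z sub[OF that]])
 next
  fix Y k e assume k: "k : hom Y (ctx x)" and e: "ALL a<g. e a : hom Y (ctx (the (X a)))"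
  define ia where "ia v = (SOME a. a < g & v : the (X a))" for v
  have ia: "ia v = a" if "a < g" "v : the (X a)" for v a
  proof -
  have "ia v < g & v : the (X (ia v))" unfolding ia_def by(rule someI[of _ a]) (use that in auto)
  thus ?thesis using B(10)[of "ia v" a] that by blast
  qed
  define q where "q v = (if v : x then cpr x v oo k else cpr (the (X (ia v))) v oo e (ia v))" for v
  have q1: "q v = cpr (the (X a)) v oo e a" if "a < g" "v : the (X a)" for v a
  using that ia[OF that] B(7)[OF that(1)] d by(auto simp: q_def)
  have qh: "q v : hom Y (sort_ob M (fst v))" if v: "v : ?z" for v
  proof(cases "v : x")
  case True
  thus ?thesis using Cmp_hom[OF cpr_hom[OF x True] k] by(simp add: q_def)
  next
  case False
  then obtain a where a: "a < g" "v : the (X a)" using v B(9) by auto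
  thus ?thesis using Cmp_hom[OF cpr_hom[OF B(6)[OF a(1)] a(2)]] e q1[OF a] by simp
  qed
  have Y: "Y : Ob" using homD(4)[OF k] .
  note w = ctup[OF z Y qh]
  let ?w = "ctup ?z Y q"
  have 1: "prj ?z x oo ?w = k"
  proof(rule ctx_eqI[OF x Cmp_hom[OF prj_hom[OF z] w(1)] k])
  fix v assume v: "v : x"
  show "cpr x v oo (prj ?z x oo ?w) = cpr x v oo k"
  proof -
  have "q v = cpr x v oo k" using v by(simp add: q_def)
  thus ?thesis using cpr_prj_comp[OF z _ v w(1)] w(2)[of v] v by simp
  qed
  qed auto
  have 2: "prj ?z (the (X a)) oo ?w = e a" if a: "a < g" for a
  proof(rule ctx_eqI[OF B(6)[OF a] Cmp_hom[OF prj_hom[OF z sub[OF a]] w(1)]])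
  show "e a : hom Y (ctx (the (X a)))" using e a by blast
  fix v assume v: "v : the (X a)"
  show "cpr (the (X a)) v oo (prj ?z (the (X a)) oo ?w) = cpr (the (X a)) v oo e a"
  using cpr_prj_comp[OF z sub[OF a] v w(1)] w(2)[of v] q1[OF a v] sub[OF a] v by auto
  qed auto
  show "EX w:hom Y (ctx ?z). prj ?z x oo w = k & (ALL a<g. prj ?z (the (X a)) oo w = e a)"
  using 1 2 w(1) by blast
 next
  fix Y w w' assume w: "w : hom Y (ctx ?z)" "w' : hom Y (ctx ?z)" and 1: "prj ?z x oo w = prj ?z x oo w'"
  and 2: "ALL a<g. prj ?z (the (X a)) oo w = prj ?z (the (X a)) oo w'"
  show "w = w'"
  proof(rule ctx_eqI[OF z w])
  fix v assume v: "v : ?z"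
  show "cpr ?z v oo w = cpr ?z v oo w'"
  proof(cases "v : x")
  case True
  thus ?thesis using cpr_prj_comp[OF z _ True w(1)] cpr_prj_comp[OF z _ True w(2)] 1 by auto
  next
  case False
  then obtain a where a: "a < g" "v : the (X a)" using v B(9) by auto
  thus ?thesis using cpr_prj_comp[OF z sub[OF a(1)] a(2) w(1)] cpr_prj_comp[OF z sub[OF a(1)] a(2) w(2)] 2 by auto
  qed
  qed
 qed
qed

definition inX :: "('k => bool) => ('k \<rightharpoonup> ('s, 'k) block) => ('s, 'k) block => 'a set => 'a => bool" where
 "inX cov X x S l = in_T cov (len X) (bob X) (prj (x Un bvars X) x) (bpr (x Un bvars X) X) S l"

lemma empty_pt: "X : Ob ==> EX t. t : hom X (ctx ({} :: ('s, 'k) block))"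
 using ctup(1)[OF wfc_empty, of X undefined] by(intro exI[of _ "ctup {} X undefined"]) simp

text \<open>With \<open>z\<close> false this is the correction made by \<open>realign\<close>. With
  \<open>z\<close> true an empty block also stands in front, and the parity of every original stage
  is reversed.\<close>

definition ins :: "bool => 'k => ('k \<rightharpoonup> ('s, 'k) block) => ('k \<rightharpoonup> ('s, 'k) block)" where
 "ins z g X = (%c. if insD z c then (if c < g then Some {} else None) else X (insq z c))"

lemma ins_blen:
 assumes X: "blen X g" and g: "is_lim g"
 shows "blen (ins z g X) g" "bvars (ins z g X) = bvars X"
proof -
 note B = blenD[OF X]
 have q: "insq z c < g \<longleftrightarrow> c < g" if "~ insD z c" for c
 proof
  assume a: "insq z c < g"
  have "c = insq z c \<or> c = osuc (insq z c)" using that by(cases c rule: ord_cases) (auto simp: insD_def insq_def)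
  thus "c < g" using a is_lim_osuc_less[OF g a] by auto
 qed (use insq_le[of z c] in simp)
 have dm: "dom (ins z g X) = {..<g}"
 proof(intro equalityI subsetI)
  fix c assume "c : dom (ins z g X)"
  thus "c : {..<g}" using q[of c] B(5)[of "insq z c"] by(auto simp: ins_def split: if_splits)
 next
  fix c assume "c : {..<g}"
  thus "c : dom (ins z g X)" using q[of c] B(4)[of "insq z c"] by(cases "insD z c") (auto simp: ins_def intro: domI)
 qed
 have rn: "ran (ins z g X) <= insert {} (ran X)" by(auto simp: ins_def ran_def split: if_splits)
 have dj: "A Int A' = {}" if "a ~= b" "ins z g X a = Some A" "ins z g X b = Some A'" for a b A A'
 proof(cases "insD z a \<or> insD z b")
  case False
  hence "insq z a ~= insq z b" using insD_real that(1) by metis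
  thus ?thesis using B(1) that False unfolding wf_blocks_def by(auto simp: ins_def)
 qed (insert that, auto simp: ins_def split: if_splits)
 show "blen (ins z g X) g" unfolding blen_def wf_blocks_def
 proof(intro conjI exI[of _ g] ballI allI impI dm)
  fix A assume "A : ran (ins z g X)"
  hence "A = {} \<or> A : ran X" using rn by blast
  thus "wfc A" using wfc_empty B(1) unfolding wf_blocks_def by blast
 qed (rule dj, assumption+)
 show "bvars (ins z g X) = bvars X"
 proof
  show "bvars (ins z g X) <= bvars X" using rn by(auto simp: bvars_def)
  have "ran X <= ran (ins z g X)"
  proof
  fix A assume "A : ran X"
  then obtain a where "X a = Some A" by(auto simp: ran_def)
  hence "ins z g X (insr z a) = Some A" using insr_real[of z a] by(simp add: ins_def)
  thus "A : ran (ins z g X)" by(rule ranI)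
  qed
  thus "bvars X <= bvars (ins z g X)" by(auto simp: bvars_def)
 qed
qed

text \<open>The empty context is terminal, which supplies the points that the inserted stages
  require.\<close>

lemma inX_ins:
 assumes X: "blen X g" and g: "is_lim g" and w: "inX cov'' (ins z g X) x S l"
  and alt: "!!c. insD z c ==> cov'' c ==> ~ cov'' (osuc c) & cov'' (suc2 c)"
  and real: "!!c. ~ insD z c ==> cov'' c \<longleftrightarrow> cov (insq z c)"
 shows "inX cov X x S l"
proof -
 note B = blenD[OF X] and B' = blenD[OF ins_blen(1)[OF X g, of z]] and bv = ins_blen(2)[OF X g, of z]
 let ?z = "x Un bvars X"
 show ?thesis unfolding inX_def in_T_iff B(3)
 proof(rule wins_ins[OF g w[unfolded inX_def in_T_iff B'(3) bv] alt real])
  show "bob (ins z g X) c = bob X (insq z c) & bob (ins z g X) c : Ob" if "c < g" "~ insD z c" for c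
  using that ctx_Ob[OF B'(6)[OF that(1)]] by(auto simp: ins_def)
  show "EX t. t : hom Y (bob (ins z g X) c)" if "c < g" "insD z c" "Y : Ob" for c Y
  using that empty_pt by(simp add: ins_def)
  fix k e e'' assume "EX w:S. Dom w = Dom k & prj ?z x oo w = l oo k & (ALL a<g. prj ?z (the (ins z g X a)) oo w = e'' a)"
  and r: "!!c. c < g ==> ~ insD z c ==> e'' c = e (insq z c)"
  then obtain w where w: "w : S" "Dom w = Dom k" "prj ?z x oo w = l oo k" "ALL a<g. prj ?z (the (ins z g X a)) oo w = e'' a" by blast
  have "prj ?z (the (X a)) oo w = e a" if a: "a < g" for a
  proof -
  have c: "insr z a < g" using is_lim_osuc_less[OF g a] a by(simp add: insr_def)
  note R = insr_real[of z a]
  have "the (ins z g X (insr z a)) = the (X a)" using R by(simp add: ins_def)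
  thus ?thesis using w(4) c r[OF c] R by metis
  qed
  thus "EX w:S. Dom w = Dom k & prj ?z x oo w = l oo k & (ALL a<g. prj ?z (the (X a)) oo w = e a)" using w by blast
 qed auto
qed

definition pad :: "'k => 'k => ('k \<rightharpoonup> ('s, 'k) block) => ('k \<rightharpoonup> ('s, 'k) block)" where
 "pad g g' X = (%c. if c < g then X c else if c < g' then Some {} else None)"

lemma pad_blen:
 assumes X: "blen X g" and g: "g <= g'"
 shows "blen (pad g g' X) g'" "bvars (pad g g' X) = bvars X"
proof -
 note B = blenD[OF X]
 have "pad g g' X c = None \<longleftrightarrow> ~ c < g'" for c
  using g B(4)[of c] by(cases "c < g") (auto simp: pad_def)
 hence dm: "dom (pad g g' X) = {..<g'}" by(simp add: dom_def lessThan_def)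
 have rn: "ran (pad g g' X) <= insert {} (ran X)" by(auto simp: pad_def ran_def split: if_splits)
 have dj: "A Int A' = {}" if "a ~= b" "pad g g' X a = Some A" "pad g g' X b = Some A'" for a b A A'
  using that B(1) unfolding wf_blocks_def by(auto simp: pad_def split: if_splits)
 show "blen (pad g g' X) g'" unfolding blen_def wf_blocks_def
 proof(intro conjI exI[of _ g'] ballI allI impI dm)
  fix A assume "A : ran (pad g g' X)"
  hence "A = {} \<or> A : ran X" using rn by blast
  thus "wfc A" using wfc_empty B(1) unfolding wf_blocks_def by blast
 qed (rule dj, assumption+)
 have "ran X <= ran (pad g g' X)"
 proof
  fix A assume "A : ran X"
  then obtain a where a: "X a = Some A" by(auto simp: ran_def)
  hence "a < g" using B(5)[of a] by(cases "a < g") auto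
  thus "A : ran (pad g g' X)" using a by(intro ranI[of _ a]) (simp add: pad_def)
 qed
 thus "bvars (pad g g' X) = bvars X" using rn by(auto simp: bvars_def)
qed

text \<open>After \<open>g\<close> moves the arrow \<open>w\<close> into the full context is already
  determined, and winning means that it lies in \<open>S\<close>. The subobject required by
  \<open>wins_truncate\<close> is therefore \<open>pull w S\<close>.\<close>

lemma inX_pad:
 assumes x: "wfc x" and X: "blen X g" and d: "x Int bvars X = {}" and g: "g <= g'" and w: "inX cov (pad g g' X) x S l"
  and S: "S : Sub (ctx (x Un bvars X))" and l: "l : Ar" "Cod l = ctx x"
 shows "inX cov X x S l"
proof -
 note B = blenD[OF X] and B' = blenD[OF pad_blen(1)[OF X g]] and bv = pad_blen(2)[OF X g]
 let ?z = "x Un bvars X" and ?X = "pad g g' X"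
 let ?W' = "%k e. EX w:S. Dom w = Dom k & prj ?z x oo w = l oo k & (ALL a<g'. prj ?z (the (?X a)) oo w = e a)"
 note Z = prodZ_D[OF ctx_prodZ[OF x X d]]
 have th: "the (?X a) = the (X a)" if "a < g" for a using that by(simp add: pad_def)
 have "wins cov (bob ?X) g (Dom l) (%k e. EX w:S. Dom w = Dom k & prj ?z x oo w = l oo k & (ALL a<g. prj ?z (the (X a)) oo w = e a))"
 proof(rule wins_truncate[OF w[unfolded inX_def in_T_iff B'(3) bv] g])
  show "EX t. t : hom Y (bob ?X a)" if "g <= a" "a < g'" "Y : Ob" for a Y
  using that empty_pt[OF that(3)] by(simp add: pad_def not_less[symmetric])
 next
  fix k :: 'a and e e' :: "'k => 'a"
  assume "!!a. a < g' ==> e a = e' a" "?W' k e"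
  thus "?W' k e'" by auto
 next
  fix k e assume v: "valid (bob ?X) g (Dom l) k e"
  hence k: "k : Ar" "Cod k = Dom l" and e: "!!a. a < g ==> e a : hom (Dom k) (bob X a)"
  using th by(auto simp: valid_def)
  have lk: "l oo k : hom (Dom k) (ctx x)" using k l by(simp add: hom_def)
  obtain w where w: "w : hom (Dom k) (ctx ?z)" "prj ?z x oo w = l oo k" "ALL a<g. prj ?z (the (X a)) oo w = e a"
  using Z(3)[OF lk e] by blast
  have wA: "w : Ar" "Dom w = Dom k" "Cod w = ctx ?z" using w(1) by(auto simp: hom_def)
  show "EX R:Sub (Dom k). (Idn (Dom k) : R -->
  (EX w:S. Dom w = Dom k & prj ?z x oo w = l oo k & (ALL a<g. prj ?z (the (X a)) oo w = e a))) &
  (ALL h e'. h : Ar --> Cod h = Dom k --> (ALL a<g. e' a = e a oo h) --> ?W' (k oo h) e' --> h : R)"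
  proof(intro bexI[of _ "pull w S"] conjI impI allI)
  show "pull w S : Sub (Dom k)" using pull_Sub[of w S] wA S by simp
  assume "Idn (Dom k) : pull w S"
  hence "w : S" using wA by(simp add: mem_pull)
  thus "EX w:S. Dom w = Dom k & prj ?z x oo w = l oo k & (ALL a<g. prj ?z (the (X a)) oo w = e a)" using w wA by blast
  next
  fix h e' assume h: "h : Ar" "Cod h = Dom k" and e': "ALL a<g. e' a = e a oo h" and W: "?W' (k oo h) e'"
  obtain v where v: "v : S" "Dom v = Dom (k oo h)" "prj ?z x oo v = l oo (k oo h)" "ALL a<g'. prj ?z (the (?X a)) oo v = e' a"
  using W by blast
  have vh: "v : hom (Dom h) (ctx ?z)" using SubD[OF S v(1)] v(2) h k by(simp add: hom_def)
  have hh: "h : hom (Dom h) (Dom k)" using h by(simp add: hom_def)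
  have "v = w oo h"
  proof(rule Z(4)[OF vh Cmp_hom[OF w(1) hh]])
  have "prj ?z x oo (w oo h) = (prj ?z x oo w) oo h" by(rule comp_assoc[OF hh w(1) Z(1), symmetric])
  thus "prj ?z x oo v = prj ?z x oo (w oo h)" using v(3) w(2) h k l by simp
  fix a assume a: "a < g"
  have "prj ?z (the (X a)) oo (w oo h) = (prj ?z (the (X a)) oo w) oo h" by(rule comp_assoc[OF hh w(1) Z(2)[OF a], symmetric])
  thus "prj ?z (the (X a)) oo v = prj ?z (the (X a)) oo (w oo h)"
  using v(4)[rule_format, of a] w(3) e' a th[OF a] g by simp
  qed
  thus "h : pull w S" using v(1) h wA by(simp add: mem_pull)
  qed
 qed
 hence "wins cov (bob ?X) g (Dom l) (%k e. EX w:S. Dom w = Dom k & prj ?z x oo w = l oo k & (ALL a<g. prj ?z (the (X a)) oo w = e a))" .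
 thus ?thesis unfolding inX_def in_T_iff B(3) by(rule wins_cong_obj) (simp add: th)
qed

end

context kcat
begin

subsubsection \<open>Games of finite length\<close>

text \<open>If there are no limit ordinals below \<open>\<kappa>\<close>, determinacy says nothing; the games are then of finite length and
 are solved by removing the last move.\<close>

definition last_move where
 "last_move cov As g k e W \<longleftrightarrow>
  (if cov g then EX (I::'k set) u x. covers (Dom k) I u &
  (ALL i:I. x i : hom (Dom (u i)) (As g) & W (k oo u i) ((%a. e a oo u i)(g := x i)))
  else ALL d x. d : Ar --> Cod d = Dom k --> x : hom (Dom d) (As g) --> W (k oo d) ((%a. e a oo d)(g := x)))"

text \<open>The strategy is kept; the target becomes what its answer to the last stage
  guarantees.\<close>

lemma wins_last:
 assumes w: "wins cov As (osuc g) C W" and Wc: "!!k e e'. (!!a. a < osuc g ==> e a = e' a) ==> W k e ==> W k e'"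
 shows "wins cov As g C (%k e. last_move cov As g k e W)"
proof -
 obtain \<sigma> where \<sigma>: "covering_strategy cov As C (osuc g) \<sigma>"
  "!!r. is_chain C (osuc g) r ==> follows cov As \<sigma> (osuc g) r ==> W (link r (osuc g) ozero) (%a. elt r a oo link r (osuc g) (osuc a))"
  using w unfolding wins_def by blast
 show ?thesis unfolding wins_def
 proof(intro exI[of _ \<sigma>] conjI allI impI)
  show "covering_strategy cov As C g \<sigma>" using \<sigma>(1) unfolding covering_strategy_def by(meson less_osuc order_less_trans)
  fix r assume r: "is_chain C g r" "follows cov As \<sigma> g r"
  let ?k = "link r g ozero" and ?e = "%a. elt r a oo link r g (osuc a)"
  have kd: "Dom ?k = stage r g" using chainD(3)[OF r(1) order_refl, of ozero] by(simp add: hom_def)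
  have step: "W (?k oo d) ((%a. ?e a oo d)(g := x))" if d: "d : Ar" "Cod d = stage r g" and x: "x : hom (Dom d) (As g)"
  and c: "cov g ==> i : sI \<sigma> g r & d = sU \<sigma> g r i & x = sE \<sigma> g r i" for d x i
  proof -
  let ?r = "ext_play r g d x i"
  have "W (?k oo d) (%a. elt ?r a oo link ?r (osuc g) (osuc a))"
  using \<sigma>(2)[OF ext_chain[OF r(1) d] ext_follows[OF r d x c]] by(simp add: ext_play_def)
  thus ?thesis
  proof(rule Wc[rotated])
  fix a assume "a < osuc g"
  show "elt ?r a oo link ?r (osuc g) (osuc a) = ((%a. ?e a oo d)(g := x)) a"
  proof(cases "a = g")
  case True
  thus ?thesis using x d by(auto simp: ext_play_def hom_def)
  next
  case False
  hence a: "a < g" using \<open>a < osuc g\<close> by simp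
  have "(elt r a oo link r g (osuc a)) oo d = elt r a oo (link r g (osuc a) oo d)"
  by(rule comp_assoc[of d "Dom d" "stage r g" _ "stage r (osuc a)" _ "As a"])
  (insert d a r(2) chainD(3)[OF r(1) order_refl, of "osuc a"], auto simp: hom_def follows_iff)
  thus ?thesis using False by(simp add: ext_play_def)
  qed
  qed
  qed
  show "last_move cov As g ?k ?e W"
  proof(cases "cov g")
  case True
  have cs: "covers (stage r g) (sI \<sigma> g r) (sU \<sigma> g r) & (ALL i:sI \<sigma> g r. sE \<sigma> g r i : hom (Dom (sU \<sigma> g r i)) (As g))"
  using \<sigma>(1) True r unfolding covering_strategy_iff by simp
  have "W (?k oo sU \<sigma> g r i) ((%a. ?e a oo sU \<sigma> g r i)(g := sE \<sigma> g r i))" if "i : sI \<sigma> g r" for i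
  by(rule step[of _ _ i]) (use cs that coversD(2,3)[of "stage r g" "sI \<sigma> g r" "sU \<sigma> g r" i] in auto)
  thus ?thesis unfolding last_move_def kd if_P[OF True] using cs
  by(intro exI[of _ "sI \<sigma> g r"] exI[of _ "sU \<sigma> g r"] exI[of _ "sE \<sigma> g r"]) blast
  qed (insert step, auto simp: last_move_def kd)
 qed
qed

text \<open>The converse of \<open>wins_last\<close>: the last answer is picked from the existence
  claim in \<open>last_move\<close>.\<close>

lemma wins_extend:
 assumes w: "wins cov As g C W'" and W': "!!k e. valid As g C k e ==> W' k e ==> last_move cov As g k e W"
  and Wc: "!!k e e'. (!!a. a < osuc g ==> e a = e' a) ==> W k e ==> W k e'"
 shows "wins cov As (osuc g) C W"
proof -
 obtain \<sigma> where \<sigma>: "covering_strategy cov As C g \<sigma>"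
  "!!r. is_chain C g r ==> follows cov As \<sigma> g r ==> W' (link r g ozero) (%a. elt r a oo link r g (osuc a))"
  using w unfolding wins_def by blast
 \<comment> \<open>\<open>Q\<close> singles out the good answers at stage \<open>g\<close>. By
   \<open>Qh\<close> it depends on the history only, so choosing from it is a legitimate
   strategy.\<close>
 define Q where "Q h t \<longleftrightarrow> (case t of (I::'k set, u, x) => covers (stage h g) I u &
  (ALL i:I. x i : hom (Dom (u i)) (As g) &
  W (link h g ozero oo u i) (%a. if a < g then (elt h a oo link h g (osuc a)) oo u i else x i)))"
  for h :: "('o, 'a, 'k) play" and t
 have Qh: "Q (history g r) = Q r" for r
 proof -
  have eq: "(%a. if a < g then (elt (history g r) a oo link (history g r) g (osuc a)) oo d else x) =
  (%a. if a < g then (elt r a oo link r g (osuc a)) oo d else x)" for d x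
  by(auto simp: history_def fun_eq_iff)
  show ?thesis unfolding Q_def eq by(simp add: history_def)
 qed
 define \<tau> where "\<tau> a h = (if a = g then (SOME t. Q h t) else \<sigma> a h)" for a h
 have fol: "follows cov As \<sigma> a r" if "follows cov As \<tau> a r" "a <= g" for a r
  using that unfolding follows_iff \<tau>_def by auto
 have lm: "last_move cov As g (link r g ozero) (%a. elt r a oo link r g (osuc a)) W" and
  kd: "Dom (link r g ozero) = stage r g" if "is_chain C g r" "follows cov As \<sigma> g r" for r
  using W'[OF play_valid[OF that] \<sigma>(2)[OF that]] chainD(3)[OF that(1) order_refl, of ozero] by(auto simp: hom_def)
 have QS: "Q r (\<tau> g (history g r))" if r: "is_chain C g r" "follows cov As \<sigma> g r" and c: "cov g" for r
 proof -
  obtain I u x where "covers (stage r g) (I::'k set) u" "ALL i:I. x i : hom (Dom (u i)) (As g) &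
  W (link r g ozero oo u i) ((%a. (elt r a oo link r g (osuc a)) oo u i)(g := x i))"
  using lm[OF r] c unfolding last_move_def kd[OF r] by auto
  moreover have "W k (%a. if a < g then e a else y)" if "W k (e(g := y))" for k e y by(rule Wc[OF _ that]) auto
  ultimately have "Q r (I, u, x)" unfolding Q_def prod.case by blast
  thus ?thesis unfolding \<tau>_def Qh by(simp add: someI[of "Q r"])
 qed
 show ?thesis unfolding wins_def
 proof(intro exI[of _ \<tau>] conjI allI impI)
  show "covering_strategy cov As C (osuc g) \<tau>" unfolding covering_strategy_iff
  proof(intro allI impI)
  fix a r assume a: "a < osuc g" "cov a" and r: "is_chain C a r" "follows cov As \<tau> a r"
  have f: "follows cov As \<sigma> a r" using fol[OF r(2)] a by simp
  show "covers (stage r a) (sI \<tau> a r) (sU \<tau> a r) & (ALL i:sI \<tau> a r. sE \<tau> a r i : hom (Dom (sU \<tau> a r i)) (As a))"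
  proof(cases "a = g")
  case True
  thus ?thesis using QS[of r] r f a by(auto simp: Q_def split_beta)
  next
  case False
  thus ?thesis using \<sigma>(1) a r(1) f unfolding covering_strategy_iff by(auto simp: \<tau>_def)
  qed
  qed
  fix r assume r: "is_chain C (osuc g) r" "follows cov As \<tau> (osuc g) r"
  have rg: "is_chain C g r" "follows cov As \<sigma> g r" using chain_mono[OF r(1)] fol[OF follows_mono[OF r(2)]] by auto
  let ?d = "link r (osuc g) g"
  have d: "?d : Ar" "Cod ?d = stage r g" "Dom ?d = stage r (osuc g)" using chainD(3)[OF r(1) order_refl, of g] by(auto simp: hom_def)
  have x: "elt r g : hom (Dom ?d) (As g)" using r(2) d unfolding follows_iff by simp
  have l0: "link r g ozero oo ?d = link r (osuc g) ozero" by(rule chainD(4)[OF r(1) order_refl]) auto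
  have eq: "(elt r a oo link r g (osuc a)) oo ?d = elt r a oo link r (osuc g) (osuc a)" if a: "a < g" for a
  proof -
  have "(elt r a oo link r g (osuc a)) oo ?d = elt r a oo (link r g (osuc a) oo ?d)"
  by(rule comp_assoc[of _ "stage r (osuc g)" "stage r g" _ "stage r (osuc a)" _ "As a"])
  (insert d a rg(2) chainD(3)[OF rg(1) order_refl, of "osuc a"], auto simp: hom_def follows_iff)
  thus ?thesis using chainD(4)[OF r(1) order_refl, of g "osuc a"] a by simp
  qed
  have eg: "elt r g oo link r (osuc g) (osuc g) = elt r g" using x chainD(2)[OF r(1) order_refl] d by(simp add: hom_def)
  have "W (link r g ozero oo ?d) (%a. if a < g then (elt r a oo link r g (osuc a)) oo ?d else elt r g)"
  proof(cases "cov g")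
  case True
  have i: "idx r g : sI \<tau> g r" "?d = sU \<tau> g r (idx r g)" "elt r g = sE \<tau> g r (idx r g)" using r(2) True unfolding follows_iff by simp_all
  show ?thesis unfolding i(2,3) using QS[OF rg True] i(1) unfolding Q_def split_beta by blast
  next
  case False
  hence "W (link r g ozero oo ?d) ((%a. (elt r a oo link r g (osuc a)) oo ?d)(g := elt r g))"
  using lm[OF rg] d x unfolding last_move_def kd[OF rg] by simp
  thus ?thesis by(rule Wc[rotated]) auto
  qed
  thus "W (link r (osuc g) ozero) (%a. elt r a oo link r (osuc g) (osuc a))" unfolding l0
  by(rule Wc[rotated]) (insert eq eg, auto simp: order.order_iff_strict)
 qed
qed

text \<open>If winning is membership in a subobject, the family over \<open>f\<close> has the
  inverse image of \<open>J\<close> as greatest member, so stability comes for free.\<close>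

lemma goodJ_iff:
 assumes J: "J : Sub A" and iff: "!!l. l : Ar ==> Cod l = A ==> in_T cov g As pA pr S l \<longleftrightarrow> l : J"
 shows "goodJ cov g As A pA pr S J"
 unfolding goodJ_def
proof(intro conjI J ballI impI is_joinI)
 fix f assume f: "f : Ar" "Cod f = A"
 show p: "pull f J : Sub (Dom f)" using pull_Sub[OF f(1)] J f by simp
 fix R assume "R : {sub_of l | l. monic l & Cod l = Dom f & in_T cov g As pA pr S (f oo l)}"
 then obtain l where l: "R = sub_of l" "monic l" "Cod l = Dom f" "in_T cov g As pA pr S (f oo l)" by blast
 have lA: "l : Ar" using l(2) monicD(1) by blast
 have "l : pull f J" using l(4) iff[of "f oo l"] f lA l(3) by(simp add: mem_pull)
 thus "R <= pull f J" using Sub_comp[OF p] lA l(1) by(auto simp: mem_sub_of)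
next
 fix f K assume f: "f : Ar" "Cod f = A"
  and K: "!!R. R : {sub_of l | l. monic l & Cod l = Dom f & in_T cov g As pA pr S (f oo l)} ==> R <= K"
 have "pull f J : Sub (Dom f)" using pull_Sub[OF f(1)] J f by simp
 then obtain m where m: "monic m" "m : Ar" "Cod m = Dom f" "pull f J = sub_of m" by(elim SubE)
 have "m : pull f J" using m sub_of_self by simp
 hence "in_T cov g As pA pr S (f oo m)" using iff[of "f oo m"] f m(2,3) by(auto simp only: mem_pull Cmp_Ar Cod_Cmp)
 thus "pull f J <= K" using K m by blast
qed

end

context kstr
begin

definition goodX :: "('k => bool) => ('k \<rightharpoonup> ('s, 'k) block) => ('s, 'k) block => 'a set => 'a set => bool" where
 "goodX cov X x S J \<longleftrightarrow> goodJ cov (len X) (bob X) (ctx x) (prj (x Un bvars X) x) (bpr (x Un bvars X) X) S J"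

lemma blen_restrict:
 assumes X: "blen X g'" and g: "g <= g'"
 shows "blen (X |` {..<g}) g" "bvars (X |` {..<g}) <= bvars X"
proof -
 note B = blenD[OF X]
 have rn: "ran (X |` {..<g}) <= ran X" by(auto simp: ran_def restrict_map_def split: if_splits)
 have dm: "dom (X |` {..<g}) = {..<g}" using B(2) g by auto
 show "blen (X |` {..<g}) g" unfolding blen_def wf_blocks_def
 proof(intro conjI exI[of _ g] ballI allI impI dm)
  fix A assume "A : ran (X |` {..<g})"
  thus "wfc A" using rn B(1) unfolding wf_blocks_def by blast
 next
  fix a b A A' assume "a ~= b" "(X |` {..<g}) a = Some A" "(X |` {..<g}) b = Some A'"
  thus "A Int A' = {}" using B(1) unfolding wf_blocks_def by(auto simp: restrict_map_def split: if_splits)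
 qed
 show "bvars (X |` {..<g}) <= bvars X" using rn by(auto simp: bvars_def)
qed

text \<open>The innermost quantifier can be evaluated first: a last cover with its elements is a
  local witness for \<exists> along the projection, and a last arbitrary move is a test arrow for
  \<forall> along it.\<close>

lemma inX_last:
 assumes x: "wfc x" and X: "blen X (osuc g)" and d: "x Int bvars X = {}" and S: "S : Sub (ctx (x Un bvars X))"
  and l: "l : Ar" "Cod l = ctx x"
 defines "X' == X |` {..<g}"
 defines "\<pi> == prj (x Un bvars X) (x Un bvars X')"
 shows "inX cov X x S l \<longleftrightarrow> inX cov X' x (if cov g then ex_along \<pi> S else all_along \<pi> S) l"
proof -
 let ?z = "x Un bvars X" and ?z' = "x Un bvars X'"
 note B = blenD[OF X]
 have X': "blen X' g" and bv: "bvars X' <= bvars X" using blen_restrict[OF X, of g] by(auto simp: X'_def)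
 note B' = blenD[OF X']
 have z: "wfc ?z" and z': "wfc ?z'" using wfc_Un x B(8) B'(8) by auto
 note Z = prodZ_D[OF ctx_prodZ[OF x X d]]
 have d': "x Int bvars X' = {}" using d bv by blast
 note Z' = prodZ_D[OF ctx_prodZ[OF x X' d']]
 have th: "the (X' a) = the (X a)" if "a < g" for a using that by(simp add: X'_def)
 have sub: "?z' <= ?z" using bv by blast
 have \<pi>: "\<pi> : hom (ctx ?z) (ctx ?z')" unfolding \<pi>_def by(rule prj_hom[OF z sub])
 have p: "\<pi> : Ar" "Dom \<pi> = ctx ?z" "Cod \<pi> = ctx ?z'" using \<pi> by(auto simp: hom_def)
 have SR: "S : Sub (Dom \<pi>)" using S p by simp
 let ?S' = "if cov g then ex_along \<pi> S else all_along \<pi> S"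
 have S': "?S' : Sub (ctx ?z')" using ex_Sub[OF p(1) SR] all_Sub[OF p(1) SR] p by simp
 have px: "prj ?z' x oo (\<pi> oo w) = prj ?z x oo w" if "w : hom D (ctx ?z)" for w D
  using comp_assoc[OF that \<pi> Z'(1)] prj_prj[OF z sub, of x] by(simp add: \<pi>_def)
 have pa: "prj ?z' (the (X' a)) oo (\<pi> oo w) = prj ?z (the (X a)) oo w" if "w : hom D (ctx ?z)" "a < g" for w D a
  using comp_assoc[OF that(1) \<pi> Z'(2)[OF that(2)]] prj_prj[OF z sub, of "the (X' a)"] B'(7)[OF that(2)] th[OF that(2)]
  by(simp add: \<pi>_def le_supI2)
 let ?W = "%k e. EX w:S. Dom w = Dom k & prj ?z x oo w = l oo k & (ALL a<osuc g. prj ?z (the (X a)) oo w = e a)"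
 let ?W' = "%k e. EX w:?S'. Dom w = Dom k & prj ?z' x oo w = l oo k & (ALL a<g. prj ?z' (the (X' a)) oo w = e a)"
 text \<open>The arrow \<open>w'\<close> classifies a play of length \<open>g\<close>, and \<open>w\<close> its continuation by the move \<open>(t, y)\<close>.\<close>
 have ext: "\<pi> oo w = w' oo t \<longleftrightarrow> prj ?z x oo w = l oo (k oo t) & (ALL a<g. prj ?z (the (X a)) oo w = e a oo t)"
  if k: "k : Ar" "Cod k = Dom l" and w': "w' : hom (Dom k) (ctx ?z')" "prj ?z' x oo w' = l oo k" "ALL a<g. prj ?z' (the (X' a)) oo w' = e a"
  and t: "t : hom D (Dom k)" and w: "w : hom D (ctx ?z)" for k e w' t w D
 proof -
  note wt = Cmp_hom[OF w'(1) t]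
  have 1: "prj ?z' x oo (w' oo t) = l oo (k oo t)" using comp_assoc[OF t w'(1) Z'(1)] w'(2) k l t by(simp add: hom_def)
  have 2: "prj ?z' (the (X' a)) oo (w' oo t) = e a oo t" if "a < g" for a
  using comp_assoc[OF t w'(1) Z'(2)[OF that]] w'(3) that by simp
  show ?thesis
  proof
  assume "\<pi> oo w = w' oo t"
  thus "prj ?z x oo w = l oo (k oo t) & (ALL a<g. prj ?z (the (X a)) oo w = e a oo t)" using px[OF w] pa[OF w] 1 2 by simp
  next
  assume "prj ?z x oo w = l oo (k oo t) & (ALL a<g. prj ?z (the (X a)) oo w = e a oo t)"
  thus "\<pi> oo w = w' oo t" using px[OF w] pa[OF w] 1 2 by(intro Z'(4)[OF Cmp_hom[OF \<pi> w] wt]) auto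
  qed
 qed
 have Wc: "?W k e'" if "!!a. a < osuc g ==> e a = e' a" "?W k e" for k e e' using that by auto
 have dec: "prj ?z x oo w = K & (ALL a<osuc g. prj ?z (the (X a)) oo w = (E(g := y)) a) \<longleftrightarrow>
  (prj ?z x oo w = K & (ALL a<g. prj ?z (the (X a)) oo w = E a)) & prj ?z (the (X g)) oo w = y" for w K E y
  by(auto simp: order.order_iff_strict)
 have lm: "last_move cov (bob X) g k e ?W \<longleftrightarrow> ?W' k e" if v: "valid (bob X) g (Dom l) k e" for k e
 proof -
  have k: "k : Ar" "Cod k = Dom l" and e: "!!a. a < g ==> e a : hom (Dom k) (bob X' a)"
  using v th by(auto simp: valid_def)
  have lk: "l oo k : hom (Dom k) (ctx x)" using k l by(simp add: hom_def)
  obtain w' where w': "w' : hom (Dom k) (ctx ?z')" "prj ?z' x oo w' = l oo k" "ALL a<g. prj ?z' (the (X' a)) oo w' = e a"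
  using Z'(3)[OF lk e] by blast
  have w'A: "w' : Ar" "Dom w' = Dom k" "Cod w' = ctx ?z'" using w'(1) by(auto simp: hom_def)
  have W'iff: "?W' k e \<longleftrightarrow> w' : ?S'"
  proof
  assume "?W' k e"
  then obtain v where v: "v : ?S'" "Dom v = Dom k" "prj ?z' x oo v = l oo k" "ALL a<g. prj ?z' (the (X' a)) oo v = e a" by(elim bexE conjE) (rule that)
  have "v : hom (Dom k) (ctx ?z')" using SubD[OF S' v(1)] v(2) by(simp add: hom_def)
  hence "v = w'" by(rule Z'(4)[OF _ w'(1)]) (use v w' in auto)
  thus "w' : ?S'" using v(1) by simp
  next
  assume "w' : ?S'"
  thus "?W' k e" by(rule bexI[rotated]) (intro conjI w'(2,3) w'A(2))
  qed
  have Wx: "?W (k oo t) ((%a. e a oo t)(g := y)) \<longleftrightarrow> (EX w:S. Dom w = Dom t & \<pi> oo w = w' oo t & prj ?z (the (X g)) oo w = y)"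
  if t: "t : Ar" "Cod t = Dom k" for t y
  unfolding dec
  proof(intro bex_cong refl)
  fix w assume w: "w : S"
  have th: "t : hom (Dom t) (Dom k)" using t by(simp add: hom_def)
  show "Dom w = Dom (k oo t) & (prj ?z x oo w = l oo k oo t & (ALL a<g. prj ?z (the (X a)) oo w = e a oo t)) & prj ?z (the (X g)) oo w = y \<longleftrightarrow>
  Dom w = Dom t & \<pi> oo w = w' oo t & prj ?z (the (X g)) oo w = y"
  using ext[OF k w' th, of w] SubD[OF S w] k t by(auto simp: hom_def)
  qed
  have Zg: "prj ?z (the (X g)) : hom (ctx ?z) (bob X g)" using Z(2)[of g] by simp
  show ?thesis
  proof(cases "cov g")
  case True
  show ?thesis unfolding W'iff unfolding if_P[OF True, of "ex_along \<pi> S"]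
  proof
  assume "last_move cov (bob X) g k e ?W"
  then obtain I u y where u: "covers (Dom k) (I::'k set) u"
  and y: "!!i. i : I ==> ?W (k oo u i) ((%a. e a oo u i)(g := y i))" unfolding last_move_def if_P[OF True] by blast
  show "w' : ex_along \<pi> S"
  proof(rule covers_local[OF u _ w'A(1,3,2)])
  show "ex_along \<pi> S : Sub (ctx ?z')" using S' True by simp
  fix i assume i: "i : I"
  obtain w where "w : S" "\<pi> oo w = w' oo u i" using y[OF i] Wx[OF coversD(2,3)[OF u i]] by blast
  thus "w' oo u i : ex_along \<pi> S" using ex_mem[OF p(1) SR] by metis
  qed
  next
  assume "w' : ex_along \<pi> S"
  then obtain c h where c: "cover c" "c : Ar" "Cod c = Dom w'" and h: "h : S" "Dom h = Dom c" "\<pi> oo h = w' oo c"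
  by(rule mem_ex[OF p(1) SR])
  have cv: "covers (Dom k) {ozero::'k} (%_. c)" using c(1) unfolding covers_def c(3) w'A by simp
  have hh: "h : hom (Dom c) (ctx ?z)" using SubD[OF S h(1)] h(2) by(simp add: hom_def)
  show "last_move cov (bob X) g k e ?W" unfolding last_move_def if_P[OF True]
  by(rule exI[of _ "{ozero}"], rule exI[of _ "%_. c"], rule exI[of _ "%_. prj ?z (the (X g)) oo h"])
  (use cv Cmp_hom[OF Zg hh] Wx[of c] c(2,3) w'A(2) h in auto)
  qed
  next
  case False
  show ?thesis unfolding W'iff unfolding if_not_P[OF False]
  proof
  assume L: "last_move cov (bob X) g k e ?W"
  show "w' : all_along \<pi> S" unfolding mem_all[OF p(1) SR] p
  proof(intro conjI allI impI w'A)
  fix h t assume ht: "h : Ar" "t : Ar" "Cod h = ctx ?z" "Cod t = Dom w'" "Dom h = Dom t" "\<pi> oo h = w' oo t"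
  have hh: "h : hom (Dom t) (ctx ?z)" using ht by(simp add: hom_def)
  have t: "t : Ar" "Cod t = Dom k" using ht w'A by auto
  have "?W (k oo t) ((%a. e a oo t)(g := prj ?z (the (X g)) oo h))" using L Cmp_hom[OF Zg hh] t unfolding last_move_def if_not_P[OF False] by blast
  then obtain w where w: "w : S" "Dom w = Dom t" "\<pi> oo w = w' oo t" "prj ?z (the (X g)) oo w = prj ?z (the (X g)) oo h" unfolding Wx[OF t] by blast
  have wh: "w : hom (Dom t) (ctx ?z)" using SubD[OF S w(1)] w(2) by(simp add: hom_def)
  have "w = h"
  proof(rule Z(4)[OF wh hh])
  show "prj ?z x oo w = prj ?z x oo h" using px[OF wh] px[OF hh] w(3) ht(6) by simp
  show "prj ?z (the (X a)) oo w = prj ?z (the (X a)) oo h" if "a < osuc g" for a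
  using pa[OF wh, of a] pa[OF hh, of a] w(3,4) ht(6) that by(cases "a = g") auto
  qed
  thus "h : S" using w(1) by simp
  qed
  next
  assume A: "w' : all_along \<pi> S"
  show "last_move cov (bob X) g k e ?W" unfolding last_move_def if_not_P[OF False]
  proof(intro allI impI)
  fix t y assume t: "t : Ar" "Cod t = Dom k" and y: "y : hom (Dom t) (bob X g)"
  have th': "t : hom (Dom t) (Dom k)" using t by(simp add: hom_def)
  have e2: "((%a. e a oo t)(g := y)) a : hom (Dom t) (bob X a)" if "a < osuc g" for a
  using that y Cmp_hom[OF e[of a] th'] th[of a] by(cases "a = g") auto
  obtain w where w: "w : hom (Dom t) (ctx ?z)" "prj ?z x oo w = (l oo k) oo t" "ALL a<osuc g. prj ?z (the (X a)) oo w = ((%a. e a oo t)(g := y)) a"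
  using Z(3)[OF Cmp_hom[OF lk th'] e2] by blast
  have "(l oo k) oo t = l oo (k oo t)" using k l t by simp
  hence q: "prj ?z x oo w = l oo (k oo t) & (ALL a<osuc g. prj ?z (the (X a)) oo w = ((%a. e a oo t)(g := y)) a)" using w by simp
  hence "\<pi> oo w = w' oo t" unfolding dec ext[OF k w' th' w(1)] by blast
  hence "w : S" using A w(1) t w'A unfolding mem_all[OF p(1) SR] p by(auto simp: hom_def)
  thus "?W (k oo t) ((%a. e a oo t)(g := y))" using q w(1) t k by(intro bexI[of _ w]) (auto simp: hom_def)
  qed
  qed
  qed
 qed
 show ?thesis
 proof
  assume "inX cov X x S l"
  hence "wins cov (bob X) g (Dom l) (%k e. last_move cov (bob X) g k e ?W)"
  unfolding inX_def in_T_iff B(3) by(rule wins_last) (rule Wc)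
  hence "wins cov (bob X) g (Dom l) ?W'" by(rule wins_mono) (use lm in blast)
  thus "inX cov X' x ?S' l" unfolding inX_def in_T_iff B'(3) by(rule wins_cong_obj) (simp add: th)
 next
  assume "inX cov X' x ?S' l"
  hence "wins cov (bob X) g (Dom l) ?W'" unfolding inX_def in_T_iff B'(3) by(rule wins_cong_obj) (simp add: th)
  thus "inX cov X x S l" unfolding inX_def in_T_iff B(3) by(rule wins_extend) (use lm Wc in blast)+
 qed
qed

text \<open>Backward induction: \<open>inX_last\<close> absorbs the last stage into the target, and
  a game without moves is won exactly by the arrows in its target.\<close>

lemma finite_good:
 assumes x: "wfc x"
 shows "finite {..<g} ==> blen X g ==> x Int bvars X = {} ==> S : Sub (ctx (x Un bvars X)) ==>
  EX J:Sub (ctx x). ALL l:Ar. Cod l = ctx x --> (inX cov X x S l \<longleftrightarrow> l : J)"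
proof(induction g arbitrary: X S rule: ord_induct)
 case zero
 note B = blenD[OF zero(2)]
 have bv: "bvars X = {}" using B(9) by auto
 have S: "S : Sub (ctx x)" using zero bv by simp
 have "inX cov X x S l \<longleftrightarrow> l : S" if l: "l : Ar" "Cod l = ctx x" for l
 proof -
  have W: "(EX w:S. Dom w = Dom (Idn (Dom l)) & prj (x Un bvars X) x oo w = l oo Idn (Dom l) & (ALL a<ozero. Q a w)) \<longleftrightarrow> l : S" for Q :: "'k => 'a => bool"
  using l SubD[OF S] prj_Idn[OF x] bv by auto
  show ?thesis
  proof
  assume "inX cov X x S l"
  thus "l : S" unfolding inX_def in_T_iff B(3) wins_def
  using triv_chain[of "Dom l"] triv_follows chainD(2)[OF triv_chain[of "Dom l"] order_refl] chain_zero[OF triv_chain[of "Dom l"]] l W by fastforce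
  next
  assume "l : S"
  thus "inX cov X x S l" unfolding inX_def in_T_iff B(3) wins_def
  using W chainD(2)[of "Dom l" ozero _ ozero] chain_zero by(auto simp: covering_strategy_def)
  qed
 qed
 thus ?case using S by blast
next
 case (succ g)
 let ?X' = "X |` {..<g}" let ?\<pi> = "prj (x Un bvars X) (x Un bvars ?X')"
 let ?S' = "if cov g then ex_along ?\<pi> S else all_along ?\<pi> S"
 have bv: "bvars ?X' <= bvars X" and b: "blen ?X' g" using blen_restrict[OF succ.prems(2), of g] by auto
 have \<pi>: "?\<pi> : hom (ctx (x Un bvars X)) (ctx (x Un bvars ?X'))" using bv by(intro prj_hom wfc_Un x blenD(8)[OF succ.prems(2)]) auto
 have S': "?S' : Sub (ctx (x Un bvars ?X'))" using ex_Sub[of ?\<pi> S] all_Sub[of ?\<pi> S] \<pi> succ.prems(4) by(auto simp: hom_def)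
 obtain J where J: "J : Sub (ctx x)" "ALL l:Ar. Cod l = ctx x --> (inX cov ?X' x ?S' l \<longleftrightarrow> l : J)"
  using succ.IH[OF _ b _ S'] succ.prems bv by auto
 thus ?case using inX_last[OF x succ.prems(2-4)] by(intro bexI[of _ J]) blast+
qed (simp add: infinite_lim)

end

section \<open>Determinacy and stability for games given by formulas\<close>

locale khet = kstr K H Sg M for K :: "'k::wellorder itself" and H :: "('o, 'a) cat"
  and Sg :: "('k, 's::wellorder, 'f, 'r) signature" and M :: "('s, 'f, 'r, 'o, 'a) struc" +
 fixes C :: "('k, 's, 'f, 'r) fm set"
 assumes het: "kappa_heterogeneous Sg C H M" and wdet: "well_determined Sg C H M"
begin

abbreviation "sm == sem Sg H M"

definition detX where
 "detX cov X x S1 S2 J1 J2 \<longleftrightarrow> det cov (len X) (bob X) (ctx x) (prj (x Un bvars X) x) (bpr (x Un bvars X) X) S1 S2 J1 J2"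

lemma sem_Neg: "sm (Neg \<phi>) x = imp_sub H (ctx x) (sm \<phi> x) (bot (ctx x))" by(simp add: bot_def)

lemma sem_Neg_Sub: "sm \<phi> x : Sub (ctx x) ==> sm (Neg \<phi>) x : Sub (ctx x)"
 unfolding sem_Neg using imp_Sub bot_Sub Sub_Ob by blast

lemma sem_Neg_disj: "sm \<phi> x : Sub (ctx x) ==> sm \<phi> x Int sm (Neg \<phi>) x <= bot (ctx x)"
 unfolding sem_Neg using imp_adj[OF _ bot_Sub imp_Sub[OF _ bot_Sub]] Sub_Ob by(metis Int_commute order_refl)

lemma wf_Bot: "wf_fm Sg C Bot" by(rule wf_fm.intros(5)) (auto intro: less_kappa_finite)
lemma wf_Neg: "wf_fm Sg C \<phi> ==> wf_fm Sg C (Neg \<phi>)" by(rule wf_fm.intros(3)[OF _ wf_Bot])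
lemma FV_Neg [simp]: "FV (Neg \<phi>) = FV \<phi>" by simp

lemma sem_pair: "{R x | (i::'k) R. map_option sm ([ozero |-> \<phi>, osuc ozero |-> \<psi>] i) = Some R} = {sm \<phi> x, sm \<psi> x}"
proof(intro equalityI subsetI)
 fix S assume "S : {sm \<phi> x, sm \<psi> x}"
 thus "S : {R x | (i::'k) R. map_option sm ([ozero |-> \<phi>, osuc ozero |-> \<psi>] i) = Some R}"
 proof(elim insertE emptyE)
  assume "S = sm \<phi> x"
  thus ?thesis by(intro CollectI exI[of _ "ozero::'k"] exI[of _ "sm \<phi>"]) simp
 next
  assume "S = sm \<psi> x"
  thus ?thesis by(intro CollectI exI[of _ "osuc ozero::'k"] exI[of _ "sm \<psi>"]) simp
 qed
qed (auto split: if_splits)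

text \<open>The determinacy axiom read in the model: the two joins, which exist by
  \<open>kappa_heterogeneous\<close>, together exhaust the context.\<close>

lemma base_det:
 assumes g: "is_lim g" and X: "blen X g" and x: "wfc x" and d: "x Int bvars X = {}" and \<phi>: "\<phi> : C" "wf_fm Sg C \<phi>"
  "FV \<phi> <= x Un bvars X"
 defines "z == x Un bvars X"
 shows "EX J1 J2. detX (%a. ~ ord_even a) X x (sm \<phi> z) (sm (Neg \<phi>) z) J1 J2"
proof -
 note B = blenD[OF X]
 have xb: "x - bvars X = x" using d by blast
 let ?F1 = "het_family H M (%a. ~ ord_even a) X x (sm \<phi> z)" and ?F2 = "het_family H M ord_even X x (sm (Neg \<phi>) z)"
 obtain J1 J2 where J: "is_join (ctx x) ?F1 J1" "is_join (ctx x) ?F2 J2"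
  using het g B(1,2) x d \<phi> unfolding kappa_heterogeneous_def Let_def z_def by blast
 let ?A = "AE X \<phi>" and ?E = "EA X (Neg \<phi>)"
 have "dom X ~= {}" using B(2) is_lim_ozero_less[OF g] by blast
 hence wA: "wf_fm Sg C ?A" and wE: "wf_fm Sg C ?E"
  using B(1) \<phi> wf_Neg by(auto intro!: wf_fm.intros(6) simp del: dom_eq_empty_conv)
 have FV: "FV ?A <= x" "FV ?E <= x" using \<phi>(3) by(auto simp del: split_paired_All)
 have "wf_sequent Sg C (Top, x, Or ?A ?E)" unfolding wf_sequent_def prod.case
 proof(intro conjI x)
  show "wf_fm Sg C Top" by(rule wf_fm.intros(4)[of _ ozero]) (auto intro: less_kappa_finite)
  have fv: "FV (Or ?A ?E) <= x" using FV unfolding Or_def by(auto simp del: FV.simps(6) split: if_splits)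
  thus "FV Top Un FV (Or ?A ?E) <= x" by simp
  show "wf_fm Sg C (Or ?A ?E)" using wA wE less_kappa_subset[OF wfcD(1)[OF x] fv] unfolding Or_def
  by(intro wf_fm.intros(5)) (auto split: if_splits)
 qed
 hence "(Top, x, Or ?A ?E) : determinacy_axioms Sg C" using \<phi>(1) g B(2) by(auto intro: determinacy_axioms.intros)
 hence h: "sm Top x <= sm (Or ?A ?E) x" using wdet unfolding well_determined_def holds_def by fastforce
 have sA: "sm ?A x = J1" and sE: "sm ?E x = J2"
  using join_eq[OF J(1)] join_eq[OF J(2)] pull_Idn[OF is_joinD(1)[OF J(1)]] pull_Idn[OF is_joinD(1)[OF J(2)]] prj_Idn[OF x]
  by(simp_all add: Let_def xb z_def)
 from sem_pair[of x ?A ?E] have "whole (ctx x) <= join (ctx x) {J1, J2}" using h sA sE unfolding Or_def by(simp del: sem.simps(6))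
 moreover have jj: "is_join (ctx x) {J1, J2} (join (ctx x) {J1, J2})"
  by(rule join_is_join[OF ctx_Ob[OF x] _ ordLess_imp_ordLeq[OF card_finite]]) (use is_joinD(1)[OF J(1)] is_joinD(1)[OF J(2)] in auto)
 ultimately have "is_join (ctx x) {J1, J2} (whole (ctx x))" using Sub_whole[OF is_joinD(1)[OF jj]] by auto
 thus ?thesis unfolding detX_def det_def z_def[symmetric]
  by(intro exI[of _ J1] exI[of _ J2] exI[of _ ?F1] exI[of _ ?F2] conjI J)
  (auto simp: het_family_def T_sub_def Let_def z_def[symmetric] simp del: sem.simps)
qed

text \<open>The axiom gives \<phi> to the player covering at odd stages. Empty blocks at stage 0 and
  at all limits reverse every parity, so the axiom for the enlarged sequence of blocks settles the
  other assignment.\<close>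

lemma det_lim:
 assumes g: "is_lim g" and X: "blen X g" and x: "wfc x" and d: "x Int bvars X = {}" and \<phi>: "\<phi> : C" "wf_fm Sg C \<phi>"
  "FV \<phi> <= x Un bvars X" and c: "cov = ord_even \<or> cov = (%a. ~ ord_even a)"
 defines "z == x Un bvars X"
 shows "EX J1 J2. detX cov X x (sm \<phi> z) (sm (Neg \<phi>) z) J1 J2"
 using c
proof
 assume "cov = (%a. ~ ord_even a)"
 thus ?thesis using base_det[OF g X x d \<phi>] by(simp add: z_def)
next
 assume c: "cov = ord_even"
 note I = ins_blen[OF X g, of True]
 let ?Y = "ins True g X"
 obtain J1 J2 where J: "detX (%a. ~ ord_even a) ?Y x (sm \<phi> z) (sm (Neg \<phi>) z) J1 J2"
  using base_det[OF g I(1) x _ \<phi>(1,2)] d \<phi>(3) by(auto simp: I(2) z_def)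
 have ev: "insD True c ==> ord_even c" for c by(auto simp: insD_def)
 have real: "~ insD True c ==> ord_even c \<longleftrightarrow> ~ ord_even (insq True c)" for c
  by(cases c rule: ord_cases) (auto simp: insD_def insq_def)
 have "detX cov X x (sm \<phi> z) (sm (Neg \<phi>) z) J1 J2" unfolding detX_def c
 proof(rule det_transfer[OF J[unfolded detX_def]])
  fix l assume "in_T (%a. ~ ord_even a) (len ?Y) (bob ?Y) (prj (x Un bvars ?Y) x) (bpr (x Un bvars ?Y) ?Y) (sm \<phi> z) l"
  hence "inX (%a. ~ ord_even a) ?Y x (sm \<phi> z) l" by(simp add: inX_def)
  hence "inX ord_even X x (sm \<phi> z) l" by(rule inX_ins[OF X g]) (use ev real in auto)
  thus "in_T ord_even (len X) (bob X) (prj (x Un bvars X) x) (bpr (x Un bvars X) X) (sm \<phi> z) l" by(simp add: inX_def)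
 next
  fix l assume "in_T (%a. ~ ~ ord_even a) (len ?Y) (bob ?Y) (prj (x Un bvars ?Y) x) (bpr (x Un bvars ?Y) ?Y) (sm (Neg \<phi>) z) l"
  hence "inX ord_even ?Y x (sm (Neg \<phi>) z) l" by(simp add: inX_def)
  hence "inX (%a. ~ ord_even a) X x (sm (Neg \<phi>) z) l" by(rule inX_ins[OF X g]) (use ev real in auto)
  thus "in_T (%a. ~ ord_even a) (len X) (bob X) (prj (x Un bvars X) x) (bpr (x Un bvars X) X) (sm (Neg \<phi>) z) l" by(simp add: inX_def)
 qed
 thus ?thesis by blast
qed

text \<open>Padding up to a limit brings any length within reach of \<open>det_lim\<close>. If no
  limit lies above, the length is finite and backward induction takes over.\<close>

lemma het_good:
 assumes X: "blen X g" and g0: "g ~= ozero" and x: "wfc x" and d: "x Int bvars X = {}" and \<chi>: "\<chi> : C" "wf_fm Sg C \<chi>"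
  "FV \<chi> <= x Un bvars X" and \<phi>: "\<phi> = \<chi> \<or> \<phi> = Neg \<chi>" and S: "sm \<chi> (x Un bvars X) : Sub (ctx (x Un bvars X))"
  and c: "cov = ord_even \<or> cov = (%a. ~ ord_even a)"
 shows "EX J. goodX cov X x (sm \<phi> (x Un bvars X)) J"
proof -
 note B = blenD[OF X]
 let ?z = "x Un bvars X"
 have Sn: "sm (Neg \<chi>) ?z : Sub (ctx ?z)" and disj: "sm \<chi> ?z Int sm (Neg \<chi>) ?z <= bot (ctx ?z)"
  using sem_Neg_Sub[OF S] sem_Neg_disj[OF S] by auto
 have c': "(%a. ~ cov a) = ord_even \<or> (%a. ~ cov a) = (%a. ~ ord_even a)" using c by auto
 show ?thesis
 proof(cases "EX g'. is_lim g' & g <= g'")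
  case True
  then obtain g' where g': "is_lim g'" "g <= g'" by blast
  note P = pad_blen[OF X g'(2)]
  let ?Y = "pad g g' X"
  have D: "EX J1 J2. detX cov X x (sm \<chi> ?z) (sm (Neg \<chi>) ?z) J1 J2" if c: "cov = ord_even \<or> cov = (%a. ~ ord_even a)" for cov
  proof -
  obtain J1 J2 where J: "detX cov ?Y x (sm \<chi> ?z) (sm (Neg \<chi>) ?z) J1 J2"
  using det_lim[OF g'(1) P(1) x _ \<chi>(1,2) _ c] d \<chi>(3) by(auto simp: P(2))
  have "detX cov X x (sm \<chi> ?z) (sm (Neg \<chi>) ?z) J1 J2" unfolding detX_def
  by(rule det_transfer[OF J[unfolded detX_def]])
  (insert inX_pad[OF x X d g'(2)] S Sn, simp_all add: inX_def)
  thus ?thesis by blast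
  qed
  have nc: "~ (cov ozero & cov (osuc ozero))" "cov ozero \<or> cov (osuc ozero)"
  if "cov = ord_even \<or> cov = (%a. ~ ord_even a)" for cov :: "'k => bool" using that by auto
  have g: "ozero < len X" using g0 B(3) by simp
  from \<phi> show ?thesis
  proof
  assume p: "\<phi> = \<chi>"
  obtain J1 J2 where J: "detX cov X x (sm \<chi> ?z) (sm (Neg \<chi>) ?z) J1 J2" using D[OF c] by blast
  hence "goodX cov X x (sm \<chi> ?z) J1" unfolding detX_def goodX_def
  by(rule det_good[OF _ _ S Sn disj nc[OF c] g]) (use ctx_prodZ[OF x X d] B(3) in simp)
  thus ?thesis using p by blast
  next
  assume p: "\<phi> = Neg \<chi>"
  obtain J1 J2 where J: "detX (%a. ~ cov a) X x (sm \<chi> ?z) (sm (Neg \<chi>) ?z) J1 J2" using D[OF c'] by blast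
  have "goodX cov X x (sm (Neg \<chi>) ?z) J2" unfolding goodX_def
  by(rule det_good[OF det_swap[OF J[unfolded detX_def], unfolded not_not] _ Sn S _ nc[OF c] g])
  (insert ctx_prodZ[OF x X d] B(3) disj, auto simp del: sem.simps)
  thus ?thesis using p by blast
  qed
 next
  case False
  \<comment> \<open>\<open>g\<close> is a finite successor of \<open>ozero\<close> or of a limit; in
    the latter case \<open>ex_lim_greater\<close> would give a limit above \<open>g\<close>.\<close>
  have "finite {..<g}"
  proof(rule ccontr)
  assume "infinite {..<g}"
  moreover obtain l n where l: "obase l" "g = (osuc ^^ n) l" using ord_decomp by blast
  moreover have "finite {..<(osuc ^^ n) (ozero::'k)}" for n
  by(induction n) (simp_all del: lessThan_iff, simp add: lessThan_def)
  ultimately have "is_lim l" by(auto simp: obase_def)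
  thus False using ex_lim_greater False less_imp_le by blast
  qed
  moreover have "sm \<phi> ?z : Sub (ctx ?z)" using \<phi> S Sn by blast
  ultimately obtain J where "J : Sub (ctx x)" "ALL l:Ar. Cod l = ctx x --> (inX cov X x (sm \<phi> ?z) l \<longleftrightarrow> l : J)"
  using finite_good[OF x _ X d] by blast
  hence "goodX cov X x (sm \<phi> ?z) J" unfolding goodX_def by(intro goodJ_iff) (auto simp: inX_def)
  thus ?thesis by blast
 qed
qed

end

context kstr
begin

subsubsection \<open>Terms\<close>

abbreviation "ts == tsem Sg H M"

lemma arity_Ob: "ran ar <= Sorts Sg ==> i : dom ar ==> sort_ob M (the (ar i)) : Ob"
 by(auto intro!: sort_Ob ranI)

lemma arity_tuple_hom:
 assumes ar: "dom ar = {..<g::'k}" "ran ar <= Sorts Sg" and D: "ctx x : Ob"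
  and q: "!!i. i : dom ar ==> q i : hom (ctx x) (sort_ob M (the (ar i)))"
 shows "arity_tuple H M ar x q : hom (ctx x) (arity_ob H M ar)"
  and "i : dom ar ==> prod_pr H (dom ar) (%i. sort_ob M (the (ar i))) i oo arity_tuple H M ar x q = q i"
proof -
 have s: "less_kappa TYPE('k) (dom ar)" "!!i. i : dom ar ==> sort_ob M (the (ar i)) : Ob"
  using ar arity_Ob[OF ar(2)] less_kappa_lessThan by simp_all
 show "arity_tuple H M ar x q : hom (ctx x) (arity_ob H M ar)"
  "i : dom ar ==> prod_pr H (dom ar) (%i. sort_ob M (the (ar i))) i oo arity_tuple H M ar x q = q i"
  unfolding arity_tuple_def arity_ob_def
  using tuple_hom[of "dom ar" "%i. sort_ob M (the (ar i))" "ctx x" q] tuple_pr[of "dom ar" "%i. sort_ob M (the (ar i))" "ctx x" q i] s D q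
  by auto
qed

lemma arity_tuple_comp:
 assumes ar: "dom ar = {..<g::'k}" "ran ar <= Sorts Sg" and f: "f : hom (ctx y) (ctx x)"
  and q: "!!i. i : dom ar ==> q i : hom (ctx x) (sort_ob M (the (ar i)))"
  and q': "!!i. i : dom ar ==> q' i = q i oo f"
 shows "arity_tuple H M ar y q' = arity_tuple H M ar x q oo f"
proof -
 have s: "less_kappa TYPE('k) (dom ar)" "!!i. i : dom ar ==> sort_ob M (the (ar i)) : Ob"
  using ar arity_Ob[OF ar(2)] less_kappa_lessThan by simp_all
 note hx = arity_tuple_hom[OF ar homD(5)[OF f] q]
 have q'h: "q' i : hom (ctx y) (sort_ob M (the (ar i)))" if "i : dom ar" for i using Cmp_hom[OF q[OF that] f] q'[OF that] by simp
 note hy = arity_tuple_hom[OF ar homD(4)[OF f] q'h]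
 show ?thesis
 proof(rule prod_eqI[OF s, where B = "ctx y", OF _ hy(1)[unfolded arity_ob_def] Cmp_hom[OF hx(1)[unfolded arity_ob_def] f]])
  fix i assume i: "i : dom ar"
  have "prod_pr H (dom ar) (%i. sort_ob M (the (ar i))) i oo (arity_tuple H M ar x q oo f) =
  (prod_pr H (dom ar) (%i. sort_ob M (the (ar i))) i oo arity_tuple H M ar x q) oo f"
  by(rule comp_assoc[OF f hx(1)[unfolded arity_ob_def] prod_pr_hom, symmetric]) (use s i in auto)
  thus "prod_pr H (dom ar) (%i. sort_ob M (the (ar i))) i oo arity_tuple H M ar y q' =
  prod_pr H (dom ar) (%i. sort_ob M (the (ar i))) i oo (arity_tuple H M ar x q oo f)" using hx(2)[OF _ i] hy(2)[OF _ i] q'[OF i] by auto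
 qed
qed

lemma fun_arityD: "f : Funs Sg ==> EX g. dom (fun_arity Sg f) = {..<g}" "f : Funs Sg ==> ran (fun_arity Sg f) <= Sorts Sg"
 "f : Funs Sg ==> fun_ar M f : hom (arity_ob H M (fun_arity Sg f)) (sort_ob M (fun_sort Sg f))"
 and rel_arityD: "r : Rels Sg ==> EX g. dom (rel_arity Sg r) = {..<g}" "r : Rels Sg ==> ran (rel_arity Sg r) <= Sorts Sg"
 "r : Rels Sg ==> rel_sub M r : Sub (arity_ob H M (rel_arity Sg r))"
 using wfS str by(auto simp: wf_signature_def is_structure_def)

lemma tvars_App: "tvars (App f us) = (UN i:dom us. tvars (the (us i)))"
proof -
 have a: "v : tvars (App f us) \<longleftrightarrow> (EX i t. us i = Some t & v : tvars t)" for v by(auto simp: map_option_eq_Some)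
 have b: "v : (UN i:dom us. tvars (the (us i))) \<longleftrightarrow> (EX i t. us i = Some t & v : tvars t)" for v
  unfolding UN_iff dom_def by force
 show ?thesis by(rule set_eqI) (simp only: a b)
qed

lemma wfc_UN: "less_kappa TYPE('k) I ==> (!!i. i : I ==> wfc (A i)) ==> wfc (UN i:I. A i)"
 unfolding wf_context_def using less_kappa_UN[of I A] by blast

lemma wf_tvars: "wf_tm Sg t s ==> wfc (tvars t)"
proof(induction rule: wf_tm.induct)
 case (1 v)
 thus ?case by(auto simp: wf_context_def intro: less_kappa_finite)
next
 case (2 f us)
 obtain g where g: "dom (fun_arity Sg f) = {..<g}" using fun_arityD(1)[OF 2(1)] by blast
 show ?case unfolding tvars_App
 proof(rule wfc_UN)
  show "less_kappa TYPE('k) (dom us)" using 2(2) g less_kappa_lessThan by simp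
  fix i assume "i : dom us"
  then obtain t s where "us i = Some t" "fun_arity Sg f i = Some s" using 2(2) by blast
  thus "wfc (tvars (the (us i)))" using 2(4) by simp
 qed
qed

lemma tsem_hom: "wf_tm Sg t s ==> wfc x ==> tvars t <= x ==> ts t x : hom (ctx x) (sort_ob M s)"
proof(induction rule: wf_tm.induct)
 case (1 v)
 thus ?case using cpr_hom by simp
next
 case (2 f us)
 obtain g where g: "dom (fun_arity Sg f) = {..<g}" using fun_arityD(1)[OF 2(1)] by blast
 have "arity_tuple H M (fun_arity Sg f) x (%i. the (map_option ts (us i)) x) : hom (ctx x) (arity_ob H M (fun_arity Sg f))"
 proof(rule arity_tuple_hom(1)[OF g fun_arityD(2)[OF 2(1)] ctx_Ob[OF 2(5)]])
  fix i assume "i : dom (fun_arity Sg f)"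
  then obtain t s where u: "us i = Some t" "fun_arity Sg f i = Some s" using 2(2) by blast
  hence "tvars t <= x" using 2(6) unfolding tvars_App by fastforce
  thus "the (map_option ts (us i)) x : hom (ctx x) (sort_ob M (the (fun_arity Sg f i)))" using 2(4)[OF u 2(5)] u by simp
 qed
 thus ?case using Cmp_hom[OF fun_arityD(3)[OF 2(1)]] by simp
qed

lemma tsem_subst:
 assumes x: "wfc x" and f: "f : hom (ctx y) (ctx x)"
 shows "wf_tm Sg t s ==> tvars t <= x ==> (!!v. v : tvars t ==> ts (\<sigma> v) y = cpr x v oo f) ==> ts (tsubst \<sigma> t) y = ts t x oo f"
proof(induction rule: wf_tm.induct)
 case (2 g us)
 obtain l where l: "dom (fun_arity Sg g) = {..<l}" using fun_arityD(1)[OF 2(1)] by blast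
 have h: "the (map_option ts (us i)) x : hom (ctx x) (sort_ob M (the (fun_arity Sg g i)))"
  "the (map_option ts (map_option (tsubst \<sigma>) (us i))) y = the (map_option ts (us i)) x oo f" if "i : dom (fun_arity Sg g)" for i
 proof -
  have "i : dom us" "i : dom (fun_arity Sg g)" using 2(2) that by simp_all
  then obtain t s where u: "us i = Some t" "fun_arity Sg g i = Some s" by blast
  hence tv: "tvars t <= tvars (App g us)" unfolding tvars_App by fastforce
  thus "the (map_option ts (us i)) x : hom (ctx x) (sort_ob M (the (fun_arity Sg g i)))"
  using tsem_hom[OF 2(3)[OF u] x] u 2(5) by auto
  show "the (map_option ts (map_option (tsubst \<sigma>) (us i))) y = the (map_option ts (us i)) x oo f"
  using 2(4)[OF u subset_trans[OF tv 2(5)] 2(6)[OF subsetD[OF tv]]] u by simp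
 qed
 note at = arity_tuple_comp[OF l fun_arityD(2)[OF 2(1)] f h]
 show ?case using at comp_assoc[OF f arity_tuple_hom(1)[OF l fun_arityD(2)[OF 2(1)] ctx_Ob[OF x] h(1)] fun_arityD(3)[OF 2(1)]] by simp
qed simp

lemma tsubst_Var [simp]: "tsubst Var t = t"
proof(induction t)
 case (App f us)
 have "map_option (tsubst Var) (us i) = us i" for i using App[OF rangeI[of us i]] by(cases "us i") auto
 thus ?case by simp
qed simp

subsubsection \<open>Change of base for blocks of quantifiers\<close>

definition qcov :: "quant => 'k => bool" where "qcov q = (if q = QAE then (%a. ~ ord_even a) else ord_even)"

definition qop :: "quant => ('k \<rightharpoonup> ('s, 'k) block) => ('s, 'k) block => 'a set => 'a set" where
 "qop q X y S = (let z = y Un bvars X in case q of QAll => all_along (prj z y) S | QEx => ex_along (prj z y) S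
  | _ => join (ctx y) (het_family H M (qcov q) X y S))"

lemma sem_Quant: "sem Sg H M (Quant q X \<phi>) x =
 pull (prj x (x - bvars X)) (qop q X (x - bvars X) (sem Sg H M \<phi> ((x - bvars X) Un bvars X)))"
 by(cases q) (simp_all add: qop_def qcov_def Let_def)

text \<open>Stability of the heterogeneous join enters as an assumption, so that base change can be
  stated for an arbitrary subobject \<open>S\<close>. For formulas it is discharged by
  \<open>het_okI\<close>.\<close>

definition het_ok where "het_ok q X y S \<longleftrightarrow> (q = QAE \<or> q = QEA --> (EX J. goodX (qcov q) X y S J))"

lemma qop_het: "q = QAE \<or> q = QEA ==> goodX (qcov q) X y S J ==> qop q X y S = J"
 using join_eq[OF goodJ_T_sub, of "qcov q" "len X" "bob X" "ctx y"] by(auto simp only: qop_def goodX_def het_family_def Let_def quant.case)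

lemma qop_Sub:
 assumes y: "wfc y" and X: "blen X g" and S: "S : Sub (ctx (y Un bvars X))" and ok: "het_ok q X y S"
 shows "qop q X y S : Sub (ctx y)"
proof -
 have p: "prj (y Un bvars X) y : hom (ctx (y Un bvars X)) (ctx y)" using wfc_Un[OF y blenD(8)[OF X]] by(intro prj_hom) auto
 show ?thesis
 proof(cases "q = QAE \<or> q = QEA")
  case True
  then obtain J where J: "goodX (qcov q) X y S J" using ok by(auto simp: het_ok_def)
  show ?thesis using qop_het[OF True J] J by(simp add: goodX_def goodJ_def)
 next
  case False
  thus ?thesis using all_Sub[of "prj (y Un bvars X) y" S] ex_Sub[of "prj (y Un bvars X) y" S] p S
  by(cases q) (auto simp: qop_def Let_def hom_def)
 qed
qed

text \<open>For \<forall> and \<exists> the contexts form a pullback square and Beck-Chevalley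
  applies. For the other two, \<open>l\<close> wins the new game exactly when \<open>f oo l\<close>
  wins the old one, and \<open>goodX\<close> says that the join of such \<open>l\<close> is the
  inverse image of the old join.\<close>

lemma qop_base_change:
 assumes y: "wfc y" and y': "wfc y'" and X: "blen X g" and X': "blen X' g" and XX: "X' = (%a. map_option ((`) \<rho>) (X a))"
  and \<rho>: "inj_on \<rho> (bvars X)" "!!v. v : bvars X ==> fst (\<rho> v) = fst v" and d: "y Int bvars X = {}" and d': "y' Int bvars X' = {}"
  and f: "f : hom (ctx y') (ctx y)" and F: "F : hom (ctx (y' Un bvars X')) (ctx (y Un bvars X))"
  and Fy: "prj (y Un bvars X) y oo F = f oo prj (y' Un bvars X') y'"
  and FX: "!!v. v : bvars X ==> cpr (y Un bvars X) v oo F = cpr (y' Un bvars X') (\<rho> v)"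
  and S: "S : Sub (ctx (y Un bvars X))" and ok: "het_ok q X y S"
 shows "qop q X' y' (pull F S) = pull f (qop q X y S)"
proof -
 let ?z = "y Un bvars X" and ?z' = "y' Un bvars X'"
 note B = blenD[OF X] and B' = blenD[OF X']
 have z: "wfc ?z" and z': "wfc ?z'" using wfc_Un[OF y B(8)] wfc_Un[OF y' B'(8)] by auto
 have p: "prj ?z y : hom (ctx ?z) (ctx y)" and p': "prj ?z' y' : hom (ctx ?z') (ctx y')" by(rule prj_hom, use z z' in auto)+
 have Xa: "the (X' a) = \<rho> ` the (X a)" if "a < g" for a unfolding XX by(subst B(4)[OF that]) simp
 have bv: "bvars X' = \<rho> ` bvars X" unfolding B'(9) B(9) using Xa by(auto simp: image_UN)
 define \<rho>i where "\<rho>i = the_inv_into (bvars X) \<rho>"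
 have \<rho>i: "\<rho>i (\<rho> v) = v" if "v : bvars X" for v using the_inv_into_f_f[OF \<rho>(1) that] by(simp add: \<rho>i_def)
 have FA: "F : Ar" "Dom F = ctx ?z'" "Cod F = ctx ?z" and fA: "f : Ar" "Dom f = ctx y'" "Cod f = ctx y" using F f by(auto simp: hom_def)
 note Zp = ctx_prodZ[OF y X d] and Zp' = ctx_prodZ[OF y' X' d']
 note Z = prodZ_D[OF Zp] and Z' = prodZ_D[OF Zp']
 show ?thesis
 proof(cases "q = QAE \<or> q = QEA")
  case False
  have pb: "is_pullback f (prj ?z y) (prj ?z' y') F"
  unfolding is_pullback_def
  proof(intro conjI allI ballI impI)
  fix K a b assume a: "a : hom K (Dom f)" and b: "b : hom K (Dom (prj ?z y))" and e: "f oo a = prj ?z y oo b"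
  have a: "a : hom K (ctx y')" and b: "b : hom K (ctx ?z)" using a b fA p by(auto simp: hom_def)
  \<comment> \<open>Free variables are read from \<open>a\<close>; bound ones are renamed back and
    read from \<open>b\<close>.\<close>
  define q where "q w = (if w : y' then cpr y' w oo a else cpr ?z (\<rho>i w) oo b)" for w
  have q2: "q (\<rho> v) = cpr ?z v oo b" if "v : bvars X" for v
  using that d' bv \<rho>i[OF that] unfolding q_def by auto
  have qh: "q w : hom K (sort_ob M (fst w))" if w: "w : ?z'" for w
  proof(cases "w : y'")
  case True
  thus ?thesis using Cmp_hom[OF cpr_hom[OF y' True] a] by(simp add: q_def)
  next
  case False
  then obtain v where v: "v : bvars X" "w = \<rho> v" using w bv by blast
  show ?thesis using Cmp_hom[OF cpr_hom[OF z] b, of v] q2[OF v(1)] v \<rho>(2)[OF v(1)] by simp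
  qed
  note h = ctup[OF z' homD(4)[OF a] qh]
  let ?h = "ctup ?z' K q"
  have h1: "prj ?z' y' oo ?h = a"
  by(rule ctx_eqI[OF y' Cmp_hom[OF p' h(1)] a]) (insert cpr_prj_comp[OF z' _ _ h(1), of y'] h(2), auto simp: q_def)
  have h2: "F oo ?h = b"
  proof(rule ctx_eqI[OF z Cmp_hom[OF F h(1)] b])
  fix v assume v: "v : ?z"
  have as: "cpr ?z v oo (F oo ?h) = (cpr ?z v oo F) oo ?h" by(rule comp_assoc[OF h(1) F cpr_hom[OF z v], symmetric])
  show "cpr ?z v oo (F oo ?h) = cpr ?z v oo b"
  proof(cases "v : bvars X")
  case True
  thus ?thesis using FX[OF True] h(2)[of "\<rho> v"] q2[OF True] bv as by auto
  next
  case False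
  hence vy: "v : y" using v by simp
  have "cpr ?z v oo (F oo ?h) = cpr y v oo (prj ?z y oo (F oo ?h))" by(rule cpr_prj_comp[OF z _ vy Cmp_hom[OF F h(1)], symmetric]) simp
  also have "prj ?z y oo (F oo ?h) = (prj ?z y oo F) oo ?h" by(rule comp_assoc[OF h(1) F p, symmetric])
  also have "\<dots> = f oo (prj ?z' y' oo ?h)" unfolding Fy by(rule comp_assoc[OF h(1) p' f])
  also have "\<dots> = prj ?z y oo b" using h1 e by simp
  also have "cpr y v oo (prj ?z y oo b) = cpr ?z v oo b" by(rule cpr_prj_comp[OF z _ vy b]) simp
  finally show ?thesis .
  qed
  qed
  show "EX! h. h : hom K (Dom (prj ?z' y')) & prj ?z' y' oo h = a & F oo h = b"
  proof(intro ex1I[of _ ?h] conjI h1 h2)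
  show "?h : hom K (Dom (prj ?z' y'))" using h(1) p' by(simp add: hom_def)
  fix k assume "k : hom K (Dom (prj ?z' y')) & prj ?z' y' oo k = a & F oo k = b"
  hence k: "k : hom K (ctx ?z')" "prj ?z' y' oo k = a" "F oo k = b" using p' by(auto simp: hom_def)
  show "k = ?h"
  proof(rule ctx_eqI[OF z' k(1) h(1)])
  fix w assume w: "w : ?z'"
  show "cpr ?z' w oo k = cpr ?z' w oo ?h"
  proof(cases "w : y'")
  case True
  thus ?thesis using cpr_prj_comp[OF z' _ True k(1)] cpr_prj_comp[OF z' _ True h(1)] k(2) h1 by auto
  next
  case False
  then obtain v where v: "v : bvars X" "w = \<rho> v" using w bv by blast
  have vz: "v : ?z" using v by simp
  have "cpr ?z' w oo k = cpr ?z v oo b" unfolding v(2) FX[OF v(1), symmetric] k(3)[symmetric] by(rule comp_assoc[OF k(1) F cpr_hom[OF z vz]])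
  thus ?thesis using h(2)[OF _ w] q2[OF v(1)] v(2) by simp
  qed
  qed
  qed
  qed (insert p p' F f Fy, auto simp: hom_def)
  have "S : Sub (Dom (prj ?z y))" using S p by(simp add: hom_def)
  thus ?thesis using pull_all[OF pb] pull_ex[OF pb] False by(cases q) (auto simp: qop_def Let_def)
 next
  case True
  then obtain J where J: "goodX (qcov q) X y S J" using ok by(auto simp: het_ok_def)
  \<comment> \<open>Renaming the variables of block \<open>a\<close> is an isomorphism between the
    objects of the two games at that stage.\<close>
  define \<theta> where "\<theta> a = ctup (the (X' a)) (ctx (the (X a))) (%w. cpr (the (X a)) (\<rho>i w))" for a
  define \<theta>' where "\<theta>' a = ctup (the (X a)) (ctx (the (X' a))) (%v. cpr (the (X' a)) (\<rho> v))" for a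
  have th: "\<theta> a : hom (bob X a) (bob X' a)" "\<theta>' a : hom (bob X' a) (bob X a)" "\<theta> a oo \<theta>' a = Idn (bob X' a)" "\<theta>' a oo \<theta> a = Idn (bob X a)"
  and thF: "bpr ?z X a oo F = \<theta>' a oo bpr ?z' X' a" if a: "a < g" for a
  proof -
  have sb: "the (X a) <= bvars X" "the (X' a) <= bvars X'" using B(7) B'(7) a by auto
  have w: "wfc (the (X a))" "wfc (the (X' a))" using B(6) B'(6) a by auto
  have O: "bob X a : Ob" "bob X' a : Ob" using w ctx_Ob by auto
  have e1: "cpr (the (X a)) (\<rho>i w') : hom (bob X a) (sort_ob M (fst w'))" if "w' : the (X' a)" for w'
  proof -
  have "w' : \<rho> ` the (X a)" using that Xa[OF a] by simp
  then obtain v where v: "v : the (X a)" "w' = \<rho> v" by blast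
  hence "v : bvars X" using sb by blast
  thus ?thesis using cpr_hom[OF w(1) v(1)] \<rho>i[of v] \<rho>(2)[of v] v by simp
  qed
  note T1 = ctup[OF w(2) O(1) e1, folded \<theta>_def]
  have e2: "cpr (the (X' a)) (\<rho> v) : hom (bob X' a) (sort_ob M (fst v))" if "v : the (X a)" for v
  proof -
  have "\<rho> v : the (X' a)" using that Xa[OF a] by simp
  thus ?thesis using cpr_hom[OF w(2)] \<rho>(2)[of v] that sb by fastforce
  qed
  have T2: "\<theta>' a : hom (bob X' a) (bob X a)" "v : the (X a) ==> cpr (the (X a)) v oo \<theta>' a = cpr (the (X' a)) (\<rho> v)" for v
  using ctup[OF w(1) O(2) e2, folded \<theta>'_def] by auto
  have T1: "\<theta> a : hom (bob X a) (bob X' a)" "v : the (X a) ==> cpr (the (X' a)) (\<rho> v) oo \<theta> a = cpr (the (X a)) v" for v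
  using T1(1) T1(2)[of "\<rho> v"] \<rho>i[of v] sb Xa[OF a] by auto
  show "\<theta> a : hom (bob X a) (bob X' a)" "\<theta>' a : hom (bob X' a) (bob X a)" by(rule T1(1), rule T2(1))
  show "\<theta> a oo \<theta>' a = Idn (bob X' a)"
  proof(rule ctx_eqI[OF w(2) Cmp_hom[OF T1(1) T2(1)] Idn_hom[OF O(2)]])
  fix w' assume w': "w' : the (X' a)"
  have "w' : \<rho> ` the (X a)" using w' Xa[OF a] by simp
  then obtain v where v: "v : the (X a)" "w' = \<rho> v" by blast
  have "cpr (the (X' a)) w' oo (\<theta> a oo \<theta>' a) = (cpr (the (X' a)) w' oo \<theta> a) oo \<theta>' a" by(rule comp_assoc[OF T2(1) T1(1) cpr_hom[OF w(2) w'], symmetric])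
  thus "cpr (the (X' a)) w' oo (\<theta> a oo \<theta>' a) = cpr (the (X' a)) w' oo Idn (bob X' a)"
  using T1(2)[OF v(1)] T2(2)[OF v(1)] v(2) cpr_hom[OF w(2) w'] by(simp add: hom_def)
  qed
  show "\<theta>' a oo \<theta> a = Idn (bob X a)"
  proof(rule ctx_eqI[OF w(1) Cmp_hom[OF T2(1) T1(1)] Idn_hom[OF O(1)]])
  fix v assume v: "v : the (X a)"
  have "cpr (the (X a)) v oo (\<theta>' a oo \<theta> a) = (cpr (the (X a)) v oo \<theta>' a) oo \<theta> a" by(rule comp_assoc[OF T1(1) T2(1) cpr_hom[OF w(1) v], symmetric])
  thus "cpr (the (X a)) v oo (\<theta>' a oo \<theta> a) = cpr (the (X a)) v oo Idn (bob X a)"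
  using T1(2)[OF v] T2(2)[OF v] cpr_hom[OF w(1) v] by(simp add: hom_def)
  qed
  have sz: "the (X a) <= ?z" "the (X' a) <= ?z'" using sb by auto
  show "bpr ?z X a oo F = \<theta>' a oo bpr ?z' X' a"
  proof(rule ctx_eqI[OF w(1) Cmp_hom[OF Z(2)[OF a] F] Cmp_hom[OF T2(1) Z'(2)[OF a]]])
  fix v assume v: "v : the (X a)"
  have vb: "v : bvars X" using v sb by blast
  have "cpr (the (X a)) v oo (bpr ?z X a oo F) = cpr ?z' (\<rho> v)" using cpr_prj_comp[OF z sz(1) v F] FX[OF vb] by simp
  moreover have "cpr (the (X a)) v oo (\<theta>' a oo bpr ?z' X' a) = (cpr (the (X a)) v oo \<theta>' a) oo bpr ?z' X' a"
  by(rule comp_assoc[OF Z'(2)[OF a] T2(1) cpr_hom[OF w(1) v], symmetric])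
  moreover have "cpr (the (X' a)) (\<rho> v) oo bpr ?z' X' a = cpr ?z' (\<rho> v)" using cpr_prj[OF z' sz(2), of "\<rho> v"] v Xa[OF a] by simp
  ultimately show "cpr (the (X a)) v oo (bpr ?z X a oo F) = cpr (the (X a)) v oo (\<theta>' a oo bpr ?z' X' a)" using T2(2)[OF v] by simp
  qed
  qed
  have S': "pull F S : Sub (ctx ?z')" using pull_Sub[OF FA(1)] S FA by simp
  \<comment> \<open>The two games have the same objects and links; only elements are renamed, and
    the targets correspond through \<open>F\<close>.\<close>
  have key: "inX cov X' y' (pull F S) l \<longleftrightarrow> inX cov X y S (f oo l)" if l: "l : Ar" "Cod l = ctx y'" for l cov
  proof -
  have Dl: "Dom (f oo l) = Dom l" using l fA by simp
  let ?W = "%k e. EX w:S. Dom w = Dom k & prj ?z y oo w = (f oo l) oo k & (ALL a<g. bpr ?z X a oo w = e a)"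
  let ?W' = "%k e. EX w:pull F S. Dom w = Dom k & prj ?z' y' oo w = l oo k & (ALL a<g. bpr ?z' X' a oo w = e a)"
  have comp: "prj ?z y oo (F oo w) = f oo (prj ?z' y' oo w)" "a < g ==> bpr ?z X a oo (F oo w) = \<theta>' a oo (bpr ?z' X' a oo w)"
  if w: "w : hom K (ctx ?z')" for w K a
  using comp_assoc[OF w F Z(1)] comp_assoc[OF w p' f] comp_assoc[OF w F Z(2)] comp_assoc[OF w Z'(2) th(2)] Fy thF by auto
  have fl: "(f oo l) oo k = f oo (l oo k)" if "k : Ar" "Cod k = Dom l" for k using that l fA by simp
  show ?thesis unfolding inX_def in_T_iff B(3) B'(3) Dl
  proof
  assume w: "wins cov (bob X') g (Dom l) ?W'"
  show "wins cov (bob X) g (Dom l) ?W"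
  proof(rule wins_reindex[OF w, where q = "%c. c" and rd = "%c. c" and Dm = "%_. False" and \<theta> = \<theta> and \<theta>' = \<theta>'])
  fix k e e'' assume v: "valid (bob X) g (Dom l) k e" and W: "?W' k e''" and ee: "!!c. c < g ==> ~ False ==> e'' c = \<theta> c oo e c"
  obtain w where w: "w : pull F S" "Dom w = Dom k" "prj ?z' y' oo w = l oo k" "ALL a<g. bpr ?z' X' a oo w = e'' a" using W by(elim bexE conjE) (rule that)
  have wh: "w : hom (Dom k) (ctx ?z')" using SubD[OF S' w(1)] w(2) by(simp add: hom_def)
  have k: "k : Ar" "Cod k = Dom l" using v by(auto simp: valid_def)
  have "bpr ?z X a oo (F oo w) = e a" if a: "a < g" for a
  proof -
  have ea: "e a : hom (Dom k) (bob X a)" using v a by(simp add: valid_def)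
  have "\<theta>' a oo (\<theta> a oo e a) = (\<theta>' a oo \<theta> a) oo e a" by(rule comp_assoc[OF ea th(1)[OF a] th(2)[OF a], symmetric])
  thus ?thesis using comp(2)[OF wh a] w(4) ee[OF a] th(4)[OF a] ea a by(simp add: hom_def)
  qed
  thus "?W k e" using w comp(1)[OF wh] fl[OF k] FA k wh by(intro bexI[of _ "F oo w"]) (auto simp: mem_pull hom_def)
  qed (use th in auto)
  next
  assume w: "wins cov (bob X) g (Dom l) ?W"
  show "wins cov (bob X') g (Dom l) ?W'"
  proof(rule wins_reindex[OF w, where q = "%c. c" and rd = "%c. c" and Dm = "%_. False" and \<theta> = \<theta>' and \<theta>' = \<theta>])
  fix k e e'' assume v: "valid (bob X') g (Dom l) k e" and W: "?W k e''" and ee: "!!c. c < g ==> ~ False ==> e'' c = \<theta>' c oo e c"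
  obtain w where w: "w : S" "Dom w = Dom k" "prj ?z y oo w = (f oo l) oo k" "ALL a<g. bpr ?z X a oo w = e'' a" using W by(elim bexE conjE) (rule that)
  have wh: "w : hom (Dom k) (ctx ?z)" using SubD[OF S w(1)] w(2) by(simp add: hom_def)
  have k: "k : Ar" "Cod k = Dom l" and e: "!!a. a < g ==> e a : hom (Dom k) (bob X' a)" using v by(auto simp: valid_def)
  have lk: "l oo k : hom (Dom k) (ctx y')" using k l by(simp add: hom_def)
  obtain w' where w': "w' : hom (Dom k) (ctx ?z')" "prj ?z' y' oo w' = l oo k" "ALL a<g. bpr ?z' X' a oo w' = e a" using Z'(3)[OF lk e] by blast
  have "F oo w' = w"
  by(rule Z(4)[OF Cmp_hom[OF F w'(1)] wh]) (use comp[OF w'(1)] w' w fl[OF k] ee in auto)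
  thus "?W' k e" using w' w(1) FA by(intro bexI[of _ w']) (auto simp: mem_pull hom_def)
  qed (use th in auto)
  qed
  qed
  have Jg: "J : Sub (ctx y)" "!!f. f : Ar ==> Cod f = ctx y ==> is_join (Dom f)
  {sub_of l | l. monic l & Cod l = Dom f & inX (qcov q) X y S (f oo l)} (pull f J)"
  using J by(auto simp: goodX_def goodJ_def inX_def)
  have "{sub_of l | l. monic l & Cod l = ctx y' & inX (qcov q) X y S (f oo l)} = het_family H M (qcov q) X' y' (pull F S)"
  unfolding het_family_def T_sub_def Let_def using key[unfolded inX_def] monicD(1) by(auto simp: inX_def)
  hence e: "join (ctx y') (het_family H M (qcov q) X' y' (pull F S)) = pull f J" using join_eq[OF Jg(2)[OF fA(1,3)]] fA(2) by simp
  have "qop q X' y' (pull F S) = join (ctx y') (het_family H M (qcov q) X' y' (pull F S))"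
  using True by(elim disjE) (simp_all only: qop_def Let_def quant.case)
  thus ?thesis unfolding e qop_het[OF True J] .
 qed
qed

end

context khet
begin

subsubsection \<open>Interpretations are subobjects\<close>

abbreviation "wff == wf_fm Sg C"
abbreviation "wfs == wf_sequent Sg C"

inductive_cases wf_ImpE: "wff (Imp \<phi> \<psi>)"
inductive_cases wf_ConjE: "wff (Conj F)"
inductive_cases wf_DisjE: "wff (Disj F)"
inductive_cases wf_QuantE: "wff (Quant q X \<phi>)"
inductive_cases wf_EqE: "wff (Eq s t)"
inductive_cases wf_RelE: "wff (Rel r us)"

lemma mem_FV: "v : FV (Conj F) \<longleftrightarrow> (EX i \<phi>. F i = Some \<phi> & v : FV \<phi>)" "v : FV (Disj F) \<longleftrightarrow> (EX i \<phi>. F i = Some \<phi> & v : FV \<phi>)"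
 by(auto simp: map_option_eq_Some)

lemma FV_fam: "F i = Some \<phi> ==> FV \<phi> <= FV (Conj F)" "F i = Some \<phi> ==> FV \<phi> <= FV (Disj F)"
 unfolding subset_iff mem_FV by blast+

lemma wf_FV: "wff \<phi> ==> wfc (FV \<phi>)"
proof(induction rule: wf_fm.induct)
 case (2 r us)
 obtain g where g: "dom (rel_arity Sg r) = {..<g}" using rel_arityD(1)[OF 2(1)] by blast
 have "wfc (UN i:dom us. tvars (the (us i)))"
 proof(rule wfc_UN)
  show "less_kappa TYPE('k) (dom us)" using 2(2) g less_kappa_lessThan by simp
  fix i assume "i : dom us"
  then obtain t s where "us i = Some t" "rel_arity Sg r i = Some s" using 2(2) by blast
  thus "wfc (tvars (the (us i)))" using wf_tvars[OF 2(3)] by simp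
 qed
 moreover have "(UN t:ran us. tvars t) <= (UN i:dom us. tvars (the (us i)))" by(force simp: ran_def)
 ultimately show ?case using wfc_subset by simp
next
 case (4 F g)
 thus ?case unfolding wf_context_def image_subset_iff Ball_def mem_FV by blast
next
 case (5 F)
 thus ?case unfolding wf_context_def image_subset_iff Ball_def mem_FV by blast
next
 case (6 X \<phi> q)
 thus ?case using wfc_subset[of "FV \<phi>"] by auto
qed (auto intro: wf_tvars wfc_Un)

lemma wf_blen: "wf_blocks Sg X ==> blen X (len X)"
 unfolding blen_def using len_eq by(auto simp: wf_blocks_def)

lemma sem_fam: "{R x | i R. map_option sm (F i) = Some R} = (%i. sm (the (F i)) x) ` dom F"
proof(intro equalityI subsetI)
 fix S assume "S : (%i. sm (the (F i)) x) ` dom F"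
 then obtain i \<phi> where "F i = Some \<phi>" "S = sm \<phi> x" by auto
 thus "S : {R x | i R. map_option sm (F i) = Some R}" by(intro CollectI exI[of _ i] exI[of _ "sm \<phi>"]) simp
qed force

lemma sem_Conj: "sm (Conj F) x = whole (ctx x) Int (INT i:dom F. sm (the (F i)) x)"
 and sem_Disj: "sm (Disj F) x = join (ctx x) ((%i. sm (the (F i)) x) ` dom F)"
 by(simp_all only: sem.simps sem_fam)

lemma het_ok_base:
 assumes wf: "wff (Quant q X \<phi>)" and y: "wfc y" and d: "y Int bvars X = {}" and FV: "FV \<phi> <= y Un bvars X"
  and S: "sm \<phi> (y Un bvars X) : Sub (ctx (y Un bvars X))"
  and SN: "!!\<chi>. \<phi> = Neg \<chi> ==> sm \<chi> (y Un bvars X) : Sub (ctx (y Un bvars X))"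
 shows "het_ok q X y (sm \<phi> (y Un bvars X))"
 unfolding het_ok_def
proof
 assume q: "q = QAE \<or> q = QEA"
 have w: "wf_blocks Sg X" "wff \<phi>" "dom X ~= {}" "\<phi> : C \<or> (EX \<chi>:C. \<phi> = Neg \<chi>)" using wf q by(auto elim: wf_QuantE)
 have g0: "len X ~= ozero" using blenD(2)[OF wf_blen[OF w(1)]] w(3) by auto
 have c: "qcov q = ord_even \<or> qcov q = (%a. ~ ord_even a)" by(auto simp: qcov_def)
 obtain \<chi> where \<chi>: "\<chi> : C" "\<phi> = \<chi> \<or> \<phi> = Neg \<chi>" using w(4) by blast
 have "wff \<chi>" "FV \<chi> <= y Un bvars X" "sm \<chi> (y Un bvars X) : Sub (ctx (y Un bvars X))"
  using \<chi>(2) w(2) FV S SN by(auto elim: wf_ImpE simp del: sem.simps)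
 thus "EX J. goodX (qcov q) X y (sm \<phi> (y Un bvars X)) J"
  using het_good[OF wf_blen[OF w(1)] g0 y d \<chi>(1) _ _ \<chi>(2) _ c] by blast
qed

text \<open>The body of a heterogeneous quantifier may be \<open>Neg \<chi>\<close> with \<chi> in
  \<open>C\<close>, and determinacy then needs the interpretation of \<chi>, two levels down. So the
  induction also records the claim for the antecedent of an implication.\<close>

lemma sem_Sub_aux: "wff \<phi> ==> (ALL x. wfc x --> FV \<phi> <= x --> sm \<phi> x : Sub (ctx x)) &
  (ALL \<chi> \<theta>. \<phi> = Imp \<chi> \<theta> --> (ALL x. wfc x --> FV \<chi> <= x --> sm \<chi> x : Sub (ctx x)))"
proof(induction rule: wf_fm.induct)
 case (1 t s u)
 thus ?case using equalizer_Sub[OF tsem_hom tsem_hom] by auto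
next
 case (2 r us)
 obtain g where g: "dom (rel_arity Sg r) = {..<g}" using rel_arityD(1)[OF 2(1)] by blast
 have "sm (Rel r us) x : Sub (ctx x)" if x: "wfc x" "FV (Rel r us) <= x" for x
 proof -
  have "arity_tuple H M (rel_arity Sg r) x (%i. ts (the (us i)) x) : hom (ctx x) (arity_ob H M (rel_arity Sg r))"
  proof(rule arity_tuple_hom(1)[OF g rel_arityD(2)[OF 2(1)] ctx_Ob[OF x(1)]])
  fix i assume "i : dom (rel_arity Sg r)"
  then obtain t s where u: "us i = Some t" "rel_arity Sg r i = Some s" using 2(2) by blast
  hence "tvars t <= x" using x(2) by(auto simp: ran_def)
  thus "ts (the (us i)) x : hom (ctx x) (sort_ob M (the (rel_arity Sg r i)))" using tsem_hom[OF 2(3)[OF u] x(1)] u by simp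
  qed
  thus ?thesis using pull_Sub[OF homD(1)] rel_arityD(3)[OF 2(1)] by(simp add: hom_def) (metis (no_types, lifting) pull_Sub)
 qed
 thus ?case by blast
next
 case (3 \<phi> \<psi>)
 thus ?case by(auto intro!: imp_Sub)
next
 case (4 F g)
 have "sm (Conj F) x : Sub (ctx x)" if x: "wfc x" "FV (Conj F) <= x" for x
  unfolding sem_Conj
 proof(rule Inter_Sub[OF _ ctx_Ob[OF x(1)]])
  show "less_kappa TYPE('k) (dom F)" using 4(1) less_kappa_lessThan by simp
  fix i assume "i : dom F"
  then obtain \<phi> where p: "F i = Some \<phi>" by blast
  thus "sm (the (F i)) x : Sub (ctx x)" using "4.IH"[OF p] x FV_fam(1)[of F, OF p] by(auto simp del: FV.simps)
 qed
 thus ?case by blast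
next
 case (5 F)
 have "sm (Disj F) x : Sub (ctx x)" if x: "wfc x" "FV (Disj F) <= x" for x
  unfolding sem_Disj
 proof(rule is_joinD(1)[OF join_is_join[OF ctx_Ob[OF x(1)] _ card_image_k]], safe)
  fix i \<phi> assume p: "F i = Some \<phi>"
  thus "sm (the (F i)) x : Sub (ctx x)" using "5.IH"[OF p] x FV_fam(2)[of F, OF p] by(auto simp del: FV.simps)
 qed
 thus ?case by blast
next
 case (6 X \<phi> q)
 note X = wf_blen[OF 6(1)]
 have "sm (Quant q X \<phi>) x : Sub (ctx x)" if x: "wfc x" "FV (Quant q X \<phi>) <= x" for x
 proof -
  let ?y = "x - bvars X" let ?z = "?y Un bvars X"
  have y: "wfc ?y" using wfc_subset[OF x(1)] by simp
  have z: "wfc ?z" using wfc_Un[OF y blenD(8)[OF X]] .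
  have FV: "FV \<phi> <= ?z" using x(2) by auto
  have S: "sm \<phi> ?z : Sub (ctx ?z)" using "6.IH" z FV by blast
  have "sm \<chi> ?z : Sub (ctx ?z)" if "\<phi> = Neg \<chi>" for \<chi> using "6.IH" z FV that by(auto simp del: sem.simps)
  hence ok: "het_ok q X ?y (sm \<phi> ?z)"
  by(intro het_ok_base y FV S wf_fm.intros(6)[OF 6(1-3)]) auto
  have "prj x ?y : hom (ctx x) (ctx ?y)" by(rule prj_hom[OF x(1)]) simp
  hence p: "prj x ?y : Ar" "Dom (prj x ?y) = ctx x" "Cod (prj x ?y) = ctx ?y" by(auto simp: hom_def)
  show ?thesis unfolding sem_Quant using pull_Sub[OF p(1)] qop_Sub[OF y X S ok] unfolding p(2,3) by blast
 qed
 thus ?case by blast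
qed

lemma sem_Sub: "wff \<phi> ==> wfc x ==> FV \<phi> <= x ==> sm \<phi> x : Sub (ctx x)"
 using sem_Sub_aux by blast

lemma het_okI:
 assumes wf: "wff (Quant q X \<phi>)" and y: "wfc y" and d: "y Int bvars X = {}" and FV: "FV \<phi> <= y Un bvars X"
 shows "het_ok q X y (sm \<phi> (y Un bvars X))"
proof -
 have w: "wf_blocks Sg X" "wff \<phi>" using wf by(auto elim: wf_QuantE)
 have z: "wfc (y Un bvars X)" using wfc_Un[OF y blenD(8)[OF wf_blen[OF w(1)]]] .
 have "wff \<chi>" if "\<phi> = Neg \<chi>" for \<chi> using w(2) that by(auto elim: wf_ImpE)
 thus ?thesis using sem_Sub z w(2) FV by(intro het_ok_base[OF wf y d FV]) (auto simp del: sem.simps)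
qed

lemma sem_Quant_disj:
 assumes wf: "wff (Quant q X \<phi>)" and u: "wfc u" "u Int bvars X = {}" "FV \<phi> <= u Un bvars X"
 shows "sm (Quant q X \<phi>) u = qop q X u (sm \<phi> (u Un bvars X))"
proof -
 have wX: "wf_blocks Sg X" "wff \<phi>" using wf by(auto elim: wf_QuantE)
 note bX = wf_blen[OF wX(1)]
 have "u - bvars X = u" using u(2) by blast
 moreover have "qop q X u (sm \<phi> (u Un bvars X)) : Sub (ctx u)"
  by(rule qop_Sub[OF u(1) bX sem_Sub[OF wX(2) wfc_Un[OF u(1) blenD(8)[OF bX]] u(3)] het_okI[OF wf u]])
 ultimately show ?thesis unfolding sem_Quant using prj_Idn[OF u(1)] pull_Idn by simp
qed

subsubsection \<open>Weakening and substitution\<close>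

lemma pull_Eq:
 assumes f: "f : hom (ctx y) (ctx x)" and s: "wf_tm Sg s r" "wf_tm Sg t r" "wfc x" "tvars s <= x" "tvars t <= x"
  and e: "ts s' y = ts s x oo f" "ts t' y = ts t x oo f"
 shows "sm (Eq s' t') y = pull f (sm (Eq s t) x)"
proof -
 have "(u oo f) oo g = u oo (f oo g)" if "g : Ar" "Cod g = ctx y" "u : hom (ctx x) D" for g u D
  using that f by(simp add: hom_def)
 thus ?thesis using f e tsem_hom[OF s(1,3,4)] tsem_hom[OF s(2,3,5)] by(auto simp: mem_pull mem_whole hom_def)
qed

lemma pull_Rel:
 assumes f: "f : hom (ctx y) (ctx x)" and wf: "wff (Rel r us)" "wfc x" "FV (Rel r us) <= x"
  and e: "!!i t. us i = Some t ==> ts (the (us' i)) y = ts t x oo f"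
 shows "sm (Rel r us') y = pull f (sm (Rel r us) x)"
proof -
 have r: "r : Rels Sg" "dom us = dom (rel_arity Sg r)" "!!i t s. us i = Some t ==> rel_arity Sg r i = Some s ==> wf_tm Sg t s"
  by(rule wf_RelE[OF wf(1)], blast)+
 obtain g where g: "dom (rel_arity Sg r) = {..<g}" using rel_arityD(1)[OF r(1)] by blast
 have h: "ts (the (us i)) x : hom (ctx x) (sort_ob M (the (rel_arity Sg r i)))" "ts (the (us' i)) y = ts (the (us i)) x oo f"
  if "i : dom (rel_arity Sg r)" for i
 proof -
  have "i : dom us" "i : dom (rel_arity Sg r)" using r(2) that by simp_all
  then obtain t s where u: "us i = Some t" "rel_arity Sg r i = Some s" by blast
  hence "tvars t <= x" using wf(3) by(auto simp: ran_def)
  thus "ts (the (us i)) x : hom (ctx x) (sort_ob M (the (rel_arity Sg r i)))" using tsem_hom[OF r(3)[OF u] wf(2)] u by simp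
  show "ts (the (us' i)) y = ts (the (us i)) x oo f" using e[OF u(1)] u(1) by simp
 qed
 note a = arity_tuple_hom(1)[OF g rel_arityD(2)[OF r(1)] ctx_Ob[OF wf(2)] h(1)]
 show ?thesis using pull_Cmp[of f "arity_tuple H M (rel_arity Sg r) x (%i. ts (the (us i)) x)"]
  arity_tuple_comp[OF g rel_arityD(2)[OF r(1)] f h] a f by(simp add: hom_def)
qed

lemma pull_Imp:
 assumes f: "f : hom (ctx y) (ctx x)" and S: "sm \<phi> x : Sub (ctx x)" "sm \<psi> x : Sub (ctx x)"
  and e: "sm \<phi>' y = pull f (sm \<phi> x)" "sm \<psi>' y = pull f (sm \<psi> x)"
 shows "sm (Imp \<phi>' \<psi>') y = pull f (sm (Imp \<phi> \<psi>) x)"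
 using pull_imp[OF S] f e by(simp add: hom_def)

lemma pull_fam:
 assumes f: "f : hom (ctx y) (ctx x)" and S: "!!i \<phi>. F i = Some \<phi> ==> sm \<phi> x : Sub (ctx x)"
  and d: "dom F = dom F'" and e: "!!i \<phi> \<phi>'. F i = Some \<phi> ==> F' i = Some \<phi>' ==> sm \<phi>' y = pull f (sm \<phi> x)"
 shows "sm (Conj F') y = pull f (sm (Conj F) x)" "sm (Disj F') y = pull f (sm (Disj F) x)"
proof -
 have fA: "f : Ar" "Dom f = ctx y" "Cod f = ctx x" using f by(auto simp: hom_def)
 have e': "sm (the (F' i)) y = pull f (sm (the (F i)) x)" if i: "i : dom F" for i
 proof -
  have "i : dom F" "i : dom F'" using i d by simp_all
  then obtain \<phi> \<phi>' where "F i = Some \<phi>" "F' i = Some \<phi>'" by blast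
  thus ?thesis using e by simp
 qed
 show "sm (Conj F') y = pull f (sm (Conj F) x)" unfolding sem_Conj d[symmetric]
  using e' fA by(auto simp: mem_pull mem_whole simp del: dom_def) (metis domI option.sel)
 have S': "(%i. sm (the (F i)) x) ` dom F <= Sub (Cod f)" using S fA(3) by auto
 have "(%i. sm (the (F' i)) y) ` dom F = pull f ` (%i. sm (the (F i)) x) ` dom F"
  unfolding image_image by(rule image_cong[OF refl e'])
 thus "sm (Disj F') y = pull f (sm (Disj F) x)" unfolding sem_Disj d[symmetric]
  using pull_join[OF fA(1) S' card_image_k] fA by simp
qed

lemma tsem_weaken: "wf_tm Sg t s ==> wfc x' ==> x <= x' ==> tvars t <= x ==> ts t x' = ts t x oo prj x' x"
proof -
 assume a: "wf_tm Sg t s" "wfc x'" "x <= x'" "tvars t <= x"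
 have "ts (Var v) x' = cpr x v oo prj x' x" if "v : tvars t" for v using cpr_prj[OF a(2,3) subsetD[OF a(4) that]] by simp
 thus ?thesis using tsem_subst[OF wfc_subset[OF a(2,3)] prj_hom[OF a(2,3)] a(1,4), of Var] by simp
qed

text \<open>For quantifiers this is base change along a projection with the identity renaming. It
  comes before substitution, where contexts must be cut down because bound variables may shadow
  theirs.\<close>

lemma sem_weaken: "wff \<phi> ==> wfc x' ==> x <= x' ==> FV \<phi> <= x ==> sm \<phi> x' = pull (prj x' x) (sm \<phi> x)"
proof(induction arbitrary: x x' rule: wf_fm.induct)
 case (1 t s u)
 thus ?case using wfc_subset[OF 1(3,4)] by(intro pull_Eq prj_hom tsem_weaken) auto
next
 case (2 r us)
 obtain g where g: "dom (rel_arity Sg r) = {..<g}" using rel_arityD(1)[OF 2(1)] by blast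
 show ?case
 proof(rule pull_Rel[OF prj_hom[OF 2(4,5)] wf_fm.intros(2)[OF 2(1-3)] wfc_subset[OF 2(4,5)] 2(6)])
  fix i t assume u: "us i = Some t"
  then obtain s where "rel_arity Sg r i = Some s" using 2(2) by blast
  thus "ts (the (us i)) x' = ts t x oo prj x' x" using tsem_weaken[OF 2(3)[OF u] 2(4,5)] u 2(6) by(auto simp: ran_def)
 qed
next
 case (3 \<phi> \<psi>)
 thus ?case using wfc_subset[OF 3(5,6)] by(intro pull_Imp prj_hom sem_Sub 3(3,4)) auto
next
 case (4 F g)
 have F: "FV \<phi> <= x" if "F i = Some \<phi>" for i \<phi> using FV_fam(1)[of F, OF that] "4.prems"(3) by blast
 show ?case by(rule pull_fam(1)[OF prj_hom[OF "4.prems"(1,2)] sem_Sub refl]) (use F 4 wfc_subset[OF "4.prems"(1,2)] in auto)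
next
 case (5 F)
 have F: "FV \<phi> <= x" if "F i = Some \<phi>" for i \<phi> using FV_fam(2)[of F, OF that] "5.prems"(3) by blast
 show ?case by(rule pull_fam(2)[OF prj_hom[OF "5.prems"(1,2)] sem_Sub refl]) (use F 5 wfc_subset[OF "5.prems"(1,2)] in auto)
next
 case (6 X \<phi> q)
 note X = wf_blen[OF 6(1)]
 let ?y = "x - bvars X" and ?y' = "x' - bvars X" let ?z = "?y Un bvars X" and ?z' = "?y' Un bvars X"
 have x: "wfc x" using wfc_subset[OF 6(5,6)] .
 have y: "wfc ?y" and y': "wfc ?y'" using wfc_subset[OF x] wfc_subset[OF 6(5)] by auto
 have z': "wfc ?z'" and z: "wfc ?z" using wfc_Un[OF y' blenD(8)[OF X]] wfc_Un[OF y blenD(8)[OF X]] by auto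
 have sub: "?y <= ?y'" "?z <= ?z'" using 6(6) by auto
 have FV: "FV \<phi> <= ?z" using 6(7) by auto
 have S: "sm \<phi> ?z : Sub (ctx ?z)" by(rule sem_Sub[OF 6(2) z FV])
 have ok: "het_ok q X ?y (sm \<phi> ?z)" by(rule het_okI[OF wf_fm.intros(6)[OF 6(1-3)] y _ FV]) auto
 have "qop q X ?y' (pull (prj ?z' ?z) (sm \<phi> ?z)) = pull (prj ?y' ?y) (qop q X ?y (sm \<phi> ?z))"
 proof(rule qop_base_change[OF y y' X X, where \<rho> = "%v. v"])
  show "X = (%a. map_option ((`) (%v. v)) (X a))" by(simp add: option.map_ident image_ident[abs_def])
  show "prj ?z ?y oo prj ?z' ?z = prj ?y' ?y oo prj ?z' ?y'" unfolding prj_prj[OF z' sub(2) Un_upper1] prj_prj[OF z' Un_upper1 sub(1)] ..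
  show "cpr ?z v oo prj ?z' ?z = cpr ?z' v" if "v : bvars X" for v using cpr_prj[OF z' sub(2)] that by simp
 qed (use prj_hom y' z' sub S ok in auto)
 moreover have "prj ?y' ?y oo prj x' ?y' = prj x ?y oo prj x' x" using prj_prj[OF 6(5) _ sub(1)] prj_prj[OF 6(5,6), of ?y] by auto
 moreover have "prj x ?y : hom (ctx x) (ctx ?y)" "prj x' x : hom (ctx x') (ctx x)" "prj x' ?y' : hom (ctx x') (ctx ?y')"
  "prj ?y' ?y : hom (ctx ?y') (ctx ?y)" using prj_hom x y' 6(5,6) sub by auto
 ultimately show ?case unfolding sem_Quant 6(4)[OF z' sub(2) FV]
  using pull_Cmp[of "prj x' x" "prj x ?y"] pull_Cmp[of "prj x' ?y'" "prj ?y' ?y"] by(simp add: hom_def)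
qed

lemma mem_tvars: "v : tvars (App f us) \<longleftrightarrow> (EX i t. us i = Some t & v : tvars t)"
 by(auto simp: map_option_eq_Some)

lemma tvars_tsubst: "tvars (tsubst \<sigma> t) = (UN v:tvars t. tvars (\<sigma> v))"
proof(induction t)
 case (App f us)
 have "w : tvars (tsubst \<sigma> t) \<longleftrightarrow> (EX v:tvars t. w : tvars (\<sigma> v))" if "us i = Some t" for i t w using App[OF rangeI[of us i]] that by simp
 thus ?case unfolding set_eq_iff tsubst.simps UN_iff mem_tvars map_option_eq_Some Bex_def by blast
qed simp

lemma bvars_image: "bvars (%a. map_option ((`) \<rho>) (X a)) = \<rho> ` bvars X"
 by(simp add: bvars_def ran_map_option image_Union)

lemma subst_FV: "subst \<sigma> \<phi> \<phi>' ==> FV \<phi>' <= (UN v:FV \<phi>. tvars (\<sigma> v))"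
proof(induction rule: subst.induct)
 case (2 \<sigma> r us)
 thus ?case by(force simp: tvars_tsubst ran_def)
next
 case (4 F F' \<sigma>)
 show ?case
 proof
  fix w assume "w : FV (Conj F')"
  then obtain i \<phi>' where 1: "F' i = Some \<phi>'" "w : FV \<phi>'" unfolding mem_FV by blast
  then obtain \<phi> where 2: "F i = Some \<phi>" using 4(1) by blast
  show "w : (UN v:FV (Conj F). tvars (\<sigma> v))" using 4(3)[OF 2 1(1)] 1(2) FV_fam(1)[of F, OF 2] by blast
 qed
next
 case (5 F F' \<sigma>)
 show ?case
 proof
  fix w assume "w : FV (Disj F')"
  then obtain i \<phi>' where 1: "F' i = Some \<phi>'" "w : FV \<phi>'" unfolding mem_FV by blast
  then obtain \<phi> where 2: "F i = Some \<phi>" using 5(1) by blast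
  show "w : (UN v:FV (Disj F). tvars (\<sigma> v))" using 5(3)[OF 2 1(1)] 1(2) FV_fam(2)[of F, OF 2] by blast
 qed
next
 case (6 \<rho> X \<phi> \<sigma> \<phi>' q)
 note bvars_image[of \<rho> X]
 thus ?case using 6(5) by(fastforce split: if_splits)
qed (auto simp: tvars_tsubst)

definition sub_ar :: "(('s, 'k) var => ('k, 's, 'f) tm) => ('s, 'k) block => ('s, 'k) block => 'a" where
 "sub_ar \<sigma> y x = ctup x (ctx y) (%v. ts (\<sigma> v) y)"

definition sub_ok where "sub_ok \<sigma> y x \<longleftrightarrow> wfc x & wfc y & (ALL v:x. wf_tm Sg (\<sigma> v) (fst v) & tvars (\<sigma> v) <= y)"

lemma sub_ar:
 assumes "sub_ok \<sigma> y x"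
 shows "sub_ar \<sigma> y x : hom (ctx y) (ctx x)" "v : x ==> cpr x v oo sub_ar \<sigma> y x = ts (\<sigma> v) y"
 using ctup[of x "ctx y" "%v. ts (\<sigma> v) y"] assms tsem_hom[of _ _ y] ctx_Ob unfolding sub_ok_def sub_ar_def by auto

theorem sem_subst: "subst \<sigma> \<phi> \<phi>' ==> wff \<phi> ==> wff \<phi>' ==> FV \<phi> <= x ==> sub_ok \<sigma> y x ==>
  sm \<phi>' y = pull (sub_ar \<sigma> y x) (sm \<phi> x)"
proof(induction arbitrary: x y rule: subst.induct)
 case (1 \<sigma> s t)
 obtain r where r: "wf_tm Sg s r" "wf_tm Sg t r" using 1(1) by(auto elim: wf_EqE)
 have x: "wfc x" using 1(4) by(simp add: sub_ok_def)
 note f = sub_ar[OF 1(4)]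
 show ?case by(rule pull_Eq[OF f(1) r x]) (insert 1(3) f(2)[symmetric] tsem_subst[OF x f(1) r(1), of \<sigma>] tsem_subst[OF x f(1) r(2), of \<sigma>], auto simp: subset_iff)
next
 case (2 \<sigma> r us)
 have x: "wfc x" using 2(4) by(simp add: sub_ok_def)
 note f = sub_ar[OF 2(4)]
 show ?case
 proof(rule pull_Rel[OF f(1) 2(1) x 2(3)])
  fix i t assume u: "us i = Some t"
  have d: "dom us = dom (rel_arity Sg r)" and w: "!!s. rel_arity Sg r i = Some s ==> wf_tm Sg t s"
  by(rule wf_RelE[OF 2(1)], use u in blast)+
  obtain s where "rel_arity Sg r i = Some s" using u d by blast
  moreover have "tvars t <= x" using u 2(3) by(auto simp: ran_def)
  ultimately show "ts (the (map_option (tsubst \<sigma>) (us i))) y = ts t x oo sub_ar \<sigma> y x"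
  using tsem_subst[OF x f(1) w, of s \<sigma>] f(2)[symmetric] u by(auto simp: subset_iff)
 qed
next
 case (3 \<sigma> \<phi> \<phi>' \<psi> \<psi>')
 have w: "wff \<phi>" "wff \<psi>" "wff \<phi>'" "wff \<psi>'" using 3(5,6) by(auto elim: wf_ImpE)
 have x: "wfc x" "FV \<phi> <= x" "FV \<psi> <= x" using 3(7,8) by(auto simp: sub_ok_def)
 show ?case by(rule pull_Imp[OF sub_ar(1)[OF 3(8)] sem_Sub[OF w(1) x(1,2)] sem_Sub[OF w(2) x(1,3)] 3(3)[OF w(1,3) x(2) 3(8)] 3(4)[OF w(2,4) x(3) 3(8)]])
next
 case (4 F F' \<sigma>)
 have w: "F i = Some \<phi> ==> wff \<phi>" "F' i = Some \<phi> ==> wff \<phi>" for i \<phi> using 4(4,5) by(auto elim: wf_ConjE)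
 have x: "wfc x" "F i = Some \<phi> ==> FV \<phi> <= x" for i \<phi> using 4(6,7) FV_fam(1)[of F i] by(auto simp: sub_ok_def simp del: FV.simps)
 show ?case by(rule pull_fam(1)[OF sub_ar(1)[OF 4(7)] sem_Sub[OF w(1) x] 4(1) 4(3)[OF _ _ w x(2) 4(7)]])
next
 case (5 F F' \<sigma>)
 have w: "F i = Some \<phi> ==> wff \<phi>" "F' i = Some \<phi> ==> wff \<phi>" for i \<phi> using 5(4,5) by(auto elim: wf_DisjE)
 have x: "wfc x" "F i = Some \<phi> ==> FV \<phi> <= x" for i \<phi> using 5(6,7) FV_fam(2)[of F i] by(auto simp: sub_ok_def simp del: FV.simps)
 show ?case by(rule pull_fam(2)[OF sub_ar(1)[OF 5(7)] sem_Sub[OF w(1) x] 5(1) 5(3)[OF _ _ w x(2) 5(7)]])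
next
 case (6 \<rho> X \<phi> \<sigma> \<phi>' q)
 let ?X' = "%a. map_option ((`) \<rho>) (X a)" and ?\<sigma>' = "%v. if v : bvars X then Var (\<rho> v) else \<sigma> v"
 have w: "wf_blocks Sg X" "wff \<phi>" "wf_blocks Sg ?X'" "wff \<phi>'" using 6(6,7) by(auto elim: wf_QuantE)
 have dX: "dom ?X' = dom X" by(auto simp: dom_def)
 note X = wf_blen[OF w(1)]
 have X': "blen ?X' (len X)" using w(3) dX blenD(2)[OF X] unfolding blen_def by simp
 note bv = bvars_image[of \<rho> X]
 have xy: "wfc x" "wfc y" "!!v. v : x ==> wf_tm Sg (\<sigma> v) (fst v) & tvars (\<sigma> v) <= y" using 6(9) by(auto simp: sub_ok_def)
 \<comment> \<open>Freshness in \<open>subst\<close> concerns only variables free in the formula,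
   while \<open>x\<close> and \<open>y\<close> may contain bound ones. The quantifier is therefore
   treated over the least possible contexts, and weakening leads back to \<open>x\<close> and
   \<open>y\<close>.\<close>
 let ?y = "FV \<phi> - bvars X" let ?y' = "UN v:?y. tvars (\<sigma> v)" let ?z = "?y Un bvars X" and ?z' = "?y' Un bvars ?X'"
 have sx: "?y <= x" and sy: "?y' <= y" using 6(8) xy(3) by auto
 have y: "wfc ?y" and y': "wfc ?y'" using wfc_subset[OF xy(1) sx] wfc_subset[OF xy(2) sy] by auto
 have z: "wfc ?z" and z': "wfc ?z'" using wfc_Un[OF y blenD(8)[OF X]] wfc_Un[OF y' blenD(8)[OF X']] by auto
 have d: "?y Int bvars X = {}" and d': "?y' Int bvars ?X' = {}" using 6(3) unfolding bv by auto
 have FV: "FV \<phi> <= ?z" by blast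
 have FV': "FV \<phi>' <= ?z'" using subst_FV[OF 6(4)] unfolding bv by(fastforce split: if_splits)
 have ok\<sigma>: "sub_ok \<sigma> ?y' ?y" unfolding sub_ok_def using y y' sx xy(3) by auto
 have ok\<sigma>': "sub_ok ?\<sigma>' ?z' ?z" unfolding sub_ok_def
 proof(intro conjI z z' ballI)
  fix v assume v: "v : ?z"
  have "wf_tm Sg (Var (\<rho> v)) (fst v)" if "v : bvars X"
  using wf_tm.intros(1)[of "\<rho> v" Sg] 6(2)[OF that] blenD(8)[OF X] that by(auto simp: wf_context_def)
  thus "wf_tm Sg (?\<sigma>' v) (fst v)" using v sx xy(3)[of v] by auto
  show "tvars (?\<sigma>' v) <= ?z'" using v unfolding bv by auto
 qed
 note f = sub_ar[OF ok\<sigma>] and F = sub_ar[OF ok\<sigma>']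
 have S: "sm \<phi> ?z : Sub (ctx ?z)" by(rule sem_Sub[OF w(2) z FV])
 have IH: "sm \<phi>' ?z' = pull (sub_ar ?\<sigma>' ?z' ?z) (sm \<phi> ?z)" by(rule 6(5)[OF w(2,4) FV ok\<sigma>'])
 have pz: "prj ?z ?y : hom (ctx ?z) (ctx ?y)" "prj ?z' ?y' : hom (ctx ?z') (ctx ?y')" by(rule prj_hom, use z z' in auto)+
 have nat: "ts (\<sigma> v) u' = ts (\<sigma> v) ?y' oo prj u' ?y'" if "v : ?y" "wfc u'" "?y' <= u'" for v u'
  using tsem_weaken[of "\<sigma> v" "fst v" u' ?y'] that xy(3)[of v] sx by blast
 have base: "qop q ?X' ?y' (pull (sub_ar ?\<sigma>' ?z' ?z) (sm \<phi> ?z)) = pull (sub_ar \<sigma> ?y' ?y) (qop q X ?y (sm \<phi> ?z))"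
 proof(rule qop_base_change[OF y y' X X' refl 6(1,2) d d' f(1) F(1) _ _ S het_okI[OF 6(6) y d FV]])
  show "prj ?z ?y oo sub_ar ?\<sigma>' ?z' ?z = sub_ar \<sigma> ?y' ?y oo prj ?z' ?y'"
  proof(rule ctx_eqI[OF y Cmp_hom[OF pz(1) F(1)] Cmp_hom[OF f(1) pz(2)]])
  fix v assume v: "v : ?y"
  have "cpr ?y v oo (prj ?z ?y oo sub_ar ?\<sigma>' ?z' ?z) = ts (\<sigma> v) ?z'" using cpr_prj_comp[OF z _ v F(1)] F(2)[of v] v by auto
  moreover have "cpr ?y v oo (sub_ar \<sigma> ?y' ?y oo prj ?z' ?y') = (cpr ?y v oo sub_ar \<sigma> ?y' ?y) oo prj ?z' ?y'"
  by(rule comp_assoc[OF pz(2) f(1) cpr_hom[OF y v], symmetric])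
  ultimately show "cpr ?y v oo (prj ?z ?y oo sub_ar ?\<sigma>' ?z' ?z) = cpr ?y v oo (sub_ar \<sigma> ?y' ?y oo prj ?z' ?y')"
  using f(2)[OF v] nat[OF v z'] by simp
  qed
  show "cpr ?z v oo sub_ar ?\<sigma>' ?z' ?z = cpr ?z' (\<rho> v)" if "v : bvars X" for v using F(2)[of v] that by simp
 qed
 have "sm (Quant q X \<phi>) x = pull (prj x ?y) (sm (Quant q X \<phi>) ?y)" by(rule sem_weaken[OF 6(6) xy(1) sx]) simp
 moreover have "sm (Quant q ?X' \<phi>') y = pull (prj y ?y') (sm (Quant q ?X' \<phi>') ?y')" by(rule sem_weaken[OF 6(7) xy(2) sy]) (use FV' in auto)
 moreover note sem_Quant_disj[OF 6(6) y d FV] sem_Quant_disj[OF 6(7) y' d' FV']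
 moreover have "prj x ?y oo sub_ar \<sigma> y x = sub_ar \<sigma> ?y' ?y oo prj y ?y'"
 proof(rule ctx_eqI[OF y Cmp_hom[OF prj_hom[OF xy(1) sx] sub_ar(1)[OF 6(9)]] Cmp_hom[OF f(1) prj_hom[OF xy(2) sy]]])
  fix v assume v: "v : ?y"
  have "cpr ?y v oo (prj x ?y oo sub_ar \<sigma> y x) = ts (\<sigma> v) y" using cpr_prj_comp[OF xy(1) sx v sub_ar(1)[OF 6(9)]] sub_ar(2)[OF 6(9) subsetD[OF sx v]] by simp
  moreover have "cpr ?y v oo (sub_ar \<sigma> ?y' ?y oo prj y ?y') = (cpr ?y v oo sub_ar \<sigma> ?y' ?y) oo prj y ?y'"
  by(rule comp_assoc[OF prj_hom[OF xy(2) sy] f(1) cpr_hom[OF y v], symmetric])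
  ultimately show "cpr ?y v oo (prj x ?y oo sub_ar \<sigma> y x) = cpr ?y v oo (sub_ar \<sigma> ?y' ?y oo prj y ?y')"
  using f(2)[OF v] nat[OF v xy(2) sy] by simp
 qed
 ultimately show ?case using base IH pull_Cmp[of "sub_ar \<sigma> y x" "prj x ?y"] pull_Cmp[of "prj y ?y'" "sub_ar \<sigma> ?y' ?y"]
  prj_hom[OF xy(1) sx] prj_hom[OF xy(2) sy] sub_ar(1)[OF 6(9)] f(1) by(simp add: hom_def del: sem.simps)
qed


subsubsection \<open>Soundness of the first-order rules\<close>

lemma And_simps: "sm (And \<phi> \<psi>) x = whole (ctx x) Int (sm \<phi> x Int sm \<psi> x)" "FV (And \<phi> \<psi>) = FV \<phi> Un FV \<psi>"
 "wff (And \<phi> \<psi>) ==> wff \<phi> & wff \<psi>"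
proof -
 show "sm (And \<phi> \<psi>) x = whole (ctx x) Int (sm \<phi> x Int sm \<psi> x)" unfolding And_def sem.simps(4) sem_pair by simp
 have 1: "[ozero |-> \<phi>, osuc ozero |-> \<psi>] (ozero::'k) = Some \<phi>" "[ozero |-> \<phi>, osuc ozero |-> \<psi>] (osuc ozero::'k) = Some \<psi>" by auto
 show "FV (And \<phi> \<psi>) = FV \<phi> Un FV \<psi>" using FV_fam(1)[of "[ozero |-> \<phi>, osuc ozero |-> \<psi>]", OF 1(1)]
  FV_fam(1)[of "[ozero |-> \<phi>, osuc ozero |-> \<psi>]", OF 1(2)] unfolding And_def
  by(auto simp: mem_FV simp del: FV.simps split: if_splits)
 show "wff (And \<phi> \<psi>) ==> wff \<phi> & wff \<psi>" unfolding And_def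
  by(erule wf_ConjE) (use 1 in blast)
qed

lemma wf_seqD: "wfs (\<phi>, x, \<psi>) ==> wff \<phi> & wff \<psi> & wfc x & FV \<phi> <= x & FV \<psi> <= x
  & sm \<phi> x : Sub (ctx x) & sm \<psi> x : Sub (ctx x)"
 unfolding wf_sequent_def using sem_Sub by(auto simp del: sem.simps)

lemma weaken_seq:
 assumes "wff \<phi>" "wff \<psi>" "wfc x" "y <= x" "FV \<phi> <= y" "FV \<psi> <= y" "sm \<phi> y <= sm \<psi> y"
 shows "sm \<phi> x <= sm \<psi> x"
 unfolding sem_weaken[OF assms(1,3-5)] sem_weaken[OF assms(2-4,6)] by(rule pull_mono[OF assms(7)])

text \<open>The adjunctions for the projection, its inverse image being weakening.\<close>

lemma sound_quant:
 assumes w: "wff \<phi>" "wff \<psi>" "wf_blocks Sg Y" "wfc x" and d: "x Int bvars Y = {}"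
 shows "FV \<phi> <= x Un bvars Y ==> FV \<psi> <= x ==> sm \<phi> (x Un bvars Y) <= sm \<psi> (x Un bvars Y) \<longleftrightarrow> sm (Exists Y \<phi>) x <= sm \<psi> x"
  and "FV \<phi> <= x ==> FV \<psi> <= x Un bvars Y ==> sm \<phi> (x Un bvars Y) <= sm \<psi> (x Un bvars Y) \<longleftrightarrow> sm \<phi> x <= sm (Forall Y \<psi>) x"
proof -
 let ?z = "x Un bvars Y"
 have z: "wfc ?z" using wfc_Un[OF w(4) blenD(8)[OF wf_blen[OF w(3)]]] .
 have p: "prj ?z x : Ar" "Dom (prj ?z x) = ctx ?z" "Cod (prj ?z x) = ctx x" using prj_hom[OF z, of x] by(auto simp: hom_def)
 have wf: "wff (Exists Y \<phi>)" "wff (Forall Y \<psi>)" using w by(auto intro: wf_fm.intros(6))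
 assume FV: "FV \<phi> <= ?z" "FV \<psi> <= x"
 have "sm \<phi> ?z : Sub (Dom (prj ?z x))" "sm \<psi> x : Sub (Cod (prj ?z x))" using sem_Sub[OF w(1) z] sem_Sub[OF w(2,4)] FV p by auto
 thus "sm \<phi> ?z <= sm \<psi> ?z \<longleftrightarrow> sm (Exists Y \<phi>) x <= sm \<psi> x"
  unfolding sem_Quant_disj[OF wf(1) w(4) d FV(1)] sem_weaken[OF w(2) z _ FV(2), OF Un_upper1] qop_def Let_def quant.case
  using ex_adj[OF p(1)] by blast
next
 let ?z = "x Un bvars Y"
 have z: "wfc ?z" using wfc_Un[OF w(4) blenD(8)[OF wf_blen[OF w(3)]]] .
 have p: "prj ?z x : Ar" "Dom (prj ?z x) = ctx ?z" "Cod (prj ?z x) = ctx x" using prj_hom[OF z, of x] by(auto simp: hom_def)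
 have wf: "wff (Forall Y \<psi>)" using w by(auto intro: wf_fm.intros(6))
 assume FV: "FV \<phi> <= x" "FV \<psi> <= ?z"
 have "sm \<psi> ?z : Sub (Dom (prj ?z x))" "sm \<phi> x : Sub (Cod (prj ?z x))" using sem_Sub[OF w(2) z] sem_Sub[OF w(1,4)] FV p by auto
 thus "sm \<phi> ?z <= sm \<psi> ?z \<longleftrightarrow> sm \<phi> x <= sm (Forall Y \<psi>) x"
  unfolding sem_Quant_disj[OF wf w(4) d FV(2)] sem_weaken[OF w(1) z _ FV(1), OF Un_upper1] qop_def Let_def quant.case
  using all_adj[OF p(1)] by blast
qed

text \<open>The converse of \<open>subst_FV\<close>. It confines the terms substituted in the
  equality rule to the context of the sequent.\<close>

lemma subst_FV_sup: "subst \<sigma> \<phi> \<phi>' ==> v : FV \<phi> ==> tvars (\<sigma> v) <= FV \<phi>'"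
proof(induction arbitrary: v rule: subst.induct)
 case (2 \<sigma> r us)
 then obtain i t where "us i = Some t" "v : tvars t" by(auto simp: ran_def)
 thus ?case by(force simp: tvars_tsubst ran_def)
next
 case (4 F F' \<sigma>)
 then obtain i \<phi> where 1: "F i = Some \<phi>" "v : FV \<phi>" unfolding mem_FV by blast
 then obtain \<phi>' where 2: "F' i = Some \<phi>'" using 4(1) by blast
 show ?case using 4(3)[OF 1(1) 2 1(2)] FV_fam(1)[of F', OF 2] by blast
next
 case (5 F F' \<sigma>)
 then obtain i \<phi> where 1: "F i = Some \<phi>" "v : FV \<phi>" unfolding mem_FV by blast
 then obtain \<phi>' where 2: "F' i = Some \<phi>'" using 5(1) by blast
 show ?case using 5(3)[OF 1(1) 2 1(2)] FV_fam(2)[of F', OF 2] by blast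
next
 case (6 \<rho> X \<phi> \<sigma> \<phi>' q)
 hence v: "v : FV \<phi>" "v ~: bvars X" by auto
 show ?case using 6(5)[OF v(1)] 6(3)[of v] v bvars_image[of \<rho> X] by auto
next
 case (3 \<sigma> \<phi> \<phi>' \<psi> \<psi>')
 thus ?case by fastforce
qed (auto simp: tvars_tsubst)

lemma sound_subst:
 assumes "sm \<phi> x <= sm \<psi> x" "sub_ok \<sigma> y x" "subst \<sigma> \<phi> \<phi>'" "subst \<sigma> \<psi> \<psi>'" "wff \<phi>" "wff \<psi>" "wff \<phi>'" "wff \<psi>'"
  "FV \<phi> <= x" "FV \<psi> <= x"
 shows "sm \<phi>' y <= sm \<psi>' y"
 unfolding sem_subst[OF assms(3,5,7,9,2)] sem_subst[OF assms(4,6,8,10,2)] by(rule pull_mono[OF assms(1)])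

text \<open>The equations make the two substitution arrows equal after composition with
  \<open>k\<close>. Taking the free variables of \<phi> as source context leaves only terms whose
  variables lie in \<open>z\<close>.\<close>

lemma sound_eq:
 assumes ws: "dom ws = {..<g}" and xy: "!!i. i < g ==> fst (xs i) = fst (the (ws i)) & fst (ys i) = fst (the (ws i))"
  "!!i. i < g ==> \<sigma> (the (ws i)) = Var (xs i) & \<tau> (the (ws i)) = Var (ys i)" "!!v. v ~: ran ws ==> \<sigma> v = Var v & \<tau> v = Var v"
  and \<phi>: "wff \<phi>" "subst \<sigma> \<phi> \<phi>x" "subst \<tau> \<phi> \<phi>y"
  and wf: "wfs (And (Conj (%i. if i < g then Some (Eq (Var (xs i)) (Var (ys i))) else None)) \<phi>x, z, \<phi>y)"
 shows "sm (And (Conj (%i. if i < g then Some (Eq (Var (xs i)) (Var (ys i))) else None)) \<phi>x) z <= sm \<phi>y z"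
proof -
 let ?E = "Conj (%i. if i < g then Some (Eq (Var (xs i)) (Var (ys i))) else None)"
 have w: "wff \<phi>x" "wff \<phi>y" "wfc z" "FV \<phi>x <= z" "FV \<phi>y <= z" using wf_seqD[OF wf] And_simps(2,3)[of ?E \<phi>x] by auto
 let ?x = "FV \<phi>"
 note x = wf_FV[OF \<phi>(1)]
 have var: "(EX i<g. ws i = Some v & \<sigma> v = Var (xs i) & \<tau> v = Var (ys i) & fst (xs i) = fst v & fst (ys i) = fst v) \<or> \<sigma> v = Var v & \<tau> v = Var v" for v
 proof(cases "v : ran ws")
  case True
  then obtain i where i: "ws i = Some v" by(auto simp: ran_def)
  hence "i < g" using ws by blast
  thus ?thesis using xy(1,2)[of i] i by auto
 qed (use xy(3) in blast)
 have srt: "v : ?x ==> fst v : Sorts Sg" for v using x by(auto simp: wf_context_def)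
 have tm: "wf_tm Sg (\<sigma> v) (fst v) & wf_tm Sg (\<tau> v) (fst v)" if "v : ?x" for v
  using var[of v] srt[OF that] wf_tm.intros(1)[of _ Sg] by(metis (no_types, lifting))
 have ok: "sub_ok \<sigma> z ?x" "sub_ok \<tau> z ?x" unfolding sub_ok_def
  using x w(3-5) tm subst_FV_sup[OF \<phi>(2)] subst_FV_sup[OF \<phi>(3)] by blast+
 show ?thesis
 proof
  fix k assume k: "k : sm (And ?E \<phi>x) z"
  hence kz: "k : hom (Dom k) (ctx z)" and kx: "k : sm \<phi>x z" and kE: "k : sm ?E z" unfolding And_simps(1) by(auto simp: mem_whole hom_def)
  have eq: "cpr z (xs i) oo k = cpr z (ys i) oo k" if i: "i < g" for i
  proof -
  have "i : dom (%i. if i < g then Some (Eq (Var (xs i)) (Var (ys i))) else None)"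
  by(rule domI[of _ _ "Eq (Var (xs i)) (Var (ys i))"]) (simp add: i)
  hence "k : sm (Eq (Var (xs i)) (Var (ys i))) z" using kE i unfolding sem_Conj by fastforce
  thus ?thesis by simp
  qed
  have "sub_ar \<sigma> z ?x oo k = sub_ar \<tau> z ?x oo k"
  proof(rule ctx_eqI[OF x Cmp_hom[OF sub_ar(1)[OF ok(1)] kz] Cmp_hom[OF sub_ar(1)[OF ok(2)] kz]])
  fix v assume v: "v : ?x"
  have "ts (\<sigma> v) z oo k = ts (\<tau> v) z oo k" using var[of v] eq by auto
  thus "cpr ?x v oo (sub_ar \<sigma> z ?x oo k) = cpr ?x v oo (sub_ar \<tau> z ?x oo k)"
  using comp_assoc[OF kz sub_ar(1)[OF ok(1)] cpr_hom[OF x v]] comp_assoc[OF kz sub_ar(1)[OF ok(2)] cpr_hom[OF x v]]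
  sub_ar(2)[OF ok(1) v] sub_ar(2)[OF ok(2) v] by simp
  qed
  thus "k : sm \<phi>y z" using kx sub_ar(1)[OF ok(1)] sub_ar(1)[OF ok(2)]
  unfolding sem_subst[OF \<phi>(2,1) w(1) order_refl ok(1)] sem_subst[OF \<phi>(3,1) w(2) order_refl ok(2)] by(auto simp: mem_pull hom_def)
 qed
qed

subsubsection \<open>Transfinite transitivity\<close>

lemma one_block: "dom [ozero |-> A] = {..<osuc (ozero::'k)}" "bvars [ozero::'k |-> A] = A"
 by(auto simp: bvars_def)

lemma node_restrict:
 assumes "f : nodes \<Gamma>" "a <= len f"
 shows "f |` {..<a} : nodes \<Gamma>" "len (f |` {..<a}) = (a::'k)" "dom (f |` {..<a}) = {..<a}"
proof -
 have d: "dom f = {..<len f}" using assms(1) len_eq by(auto simp: nodes_def)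
 show 1: "dom (f |` {..<a}) = {..<a}" using d assms(2) by auto
 show "f |` {..<a} : nodes \<Gamma>" using 1 assms(1) by(auto simp: nodes_def ran_def restrict_map_def split: if_splits)
 show "len (f |` {..<a}) = a" by(rule len_eq[OF 1])
qed

lemma node_simps:
 assumes f: "f : nodes \<Gamma>"
 shows "dom f = {..<len f :: 'k}" "f |` {..<len f} = f" "i : \<Gamma> ==> f(len f |-> i) : nodes \<Gamma>"
  "len (f(len f |-> i)) = osuc (len f)" "a <= len f ==> f(len f |-> i) |` {..<a} = f |` {..<a}"
  "a <= b ==> (f |` {..<b}) |` {..<a} = f |` {..<a}"
proof -
 show d: "dom f = {..<len f}" using f len_eq by(auto simp: nodes_def)
 show "f |` {..<len f} = f"
 proof
  fix c show "(f |` {..<len f}) c = f c"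
  proof(cases "c < len f")
  case False
  hence "c ~: dom f" using d by simp
  thus ?thesis using False by(simp add: domIff)
  qed simp
 qed
 have d2: "dom (f(len f |-> i)) = {..<osuc (len f)}" for i using d by auto
 show "i : \<Gamma> ==> f(len f |-> i) : nodes \<Gamma>" using d2 f by(auto simp: nodes_def ran_def split: if_splits)
 show "len (f(len f |-> i)) = osuc (len f)" by(rule len_eq[OF d2])
 show "a <= len f ==> f(len f |-> i) |` {..<a} = f |` {..<a}" by(auto simp: restrict_map_def fun_eq_iff)
 show "a <= b ==> (f |` {..<b}) |` {..<a} = f |` {..<a}" by(auto simp: restrict_map_def fun_eq_iff)
qed

lemma empty_node: "Map.empty : nodes \<Gamma>" "len Map.empty = (ozero::'k)"
proof -
 have d: "dom (Map.empty :: 'k \<rightharpoonup> 'x) = {..<ozero}" by(simp add: lessThan_def)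
 thus "len Map.empty = (ozero::'k)" by(rule len_eq)
 show "Map.empty : nodes \<Gamma>" using d by(auto simp: nodes_def intro: exI[of _ ozero])
qed

end

section \<open>The tree of objects behind the rule of transfinite transitivity\<close>

locale ttree = khet K H Sg M C for K :: "'k::wellorder itself" and H :: "('o, 'a) cat"
  and Sg :: "('k, 's::wellorder, 'f, 'r) signature" and M :: "('s, 'f, 'r, 'o, 'a) struc" and C :: "('k, 's, 'f, 'r) fm set" +
 fixes \<Gamma> :: "'k set" and \<Phi> :: "('k \<rightharpoonup> 'k) => ('k, 's, 'f, 'r) fm" and X :: "('k \<rightharpoonup> 'k) => ('s, 'k) block" and B :: "('k \<rightharpoonup> 'k) set"
 assumes wfP: "!!f. f : nodes \<Gamma> ==> wff (\<Phi> f)"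
  and wfX: "!!f i. f : nodes \<Gamma> ==> i : \<Gamma> ==> wff (Exists [ozero |-> X (f(len f |-> i))] (\<Phi> (f(len f |-> i))))"
  and step: "!!f. f : nodes \<Gamma> ==> sem Sg H M (\<Phi> f) (FV (\<Phi> f)) <= join (ctx_ob H M (FV (\<Phi> f)))
  ((%i. sem Sg H M (Exists [ozero |-> X (f(len f |-> i))] (\<Phi> (f(len f |-> i)))) (FV (\<Phi> f))) ` \<Gamma>)"
  and lims: "!!f. f : nodes \<Gamma> ==> is_lim (len f) ==>
  sem Sg H M (Conj (%a. if a < len f then Some (\<Phi> (f |` {..<a})) else None)) (FV (\<Phi> f)) <= sem Sg H M (\<Phi> f) (FV (\<Phi> f))"
  and FVs: "!!f i. f : nodes \<Gamma> ==> i : \<Gamma> ==> FV (\<Phi> (f(len f |-> i))) = FV (\<Phi> f) Un X (f(len f |-> i)) & X (f(len f |-> i)) Int FV (\<Phi> f) = {}"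
  and FVl: "!!f. f : nodes \<Gamma> ==> is_lim (len f) ==> FV (\<Phi> f) = (UN a:{..<len f}. FV (\<Phi> (f |` {..<a})))"
  and bar: "is_bar \<Gamma> B"
begin

abbreviation "cn f == FV (\<Phi> f)"
abbreviation "S0 f == sm (\<Phi> f) (cn f)"

lemma cn: "f : nodes \<Gamma> ==> wfc (cn f)" by(rule wf_FV[OF wfP])
lemma S0: "f : nodes \<Gamma> ==> S0 f : Sub (ctx (cn f))" by(rule sem_Sub[OF wfP cn order_refl])

text \<open>The context of a node consists of the root context and the blocks added on the way, each
  fresh when added; at limits nothing new appears.\<close>

lemma cn_len: "f : nodes \<Gamma> ==> len f = l ==> cn f = cn Map.empty Un (UN b:{..<l}. X (f |` {..b})) & (ALL a<=l. cn (f |` {..<a}) <= cn f)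
  & (ALL b<l. X (f |` {..b}) Int cn (f |` {..<b}) = {} & wfc (X (f |` {..b})))"
proof(induction l arbitrary: f rule: ord_induct)
 case zero
 hence "f = Map.empty" using node_simps(1)[OF zero(1)] by(auto simp: lessThan_def)
 thus ?case by(simp add: lessThan_def)
next
 case (succ l)
 let ?g = "f |` {..<l}"
 note g = node_restrict[OF succ.prems(1), of l]
 have gn: "?g : nodes \<Gamma>" "len ?g = l" using g succ.prems(2) by auto
 obtain i where i: "f l = Some i" using node_simps(1)[OF succ.prems(1)] succ.prems(2) by fastforce
 have i\<Gamma>: "i : \<Gamma>" using succ.prems(1) i by(auto simp: nodes_def ran_def)
 have dom: "dom f = {..<osuc l}" using node_simps(1)[OF succ.prems(1)] succ.prems(2) by simp
 have fg: "f = ?g(l |-> i)"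
 proof
  fix c show "f c = (?g(l |-> i)) c"
  proof(cases "c < osuc l")
  case False
  hence "c ~: dom f" using dom by simp
  hence "f c = None" by blast
  thus ?thesis using False by(auto simp: restrict_map_def)
  qed (insert i, auto simp: restrict_map_def)
 qed
 have "{..l} = {..<osuc l}" by auto
 hence fl: "f |` {..l} = f" using node_simps(2)[OF succ.prems(1)] succ.prems(2) by simp
 note IH = succ.IH[OF gn]
 have rs: "?g |` {..<a} = f |` {..<a}" if "a <= l" for a using node_simps(6)[OF succ.prems(1) that] .
 have rs2: "?g |` {..b} = f |` {..b}" if "b < l" for b using that by(auto simp: restrict_map_def fun_eq_iff)
 have st: "cn f = cn ?g Un X f" "X f Int cn ?g = {}" using FVs[OF gn(1) i\<Gamma>] gn(2) fg by auto
 have Ul: "{..<osuc l} = insert l {..<l}" by(auto simp: order.order_iff_strict)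
 have "wfc (X f)" using wfc_subset[OF cn[OF succ.prems(1)]] st(1) by blast
 thus ?case
 proof(intro conjI allI impI)
  show "cn f = cn Map.empty Un (UN b:{..<osuc l}. X (f |` {..b}))" using st(1) IH rs2 fl unfolding Ul by auto
  show "cn (f |` {..<a}) <= cn f" if "a <= osuc l" for a
  proof(cases "a = osuc l")
  case True
  thus ?thesis using node_simps(2)[OF succ.prems(1)] succ.prems(2) by simp
  next
  case False
  hence "a <= l" using that by(metis less_osuc_iff order.not_eq_order_implies_strict)
  hence "cn (?g |` {..<a}) <= cn ?g" using IH by blast
  thus ?thesis unfolding rs[OF \<open>a <= l\<close>] using st(1) by blast
  qed
  fix b assume b: "b < osuc l"
  show "X (f |` {..b}) Int cn (f |` {..<b}) = {}" using b IH rs rs2 fl st(2) by(cases "b = l") (auto simp: order.order_iff_strict)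
  show "wfc (X (f |` {..b}))" if "wfc (X f)" using b IH rs2 fl that by(cases "b = l") (auto simp: order.order_iff_strict)
 qed
next
 case (lim l)
 have n: "f |` {..<a} : nodes \<Gamma> & len (f |` {..<a}) = a" if "a < l" for a using node_restrict[OF lim.prems(1), of a] lim.prems(2) that by auto
 have IH: "cn (f |` {..<a}) = cn Map.empty Un (UN b:{..<a}. X (f |` {..b}))"
  "!!b. b < a ==> X (f |` {..b}) Int cn (f |` {..<b}) = {} & wfc (X (f |` {..b}))" if "a < l" for a
 proof -
  have e: "(f |` {..<a}) |` {..b} = f |` {..b}" "(f |` {..<a}) |` {..<b} = f |` {..<b}" if "b < a" for b
  using that by(auto simp: restrict_map_def fun_eq_iff)
  note I = lim.IH[OF that conjunct1[OF n[OF that]] conjunct2[OF n[OF that]]]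
  have "(UN b:{..<a}. X ((f |` {..<a}) |` {..b})) = (UN b:{..<a}. X (f |` {..b}))" by(intro SUP_cong refl) (simp only: lessThan_iff e(1))
  thus "cn (f |` {..<a}) = cn Map.empty Un (UN b:{..<a}. X (f |` {..b}))" using conjunct1[OF I] by(simp only:)
  fix b assume b: "b < a"
  have "X ((f |` {..<a}) |` {..b}) Int cn ((f |` {..<a}) |` {..<b}) = {} & wfc (X ((f |` {..<a}) |` {..b}))" using I b by blast
  thus "X (f |` {..b}) Int cn (f |` {..<b}) = {} & wfc (X (f |` {..b}))" unfolding e[OF b] .
 qed
 have FV: "cn f = (UN a:{..<l}. cn (f |` {..<a}))" using FVl[OF lim.prems(1)] lim by simp
 show ?case
 proof(intro conjI allI impI)
  show "cn f = cn Map.empty Un (UN b:{..<l}. X (f |` {..b}))"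
  proof(intro equalityI subsetI)
  fix v assume "v : cn f"
  then obtain a where a: "a < l" "v : cn (f |` {..<a})" using FV by auto
  have s: "{..<a} <= {..<l}" using a(1) by auto
  show "v : cn Map.empty Un (UN b:{..<l}. X (f |` {..b}))" by(rule subsetD[OF Un_mono[OF order_refl UN_mono[OF s order_refl]] a(2)[unfolded IH(1)[OF a(1)]]])
  next
  fix v assume "v : cn Map.empty Un (UN b:{..<l}. X (f |` {..b}))"
  thus "v : cn f"
  proof
  assume "v : cn Map.empty"
  moreover have "ozero < l" by(rule is_lim_ozero_less[OF lim(1)])
  ultimately have "v : cn (f |` {..<ozero})" unfolding IH(1)[OF \<open>ozero < l\<close>] by blast
  thus ?thesis unfolding FV using \<open>ozero < l\<close> by blast
  next
  assume "v : (UN b:{..<l}. X (f |` {..b}))"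
  then obtain b where b: "b < l" "v : X (f |` {..b})" by blast
  note o = is_lim_osuc_less[OF lim(1) b(1)]
  have "v : cn (f |` {..<osuc b})" unfolding IH(1)[OF o] using b(2) by auto
  thus ?thesis unfolding FV using o by blast
  qed
  qed
  show "cn (f |` {..<a}) <= cn f" if "a <= l" for a
  using that node_simps(2)[OF lim.prems(1)] lim.prems(2) FV by(cases "a = l") (auto simp: order.order_iff_strict)
  fix b assume "b < l"
  thus "X (f |` {..b}) Int cn (f |` {..<b}) = {}" "wfc (X (f |` {..b}))" using IH(2)[OF is_lim_osuc_less[OF lim(1)], of b b] by auto
 qed
qed

lemma cn_mono: "f : nodes \<Gamma> ==> a <= len f ==> cn (f |` {..<a}) <= cn f"
 using cn_len by blast

abbreviation "pj f a == prj (cn f) (cn (f |` {..<a}))"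

text \<open>The formula at a node need not imply those at its predecessors, whereas the conclusion
  of the rule collects them all. Cutting out objects by the whole conjunction along the branch makes
  the arrows to predecessors exist.\<close>

definition "Ps f = whole (ctx (cn f)) Int (INT a:{..len f}. pull (pj f a) (S0 (f |` {..<a})))"

lemma pj: "f : nodes \<Gamma> ==> a <= len f ==> pj f a : hom (ctx (cn f)) (ctx (cn (f |` {..<a})))"
 using prj_hom[OF cn cn_mono] by blast

lemma pj_pj: "f : nodes \<Gamma> ==> a <= b ==> b <= len f ==> prj (cn (f |` {..<b})) (cn (f |` {..<a})) oo pj f b = pj f a"
proof -
 assume a: "f : nodes \<Gamma>" "a <= b" "b <= len f"
 have "cn (f |` {..<a}) <= cn (f |` {..<b})" using cn_mono[OF node_restrict(1)[OF a(1,3)], of a] node_restrict(2)[OF a(1,3)] node_simps(6)[OF a(1,2)] a(2) by simp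
 thus ?thesis by(rule prj_prj[OF cn[OF a(1)] cn_mono[OF a(1,3)]])
qed

lemma Ps_Sub: "f : nodes \<Gamma> ==> Ps f : Sub (ctx (cn f))"
 unfolding Ps_def
proof(rule Inter_Sub[OF less_kappa_atMost ctx_Ob[OF cn]])
 fix a assume f: "f : nodes \<Gamma>" and "a : {..len f}"
 hence a: "a <= len f" by simp
 show "pull (pj f a) (S0 (f |` {..<a})) : Sub (ctx (cn f))"
  using pull_Sub[of "pj f a"] pj[OF f a] S0[OF node_restrict(1)[OF f a]] by(auto simp: hom_def)
qed

lemma mem_Ps: "f : nodes \<Gamma> ==> k : Ps f \<longleftrightarrow> k : Ar & Cod k = ctx (cn f) & (ALL a<=len f. pj f a oo k : S0 (f |` {..<a}))"
 using pj[of f] unfolding Ps_def by(auto simp: mem_whole mem_pull hom_def)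

lemma Ps_top: assumes "f : nodes \<Gamma>" "k : Ps f" shows "k : S0 f"
proof -
 have "pj f (len f) = Idn (ctx (cn f))" using prj_Idn[OF cn[OF assms(1)]] node_simps(2)[OF assms(1)] by simp
 moreover have "pj f (len f) oo k : S0 f" "k : Ar" "Cod k = ctx (cn f)" using assms mem_Ps[OF assms(1)] node_simps(2)[OF assms(1)] by force+
 ultimately show ?thesis by simp
qed

lemma Ps_restrict:
 assumes f: "f : nodes \<Gamma>" and a: "a <= len f" and k: "k : Ps f"
 shows "pj f a oo k : Ps (f |` {..<a})"
proof -
 note n = node_restrict[OF f a]
 have kA: "k : hom (Dom k) (ctx (cn f))" and m: "!!c. c <= len f ==> pj f c oo k : S0 (f |` {..<c})" using k mem_Ps[OF f] by(auto simp: hom_def)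
 have "prj (cn (f |` {..<a})) (cn (f |` {..<c})) oo (pj f a oo k) = pj f c oo k" if c: "c <= a" for c
 proof -
  have "cn (f |` {..<c}) <= cn (f |` {..<a})" using cn_mono[OF n(1), of c] n(2) node_simps(6)[OF f c] c by simp
  thus ?thesis using comp_assoc[OF kA pj[OF f a] prj_hom[OF cn[OF n(1)]]] pj_pj[OF f c a] by metis
 qed
 thus ?thesis unfolding mem_Ps[OF n(1)] n(2) using node_simps(6)[OF f] m a Cmp_hom[OF pj[OF f a] kA] by(auto simp: hom_def)
qed

definition "mm f = (SOME m. monic m & Cod m = ctx (cn f) & Ps f = sub_of m)"
definition "Dm f = Dom (mm f)"
definition "tpp f b = (SOME h. h : hom (Dm f) (Dm (f |` {..<b})) & mm (f |` {..<b}) oo h = pj f b oo mm f)"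

lemma mm: assumes "f : nodes \<Gamma>" shows "monic (mm f)" "mm f : hom (Dm f) (ctx (cn f))" "Ps f = sub_of (mm f)" "mm f : Ps f"
proof -
 have "EX m. monic m & Cod m = ctx (cn f) & Ps f = sub_of m" using SubE[OF Ps_Sub[OF assms]] by metis
 hence m: "monic (mm f) & Cod (mm f) = ctx (cn f) & Ps f = sub_of (mm f)" unfolding mm_def by(rule someI_ex)
 thus "monic (mm f)" "mm f : hom (Dm f) (ctx (cn f))" "Ps f = sub_of (mm f)" "mm f : Ps f"
  using monicD(1) sub_of_self by(auto simp: hom_def Dm_def)
qed

lemma mm_lift: assumes "f : nodes \<Gamma>" "k : Ps f" "k : hom D (ctx (cn f))" shows "EX h:hom D (Dm f). mm f oo h = k"
proof -
 have "mm f : Ar" using mm(2)[OF assms(1)] by(simp add: hom_def)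
 then obtain h where "h : Ar" "Cod h = Dom (mm f)" "k = mm f oo h" using assms(2) mm(3)[OF assms(1)] by(auto simp: mem_sub_of)
 thus ?thesis using assms(3) \<open>mm f : Ar\<close> by(auto simp: hom_def Dm_def)
qed

lemma mm_eqI: "f : nodes \<Gamma> ==> h : hom D (Dm f) ==> k : hom D (Dm f) ==> mm f oo h = mm f oo k ==> h = k"
 using mm(1)[of f] monicD(2)[of "mm f" h k] by(simp add: hom_def Dm_def)

lemma tpp: assumes f: "f : nodes \<Gamma>" and b: "b <= len f"
 shows "tpp f b : hom (Dm f) (Dm (f |` {..<b}))" "mm (f |` {..<b}) oo tpp f b = pj f b oo mm f"
proof -
 have "EX h. h : hom (Dm f) (Dm (f |` {..<b})) & mm (f |` {..<b}) oo h = pj f b oo mm f"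
  using mm_lift[OF node_restrict(1)[OF f b] Ps_restrict[OF f b mm(4)[OF f]] Cmp_hom[OF pj[OF f b] mm(2)[OF f]]] by blast
 from someI_ex[OF this, folded tpp_def]
 show "tpp f b : hom (Dm f) (Dm (f |` {..<b}))" "mm (f |` {..<b}) oo tpp f b = pj f b oo mm f" by blast+
qed

lemma mm_tpp: assumes f: "f : nodes \<Gamma>" and b: "b <= len f" and t: "t : hom D (Dm f)"
 shows "mm (f |` {..<b}) oo (tpp f b oo t) = pj f b oo (mm f oo t)"
 using comp_assoc[OF t tpp(1)[OF f b] mm(2)[OF node_restrict(1)[OF f b]]] comp_assoc[OF t mm(2)[OF f] pj[OF f b]] tpp(2)[OF f b] by simp

lemma tpp_tpp: assumes f: "f : nodes \<Gamma>" and ab: "a <= b" "b <= len f" shows "tpp (f |` {..<b}) a oo tpp f b = tpp f a"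
proof -
 note n = node_restrict[OF f ab(2)] and r = node_simps(6)[OF f ab(1)]
 have al: "a <= len f" "a <= len (f |` {..<b})" using ab n(2) by auto
 have h: "tpp (f |` {..<b}) a : hom (Dm (f |` {..<b})) (Dm (f |` {..<a}))" using tpp(1)[OF n(1) al(2)] r by simp
 show ?thesis
 proof(rule mm_eqI[OF node_restrict(1)[OF f al(1)] Cmp_hom[OF h tpp(1)[OF f ab(2)]] tpp(1)[OF f al(1)]])
  have "mm (f |` {..<a}) oo (tpp (f |` {..<b}) a oo tpp f b) = prj (cn (f |` {..<b})) (cn (f |` {..<a})) oo (pj f b oo mm f)"
  using mm_tpp[OF n(1) al(2) tpp(1)[OF f ab(2)]] r tpp(2)[OF f ab(2)] by simp
  also have "\<dots> = (prj (cn (f |` {..<b})) (cn (f |` {..<a})) oo pj f b) oo mm f"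
  by(rule comp_assoc[OF mm(2)[OF f] pj[OF f ab(2)], symmetric]) (use pj[OF n(1) al(2)] r in simp)
  finally show "mm (f |` {..<a}) oo (tpp (f |` {..<b}) a oo tpp f b) = mm (f |` {..<a}) oo tpp f a"
  using pj_pj[OF f ab] tpp(2)[OF f al(1)] by simp
 qed
qed

lemma tpp_self: assumes f: "f : nodes \<Gamma>" shows "tpp f (len f) = Idn (Dm f)"
proof -
 have r: "f |` {..<len f} = f" by(rule node_simps(2)[OF f])
 have D: "Dm f : Ob" using mm(2)[OF f] by(auto simp: hom_def Dm_def)
 show ?thesis
  by(rule mm_eqI[OF f _ Idn_hom[OF D]]) (insert tpp[OF f order_refl] r prj_Idn[OF cn[OF f]] mm(2)[OF f], auto simp: hom_def)
qed

text \<open>At a limit the context is the union of the earlier ones, so a cone is assembled variable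
  by variable, each read at a level \<open>ia v\<close> where it occurs. The limit premise then puts
  the assembled arrow into the formula at \<open>f\<close> itself.\<close>

lemma tree_limit:
 assumes f: "f : nodes \<Gamma>" and l: "is_lim (len f)"
 shows "is_limit {..<len f} (%a. Dm (f |` {..<a})) (%b a. if a <= b then {tpp (f |` {..<b}) a} else {}) (Dm f) (tpp f)"
 unfolding is_limit_def
proof(intro conjI allI impI)
 have D: "Dm f : Ob" using mm(2)[OF f] by(auto simp: hom_def Dm_def)
 show "is_cone H {..<len f} (%a. Dm (f |` {..<a})) (%b a. if a <= b then {tpp (f |` {..<b}) a} else {}) (Dm f) (tpp f)"
  unfolding is_cone_def using D tpp(1)[OF f] tpp_tpp[OF f] by auto
 fix E q assume "is_cone H {..<len f} (%a. Dm (f |` {..<a})) (%b a. if a <= b then {tpp (f |` {..<b}) a} else {}) E q"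
 hence E: "E : Ob" and q: "!!a. a < len f ==> q a : hom E (Dm (f |` {..<a}))"
  and qq: "!!a b. a <= b ==> b < len f ==> tpp (f |` {..<b}) a oo q b = q a" unfolding is_cone_def by auto
 have n: "f |` {..<a} : nodes \<Gamma>" "len (f |` {..<a}) = a" if "a < len f" for a using node_restrict[OF f, of a] that by auto
 note mh = mm(2)[OF n(1)]
 define ia where "ia v = (SOME a. a < len f & v : cn (f |` {..<a}))" for v
 have ia: "ia v < len f" "v : cn (f |` {..<ia v})" if "v : cn f" for v
 proof -
  have "EX a. a < len f & v : cn (f |` {..<a})" using that FVl[OF f l] by blast
  hence "ia v < len f & v : cn (f |` {..<ia v})" unfolding ia_def by(rule someI_ex)
  thus "ia v < len f" "v : cn (f |` {..<ia v})" by auto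
 qed
 let ?c = "%v a. cpr (cn (f |` {..<a})) v oo (mm (f |` {..<a}) oo q a)"
 have mono: "?c v a = ?c v b" if ab: "a <= b" "b < len f" and v: "v : cn (f |` {..<a})" for a b v
 proof -
  have al: "a < len f" "a <= len (f |` {..<b})" using ab n by auto
  have r: "(f |` {..<b}) |` {..<a} = f |` {..<a}" by(rule node_simps(6)[OF f ab(1)])
  have "mm (f |` {..<a}) oo q a = pj (f |` {..<b}) a oo (mm (f |` {..<b}) oo q b)"
  using mm_tpp[OF n(1)[OF ab(2)] al(2) q[OF ab(2)]] qq[OF ab] r by simp
  thus ?thesis unfolding r
  using cpr_prj_comp[OF cn[OF n(1)[OF ab(2)]] _ v Cmp_hom[OF mh[OF ab(2)] q[OF ab(2)]]] cn_mono[OF n(1)[OF ab(2)] al(2)] r by simp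
 qed
 have cc: "?c v a = ?c v (ia v)" if "a < len f" "v : cn (f |` {..<a})" "v : cn f" for v a
  using mono[of a "ia v" v] mono[of "ia v" a v] ia[OF that(3)] that by(metis nle_le)
 note kk = ctup[OF cn[OF f] E, where q = "%v. ?c v (ia v)"]
 have kh: "?c v (ia v) : hom E (sort_ob M (fst v))" if "v : cn f" for v
  by(rule Cmp_hom[OF cpr_hom[OF cn[OF n(1)]] Cmp_hom[OF mh q]]) (use ia[OF that] in auto)
 define k where "k = ctup (cn f) E (%v. ?c v (ia v))"
 have k: "k : hom E (ctx (cn f))" "!!v. v : cn f ==> cpr (cn f) v oo k = ?c v (ia v)" unfolding k_def using kk kh by auto
 have kq: "pj f a oo k = mm (f |` {..<a}) oo q a" if a: "a < len f" for a
 proof(rule ctx_eqI[OF cn[OF n(1)[OF a]] Cmp_hom[OF pj[OF f] k(1)] Cmp_hom[OF mh[OF a] q[OF a]]])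
  show "a <= len f" using a by simp
  fix v assume v: "v : cn (f |` {..<a})"
  have sub: "cn (f |` {..<a}) <= cn f" using cn_mono[OF f] a by simp
  show "cpr (cn (f |` {..<a})) v oo (pj f a oo k) = ?c v a"
  using cpr_prj_comp[OF cn[OF f] sub v k(1)] k(2)[OF subsetD[OF sub v]] cc[OF a v subsetD[OF sub v]] by simp
 qed
 have kS: "pj f a oo k : S0 (f |` {..<a})" if a: "a < len f" for a
 proof -
  have "mm (f |` {..<a}) oo q a : Ps (f |` {..<a})"
  by(rule Sub_comp[OF Ps_Sub[OF n(1)[OF a]] mm(4)[OF n(1)[OF a]]]) (insert q[OF a], auto simp: hom_def Dm_def)
  thus ?thesis using Ps_top[OF n(1)[OF a]] kq[OF a] by simp
 qed
 let ?F = "%a. if a < len f then Some (\<Phi> (f |` {..<a})) else None"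
 have "k : sm (Conj ?F) (cn f)" unfolding sem_Conj
 proof(intro IntI INT_I)
  show "k : whole (ctx (cn f))" using k(1) by(simp add: mem_whole hom_def)
  fix a assume "a : dom ?F"
  hence a: "a < len f" by(auto split: if_splits)
  have "sm (\<Phi> (f |` {..<a})) (cn f) = pull (pj f a) (S0 (f |` {..<a}))"
  by(rule sem_weaken[OF wfP[OF n(1)[OF a]] cn[OF f] cn_mono[OF f] order_refl]) (use a in simp)
  thus "k : sm (the (?F a)) (cn f)" using kS[OF a] a k(1) pj[OF f, of a] by(simp add: mem_pull hom_def)
 qed
 hence kf: "k : S0 f" using lims[OF f l] by blast
 have "k : Ps f" unfolding mem_Ps[OF f]
 proof(intro conjI allI impI)
  fix a assume "a <= len f"
  thus "pj f a oo k : S0 (f |` {..<a})" using kS[of a] kf node_simps(2)[OF f] prj_Idn[OF cn[OF f]] k(1)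
  by(cases "a = len f") (auto simp: hom_def)
 qed (insert k(1), auto simp: hom_def)
 then obtain h where h: "h : hom E (Dm f)" "mm f oo h = k" using mm_lift[OF f _ k(1)] by blast
 show "EX! h. h : hom E (Dm f) & (ALL a:{..<len f}. tpp f a oo h = q a)"
 proof(rule ex1I[of _ h])
  have "tpp f a oo h = q a" if a: "a < len f" for a
  by(rule mm_eqI[OF n(1)[OF a] Cmp_hom[OF tpp(1)[OF f] h(1)] q[OF a]]) (use mm_tpp[OF f _ h(1), of a] h(2) kq[OF a] a in auto)
  thus "h : hom E (Dm f) & (ALL a:{..<len f}. tpp f a oo h = q a)" using h(1) by simp
  fix h' assume h': "h' : hom E (Dm f) & (ALL a:{..<len f}. tpp f a oo h' = q a)"
  have h'h: "h' : hom E (Dm f)" using h' by blast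
  show "h' = h"
  proof(rule mm_eqI[OF f h'h h(1)], rule ctx_eqI[OF cn[OF f] Cmp_hom[OF mm(2)[OF f] h'h] Cmp_hom[OF mm(2)[OF f] h(1)]])
  fix v assume v: "v : cn f"
  note a = ia[OF v]
  have sub: "cn (f |` {..<ia v}) <= cn f" using cn_mono[OF f] a by simp
  have "pj f (ia v) oo (mm f oo h') = pj f (ia v) oo (mm f oo h)"
  using mm_tpp[OF f _ h'h, of "ia v"] h' a(1) kq[OF a(1)] h(2) by simp
  thus "cpr (cn f) v oo (mm f oo h') = cpr (cn f) v oo (mm f oo h)"
  using cpr_prj_comp[OF cn[OF f] sub a(2) Cmp_hom[OF mm(2)[OF f] h'h]] cpr_prj_comp[OF cn[OF f] sub a(2) Cmp_hom[OF mm(2)[OF f] h(1)]] by simp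
  qed
 qed
qed

lemma ex_one:
 assumes f: "f : nodes \<Gamma>" and i: "i : \<Gamma>"
 defines "g == f(len f |-> i)"
 shows "sm (Exists [ozero |-> X g] (\<Phi> g)) (cn f) = ex_along (prj (cn g) (cn f)) (S0 g)"
proof -
 have c: "cn f Int bvars [ozero |-> X g] = {}" "cn f Un bvars [ozero |-> X g] = cn g" using FVs[OF f i] unfolding one_block g_def by auto
 show ?thesis using sem_Quant_disj[OF wfX[OF f i, folded g_def] cn[OF f] c(1)] unfolding c(2) qop_def Let_def quant.case by simp
qed

text \<open>By \<open>step\<close> the join over the successors becomes everything when pulled back
  along \<open>mm f\<close>. A local witness for one successor satisfies all formulas of the longer
  branch, the older ones because it lies over \<open>Ps f\<close>, and so factors through the object
  of that successor.\<close>

lemma tree_cover: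
 assumes f: "f : nodes \<Gamma>"
 shows "covers (Dm f) \<Gamma> (%i. tpp (f(len f |-> i)) (len f))"
 unfolding covers_def
proof(intro conjI ballI impI)
 show D: "Dm f : Ob" using mm(2)[OF f] by(auto simp: hom_def Dm_def)
 have r: "f(len f |-> i) |` {..<len f} = f" for i using node_simps(5)[OF f order_refl] node_simps(2)[OF f] by simp
 have le: "len f <= len (f(len f |-> i))" for i using node_simps(4)[OF f] by simp
 note ph = tpp(1)[OF node_simps(3)[OF f] le, unfolded r]
 show "tpp (f(len f |-> i)) (len f) : Ar" "Cod (tpp (f(len f |-> i)) (len f)) = Dm f" if "i : \<Gamma>" for i
  using ph[OF that] by(auto simp: hom_def)
 fix R assume R: "R : Sub (Dm f)" and pR: "ALL i:\<Gamma>. tpp (f(len f |-> i)) (len f) : R"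
 let ?E = "%i. sm (Exists [ozero |-> X (f(len f |-> i))] (\<Phi> (f(len f |-> i)))) (cn f)"
 have m: "mm f : Ar" "Dom (mm f) = Dm f" "Cod (mm f) = ctx (cn f)" using mm(2)[OF f] by(auto simp: hom_def)
 have ES: "?E i : Sub (ctx (cn f))" if "i : \<Gamma>" for i
  by(rule sem_Sub[OF wfX[OF f that] cn[OF f]]) (use FVs[OF f that] one_block(2) in auto)
 have "mm f : join (ctx (cn f)) (?E ` \<Gamma>)" using step[OF f] Ps_top[OF f mm(4)[OF f]] by blast
 hence "Idn (Dm f) : pull (mm f) (join (Cod (mm f)) (?E ` \<Gamma>))" using D m by(simp add: mem_pull del: sem.simps)
 also have "\<dots> = join (Dm f) (pull (mm f) ` ?E ` \<Gamma>)" using pull_join[OF m(1) _ card_image_k, of ?E \<Gamma>] ES m(2,3) by(auto simp del: sem.simps)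
 also have "\<dots> <= R"
 proof(rule is_joinD(3)[OF join_is_join R])
  show "Dm f : Ob" by(rule D)
  show "pull (mm f) ` ?E ` \<Gamma> <= Sub (Dm f)" using pull_Sub[OF m(1)] ES m(2,3) by(auto simp del: sem.simps)
  show "ordLeq3 (card_of (pull (mm f) ` ?E ` \<Gamma>)) (card_of (UNIV :: 'k set))" unfolding image_image by(rule card_image_k)
  fix Q assume "Q : pull (mm f) ` ?E ` \<Gamma>"
  then obtain i where i: "i : \<Gamma>" "Q = pull (mm f) (?E i)" by blast
  let ?g = "f(len f |-> i)"
  have g: "?g : nodes \<Gamma>" by(rule node_simps(3)[OF f i(1)])
  have pg: "prj (cn ?g) (cn f) : hom (ctx (cn ?g)) (ctx (cn f))" using pj[OF g le] r by simp
  hence pA: "prj (cn ?g) (cn f) : Ar" "Dom (prj (cn ?g) (cn f)) = ctx (cn ?g)" by(auto simp: hom_def)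
  show "Q <= R"
  proof
  fix t assume "t : Q"
  hence t: "t : Ar" "Cod t = Dm f" "mm f oo t : ex_along (prj (cn ?g) (cn f)) (S0 ?g)"
  using i(2) ex_one[OF f i(1)] m by(auto simp: mem_pull simp del: sem.simps)
  have "S0 ?g : Sub (Dom (prj (cn ?g) (cn f)))" using S0[OF g] pA by simp
  then obtain e h where e: "cover e" "e : Ar" "Cod e = Dom (mm f oo t)" and h: "h : S0 ?g" "Dom h = Dom e" "prj (cn ?g) (cn f) oo h = (mm f oo t) oo e"
  using mem_ex[OF pA(1) _ t(3)] by metis
  have ce: "Cod e = Dom t" using e(3) t m by simp
  have te: "t oo e : hom (Dom e) (Dm f)" using e(2) ce t by(simp add: hom_def)
  have hh: "h : hom (Dom e) (ctx (cn ?g))" using SubD[OF S0[OF g] h(1)] h(2) by(simp add: hom_def)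
  have mte: "prj (cn ?g) (cn f) oo h = mm f oo (t oo e)" using h(3) e(2) ce t m by simp
  have mP: "mm f oo (t oo e) : Ps f" by(rule Sub_comp[OF Ps_Sub[OF f] mm(4)[OF f]]) (insert te m, auto simp: hom_def)
  have "h : Ps ?g" unfolding mem_Ps[OF g]
  proof(intro conjI allI impI)
  fix a assume a: "a <= len ?g"
  show "pj ?g a oo h : S0 (?g |` {..<a})"
  proof(cases "a = len ?g")
  case True
  thus ?thesis using h(1) node_simps(2)[OF g] prj_Idn[OF cn[OF g]] hh by(simp add: hom_def)
  next
  case False
  hence a': "a <= len f" using a node_simps(4)[OF f, of i] by(metis less_osuc_iff order.not_eq_order_implies_strict)
  have "pj f a oo (prj (cn ?g) (cn f) oo h) = (pj f a oo prj (cn ?g) (cn f)) oo h" by(rule comp_assoc[OF hh pg pj[OF f a'], symmetric])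
  also have "pj f a oo prj (cn ?g) (cn f) = prj (cn ?g) (cn (f |` {..<a}))" using prj_prj[OF cn[OF g] _ cn_mono[OF f a']] FVs[OF f i(1)] by blast
  finally have e1: "pj f a oo (mm f oo (t oo e)) = prj (cn ?g) (cn (f |` {..<a})) oo h" unfolding mte .
  show ?thesis unfolding node_simps(5)[OF f a'] e1[symmetric] using mP a' unfolding mem_Ps[OF f] by blast
  qed
  qed (insert hh, auto simp: hom_def)
  then obtain s where s: "s : hom (Dom e) (Dm ?g)" "mm ?g oo s = h" using mm_lift[OF g _ hh] by blast
  have "tpp ?g (len f) oo s = t oo e"
  by(rule mm_eqI[OF f Cmp_hom[OF ph[OF i(1)] s(1)] te]) (use mm_tpp[OF g le s(1)] s(2) mte r in simp)
  moreover have "tpp ?g (len f) oo s : R" by(rule Sub_comp[OF R]) (insert pR i(1) s(1) ph[OF i(1)], auto simp: hom_def)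
  ultimately show "t : R" using cover_local[OF e(1), of R t] R t ce by simp
  qed
 qed
 finally show "R = whole (Dm f)" using Sub_whole_iff[OF R] by simp
qed

text \<open>The tree pruned at the bar. Its leaves lie in \<open>B\<close> and are minimal there,
  unless \<Gamma> is empty and the root is the only node.\<close>

definition "NN = {f : nodes \<Gamma>. ALL a<len f. f |` {..<a} ~: B}"

lemma NN_succs: assumes "f : NN" shows "succs NN f = (if f : B then {} else \<Gamma>)"
proof -
 have f: "f : nodes \<Gamma>" "!!a. a < len f ==> f |` {..<a} ~: B" using assms by(auto simp: NN_def)
 have "f(len f |-> i) : NN \<longleftrightarrow> i : \<Gamma> & f ~: B" for i
 proof
  assume a: "f(len f |-> i) : NN"
  hence "ran (f(len f |-> i)) <= \<Gamma>" unfolding NN_def nodes_def by blast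
  moreover have "i : ran (f(len f |-> i))" by(rule ranI[of _ "len f"]) simp
  ultimately have "i : \<Gamma>" by blast
  moreover have "f(len f |-> i) |` {..<len f} ~: B" using a node_simps(4)[OF f(1)] by(auto simp: NN_def)
  ultimately show "i : \<Gamma> & f ~: B" using node_simps(5)[OF f(1) order_refl] node_simps(2)[OF f(1)] by simp
 next
  assume i: "i : \<Gamma> & f ~: B"
  have "f(len f |-> i) |` {..<a} ~: B" if "a < osuc (len f)" for a
  using that f(2)[of a] i node_simps(5)[OF f(1), of a] node_simps(2)[OF f(1)] by(cases "a = len f") (auto simp: order.order_iff_strict)
  thus "f(len f |-> i) : NN" using node_simps(3,4)[OF f(1)] i by(auto simp: NN_def)
 qed
 thus ?thesis by(auto simp: succs_def)
qed

lemma NN_tree: "branching_tree NN"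
 unfolding branching_tree_def
proof(intro conjI ballI allI impI)
 show "Map.empty : NN" by(simp add: NN_def empty_node)
 show "EX b. dom s = {..<b}" if "s : NN" for s using that by(auto simp: NN_def nodes_def)
 show "s |` {..<a} : NN" if s: "s : NN" for s a
 proof(cases "a <= len s")
  case True
  have n: "s : nodes \<Gamma>" using s by(simp add: NN_def)
  show ?thesis using s node_restrict[OF n True] node_simps(6)[OF n] True by(auto simp: NN_def)
 next
  case False
  hence "s |` {..<a} = s" using node_simps(1)[of s \<Gamma>] s by(auto simp: NN_def fun_eq_iff restrict_map_def domIff not_less)
  (metis domIff lessThan_iff not_le order_less_trans)
  thus ?thesis using s by simp
 qed
next
 fix s :: "'k \<rightharpoonup> 'k" and b assume s: "dom s = {..<b} & is_lim b & (ALL a<b. s |` {..<a} : NN)"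
 have lb: "len s = b" using len_eq s by blast
 have oa: "s |` {..<osuc a} : NN" if "a < b" for a using s is_lim_osuc_less[of b a] that by blast
 have "i : \<Gamma>" if "s a = Some i" for a i
 proof -
  have "a < b" using that s by blast
  hence "s |` {..<osuc a} : nodes \<Gamma>" using oa by(simp add: NN_def)
  hence "ran (s |` {..<osuc a}) <= \<Gamma>" by(simp add: nodes_def)
  moreover have "i : ran (s |` {..<osuc a})" using that by(intro ranI[of _ a]) simp
  ultimately show ?thesis by blast
 qed
 hence n: "s : nodes \<Gamma>" using s by(auto simp: nodes_def ran_def)
 moreover have "s |` {..<a} ~: B" if a: "a < b" for a
  using oa[OF a] node_restrict(2)[OF n, of "osuc a"] node_simps(6)[OF n, of a "osuc a"] lb a by(auto simp: NN_def)
 ultimately show "s : NN" using lb by(simp add: NN_def)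
next
 show "\<nexists>f :: 'k => 'k. ALL b. (Some \<circ> f) |` {..<b} : NN"
 proof
  assume "EX f :: 'k => 'k. ALL b. (Some \<circ> f) |` {..<b} : NN"
  then obtain f :: "'k => 'k" where f: "!!b. (Some \<circ> f) |` {..<b} : NN" by blast
  have "f a : \<Gamma>" for a
  proof -
  have "((Some \<circ> f) |` {..<osuc a}) a = Some (f a)" by simp
  hence "f a : ran ((Some \<circ> f) |` {..<osuc a})" by(rule ranI)
  moreover have "ran ((Some \<circ> f) |` {..<osuc a}) <= \<Gamma>" using f[of "osuc a"] by(simp add: NN_def nodes_def)
  ultimately show ?thesis by blast
  qed
  then obtain b where b: "(Some \<circ> f) |` {..<b} : B" using bar unfolding is_bar_def by blast
  have "dom ((Some \<circ> f) |` {..<osuc b}) = {..<osuc b}" by auto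
  hence "len ((Some \<circ> f) |` {..<osuc b}) = osuc b" by(rule len_eq)
  moreover have "((Some \<circ> f) |` {..<osuc b}) |` {..<b} = (Some \<circ> f) |` {..<b}" by(auto simp: restrict_map_def fun_eq_iff)
  ultimately show False using f[of "osuc b"] b by(auto simp: NN_def)
 qed
qed

theorem transfinite_sound:
 assumes J: "J : Sub (ctx (cn Map.empty))"
  and leaf: "!!f. f : nodes \<Gamma> ==> f : minimal_nodes B ==> prj (cn f) (cn Map.empty) oo mm f : J"
 shows "S0 Map.empty <= J"
proof -
 let ?e = "Map.empty :: 'k \<rightharpoonup> 'k"
 note e = empty_node(1)[of \<Gamma>]
 have N: "s : NN ==> s : nodes \<Gamma>" for s by(simp add: NN_def)
 have D: "f : nodes \<Gamma> ==> Dm f : Ob" for f using mm(2)[of f] by(auto simp: hom_def Dm_def)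
 have "tree_of_objects H NN Dm tpp" unfolding tree_of_objects_def using D N tpp_self tpp(1) tpp_tpp tree_limit by auto
 moreover have "covering TYPE('k) H (Dm s) (succs NN s) (%i. tpp (s(len s |-> i)) (len s))" if "s : NN" "succs NN s ~= {}" for s
  using tree_cover[OF N[OF that(1)]] covers_k[OF D[OF N[OF that(1)]]] NN_succs[OF that(1)] that(2) by(auto split: if_splits)
 ultimately have "covering TYPE('k) H (Dm ?e) {s : NN. succs NN s = {}} (%s. tpp s ozero)"
  using tr_trans NN_tree unfolding transfinite_transitive_def by blast
 hence cv: "covers (Dm ?e) {s : NN. succs NN s = {}} (%s. tpp s ozero)" unfolding covering_iff[OF D[OF e]] by blast
 have m: "mm ?e : Ar" "Dom (mm ?e) = Dm ?e" "Cod (mm ?e) = ctx (cn ?e)" using mm(2)[OF e] by(auto simp: hom_def)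
 have "mm ?e : J"
 proof(rule covers_local[OF cv J m(1,3,2)])
  fix s assume "s : {s : NN. succs NN s = {}}"
  hence s: "s : NN" "succs NN s = {}" by auto
  note n = N[OF s(1)]
  have r: "s |` {..<ozero} = ?e" by(auto simp: restrict_map_def)
  have eq: "mm ?e oo tpp s ozero = prj (cn s) (cn ?e) oo mm s" using tpp(2)[OF n ozero_le] r by simp
  show "mm ?e oo tpp s ozero : J"
  proof(cases "s : B")
  case True
  hence "s : minimal_nodes B" using s(1) by(auto simp: minimal_nodes_def NN_def)
  thus ?thesis using leaf[OF n] eq by simp
  next
  \<comment> \<open>With no successors at all the disjunction in the premise is empty, so the object
    of the node is degenerate.\<close>
  case False
  hence "\<Gamma> = {}" using NN_succs[OF s(1)] s(2) by simp
  hence "mm s : bot (ctx (cn s))" using step[OF n] Ps_top[OF n mm(4)[OF n]] by(auto simp: bot_def)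
  hence "degenerate (Dm s)" using mem_bot[of "mm s"] mm(2)[OF n] by(simp add: hom_def)
  moreover have "prj (cn s) (cn ?e) oo mm s : hom (Dm s) (ctx (cn ?e))" using Cmp_hom[OF pj[OF n ozero_le] mm(2)[OF n]] r by simp
  ultimately show ?thesis unfolding eq using degenerate_mem[of "prj (cn s) (cn ?e) oo mm s" J] J by(simp add: hom_def)
  qed
 qed
 moreover have "S0 ?e <= Ps ?e"
 proof
  fix k assume k: "k : S0 ?e"
  have r: "?e |` {..<a} = ?e" for a by(simp add: restrict_map_def)
  show "k : Ps ?e" unfolding mem_Ps[OF e] using SubD[OF S0[OF e] k] k prj_Idn[OF cn[OF e]] r by simp
 qed
 ultimately have mJ: "mm ?e : J" "S0 ?e <= sub_of (mm ?e)" unfolding mm(3)[OF e] by blast+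
 show ?thesis
 proof
  fix k assume "k : S0 ?e"
  then obtain h where "h : Ar" "Cod h = Dom (mm ?e)" "k = mm ?e oo h" using mJ(2) mem_sub_of[OF m(1)] by blast
  thus "k : J" using Sub_comp[OF J mJ(1)] by simp
 qed
qed

end

context kstr
begin

subsubsection \<open>Tails of games\<close>

lemma shift_blen:
 assumes X: "blen X g" and b: "b < g"
 shows "blen (shift b X) (odiff g b)" "bvars (X |` {..<b}) Un bvars (shift b X) = bvars X"
  "bvars (X |` {..<b}) Int bvars (shift b X) = {}"
proof -
 note B = blenD[OF X]
 have lt: "oplus b a < g \<longleftrightarrow> a < odiff g b" for a by(rule oplus_less_odiff) (use b in simp)
 have "shift b X a = None \<longleftrightarrow> ~ a < odiff g b" for a using B(4,5)[of "oplus b a"] lt[of a] by(cases "oplus b a < g") (auto simp: shift_def)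
 hence dm: "dom (shift b X) = {..<odiff g b}" by(simp add: dom_def lessThan_def)
 have rn: "ran (shift b X) <= ran X" by(auto simp: shift_def ran_def)
 show S: "blen (shift b X) (odiff g b)" unfolding blen_def wf_blocks_def
 proof(intro conjI exI[of _ "odiff g b"] ballI allI impI dm)
  fix A assume "A : ran (shift b X)"
  thus "wfc A" using rn B(1) unfolding wf_blocks_def by blast
 next
  fix a a' A A' assume "a ~= a'" "shift b X a = Some A" "shift b X a' = Some A'"
  moreover have "oplus b a ~= oplus b a'" using \<open>a ~= a'\<close> by simp
  ultimately show "A Int A' = {}" using B(1) unfolding wf_blocks_def shift_def by blast
 qed
 have bS: "bvars (shift b X) = (UN a:{..<odiff g b}. the (X (oplus b a)))" using blenD(9)[OF S] by(simp add: shift_def)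
 have R: "blen (X |` {..<b}) b" using blen_restrict(1)[OF X] b by simp
 have bR: "bvars (X |` {..<b}) = (UN a:{..<b}. the (X a))" using blenD(9)[OF R] by simp
 have sp: "{..<g} = {..<b} Un oplus b ` {..<odiff g b}"
 proof(intro equalityI subsetI)
  fix c assume "c : {..<g}"
  thus "c : {..<b} Un oplus b ` {..<odiff g b}" using lt[of "odiff c b"] by(cases "c < b") (auto intro: image_eqI[of _ _ "odiff c b"])
 next
  fix c assume "c : {..<b} Un oplus b ` {..<odiff g b}"
  thus "c : {..<g}" using b lt by(elim UnE imageE) (simp_all add: order_less_trans[of c b g])
 qed
 show "bvars (X |` {..<b}) Un bvars (shift b X) = bvars X" unfolding bS bR B(9) sp by auto
 have "the (X a) Int the (X (oplus b c)) = {}" if "a < b" "c < odiff g b" for a c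
  by(rule B(10)) (insert that b lt[of c] oplus_ge[of b c], auto simp del: oplus_ge dest: order_less_le_trans)
 thus "bvars (X |` {..<b}) Int bvars (shift b X) = {}" unfolding bS bR by blast
qed

text \<open>The correction of parity is an insertion of empty blocks, so that \<open>inX_ins\<close>
  applies to tails that begin at stage 1.\<close>

lemma realign_ins: assumes X: "blen X g" shows "realign X = ins False g X"
proof
 fix c :: 'k
 note B = blenD[OF X]
 have "finite {..<(ozero::'k)}" by(simp add: lessThan_def)
 thus "realign X c = ins False g X c"
  using infinite_lim[of c] B(4,5)[of c]
  by(cases c rule: ord_cases; cases "c < g") (auto simp: realign_def ins_def insD_def insq_def obase_def opred_def)
qed

lemma bvars_first: "blen X g ==> g ~= ozero ==> bvars (X |` {..<osuc ozero}) = the (X ozero)"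
proof -
 assume X: "blen X g" "g ~= ozero"
 have "osuc ozero <= g" using X(2) by simp
 note R = blen_restrict(1)[OF X(1) this]
 have "{..<osuc (ozero::'k)} = {ozero}" by auto
 thus ?thesis using blenD(9)[OF R] by simp
qed

text \<open>The moves already made are recorded by \<open>w'\<close> as a single arrow into the
  context enlarged by the first \<open>b\<close> blocks; over it the residual strategy plays for the
  same target.\<close>

lemma inX_peel:
 assumes y: "wfc y" and X: "blen X g" and d: "y Int bvars X = {}" and S: "S : Sub (ctx (y Un bvars X))"
  and l: "l : Ar" "Cod l = ctx y" and \<sigma>: "covering_strategy cov (bob X) (Dom l) g \<sigma>"
  and win: "!!r. is_chain (Dom l) g r ==> follows cov (bob X) \<sigma> g r ==> EX w:S. Dom w = stage r g &
  prj (y Un bvars X) y oo w = l oo link r g ozero & (ALL a<g. bpr (y Un bvars X) X a oo w = elt r a oo link r g (osuc a))"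
  and b: "b < g" and r: "is_chain (Dom l) b r" "follows cov (bob X) \<sigma> b r"
 defines "y1 == y Un bvars (X |` {..<b})"
 assumes w': "w' : hom (stage r b) (ctx y1)" "prj y1 y oo w' = l oo link r b ozero"
  "!!a. a < b ==> prj y1 (the (X a)) oo w' = elt r a oo link r b (osuc a)"
 shows "inX (%a. cov (oplus b a)) (shift b X) y1 S w'"
proof -
 let ?z = "y Un bvars X"
 note B = blenD[OF X] and Sh = shift_blen[OF X b] and R = blen_restrict[OF X less_imp_le[OF b]]
 have gg: "oplus b (odiff g b) = g" using b by simp
 have z: "wfc ?z" using wfc_Un[OF y B(8)] .
 have sub: "y1 <= ?z" using R(2) by(auto simp: y1_def)
 have y1: "wfc y1" by(rule wfc_subset[OF z sub])
 have zz: "y1 Un bvars (shift b X) = ?z" using Sh(2) by(auto simp: y1_def)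
 note Z1 = prodZ_D[OF ctx_prodZ[OF y R(1)], folded y1_def]
 have d1: "y Int bvars (X |` {..<b}) = {}" using d R(2) by blast
 note Z1 = Z1[OF d1]
 let ?W = "%k e. EX w:S. Dom w = Dom k & prj ?z y oo w = l oo k & (ALL a<g. bpr ?z X a oo w = e a)"
 have "wins (%a. cov (oplus b a)) (%a. bob X (oplus b a)) (odiff g b) (stage r b)
  (%k e. ?W (link r b ozero oo k) (%a. if a < b then elt r a oo (link r b (osuc a) oo k) else e (odiff a b)))"
 proof(rule wins_peel[where W = ?W and b = b and g' = "odiff g b" and r = r, unfolded gg, OF \<sigma> _ _ r])
  fix s assume s: "is_chain (Dom l) g s" "follows cov (bob X) \<sigma> g s"
  have "Dom (link s g ozero) = stage s g" using chainD(3)[OF s(1) order_refl, of ozero] by(simp add: hom_def)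
  thus "?W (link s g ozero) (%a. elt s a oo link s g (osuc a))" using win[OF s] by simp
 qed auto
 hence "wins (%a. cov (oplus b a)) (%a. bob X (oplus b a)) (odiff g b) (stage r b)
  (%k e. EX w:S. Dom w = Dom k & prj ?z y1 oo w = w' oo k & (ALL a<odiff g b. prj ?z (the (shift b X a)) oo w = e a))"
 proof(rule wins_mono)
  fix k e assume v: "valid (%a. bob X (oplus b a)) (odiff g b) (stage r b) k e"
  and W: "?W (link r b ozero oo k) (%a. if a < b then elt r a oo (link r b (osuc a) oo k) else e (odiff a b))"
  have k: "k : hom (Dom k) (stage r b)" using v by(auto simp: valid_def hom_def)
  have lk: "link r b a : hom (stage r b) (stage r a)" if "a <= b" for a using chainD(3)[OF r(1) order_refl that] .
  have l0: "link r b ozero : hom (stage r b) (Dom l)" using lk[of ozero] chain_zero[OF r(1)] by simp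
  have lh: "l : hom (Dom l) (ctx y)" using l by(simp add: hom_def)
  obtain w where w: "w : S" "Dom w = Dom (link r b ozero oo k)" "prj ?z y oo w = l oo (link r b ozero oo k)"
  "ALL a<g. bpr ?z X a oo w = (if a < b then elt r a oo (link r b (osuc a) oo k) else e (odiff a b))" using W by(elim bexE conjE) (rule that)
  have Dw: "Dom w = Dom k" using w(2) Cmp_hom[OF l0 k] by(simp add: hom_def)
  have wh: "w : hom (Dom k) (ctx ?z)" using SubD[OF S w(1)] Dw by(simp add: hom_def)
  note p1 = prj_hom[OF z sub]
  have "prj ?z y1 oo w = w' oo k"
  proof(rule Z1(4)[OF Cmp_hom[OF p1 wh] Cmp_hom[OF w'(1) k]])
  have "prj y1 y oo (prj ?z y1 oo w) = prj ?z y oo w" using comp_assoc[OF wh p1 Z1(1)] prj_prj[OF z sub, of y] by(simp add: y1_def)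
  also have "\<dots> = (l oo link r b ozero) oo k" using w(3) comp_assoc[OF k l0 lh] by simp
  also have "\<dots> = prj y1 y oo (w' oo k)" using comp_assoc[OF k w'(1) Z1(1)] w'(2) by simp
  finally show "prj y1 y oo (prj ?z y1 oo w) = prj y1 y oo (w' oo k)" .
  fix a assume a: "a < b"
  have th: "the ((X |` {..<b}) a) = the (X a)" using a by simp
  have sa: "the (X a) <= y1" using blenD(7)[OF R(1) a] th by(auto simp: y1_def)
  note pa = Z1(2)[OF a, unfolded th]
  have ea: "elt r a : hom (stage r (osuc a)) (bob X a)" using r(2) a by(simp add: follows_iff)
  have "prj y1 (the (X a)) oo (prj ?z y1 oo w) = bpr ?z X a oo w" using comp_assoc[OF wh p1 pa] prj_prj[OF z sub sa] by simp
  also have "\<dots> = elt r a oo (link r b (osuc a) oo k)" using w(4) a b by(auto dest: order_less_trans)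
  also have "\<dots> = prj y1 (the (X a)) oo (w' oo k)"
  using comp_assoc[OF k w'(1) pa] comp_assoc[OF k lk ea] w'(3)[OF a] a by simp
  finally show "prj y1 (the ((X |` {..<b}) a)) oo (prj ?z y1 oo w) = prj y1 (the ((X |` {..<b}) a)) oo (w' oo k)" unfolding th .
  qed
  moreover have "prj ?z (the (shift b X a)) oo w = e a" if a: "a < odiff g b" for a
  proof -
  have o: "oplus b a < g" using oplus_less_odiff[of b g a] b a by simp
  have "~ oplus b a < b" using oplus_ge[of b a] by(simp del: oplus_ge)
  hence "bpr ?z X (oplus b a) oo w = e a" using w(4) o by simp
  thus ?thesis by(simp add: shift_def)
  qed
  ultimately show "EX w:S. Dom w = Dom k & prj ?z y1 oo w = w' oo k & (ALL a<odiff g b. prj ?z (the (shift b X a)) oo w = e a)"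
  using w(1) Dw by blast
 qed
 moreover have "Dom w' = stage r b" using w'(1) by(simp add: hom_def)
 ultimately show ?thesis unfolding inX_def in_T_iff blenD(3)[OF Sh(1)] zz by(simp add: shift_def)
qed

end

context khet
begin

subsubsection \<open>Soundness of the heterogeneous axioms\<close>

text \<open>For a body \<open>Neg \<chi>\<close> the opposing target is \<chi> itself rather than a
  double negation, the roles being exchanged by \<open>det_swap\<close>.\<close>

lemma het_det:
 assumes g: "is_lim g" and X: "blen X g" and x: "wfc x" and d: "x Int bvars X = {}" and \<chi>: "\<chi> : C" "wff \<phi>"
  "FV \<phi> <= x Un bvars X" and \<phi>: "\<phi> = \<chi> \<or> \<phi> = Neg \<chi>" and c: "cov = ord_even \<or> cov = (%a. ~ ord_even a)"
 shows "EX S2 J1 J2. detX cov X x (sm \<phi> (x Un bvars X)) S2 J1 J2 & S2 : Sub (ctx (x Un bvars X)) &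
  sm \<phi> (x Un bvars X) Int S2 <= bot (ctx (x Un bvars X))"
proof -
 let ?z = "x Un bvars X"
 have z: "wfc ?z" using wfc_Un[OF x blenD(8)[OF X]] .
 have w: "wff \<chi>" "FV \<chi> <= ?z" using \<phi> \<chi> by(auto elim: wf_ImpE)
 note S = sem_Sub[OF w(1) z w(2)]
 have c': "(%a. ~ cov a) = ord_even \<or> (%a. ~ cov a) = (%a. ~ ord_even a)" using c by auto
 from \<phi> show ?thesis
 proof
  assume "\<phi> = \<chi>"
  thus ?thesis using det_lim[OF g X x d \<chi>(1) w c] sem_Neg_Sub[OF S] sem_Neg_disj[OF S] by blast
 next
  assume p: "\<phi> = Neg \<chi>"
  obtain J1 J2 where "detX (%a. ~ cov a) X x (sm \<chi> ?z) (sm (Neg \<chi>) ?z) J1 J2" using det_lim[OF g X x d \<chi>(1) w c'] by blast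
  hence "detX cov X x (sm (Neg \<chi>) ?z) (sm \<chi> ?z) J2 J1" using det_swap unfolding detX_def by fastforce
  thus ?thesis unfolding p using S sem_Neg_disj[OF S] by(metis Int_commute)
 qed
qed

lemma qcov_alt: "qcov q (osuc c) \<longleftrightarrow> ~ qcov q c" "qcov q = ord_even \<or> qcov q = (%a. ~ ord_even a)"
 by(auto simp: qcov_def)

text \<open>A win of the plain tail has to count in the realigned game, but \<open>inX_ins\<close>
  moves wins only from the realigned game to the plain one. Determinacy closes the gap: the
  dichotomy of the realigned game is transferred for both players at once, and in the plain game
  \<open>det_mem\<close> puts \<open>h\<close> into the join of the right one.\<close>

lemma realign_mem:
 assumes g: "is_lim g" and X: "blen X g" and y: "wfc y" and d: "y Int bvars X = {}" and \<chi>: "\<chi> : C" "wff \<phi>"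
  "FV \<phi> <= y Un bvars X" and \<phi>: "\<phi> = \<chi> \<or> \<phi> = Neg \<chi>" and q: "q = QAE \<or> q = QEA"
  and w: "inX (%a. ~ qcov q (oplus (osuc ozero) a)) X y (sm \<phi> (y Un bvars X)) h" and h: "h : Ar" "Cod h = ctx y"
 shows "h : qop q (realign X) y (sm \<phi> (y Un bvars X))"
proof -
 let ?Y = "realign X" and ?z = "y Un bvars X" and ?c = "%a. ~ qcov q (oplus (osuc ozero) a)"
 have I: "blen ?Y g" "bvars ?Y = bvars X" unfolding realign_ins[OF X] by(rule ins_blen[OF X g])+
 have z: "wfc ?z" using wfc_Un[OF y blenD(8)[OF X]] .
 note S = sem_Sub[OF \<chi>(2) z \<chi>(3)]
 obtain S2 J1 J2 where D: "detX (qcov q) ?Y y (sm \<phi> ?z) S2 J1 J2" and S2: "S2 : Sub (ctx ?z)" "sm \<phi> ?z Int S2 <= bot (ctx ?z)"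
  using het_det[OF g I(1) y _ \<chi>(1,2) _ \<phi> qcov_alt(2)] d \<chi>(3) unfolding I(2) by blast
 note D = D[unfolded detX_def I(2)]
 \<comment> \<open>Stage \<open>a\<close> of the tail is stage \<open>1 + a\<close> of the whole.
   Once dummies are inserted at the limits, its parity is reversed at every real stage, infinite
   ones included.\<close>
 have par: "ord_even (oplus (osuc ozero) (insq False c)) \<longleftrightarrow> ~ ord_even c" if "~ insD False c" for c
 proof -
  have "finite {..<(ozero::'k)}" by(simp add: lessThan_def)
  thus ?thesis using that by(cases c rule: ord_cases) (auto simp: insD_def insq_def oplus_one obase_def)
 qed
 hence real: "qcov q c \<longleftrightarrow> ~ qcov q (oplus (osuc ozero) (insq False c))" if "~ insD False c" for c
  using that unfolding qcov_def by auto
 have tr: "in_T cov (len X) (bob X) (prj ?z y) (bpr ?z X) S l"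
  if "in_T cov'' (len ?Y) (bob ?Y) (prj ?z y) (bpr ?z ?Y) S l" and "!!c. cov'' (osuc c) \<longleftrightarrow> ~ cov'' c"
  "!!c. ~ insD False c ==> cov'' c \<longleftrightarrow> cov (insq False c)" for cov'' cov S l
  using inX_ins[OF X g, of cov'' False y S l cov] that unfolding inX_def realign_ins[OF X, symmetric] I(2) by blast
 have "det ?c (len X) (bob X) (ctx y) (prj ?z y) (bpr ?z X) (sm \<phi> ?z) S2 J1 J2"
  by(rule det_transfer[OF D]; erule tr) (use real qcov_alt(1) in auto)
 moreover have Z: "is_prodZ (ctx y) (len X) (bob X) (ctx ?z) (prj ?z y) (bpr ?z X)" using ctx_prodZ[OF y X d] blenD(3)[OF X] by simp
 moreover have "ozero < len X" "osuc ozero < g" using is_lim_ozero_less[OF g] is_lim_osuc_less[OF g] blenD(3)[OF X] by auto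
 ultimately have "h : J1" using w
  by(intro det_mem[OF _ _ h _ S S2]) (auto simp: inX_def qcov_alt(1) oplus_osuc)
 moreover have "goodX (qcov q) ?Y y (sm \<phi> ?z) J1" unfolding goodX_def I(2)
 proof(rule det_good[OF D _ S S2])
  show "is_prodZ (ctx y) (len ?Y) (bob ?Y) (ctx ?z) (prj ?z y) (bpr ?z ?Y)" using ctx_prodZ[OF y I(1)] d blenD(3)[OF I(1)] unfolding I(2) by simp
  show "ozero < len ?Y" using is_lim_ozero_less[OF g] blenD(3)[OF I(1)] by simp
 qed (auto simp: qcov_alt(1))
 ultimately show ?thesis using qop_het[OF q] by simp
qed

lemma het_le:
 assumes wf: "wff (Quant q X \<phi>)" and q: "q = QAE \<or> q = QEA" and y: "wfc y" and d: "y Int bvars X = {}" and FV: "FV \<phi> <= y Un bvars X"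
  and R: "R : Sub (ctx y)" and le: "!!l. l : Ar ==> Cod l = ctx y ==> inX (qcov q) X y (sm \<phi> (y Un bvars X)) l ==> l : R"
 shows "sm (Quant q X \<phi>) y <= R"
proof -
 obtain J where J: "goodX (qcov q) X y (sm \<phi> (y Un bvars X)) J" using het_okI[OF wf y d FV] q unfolding het_ok_def by blast
 have "J <= R"
 proof(rule is_joinD(3)[OF goodJ_T_sub[OF J[unfolded goodX_def]] R])
  fix Q assume "Q : T_sub H (qcov q) (len X) (ctx y) (bob X) (prj (y Un bvars X) y) (bpr (y Un bvars X) X) (sm \<phi> (y Un bvars X))"
  then obtain l where l: "Q = sub_of l" "monic l" "Cod l = ctx y" "inX (qcov q) X y (sm \<phi> (y Un bvars X)) l" unfolding T_sub_def inX_def by blast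
  have lA: "l : Ar" using l(2) monicD(1) by blast
  show "Q <= R" using Sub_comp[OF R le[OF lA l(3,4)]] lA l(1) by(auto simp: mem_sub_of)
 qed
 thus ?thesis unfolding sem_Quant_disj[OF wf y d FV] qop_het[OF q J] .
qed

text \<open>After the first move the residual strategy wins a tail opened by the other player, and
  \<open>realign_mem\<close> places the position reached in the realigned formula. A universal first
  move is tested by restriction; an existential one is answered by the first covering
  family.\<close>

lemma sound_first:
 assumes q: "q = QAE & Q = QAll & q' = QEA \<or> q = QEA & Q = QEx & q' = QAE" and \<chi>: "\<chi> : C" and \<phi>: "\<phi> = \<chi> \<or> \<phi> = Neg \<chi>"
  and g: "is_lim g" "dom X = {..<g}"
 defines "\<psi> == Quant q' (realign (shift (osuc ozero) X)) \<phi>"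
 defines "\<theta> == Quant Q [ozero |-> the (X ozero)] \<psi>"
 assumes wf: "wfs (Quant q X \<phi>, x, \<theta>)"
 shows "sm (Quant q X \<phi>) x <= sm \<theta> x"
proof -
 let ?y = "x - bvars X" let ?X1 = "X |` {..<osuc ozero}" and ?Xs = "shift (osuc ozero) X" let ?y1 = "?y Un bvars ?X1" and ?z = "?y Un bvars X"
 have w: "wff (Quant q X \<phi>)" "wff \<theta>" "wfc x" "FV (Quant q X \<phi>) <= x" using wf_seqD[OF wf] by auto
 have wX: "wf_blocks Sg X" "wff \<phi>" using w(1) by(auto elim: wf_QuantE)
 have w\<psi>: "wff \<psi>" using w(2) unfolding \<theta>_def by(auto elim: wf_QuantE)
 have X: "blen X g" using wX(1) g(2) by(simp add: blen_def)
 note B = blenD[OF X]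
 have b: "osuc ozero < g" using is_lim_osuc_less[OF g(1) is_lim_ozero_less[OF g(1)]] .
 have g0: "g ~= ozero" using g(1) by auto
 note Sh = shift_blen[OF X b] and R1 = blen_restrict[OF X less_imp_le[OF b]] and b1 = bvars_first[OF X g0]
 have g': "is_lim (odiff g (osuc ozero))" by(rule is_lim_odiff[OF g(1) b])
 have rb: "bvars (realign ?Xs) = bvars ?Xs" unfolding realign_ins[OF Sh(1)] by(rule ins_blen(2)[OF Sh(1) g'])
 have y: "wfc ?y" using wfc_subset[OF w(3)] by simp
 have z: "wfc ?z" using wfc_Un[OF y B(8)] .
 have d: "?y Int bvars X = {}" by blast
 have FV\<phi>: "FV \<phi> <= ?z" using w(4) by auto
 have zz: "?y1 Un bvars ?Xs = ?z" using Sh(2) by blast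
 have d1: "?y Int bvars ?X1 = {}" and ds: "?y1 Int bvars ?Xs = {}" using d R1(2) Sh(2,3) by blast+
 have sub: "?y1 <= ?z" using R1(2) by blast
 have y1: "wfc ?y1" by(rule wfc_subset[OF z sub])
 note S = sem_Sub[OF wX(2) z FV\<phi>]
 have q1: "q = QAE \<or> q = QEA" "q' = QAE \<or> q' = QEA" using q by auto
 have FV\<psi>: "FV \<psi> <= ?y1" using FV\<phi> Sh(2) rb unfolding \<psi>_def by auto
 have K: "sm \<psi> ?y1 = qop q' (realign ?Xs) ?y1 (sm \<phi> ?z)"
  unfolding \<psi>_def by(subst sem_Quant_disj[OF w\<psi>[unfolded \<psi>_def] y1]) (use ds FV\<phi> zz rb in auto)
 have KS: "sm \<psi> ?y1 : Sub (ctx ?y1)" by(rule sem_Sub[OF w\<psi> y1 FV\<psi>])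
 have p: "prj ?y1 ?y : hom (ctx ?y1) (ctx ?y)" by(rule prj_hom[OF y1]) simp
 hence pA: "prj ?y1 ?y : Ar" "Dom (prj ?y1 ?y) = ctx ?y1" "Cod (prj ?y1 ?y) = ctx ?y" by(auto simp: hom_def)
 have KD: "sm \<psi> ?y1 : Sub (Dom (prj ?y1 ?y))" using KS pA by simp
 let ?T = "if q = QAE then all_along (prj ?y1 ?y) (sm \<psi> ?y1) else ex_along (prj ?y1 ?y) (sm \<psi> ?y1)"
 have \<theta>: "sm \<theta> ?y = ?T"
 proof -
  have o: "?y Int bvars [ozero::'k |-> the (X ozero)] = {}" "?y Un bvars [ozero::'k |-> the (X ozero)] = ?y1" using d1 unfolding one_block b1 by auto
  have "sm \<theta> ?y = qop Q [ozero |-> the (X ozero)] ?y (sm \<psi> ?y1)"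
  unfolding \<theta>_def by(subst sem_Quant_disj[OF w(2)[unfolded \<theta>_def] y o(1)]) (use FV\<psi> o(2) in auto)
  thus ?thesis using q unfolding qop_def o(2) Let_def by(elim disjE conjE) (simp_all only: quant.case simp_thms if_True if_False quant.distinct)
 qed
 have TS: "?T : Sub (ctx ?y)" using all_Sub[OF pA(1) KD] ex_Sub[OF pA(1) KD] pA(3) by simp
 \<comment> \<open>\<open>u\<close> and \<open>e\<close> are the first move and \<open>h\<close> is
   the position after it, in the context with block 0. If that stage is a cover, the move has to be
   member \<open>i\<close> of the answer.\<close>
 have mem: "h : sm \<psi> ?y1"
  if l: "l : Ar" "Cod l = ctx ?y" and \<sigma>: "covering_strategy (qcov q) (bob X) (Dom l) g \<sigma>"
  "!!r. is_chain (Dom l) g r ==> follows (qcov q) (bob X) \<sigma> g r ==> EX w:sm \<phi> ?z. Dom w = stage r g &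
  prj ?z ?y oo w = l oo link r g ozero & (ALL a<g. bpr ?z X a oo w = elt r a oo link r g (osuc a))"
  and u: "u : Ar" "Cod u = Dom l" and e: "e : hom (Dom u) (bob X ozero)"
  and c: "qcov q ozero ==> i : sI \<sigma> ozero (triv_play (Dom l)) & u = sU \<sigma> ozero (triv_play (Dom l)) i & e = sE \<sigma> ozero (triv_play (Dom l)) i"
  and h: "h : hom (Dom u) (ctx ?y1)" "prj ?y1 ?y oo h = l oo u" "prj ?y1 (the (X ozero)) oo h = e" for l \<sigma> u e i h
 proof -
  let ?tp = "triv_play (Dom l) :: ('o, 'a, 'k) play" let ?r = "ext_play ?tp ozero u e i"
  have t: "is_chain (Dom l) ozero ?tp" by(rule triv_chain) (use l in simp)
  have st: "stage ?tp ozero = Dom l" by(rule chain_zero[OF t])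
  have u': "u : Ar" "Cod u = stage ?tp ozero" using u st by auto
  have r: "is_chain (Dom l) (osuc ozero) ?r" by(rule ext_chain[OF t u'])
  have r2: "follows (qcov q) (bob X) \<sigma> (osuc ozero) ?r" by(rule ext_follows[OF t triv_follows u']) (use e c in auto)
  have lk: "stage ?r (osuc ozero) = Dom u" "link ?r (osuc ozero) ozero = u" "link ?r (osuc ozero) (osuc ozero) = Idn (Dom u)" "elt ?r ozero = e"
  using chainD(2)[OF t order_refl] st u by(simp_all add: ext_play_def)
  have "inX (%a. qcov q (oplus (osuc ozero) a)) ?Xs ?y1 (sm \<phi> ?z) h"
  proof(rule inX_peel[OF y X d S l \<sigma> b r r2])
  show "prj ?y1 (the (X a)) oo h = elt ?r a oo link ?r (osuc ozero) (osuc a)" if "a < osuc ozero" for a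
  proof -
  have "a = ozero" using that by simp
  thus ?thesis using lk h(3) e by(simp add: hom_def)
  qed
  qed (use h lk in auto)
  moreover have "(%a. qcov q (oplus (osuc ozero) a)) = (%a. ~ qcov q' (oplus (osuc ozero) a))" using q by(auto simp: qcov_def)
  ultimately show ?thesis unfolding K zz[symmetric]
  by(intro realign_mem[OF g' Sh(1) y1 ds \<chi> wX(2) _ \<phi> q1(2)]) (insert FV\<phi> zz h(1), auto simp: hom_def)
 qed
 have "sm (Quant q X \<phi>) ?y <= ?T"
 proof(rule het_le[OF w(1) q1(1) y d FV\<phi> TS])
  fix l assume l: "l : Ar" "Cod l = ctx ?y" and in_l: "inX (qcov q) X ?y (sm \<phi> ?z) l"
  have strat: "EX \<sigma>. covering_strategy (qcov q) (bob X) (Dom k) g \<sigma> &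
  (ALL r. is_chain (Dom k) g r --> follows (qcov q) (bob X) \<sigma> g r --> (EX w:sm \<phi> ?z. Dom w = stage r g &
  prj ?z ?y oo w = k oo link r g ozero & (ALL a<g. bpr ?z X a oo w = elt r a oo link r g (osuc a))))"
  if "inX (qcov q) X ?y (sm \<phi> ?z) k" for k using that unfolding inX_def in_T_def B(3) by blast
  show "l : ?T"
  proof(cases "q = QAE")
  case True
  have "l : all_along (prj ?y1 ?y) (sm \<psi> ?y1)" unfolding mem_all[OF pA(1) KD] pA
  proof(intro conjI allI impI l)
  fix h t assume h: "h : Ar" "t : Ar" "Cod h = ctx ?y1" "Cod t = Dom l" "Dom h = Dom t" "prj ?y1 ?y oo h = l oo t"
  have Z: "is_prodZ (Cod l) (len X) (bob X) (ctx ?z) (prj ?z ?y) (bpr ?z X)" using ctx_prodZ[OF y X d] l(2) B(3) by simp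
  \<comment> \<open>The game is first restricted to the domain of the test arrow; there the
    identity, with the tested value as element, is a legal first move.\<close>
  have "inX (qcov q) X ?y (sm \<phi> ?z) (l oo t)" unfolding inX_def
  by(rule in_T_restrict[OF in_l[unfolded inX_def] l(1) h(2,4) Z S]) (use qcov_alt(1)[of q ozero] B(3) g0 in auto)
  then obtain \<sigma> where \<sigma>: "covering_strategy (qcov q) (bob X) (Dom (l oo t)) g \<sigma>"
  "!!r. is_chain (Dom (l oo t)) g r ==> follows (qcov q) (bob X) \<sigma> g r ==> EX w:sm \<phi> ?z. Dom w = stage r g &
  prj ?z ?y oo w = (l oo t) oo link r g ozero & (ALL a<g. bpr ?z X a oo w = elt r a oo link r g (osuc a))" using strat by blast
  have lt: "l oo t : Ar" "Cod (l oo t) = ctx ?y" "Dom (l oo t) = Dom t" using l h by auto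
  have hh: "h : hom (Dom t) (ctx ?y1)" using h by(simp add: hom_def)
  have p0: "prj ?y1 (the (X ozero)) : hom (ctx ?y1) (bob X ozero)" by(rule prj_hom[OF y1]) (use b1 in auto)
  show "h : sm \<psi> ?y1"
  by(rule mem[OF lt(1,2) \<sigma>, of "Idn (Dom t)" "prj ?y1 (the (X ozero)) oo h" ozero])
  (insert lt h hh Cmp_hom[OF p0 hh] True, auto simp: qcov_def)
  qed
  thus ?thesis using True by simp
  next
  case False
  hence c0: "qcov q ozero" using q by(auto simp: qcov_def)
  obtain \<sigma> where \<sigma>: "covering_strategy (qcov q) (bob X) (Dom l) g \<sigma>"
  "!!r. is_chain (Dom l) g r ==> follows (qcov q) (bob X) \<sigma> g r ==> EX w:sm \<phi> ?z. Dom w = stage r g &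
  prj ?z ?y oo w = l oo link r g ozero & (ALL a<g. bpr ?z X a oo w = elt r a oo link r g (osuc a))" using strat[OF in_l] by blast
  let ?tp = "triv_play (Dom l) :: ('o, 'a, 'k) play"
  have t: "is_chain (Dom l) ozero ?tp" by(rule triv_chain) (use l in simp)
  have "ozero < g" using g0 by simp
  hence cv: "covers (stage ?tp ozero) (sI \<sigma> ozero ?tp) (sU \<sigma> ozero ?tp)" "!!i. i : sI \<sigma> ozero ?tp ==> sE \<sigma> ozero ?tp i : hom (Dom (sU \<sigma> ozero ?tp i)) (bob X ozero)"
  using \<sigma>(1) c0 t triv_follows unfolding covering_strategy_iff by blast+
  note cv = cv[unfolded chain_zero[OF t]]
  have "l : ex_along (prj ?y1 ?y) (sm \<psi> ?y1)"
  proof(rule covers_local[OF cv(1) _ l refl])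
  show "ex_along (prj ?y1 ?y) (sm \<psi> ?y1) : Sub (ctx ?y)" using ex_Sub[OF pA(1) KD] pA by simp
  fix i assume i: "i : sI \<sigma> ozero ?tp"
  let ?u = "sU \<sigma> ozero ?tp i" and ?e = "sE \<sigma> ozero ?tp i"
  note u = coversD(2,3)[OF cv(1) i]
  have lu: "l oo ?u : hom (Dom ?u) (ctx ?y)" using u l by(simp add: hom_def)
  have Z1: "is_prodZ (ctx ?y) (osuc ozero) (bob ?X1) (ctx ?y1) (prj ?y1 ?y) (bpr ?y1 ?X1)" by(rule ctx_prodZ[OF y R1(1) d1])
  have X0: "?X1 ozero = X ozero" by simp
  have e0: "?e : hom (Dom ?u) (bob ?X1 a)" if "a < osuc ozero" for a
  proof -
  have "a = ozero" using that by simp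
  thus ?thesis using cv(2)[OF i] X0 by simp
  qed
  obtain h where h: "h : hom (Dom ?u) (ctx ?y1)" "prj ?y1 ?y oo h = l oo ?u" "ALL a<osuc ozero. bpr ?y1 ?X1 a oo h = ?e"
  using prodZ_D(3)[OF Z1 lu, of "%_. ?e"] e0 by blast
  have "h : sm \<psi> ?y1"
  proof(rule mem[OF l \<sigma> u cv(2)[OF i] _ h(1,2)])
  show "i : sI \<sigma> ozero ?tp & ?u = sU \<sigma> ozero ?tp i & ?e = sE \<sigma> ozero ?tp i" using i by simp
  qed (use h(3) X0 in auto)
  thus "l oo ?u : ex_along (prj ?y1 ?y) (sm \<psi> ?y1)" using ex_mem[OF pA(1) KD] h(2) by metis
  qed
  thus ?thesis using False by simp
  qed
 qed
 moreover have "FV \<theta> <= ?y" using FV\<psi> w(4) b1 d1 unfolding \<theta>_def by(auto simp: one_block)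
 moreover have "FV (Quant q X \<phi>) <= ?y" using w(4) by auto
 ultimately show ?thesis using weaken_seq[OF w(1-3), of ?y] \<theta> by(simp del: sem.simps FV.simps)
qed

text \<open>At a limit \<open>b\<close> the parities of the tail and of the whole game agree, so
  nothing is realigned. The strategy is stopped at \<open>b\<close>; each position it reaches wins
  the tail and therefore lies in \<open>K\<close>.\<close>

lemma sound_second:
 fixes \<phi> :: "('k, 's, 'f, 'r) fm"
 assumes q: "q = QAE \<or> q = QEA" and b: "is_lim b" "b < g" and g: "dom X = {..<g}"
 defines "\<psi> == Quant q (shift b X) \<phi>"
 assumes wf: "wfs (Quant q X \<phi>, x, Quant q (X |` {..<b}) \<psi>)"
 shows "sm (Quant q X \<phi>) x <= sm (Quant q (X |` {..<b}) \<psi>) x"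
proof -
 let ?y = "x - bvars X" let ?X1 = "X |` {..<b}" and ?Xs = "shift b X" let ?y1 = "?y Un bvars ?X1" and ?z = "?y Un bvars X"
 let ?\<theta> = "Quant q ?X1 \<psi>"
 have w: "wff (Quant q X \<phi>)" "wff ?\<theta>" "wfc x" "FV (Quant q X \<phi>) <= x" using wf_seqD[OF wf] by auto
 have wX: "wf_blocks Sg X" "wff \<phi>" using w(1) by(auto elim: wf_QuantE)
 have w\<psi>: "wff \<psi>" using w(2) by(auto elim: wf_QuantE)
 have X: "blen X g" using wX(1) g by(simp add: blen_def)
 note B = blenD[OF X] and Sh = shift_blen[OF X b(2)] and R1 = blen_restrict[OF X less_imp_le[OF b(2)]]
 have y: "wfc ?y" using wfc_subset[OF w(3)] by simp
 have z: "wfc ?z" using wfc_Un[OF y B(8)] .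
 have d: "?y Int bvars X = {}" by blast
 have FV\<phi>: "FV \<phi> <= ?z" using w(4) by auto
 have zz: "?y1 Un bvars ?Xs = ?z" using Sh(2) by blast
 have d1: "?y Int bvars ?X1 = {}" and ds: "?y1 Int bvars ?Xs = {}" using d R1(2) Sh(2,3) by blast+
 have y1: "wfc ?y1" using wfc_Un[OF y blenD(8)[OF R1(1)]] .
 note S = sem_Sub[OF wX(2) z FV\<phi>]
 have FV\<psi>: "FV \<psi> <= ?y1" using FV\<phi> Sh(2) unfolding \<psi>_def by auto
 have FVs: "FV \<phi> <= ?y1 Un bvars ?Xs" using FV\<phi> zz by simp
 obtain K where K: "goodX (qcov q) ?Xs ?y1 (sm \<phi> ?z) K" using het_okI[OF w\<psi>[unfolded \<psi>_def] y1 ds FVs] q unfolding het_ok_def zz by blast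
 have \<psi>: "sm \<psi> ?y1 = K" using sem_Quant_disj[OF w\<psi>[unfolded \<psi>_def] y1 ds FVs] qop_het[OF q K] unfolding zz \<psi>_def by simp
 obtain R where R: "goodX (qcov q) ?X1 ?y K R" using het_okI[OF w(2) y d1 FV\<psi>] q \<psi> unfolding het_ok_def by auto
 have \<theta>: "sm ?\<theta> ?y = R" using sem_Quant_disj[OF w(2) y d1 FV\<psi>] qop_het[OF q R] \<psi> by(simp del: sem.simps)
 have RS: "R : Sub (ctx ?y)" using R by(simp add: goodX_def goodJ_def)
 have "sm (Quant q X \<phi>) ?y <= R"
 proof(rule het_le[OF w(1) q y d FV\<phi> RS])
  fix l assume l: "l : Ar" "Cod l = ctx ?y" and in_l: "inX (qcov q) X ?y (sm \<phi> ?z) l"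
  obtain \<sigma> where \<sigma>: "covering_strategy (qcov q) (bob X) (Dom l) g \<sigma>"
  "!!r. is_chain (Dom l) g r ==> follows (qcov q) (bob X) \<sigma> g r ==> EX w:sm \<phi> ?z. Dom w = stage r g &
  prj ?z ?y oo w = l oo link r g ozero & (ALL a<g. bpr ?z X a oo w = elt r a oo link r g (osuc a))"
  using in_l unfolding inX_def in_T_def B(3) by blast
  have th: "the (?X1 a) = the (X a)" if "a < b" for a using that by simp
  note Z1 = prodZ_D[OF ctx_prodZ[OF y R1(1) d1]]
  have "wins (qcov q) (bob X) b (Dom l) (%k e. EX w:K. Dom w = Dom k & prj ?y1 ?y oo w = l oo k & (ALL a<b. bpr ?y1 ?X1 a oo w = e a))"
  unfolding wins_def
  proof(intro exI[of _ \<sigma>] conjI allI impI)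
  show "covering_strategy (qcov q) (bob X) (Dom l) b \<sigma>" using \<sigma>(1) b(2) unfolding covering_strategy_def by(meson order_less_trans)
  fix r assume r: "is_chain (Dom l) b r" "follows (qcov q) (bob X) \<sigma> b r"
  let ?k = "link r b ozero" and ?e = "%a. elt r a oo link r b (osuc a)"
  have Dk: "Dom ?k = stage r b" using chainD(3)[OF r(1) order_refl, of ozero] by(simp add: hom_def)
  note v = play_valid[OF r]
  have lk: "l oo ?k : hom (stage r b) (ctx ?y)" using v l Dk by(simp add: valid_def hom_def)
  have e: "?e a : hom (stage r b) (bob ?X1 a)" if "a < b" for a using v that Dk th by(simp add: valid_def)
  obtain w' where w': "w' : hom (stage r b) (ctx ?y1)" "prj ?y1 ?y oo w' = l oo ?k" "ALL a<b. bpr ?y1 ?X1 a oo w' = ?e a" using Z1(3)[OF lk e] by blast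
  have "inX (%a. qcov q (oplus b a)) ?Xs ?y1 (sm \<phi> ?z) w'"
  by(rule inX_peel[OF y X d S l \<sigma> b(2) r w'(1,2)]) (use w'(3) th in auto)
  moreover have "(%a. qcov q (oplus b a)) = qcov q" using ord_even_oplus[of b] b(1) by(auto simp: qcov_def obase_def fun_eq_iff)
  ultimately have "w' : K" using goodJ_mem[OF K[unfolded goodX_def]] w'(1) unfolding inX_def by(simp add: hom_def)
  thus "EX w:K. Dom w = Dom ?k & prj ?y1 ?y oo w = l oo ?k & (ALL a<b. bpr ?y1 ?X1 a oo w = ?e a)"
  using w' Dk by(intro bexI[of _ w']) (auto simp: hom_def)
  qed
  hence "wins (qcov q) (bob ?X1) b (Dom l) (%k e. EX w:K. Dom w = Dom k & prj ?y1 ?y oo w = l oo k & (ALL a<b. bpr ?y1 ?X1 a oo w = e a))"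
  by(rule wins_cong_obj) (simp add: th)
  hence "in_T (qcov q) (len ?X1) (bob ?X1) (prj ?y1 ?y) (bpr ?y1 ?X1) K l" unfolding in_T_iff blenD(3)[OF R1(1)] .
  thus "l : R" by(rule goodJ_mem[OF R[unfolded goodX_def] _ l])
 qed
 moreover have "FV ?\<theta> <= ?y" using FV\<psi> d1 by auto
 moreover have "FV (Quant q X \<phi>) <= ?y" using w(4) by auto
 ultimately show ?thesis using weaken_seq[OF w(1-3), of ?y] \<theta> by(simp del: sem.simps FV.simps)
qed

lemma sound_heterogeneous: "s : heterogeneous_axioms Sg C ==> holds Sg H M s"
proof(induction rule: heterogeneous_axioms.induct)
 case (1 \<phi> g X s x)
 thus ?case using sound_first[of QAE QAll QEA \<phi> \<phi> g X x] unfolding holds_def by(simp add: tail_AE_def del: sem.simps)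
next
 case (2 \<phi> g X s x)
 thus ?case using sound_first[of QEA QEx QAE \<phi> "Neg \<phi>" g X x] unfolding holds_def by(simp add: tail_EA_def del: sem.simps)
next
 case (3 \<phi> b g X s x)
 thus ?case using sound_second[of QAE b g X \<phi> x] unfolding holds_def by(simp add: tail_AE_def del: sem.simps)
next
 case (4 \<phi> b g X s x)
 thus ?case using sound_second[of QEA b g X "Neg \<phi>" x] unfolding holds_def by(simp add: tail_EA_def del: sem.simps)
qed

subsubsection \<open>Soundness\<close>

lemma Disj_bounds:
 assumes wf: "wff (Disj F)" "wfc x" "FV (Disj F) <= x"
 shows "F i = Some \<phi> ==> sm \<phi> x <= sm (Disj F) x"
  and "S : Sub (ctx x) ==> (!!i \<phi>. F i = Some \<phi> ==> sm \<phi> x <= S) ==> sm (Disj F) x <= S"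
proof -
 have "sm (the (F i)) x : Sub (ctx x)" if i: "i : dom F" for i
 proof -
  obtain \<phi> where p: "F i = Some \<phi>" using i by blast
  have "wff \<phi>" by(rule wf_DisjE[OF wf(1)]) (use p in blast)
  thus ?thesis using sem_Sub[OF _ wf(2)] FV_fam(2)[of F, OF p] wf(3) p by(simp del: FV.simps)
 qed
 hence j: "is_join (ctx x) ((%i. sm (the (F i)) x) ` dom F) (sm (Disj F) x)" unfolding sem_Disj
  by(intro join_is_join ctx_Ob[OF wf(2)] card_image_k) blast
 show "F i = Some \<phi> ==> sm \<phi> x <= sm (Disj F) x" using is_joinD(2)[OF j, of "sm \<phi> x"] by force
 show "S : Sub (ctx x) ==> (!!i \<phi>. F i = Some \<phi> ==> sm \<phi> x <= S) ==> sm (Disj F) x <= S"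
 proof(rule is_joinD(3)[OF j], assumption)
  assume *: "!!i \<phi>. F i = Some \<phi> ==> sm \<phi> x <= S"
  fix R assume "R : (%i. sm (the (F i)) x) ` dom F"
  then obtain i \<phi> where "F i = Some \<phi>" "R = sm \<phi> x" by auto
  thus "R <= S" using *[of i \<phi>] by simp
 qed
qed

end

context ttree
begin

text \<open>By the choice of \<open>Ps\<close> the generic arrow \<open>mm f\<close> satisfies every
  formula along the branch, and so witnesses the existential disjunct after projection to the root
  context.\<close>

lemma leaf_ex:
 assumes f: "f : nodes \<Gamma>"
 defines "Y == %b. if b < len f then Some (X (f |` {..b})) else None"
  and "F == %b. if b < len f then Some (\<Phi> (f |` {..b})) else None"
 assumes wf: "wff (Exists Y (Conj F))"
 shows "prj (cn f) (cn Map.empty) oo mm f : sm (Exists Y (Conj F)) (cn Map.empty)"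
proof -
 let ?e = "Map.empty :: 'k \<rightharpoonup> 'k"
 note c = cn_len[OF f refl]
 have "ran Y = (%b. X (f |` {..b})) ` {..<len f}" by(auto simp: Y_def ran_def)
 hence bv: "bvars Y = (UN b:{..<len f}. X (f |` {..b}))" by(simp add: bvars_def)
 have u: "cn ?e Un bvars Y = cn f" using c unfolding bv by simp
 have "cn ?e <= cn (f |` {..<b})" if "b < len f" for b using cn_len[OF node_restrict(1)[OF f] refl, of b] that by simp
 hence d: "cn ?e Int bvars Y = {}" using c unfolding bv by blast
 \<comment> \<open>The conjuncts of the rule are the formulas at the levels from 1 up to the
   leaf.\<close>
 have at: "{..b} = {..<osuc b :: 'k}" for b by auto
 have n: "f |` {..b} : nodes \<Gamma> & cn (f |` {..b}) <= cn f" if "b < len f" for b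
  unfolding at using node_restrict(1)[OF f, of "osuc b"] cn_mono[OF f, of "osuc b"] that by simp
 have FV: "FV (Conj F) <= cn f" unfolding subset_iff mem_FV using n by(auto simp: F_def split: if_splits)
 have m: "mm f : Ar" "Cod (mm f) = ctx (cn f)" using mm(2)[OF f] by(auto simp: hom_def)
 have "mm f : sm (Conj F) (cn f)" unfolding sem_Conj
 proof(intro IntI INT_I)
  show "mm f : whole (ctx (cn f))" using m by(simp add: mem_whole)
  fix b assume "b : dom F"
  hence b: "b < len f" by(auto simp: F_def split: if_splits)
  have "sm (\<Phi> (f |` {..b})) (cn f) = pull (prj (cn f) (cn (f |` {..b}))) (S0 (f |` {..b}))"
  using sem_weaken[OF wfP cn[OF f]] n[OF b] by blast
  moreover have "pj f (osuc b) oo mm f : S0 (f |` {..<osuc b})" using mm(4)[OF f] b unfolding mem_Ps[OF f] by simp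
  moreover have "Dom (pj f (osuc b)) = ctx (cn f)" using pj[OF f, of "osuc b"] b by(simp add: hom_def)
  ultimately show "mm f : sm (the (F b)) (cn f)" using b m unfolding at by(simp add: F_def at mem_pull)
 qed
 moreover have "prj (cn f) (cn ?e) : hom (ctx (cn f)) (ctx (cn ?e))" by(rule prj_hom[OF cn[OF f]]) (use u in blast)
 moreover have "wff (Conj F)" using wf by(auto elim: wf_QuantE)
 ultimately show ?thesis
  using sem_Quant_disj[OF wf cn[OF empty_node(1)] d] FV ex_mem[of "prj (cn f) (cn ?e)" "sm (Conj F) (cn f)" "mm f"] sem_Sub[OF _ cn[OF f] FV]
  unfolding u qop_def Let_def quant.case by(simp add: hom_def del: sem.simps FV.simps)
qed

end

context khet
begin

lemma wf_Disj_mem: "wff (Disj F) ==> F i = Some \<phi> ==> wff \<phi>"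
 by(erule wf_DisjE) blast

lemma sound_transfinite:
 fixes \<Gamma> :: "'k set" and \<Phi> :: "('k \<rightharpoonup> 'k) => ('k, 's, 'f, 'r) fm" and X :: "('k \<rightharpoonup> 'k) => ('s, 'k) block"
 defines "D1 == %f. Disj (%i. if i : \<Gamma> then Some (let g = f(len f |-> i) in Exists [ozero |-> X g] (\<Phi> g)) else None)"
  and "D2 == %f. Conj (%a. if a < len f then Some (\<Phi> (f |` {..<a})) else None)"
 assumes 1: "!!f. f : nodes \<Gamma> ==> wfs (\<Phi> f, FV (\<Phi> f), D1 f) & holds Sg H M (\<Phi> f, FV (\<Phi> f), D1 f)"
  and 2: "!!f. f : nodes \<Gamma> ==> is_lim (len f) ==> holds Sg H M (D2 f, FV (\<Phi> f), \<Phi> f)"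
  and FVs: "!!f i. f : nodes \<Gamma> ==> i : \<Gamma> ==> FV (\<Phi> (f(len f |-> i))) = FV (\<Phi> f) Un X (f(len f |-> i)) & X (f(len f |-> i)) Int FV (\<Phi> f) = {}"
  and FVl: "!!f. f : nodes \<Gamma> ==> is_lim (len f) ==> FV (\<Phi> f) = (UN a:{..<len f}. FV (\<Phi> (f |` {..<a})))"
  and bar: "is_bar \<Gamma> B" and en: "bij_betw en I (minimal_nodes B)"
  and wf: "wfs (\<Phi> Map.empty, FV (\<Phi> Map.empty), Disj (%i. if i : I
  then Some (Exists (%b. if b < len (en i) then Some (X (en i |` {..b})) else None)
  (Conj (%b. if b < len (en i) then Some (\<Phi> (en i |` {..b})) else None))) else None))"
 shows "sm (\<Phi> Map.empty) (FV (\<Phi> Map.empty)) <= sm (Disj (%i. if i : I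
  then Some (Exists (%b. if b < len (en i) then Some (X (en i |` {..b})) else None)
  (Conj (%b. if b < len (en i) then Some (\<Phi> (en i |` {..b})) else None))) else None)) (FV (\<Phi> Map.empty))"
proof -
 let ?F = "%f i. if i : \<Gamma> then Some (let g = f(len f |-> i) in Exists [ozero |-> X g] (\<Phi> g)) else None"
 let ?G = "%i. if i : I then Some (Exists (%b. if b < len (en i) then Some (X (en i |` {..b})) else None)
  (Conj (%b. if b < len (en i) then Some (\<Phi> (en i |` {..b})) else None))) else None"
 have d: "dom (?F f) = \<Gamma>" for f by(auto split: if_splits)
 have wf1: "wff (Disj (?F f))" if "f : nodes \<Gamma>" for f using wf_seqD 1[OF that] unfolding D1_def by blast
 interpret t: ttree K H Sg M C \<Gamma> \<Phi> X B
 proof unfold_locales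
  fix f :: "'k \<rightharpoonup> 'k" assume f: "f : nodes \<Gamma>"
  show "wff (\<Phi> f)" using wf_seqD 1[OF f] by blast
  show "wff (Exists [ozero |-> X (f(len f |-> i))] (\<Phi> (f(len f |-> i))))" if i: "i : \<Gamma>" for i
  proof -
  have "?F f i = Some (Exists [ozero |-> X (f(len f |-> i))] (\<Phi> (f(len f |-> i))))" using i by(simp add: Let_def)
  thus ?thesis by(rule wf_Disj_mem[OF wf1[OF f]])
  qed
  have "sm (\<Phi> f) (FV (\<Phi> f)) <= sm (Disj (?F f)) (FV (\<Phi> f))" using 1[OF f] unfolding D1_def holds_def by blast
  also have "\<dots> = join (ctx (FV (\<Phi> f))) ((%i. sm (Exists [ozero |-> X (f(len f |-> i))] (\<Phi> (f(len f |-> i)))) (FV (\<Phi> f))) ` \<Gamma>)"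
  unfolding sem_Disj d by(intro arg_cong2[of _ _ _ _ "join"] refl image_cong) (simp_all add: Let_def del: sem.simps)
  finally show "sm (\<Phi> f) (FV (\<Phi> f)) <= join (ctx (FV (\<Phi> f))) ((%i. sm (Exists [ozero |-> X (f(len f |-> i))] (\<Phi> (f(len f |-> i)))) (FV (\<Phi> f))) ` \<Gamma>)" .
 qed (insert 2 FVs FVl bar, simp_all only: D2_def holds_def prod.case)
 have w: "wff (Disj ?G)" "wfc (FV (\<Phi> Map.empty))" "FV (Disj ?G) <= FV (\<Phi> Map.empty)" using wf_seqD[OF wf] by blast+
 show ?thesis
 proof(rule t.transfinite_sound)
  show "sm (Disj ?G) (FV (\<Phi> Map.empty)) : Sub (ctx (FV (\<Phi> Map.empty)))" by(rule sem_Sub[OF w])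
  fix f assume f: "f : nodes \<Gamma>" "f : minimal_nodes B"
  then obtain i where i: "i : I" "f = en i" using en unfolding bij_betw_def by blast
  let ?E = "Exists (%b. if b < len f then Some (X (f |` {..b})) else None) (Conj (%b. if b < len f then Some (\<Phi> (f |` {..b})) else None))"
  have g: "?G i = Some ?E" unfolding i(2) using i(1) by simp
  hence "wff ?E" by(rule wf_Disj_mem[OF w(1)])
  from t.leaf_ex[OF f(1) this] Disj_bounds(1)[OF w, OF g]
  show "prj (FV (\<Phi> f)) (FV (\<Phi> Map.empty)) oo t.mm f : sm (Disj ?G) (FV (\<Phi> Map.empty))" by blast
 qed
qed

text \<open>Well-formedness is carried through the induction because interpretations are known to be
  subobjects, with all the adjunctions this gives, only for well-formed formulas over contexts
  containing their free variables.\<close>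

theorem soundness:
 assumes T: "is_theory Sg C T" "!!s. s : T ==> holds Sg H M s"
 shows "provable Sg C T s ==> wfs s & holds Sg H M s"
proof(induction rule: provable.induct)
 case (ax s)
 thus ?case using T by simp
next
 case (identity \<phi> x)
 thus ?case by(simp add: holds_def)
next
 case (substitution \<phi> x \<psi> \<sigma> y \<phi>' \<psi>')
 have w: "wfs (\<phi>, x, \<psi>)" "sm \<phi> x <= sm \<psi> x" using substitution.IH by(simp_all add: holds_def)
 note d = wf_seqD[OF w(1)] and d' = wf_seqD[OF substitution.hyps(5)]
 have "sub_ok \<sigma> y x" unfolding sub_ok_def using substitution.hyps(2) d d' by blast
 hence "sm \<phi>' y <= sm \<psi>' y" using sound_subst[OF w(2) _ substitution.hyps(3,4)] d d' by blast
 thus ?case using substitution.hyps(5) by(simp add: holds_def)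
next
 case (cut \<phi> x \<psi> \<theta>)
 thus ?case by(auto simp: holds_def wf_sequent_def)
next
 case (eq_refl v)
 thus ?case by(auto simp: holds_def)
next
 case (eq_congruence ws g xs ys \<sigma> \<tau> \<phi> \<phi>\<^sub>x \<phi>\<^sub>y s z)
 thus ?case using sound_eq[of ws g xs ys \<sigma> \<tau> \<phi> \<phi>\<^sub>x \<phi>\<^sub>y z] by(simp add: holds_def del: sem.simps)
next
 case (conj_elim F j \<phi> x)
 hence "j : dom F" by blast
 hence "sm (Conj F) x <= sm \<phi> x" unfolding sem_Conj using conj_elim(1) by force
 thus ?case using conj_elim(2) by(simp add: holds_def del: sem.simps)
next
 case (conj_intro F \<phi> x)
 have "sm \<phi> x <= whole (ctx x)" using wf_seqD[OF conj_intro(2)] Sub_whole by blast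
 moreover have "sm \<phi> x <= sm (the (F i)) x" if i: "i : dom F" for i
 proof -
  obtain \<psi> where "F i = Some \<psi>" using i by blast
  thus ?thesis using conj_intro.IH[of i \<psi>] by(simp add: holds_def)
 qed
 ultimately have "sm \<phi> x <= sm (Conj F) x" unfolding sem_Conj by blast
 thus ?case using conj_intro(2) by(simp add: holds_def del: sem.simps)
next
 case (disj_intro F j \<phi> x)
 thus ?case using Disj_bounds(1)[of F x j \<phi>] wf_seqD[OF disj_intro(2)] by(simp add: holds_def del: sem.simps FV.simps)
next
 case (disj_elim F x \<theta>)
 have "sm \<phi> x <= sm \<theta> x" if "F i = Some \<phi>" for i \<phi> using disj_elim.IH[OF that] by(simp add: holds_def)
 hence "sm (Disj F) x <= sm \<theta> x" using Disj_bounds(2)[of F x "sm \<theta> x"] wf_seqD[OF disj_elim(2)] by blast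
 thus ?case using disj_elim(2) by(simp add: holds_def del: sem.simps)
next
 case (imp_intro \<phi> \<psi> x \<eta>)
 have w: "wfs (And \<phi> \<psi>, x, \<eta>)" "sm (And \<phi> \<psi>) x <= sm \<eta> x" using imp_intro.IH by(simp_all add: holds_def)
 note d = wf_seqD[OF w(1)] and d' = wf_seqD[OF imp_intro.hyps(2)]
 have p: "wff \<psi>" "FV \<psi> <= x" using d And_simps(2,3)[of \<phi> \<psi>] by auto
 have "sm \<phi> x <= imp_sub H (ctx x) (sm \<psi> x) (sm \<eta> x)"
  using imp_adj[of "sm \<psi> x" "ctx x" "sm \<eta> x" "sm \<phi> x"] sem_Sub[OF p(1) _ p(2)] d d' w(2) Sub_whole[of "sm \<phi> x" "ctx x"] unfolding And_simps(1) by blast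
 thus ?case using imp_intro.hyps(2) by(simp add: holds_def)
next
 case (imp_elim \<phi> x \<psi> \<eta>)
 have w: "wfs (\<phi>, x, Imp \<psi> \<eta>)" "sm \<phi> x <= imp_sub H (ctx x) (sm \<psi> x) (sm \<eta> x)" using imp_elim.IH by(simp_all add: holds_def)
 note d = wf_seqD[OF w(1)] and d' = wf_seqD[OF imp_elim.hyps(2)]
 have p: "wff \<psi>" "FV \<psi> <= x" using d' And_simps(2,3)[of \<phi> \<psi>] by auto
 have "sm \<phi> x Int sm \<psi> x <= sm \<eta> x"
  using imp_adj[of "sm \<psi> x" "ctx x" "sm \<eta> x" "sm \<phi> x"] sem_Sub[OF p(1) _ p(2)] d d' w(2) by blast
 hence "sm (And \<phi> \<psi>) x <= sm \<eta> x" unfolding And_simps(1) by blast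
 thus ?case using imp_elim.hyps(2) by(simp add: holds_def)
next
 case (ex_elim \<phi> x Y \<psi>)
 have w: "wfs (\<phi>, x Un bvars Y, \<psi>)" "sm \<phi> (x Un bvars Y) <= sm \<psi> (x Un bvars Y)" using ex_elim.IH by(simp_all add: holds_def)
 note d = wf_seqD[OF w(1)] and d' = wf_seqD[OF ex_elim.hyps(3)]
 have Y: "wf_blocks Sg Y" using d' by(auto elim: wf_QuantE)
 have "sm (Exists Y \<phi>) x <= sm \<psi> x" using sound_quant(1)[OF _ _ Y _ ex_elim.hyps(2)] d d' w(2) by blast
 thus ?case using ex_elim.hyps(3) by(simp add: holds_def del: sem.simps)
next
 case (ex_intro Y \<phi> x \<psi>)
 have w: "wfs (Exists Y \<phi>, x, \<psi>)" "sm (Exists Y \<phi>) x <= sm \<psi> x" using ex_intro.IH by(simp_all add: holds_def del: sem.simps)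
 note d = wf_seqD[OF w(1)] and d' = wf_seqD[OF ex_intro.hyps(3)]
 have Y: "wf_blocks Sg Y" using d by(auto elim: wf_QuantE)
 have "sm \<phi> (x Un bvars Y) <= sm \<psi> (x Un bvars Y)" using sound_quant(1)[OF _ _ Y _ ex_intro.hyps(2)] d d' w(2) by blast
 thus ?case using ex_intro.hyps(3) by(simp add: holds_def)
next
 case (all_intro \<phi> x Y \<psi>)
 have w: "wfs (\<phi>, x Un bvars Y, \<psi>)" "sm \<phi> (x Un bvars Y) <= sm \<psi> (x Un bvars Y)" using all_intro.IH by(simp_all add: holds_def)
 note d = wf_seqD[OF w(1)] and d' = wf_seqD[OF all_intro.hyps(3)]
 have Y: "wf_blocks Sg Y" using d' by(auto elim: wf_QuantE)
 have "sm \<phi> x <= sm (Forall Y \<psi>) x" using sound_quant(2)[OF _ _ Y _ all_intro.hyps(2)] d d' w(2) by blast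
 thus ?case using all_intro.hyps(3) by(simp add: holds_def del: sem.simps)
next
 case (all_elim \<phi> x Y \<psi>)
 have w: "wfs (\<phi>, x, Forall Y \<psi>)" "sm \<phi> x <= sm (Forall Y \<psi>) x" using all_elim.IH by(simp_all add: holds_def del: sem.simps)
 note d = wf_seqD[OF w(1)] and d' = wf_seqD[OF all_elim.hyps(3)]
 have Y: "wf_blocks Sg Y" using d by(auto elim: wf_QuantE)
 have "sm \<phi> (x Un bvars Y) <= sm \<psi> (x Un bvars Y)" using sound_quant(2)[OF _ _ Y _ all_elim.hyps(2)] d d' w(2) by blast
 thus ?case using all_elim.hyps(3) by(simp add: holds_def)
next
 case (transfinite_transitivity \<Gamma> \<Phi> X B en I s)
 note s = transfinite_transitivity.hyps(9) and wf = transfinite_transitivity.hyps(10)[unfolded transfinite_transitivity.hyps(9)]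
 show ?case unfolding s holds_def prod.case
  by(rule conjI[OF wf sound_transfinite[OF transfinite_transitivity.IH(1) conjunct2[OF transfinite_transitivity.IH(3)] transfinite_transitivity.hyps(5-8) wf]])
next
 case (heterogeneous s)
 thus ?case using sound_heterogeneous by(auto elim: heterogeneous_axioms.cases)
next
 case (preservation s)
 thus ?case using wdet unfolding well_determined_def by(auto elim: preservation_axioms.cases)
next
 case (determinacy s)
 thus ?case using wdet unfolding well_determined_def by(auto elim: determinacy_axioms.cases)
qed

end

theorem lemma2p2p7:
 fixes Sg :: "('k::wellorder, 's::wellorder, 'f, 'r) signature"
  and C :: "('k, 's, 'f, 'r) fm set"
  and T :: "('k, 's, 'f, 'r) sequent set"
  and H :: "('o, 'a) cat"
  and M :: "('s, 'f, 'r, 'o, 'a) struc"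
 assumes "regular_kappa TYPE('k)"
  and "wf_signature Sg"
  and "is_theory Sg C T"
  and "provable Sg C T (\<phi>, x, \<psi>)"
  and "kappa_heterogeneous Sg C H M"
  and "well_determined_model Sg C T H M"
 shows "holds Sg H M (\<phi>, x, \<psi>)"
proof -
 interpret khet "TYPE('k)" H Sg M C
  by unfold_locales (insert assms, auto simp: kappa_heterogeneous_def well_determined_model_def well_determined_def)
 show ?thesis using soundness[OF assms(3) _ assms(4)] assms(6) by(simp add: well_determined_model_def)
qed

end
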